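(* Let $K_1$ and $K_2$ be two CM fields sharing the same totally real subfield $F$. Assume that $h_i$ is a nondegenerate Hermitian form on a finite-dimensional $K_i$-vector space $V_i$ ($i=1,2$), such that $\mathrm{PU}(V_1,h_1)\cong\mathrm{PU}(V_2,h_2)$ as $F$-algebraic groups. Then: (1) If $m=\dim V_1=\dim V_2\ge3$, then $K_1=K_2$, and $(V_1,h_1)$ is $F$-conformal to $(V_2,h_2)$. (2) If $m=\dim V_1=\dim V_2=2$ and $K_1=K_2$, then $(V_1,h_1)$ is $F$-conformal to $(V_2,h_2)$.
   Context: A CM field $K$ is a totally imaginary quadratic extension of a totally real number field $F$; $K_1,K_2$ are both quadratic over $F$ (inside a common algebraic closure of $F$). Hermitian forms are taken with respect to the nontrivial element of $\mathrm{Gal}(K_i/F)$. $\mathrm U(V,h)$ is the $F$-algebraic group of $K$-linear transformations of $V$ preserving $h$, and $\mathrm{PU}(V,h)$ is the corresponding projective unitary group (the adjoint group of $\mathrm U(V,h)$), as $F$-algebraic group. Two $K$-Hermitian spaces are $F$-conformal if there are a $K$-linear isomorphism $f:V_1\to V_2$ and $\lambda\in F^\times$ with $h_1=\lambda\cdot f^*(h_2)$. *)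

theory Defs
  imports
    "HOL-Algebra.Algebraic_Closure"
    "HOL-Library.FuncSet"
    "Jordan_Normal_Form.VS_Connect"
    "Jordan_Normal_Form.Determinant"
begin

text \<open>
  The ambient field is a type \<open>'a\<close>, regarded as the ring \<open>class_ring\<close>; the fields
  \<open>F\<close> and \<open>K\<close> below are subsets of it. That \<open>'a\<close> is an algebraic closure of \<open>F\<close> is
  expressed by \<open>algebraic_closure class_ring F\<close>.
\<close>

abbreviation fld :: "'a::field set \<Rightarrow> 'a ring" where
  "fld K \<equiv> class_ring\<lparr>carrier := K\<rparr>"

abbreviation complex_ring :: "complex ring" where
  "complex_ring \<equiv> class_ring"

definition number_field :: "'a::field_char_0 set \<Rightarrow> bool" where
  "number_field F \<longleftrightarrow>
     subfield F class_ring \<and> ring.finite_dimension class_ring \<rat> F"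

definition totally_real :: "'a::field_char_0 set \<Rightarrow> bool" where
  "totally_real F \<longleftrightarrow>
     number_field F \<and> (\<forall>\<sigma> \<in> Ring.ring_hom (fld F) complex_ring. \<sigma> ` F \<subseteq> \<real>)"

definition totally_imaginary :: "'a::field_char_0 set \<Rightarrow> bool" where
  "totally_imaginary K \<longleftrightarrow>
     number_field K \<and> (\<forall>\<sigma> \<in> Ring.ring_hom (fld K) complex_ring. \<not> \<sigma> ` K \<subseteq> \<real>)"

definition CM_field_over :: "'a::field_char_0 set \<Rightarrow> 'a set \<Rightarrow> bool" where
  "CM_field_over F K \<longleftrightarrow>
     totally_real F \<and> totally_imaginary K \<and> F \<subseteq> K \<and> ring.dimension class_ring 2 F K"

text \<open>Automorphisms are made extensional so that each is a single HOL function.\<close>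

definition galois_group :: "'a::field set \<Rightarrow> 'a set \<Rightarrow> ('a \<Rightarrow> 'a) set" where
  "galois_group F K =
     {\<sigma> \<in> ring_iso (fld K) (fld K). \<sigma> \<in> extensional K \<and> (\<forall>x\<in>F. \<sigma> x = x)}"

definition conj_over :: "'a::field set \<Rightarrow> 'a set \<Rightarrow> 'a \<Rightarrow> 'a" where
  "conj_over F K = (THE \<sigma>. \<sigma> \<in> galois_group F K \<and> \<sigma> \<noteq> (\<lambda>x\<in>K. x))"

text \<open>Convention: linear in the first argument, hence conjugate-linear in the second.\<close>

definition hermitian_form ::
  "'a::field set \<Rightarrow> 'a set \<Rightarrow> ('a, 'v) module \<Rightarrow> ('v \<Rightarrow> 'v \<Rightarrow> 'a) \<Rightarrow> bool" where
  "hermitian_form F K V h \<longleftrightarrow>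
     (\<forall>v\<in>carrier V. \<forall>w\<in>carrier V. h v w \<in> K) \<and>
     (\<forall>u\<in>carrier V. \<forall>v\<in>carrier V. \<forall>w\<in>carrier V. h (u \<oplus>\<^bsub>V\<^esub> v) w = h u w + h v w) \<and>
     (\<forall>c\<in>K. \<forall>v\<in>carrier V. \<forall>w\<in>carrier V. h (c \<odot>\<^bsub>V\<^esub> v) w = c * h v w) \<and>
     (\<forall>v\<in>carrier V. \<forall>w\<in>carrier V. h w v = conj_over F K (h v w))"

definition nondegenerate_form :: "('a::field, 'v) module \<Rightarrow> ('v \<Rightarrow> 'v \<Rightarrow> 'a) \<Rightarrow> bool" where
  "nondegenerate_form V h \<longleftrightarrow>
     (\<forall>v\<in>carrier V. (\<forall>w\<in>carrier V. h v w = 0) \<longrightarrow> v = \<zero>\<^bsub>V\<^esub>)"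

definition hermitian_space ::
  "'a::field set \<Rightarrow> 'a set \<Rightarrow> ('a, 'v) module \<Rightarrow> ('v \<Rightarrow> 'v \<Rightarrow> 'a) \<Rightarrow> bool" where
  "hermitian_space F K V h \<longleftrightarrow>
     vectorspace (fld K) V \<and> vectorspace.fin_dim (fld K) V \<and>
     hermitian_form F K V h \<and> nondegenerate_form V h"

definition conformal ::
  "'a::field set \<Rightarrow> 'a set \<Rightarrow> ('a, 'v) module \<Rightarrow> ('v \<Rightarrow> 'v \<Rightarrow> 'a) \<Rightarrow>
   ('a, 'w) module \<Rightarrow> ('w \<Rightarrow> 'w \<Rightarrow> 'a) \<Rightarrow> bool" where
  "conformal F K V\<^sub>1 h\<^sub>1 V\<^sub>2 h\<^sub>2 \<longleftrightarrow>
     (\<exists>f c. linear_map (fld K) V\<^sub>1 V\<^sub>2 f \<and> bij_betw f (carrier V\<^sub>1) (carrier V\<^sub>2) \<and>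
            c \<in> F - {0} \<and>
            (\<forall>v\<in>carrier V\<^sub>1. \<forall>w\<in>carrier V\<^sub>1. h\<^sub>1 v w = c * h\<^sub>2 (f v) (f w)))"

text \<open>
  Let \<open>\<Omega>\<close> be the algebraically closed field given by the type \<open>'a\<close>. In characteristic zero
  every affine algebraic group over \<open>F\<close> is smooth, so it is determined by its group of
  \<open>\<Omega>\<close>-points together with its coordinate ring over \<open>F\<close>, seen as an \<open>F\<close>-algebra of
  \<open>\<Omega>\<close>-valued functions on these points; this is the field \<open>regular\<close>. The morphisms
  over \<open>F\<close> are the group homomorphisms on \<open>\<Omega>\<close>-points that pull regular functions back
  to regular functions.
\<close>

record ('g, 'a) algebraic_group = "'g monoid" +
  regular :: "('g \<Rightarrow> 'a) set"

definition algebraic_group_iso ::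
  "('g, 'a) algebraic_group \<Rightarrow> ('h, 'a) algebraic_group \<Rightarrow> ('g \<Rightarrow> 'h) set" where
  "algebraic_group_iso G H =
     {\<phi> \<in> iso G H.
        (\<forall>f\<in>regular H. compose (carrier G) f \<phi> \<in> regular G) \<and>
        (\<forall>f\<in>regular G. compose (carrier H) f (inv_into (carrier G) \<phi>) \<in> regular H)}"

definition isomorphic_algebraic_groups ::
  "('g, 'a) algebraic_group \<Rightarrow> ('h, 'a) algebraic_group \<Rightarrow> bool" where
  "isomorphic_algebraic_groups G H \<longleftrightarrow> algebraic_group_iso G H \<noteq> {}"

text \<open>
  For a normal closed \<open>F\<close>-subgroup \<open>N\<close>, one has \<open>(G/N)(\<Omega>) = G(\<Omega>)/N(\<Omega>)\<close>, and the coordinate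
  ring of \<open>G/N\<close> consists of the \<open>N\<close>-invariant elements of the coordinate ring of \<open>G\<close>.
\<close>

definition algebraic_quotient ::
  "('g, 'a) algebraic_group \<Rightarrow> 'g set \<Rightarrow> ('g set, 'a) algebraic_group" where
  "algebraic_quotient G N =
     \<lparr>carrier = carrier (G Mod N), monoid.mult = monoid.mult (G Mod N), one = one (G Mod N),
      regular = {f \<in> extensional (carrier (G Mod N)).
                   (\<lambda>g\<in>carrier G. f (N #>\<^bsub>G\<^esub> g)) \<in> regular G}\<rparr>"

definition center_of :: "('g, 'b) monoid_scheme \<Rightarrow> 'g set" where
  "center_of G = {z \<in> carrier G. \<forall>g\<in>carrier G. z \<otimes>\<^bsub>G\<^esub> g = g \<otimes>\<^bsub>G\<^esub> z}"

text \<open>The adjoint group of a connected reductive group is its quotient by the center.\<close>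

definition adjoint_group ::
  "('g, 'a) algebraic_group \<Rightarrow> ('g set, 'a) algebraic_group" where
  "adjoint_group G = algebraic_quotient G (center_of G)"

text \<open>
  The coordinate ring of \<open>GL\<^sub>n\<close> over \<open>F\<close>: polynomials with coefficients in \<open>F\<close> in the
  matrix entries and the inverse of the determinant.
\<close>

inductive_set GL_regular :: "'a::field set \<Rightarrow> nat \<Rightarrow> ('a mat \<Rightarrow> 'a) set"
  for F :: "'a set" and n :: nat where
  const: "c \<in> F \<Longrightarrow> (\<lambda>g. c) \<in> GL_regular F n"
| entry: "i < n \<Longrightarrow> j < n \<Longrightarrow> (\<lambda>g. g $$ (i, j)) \<in> GL_regular F n"
| inv_det: "(\<lambda>g. inverse (det g)) \<in> GL_regular F n"
| add: "p \<in> GL_regular F n \<Longrightarrow> q \<in> GL_regular F n \<Longrightarrow> (\<lambda>g. p g + q g) \<in> GL_regular F n"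
| mult: "p \<in> GL_regular F n \<Longrightarrow> q \<in> GL_regular F n \<Longrightarrow> (\<lambda>g. p g * q g) \<in> GL_regular F n"

text \<open>
  A \<open>K\<close>-vector space \<open>V\<close> is also an \<open>F\<close>-vector space (same record). An ordered \<open>F\<close>-basis
  \<open>b\<close> of \<open>V\<close>, of length \<open>n\<close>, identifies \<open>V \<otimes>\<^sub>F \<Omega>\<close> with \<open>\<Omega>\<^sup>n\<close>.
\<close>

definition ordered_basis :: "'a::field set \<Rightarrow> ('a, 'v) module \<Rightarrow> 'v list \<Rightarrow> bool" where
  "ordered_basis F V b \<longleftrightarrow> distinct b \<and> vectorspace.basis (fld F) V (set b)"

definition endo_mat ::
  "'a::field set \<Rightarrow> ('a, 'v) module \<Rightarrow> 'v list \<Rightarrow> ('v \<Rightarrow> 'v) \<Rightarrow> 'a mat" where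
  "endo_mat F V b T =
     (THE M. M \<in> carrier_mat (length b) (length b) \<and> elements_mat M \<subseteq> F \<and>
        (\<forall>j<length b. T (b ! j) = (\<Oplus>\<^bsub>V\<^esub>i\<in>{..<length b}. M $$ (i, j) \<odot>\<^bsub>V\<^esub> b ! i)))"

definition gram_mat :: "'v list \<Rightarrow> ('v \<Rightarrow> 'v \<Rightarrow> 'a) \<Rightarrow> 'a mat" where
  "gram_mat b B = mat (length b) (length b) (\<lambda>(i, j). B (b ! i) (b ! j))"

definition functionals :: "'a::field set \<Rightarrow> 'a set \<Rightarrow> ('a \<Rightarrow> 'a) set" where
  "functionals F K =
     {l \<in> K \<rightarrow> F. (\<forall>x\<in>K. \<forall>y\<in>K. l (x + y) = l x + l y) \<and> (\<forall>c\<in>F. \<forall>x\<in>K. l (c * x) = c * l x)}"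

text \<open>
  \<open>U(V,h)\<close> as a closed \<open>F\<close>-subgroup of \<open>GL\<^sub>F(V)\<close>. Its \<open>\<Omega>\<close>-points are the automorphisms \<open>g\<close> of
  \<open>V \<otimes>\<^sub>F \<Omega>\<close> that are linear over \<open>K \<otimes>\<^sub>F \<Omega>\<close> and preserve the extension of \<open>h\<close>, which takes
  values in \<open>K \<otimes>\<^sub>F \<Omega>\<close>. An element of \<open>K \<otimes>\<^sub>F \<Omega>\<close> is determined by its images under \<open>l \<otimes> id\<close>
  for the \<open>F\<close>-linear \<open>l : K \<rightarrow> F\<close>, so \<open>h\<close> is preserved iff the extension of every \<open>F\<close>-bilinear
  form \<open>l \<circ> h\<close> is.
\<close>

definition U ::
  "'a::field set \<Rightarrow> 'a set \<Rightarrow> ('a, 'v) module \<Rightarrow> ('v \<Rightarrow> 'v \<Rightarrow> 'a) \<Rightarrow> 'v list \<Rightarrow>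
   ('a mat, 'a) algebraic_group" where
  "U F K V h b =
     (let n = length b;
          G = {g \<in> carrier_mat n n. det g \<noteq> 0 \<and>
                 (\<forall>x\<in>K. g * endo_mat F V b (\<lambda>v. x \<odot>\<^bsub>V\<^esub> v) = endo_mat F V b (\<lambda>v. x \<odot>\<^bsub>V\<^esub> v) * g) \<and>
                 (\<forall>l\<in>functionals F K.
                    transpose_mat g * gram_mat b (\<lambda>v w. l (h v w)) * g
                      = gram_mat b (\<lambda>v w. l (h v w)))}
      in \<lparr>carrier = G, monoid.mult = (*), one = 1\<^sub>m n, regular = (\<lambda>p. restrict p G) ` GL_regular F n\<rparr>)"

text \<open>Changing the basis \<open>b\<close> changes these groups only by an \<open>F\<close>-isomorphism.\<close>

definition PU ::
  "'a::field set \<Rightarrow> 'a set \<Rightarrow> ('a, 'v) module \<Rightarrow> ('v \<Rightarrow> 'v \<Rightarrow> 'a) \<Rightarrow> 'v list \<Rightarrow>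
   ('a mat set, 'a) algebraic_group" where
  "PU F K V h b = adjoint_group (U F K V h b)"

end

theory Submission
  imports Defs "Jordan_Normal_Form.Char_Poly"
begin

text \<open>
  In an orthogonal basis of \<open>V\<close> over \<open>K\<close>, the splitting \<open>K \<otimes>\<^sub>F \<Omega> = \<Omega> \<times> \<Omega>\<close> identifies \<open>U(V, h)(\<Omega>)\<close>
  with \<open>GL\<^sub>m(\<Omega>)\<close>, and an isomorphism of adjoint groups lifts to a map \<open>f\<close> on \<open>GL\<^sub>m(\<Omega>)\<close> that is
  multiplicative up to scalars and polynomial along root subgroups, because the matrix coefficients of
  the adjoint representation are regular.

  Differentiating \<open>t \<mapsto> Ad (f (1 + t E\<^sub>i\<^sub>j))\<close> yields matrices \<open>N\<^sub>i\<^sub>j\<close> on which the images of diagonal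
  matrices act by the characters \<open>s\<^sub>i / s\<^sub>j\<close>. The image of a sufficiently general diagonal matrix is
  therefore diagonalizable, and in its eigenbasis the \<open>N\<^sub>i\<^sub>j\<close> are multiples of matrix units; comparing
  the dimensions of eigenspaces shows that, possibly after composing with the inverse transpose, \<open>f\<close>
  is conjugation by some \<open>P\<close> on enough block matrices.

  Finally \<open>f\<close> sends \<open>F\<close>-points of the first unitary group to matrices whose conjugation action is
  defined over \<open>F\<close>. Evaluated at \<open>1 + (z - 1) e\<close>, where \<open>z \<in> K\<^sub>1\<close> has norm 1 and \<open>e\<close> is a Hermitian
  projection of rank one, this gives \<open>z \<in> K\<^sub>2\<close> for \<open>m \<ge> 3\<close>, and shows that conjugation by \<open>P\<close> carries
  Hermitian projections over \<open>K\<close> for \<open>h\<^sub>1\<close> to such projections for \<open>h\<^sub>2\<close>. Hence \<open>P\<close> is, up to a scalar,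
  defined over \<open>K\<close>, and it is a conformal map.
\<close>

section \<open>Matrix units, inverses, conjugation\<close>

text \<open>The lift \<open>f\<close> comes from choosing representatives of cosets, so it need be
  neither regular nor multiplicative, and only functions on the target that are invariant under the
  center can be pulled back. Hence everything is read off from \<open>Ad (f A)\<close>, and unknown
  scalars are removed by forming the trace of a matrix times its inverse, which does not change when
  the matrix is rescaled. Only blocks in the coordinates 0 and j are treated, not all of
  \<open>GLm m\<close>: they include the unitary quasi-reflections along u_0 + c u_j that are used,
  and the corresponding projections already determine a diagonal form up to a factor. The bound m >=
  3 enters through the parameter z = -1, whose reflection has trace m - 2. For m = 2 this factor is
  0 and the argument for the equality of the fields gives nothing. The inverse transpose replaces
  the form diag(b) by its dual diag(1/b); since diag(1/b) diag(b) diag(1/b) = diag(1/b), a conformal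
  matrix for the dual yields one for the original form.\<close>

definition GLm :: "nat \<Rightarrow> 'a::field mat set" where
  "GLm m = {A \<in> carrier_mat m m. det A \<noteq> 0}"

definition minv :: "'a::field mat \<Rightarrow> 'a mat" where
  "minv A = inverse (det A) \<cdot>\<^sub>m adj_mat A"

definition mtrace :: "'a::comm_ring_1 mat \<Rightarrow> 'a" where
  "mtrace A = (\<Sum>i<dim_row A. A $$ (i, i))"

definition matunit :: "nat \<Rightarrow> nat \<Rightarrow> nat \<Rightarrow> 'a::comm_ring_1 mat" where
  "matunit m i j = mat m m (\<lambda>(a, b). if a = i \<and> b = j then 1 else 0)"

definition Ad :: "'a::field mat \<Rightarrow> 'a mat \<Rightarrow> 'a mat" where
  "Ad g E = g * E * minv g"

lemma mult_carrier_sq [simp]: "A \<in> carrier_mat m m \<Longrightarrow> B \<in> carrier_mat m m \<Longrightarrow> A * B \<in> carrier_mat m m"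
  by simp

lemma minus_carrier_sq [simp]: "A \<in> carrier_mat m m \<Longrightarrow> B \<in> carrier_mat m m \<Longrightarrow> A - B \<in> carrier_mat m m"
  by auto

lemma smult_smult_sq: "(a::'a::comm_ring_1) \<cdot>\<^sub>m (b \<cdot>\<^sub>m A) = (a * b) \<cdot>\<^sub>m A"
  by (auto intro!: eq_matI simp: mult.assoc)

lemma smult_one_sq [simp]: "(1::'a::comm_ring_1) \<cdot>\<^sub>m A = A"
  by (auto intro!: eq_matI)

lemma GLm_carrier: "A \<in> GLm m \<Longrightarrow> A \<in> carrier_mat m m"
  by (simp add: GLm_def)

lemma minv_carrier [simp]: "A \<in> carrier_mat m m \<Longrightarrow> minv A \<in> carrier_mat m m"
  by (simp add: minv_def adj_mat(1))

lemma minv_right: assumes "A \<in> GLm m" shows "A * minv A = 1\<^sub>m m"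
proof -
  have A: "A \<in> carrier_mat m m" and d: "det A \<noteq> 0" using assms by (auto simp: GLm_def)
  have "A * minv A = inverse (det A) \<cdot>\<^sub>m (A * adj_mat A)"
    unfolding minv_def by (rule mult_smult_distrib[OF A adj_mat(1)[OF A]])
  also have "\<dots> = 1\<^sub>m m" using d by (simp add: adj_mat(2)[OF A] smult_smult_sq)
  finally show ?thesis .
qed

lemma minv_left: assumes "A \<in> GLm m" shows "minv A * A = 1\<^sub>m m"
proof -
  have A: "A \<in> carrier_mat m m" and d: "det A \<noteq> 0" using assms by (auto simp: GLm_def)
  have "minv A * A = inverse (det A) \<cdot>\<^sub>m (adj_mat A * A)"
    unfolding minv_def by (rule mult_smult_assoc_mat[OF adj_mat(1)[OF A] A])
  also have "\<dots> = 1\<^sub>m m" using d by (simp add: adj_mat(3)[OF A] smult_smult_sq)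
  finally show ?thesis .
qed

lemma GLmI: assumes "A \<in> carrier_mat m m" "B \<in> carrier_mat m m" "A * B = 1\<^sub>m m"
  shows "A \<in> GLm m" "B \<in> GLm m"
proof -
  have "det A * det B = 1" using det_mult[OF assms(1,2)] assms(3) by simp
  then show "A \<in> GLm m" "B \<in> GLm m" using assms by (auto simp: GLm_def)
qed

lemma minv_unique: assumes "A \<in> carrier_mat m m" "B \<in> carrier_mat m m" "A * B = 1\<^sub>m m"
  shows "minv A = B" "minv B = A"
proof -
  note G = GLmI[OF assms]
  have "minv A = minv A * (A * B)" unfolding assms(3) using minv_carrier[OF assms(1)] by (simp add: right_mult_one_mat[of _ m m])
  also have "\<dots> = B" using assms(1,2) by (simp add: assoc_mult_mat[of _ m m _ m _ m, symmetric] minv_left[OF G(1)])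
  finally show "minv A = B" .
  have "minv B = (A * B) * minv B" unfolding assms(3) using minv_carrier[OF assms(2)] by (simp add: left_mult_one_mat[of _ m m])
  also have "\<dots> = A" using assms(1,2) by (simp add: assoc_mult_mat[of _ m m _ m _ m] minv_right[OF G(2)])
  finally show "minv B = A" .
qed

lemma GLm_minv: "A \<in> GLm m \<Longrightarrow> minv A \<in> GLm m"
  using GLmI(2)[OF GLm_carrier minv_carrier minv_right] GLm_carrier by blast

lemma minv_minv: "A \<in> GLm m \<Longrightarrow> minv (minv A) = A"
  using minv_unique(2)[OF GLm_carrier minv_carrier minv_right] GLm_carrier by blast

lemma GLm_mult: "A \<in> GLm m \<Longrightarrow> B \<in> GLm m \<Longrightarrow> A * B \<in> GLm m"
  by (auto simp: GLm_def det_mult[of _ m])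

lemma GLm_one [simp]: "1\<^sub>m m \<in> GLm m"
  by (simp add: GLm_def)

lemma GLm_smult: "k \<noteq> 0 \<Longrightarrow> A \<in> GLm m \<Longrightarrow> k \<cdot>\<^sub>m A \<in> GLm m"
  by (simp add: GLm_def)

lemma GLm_transpose: "A \<in> GLm m \<Longrightarrow> A\<^sup>T \<in> GLm m"
  by (auto simp: GLm_def det_transpose)

lemma minv_one [simp]: "minv (1\<^sub>m m) = (1\<^sub>m m :: 'a::field mat)"
  by (rule minv_unique(1)[of _ m]) auto

lemma minv_mult: assumes "A \<in> GLm m" "B \<in> GLm m"
  shows "minv (A * B) = minv B * minv A"
proof (rule minv_unique(1)[of _ m])
  have [simp]: "A \<in> carrier_mat m m" "B \<in> carrier_mat m m" using assms GLm_carrier by auto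
  have "A * B * (minv B * minv A) = A * (B * minv B) * minv A"
    by (simp add: assoc_mult_mat[of _ m m _ m _ m])
  then show "A * B * (minv B * minv A) = 1\<^sub>m m"
    by (simp add: minv_right[OF assms(1)] minv_right[OF assms(2)] right_mult_one_mat[of _ m m])
qed (use assms in \<open>simp_all add: GLm_carrier\<close>)

lemma minv_smult: assumes "k \<noteq> 0" "A \<in> GLm m" shows "minv (k \<cdot>\<^sub>m A) = inverse k \<cdot>\<^sub>m minv A"
proof (rule minv_unique(1)[of _ m])
  have [simp]: "A \<in> carrier_mat m m" using assms GLm_carrier by auto
  show "k \<cdot>\<^sub>m A * (inverse k \<cdot>\<^sub>m minv A) = 1\<^sub>m m"
    using assms by (simp add: mult_smult_distrib[of _ m m _ m] mult_smult_assoc_mat[of _ m m _ m]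
        smult_smult_sq minv_right)
qed (use assms in \<open>simp_all add: GLm_carrier\<close>)

lemma minv_transpose: assumes "A \<in> GLm m" shows "minv (A\<^sup>T) = (minv A)\<^sup>T"
proof (rule minv_unique(1)[of _ m])
  have [simp]: "A \<in> carrier_mat m m" using assms GLm_carrier by auto
  show "A\<^sup>T * (minv A)\<^sup>T = 1\<^sub>m m"
    by (simp add: transpose_mult[of _ m m _ m, symmetric] minv_left[OF assms])
qed (use assms in \<open>simp_all add: GLm_carrier\<close>)

lemma Ad_carrier [simp]: "g \<in> carrier_mat m m \<Longrightarrow> E \<in> carrier_mat m m \<Longrightarrow> Ad g E \<in> carrier_mat m m"
  by (simp add: Ad_def mult_carrier_mat[of _ m m])

lemma Ad_comp: assumes "g \<in> GLm m" "h \<in> GLm m" "E \<in> carrier_mat m m"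
  shows "Ad (g * h) E = Ad g (Ad h E)"
  using assms by (simp add: Ad_def minv_mult[of _ m] assoc_mult_mat[of _ m m _ m _ m] GLm_carrier mult_carrier_mat[of _ m m])

lemma Ad_smult_left: assumes "k \<noteq> 0" "g \<in> GLm m" "E \<in> carrier_mat m m"
  shows "Ad (k \<cdot>\<^sub>m g) E = Ad g E"
  using assms by (simp add: Ad_def minv_smult[of _ _ m] mult_smult_distrib[of _ m m _ m]
      mult_smult_assoc_mat[of _ m m _ m] smult_smult_sq GLm_carrier mult_carrier_mat[of _ m m])

lemma Ad_one [simp]: "E \<in> carrier_mat m m \<Longrightarrow> Ad (1\<^sub>m m) E = E"
  by (simp add: Ad_def left_mult_one_mat[of _ m m] right_mult_one_mat[of _ m m])

lemma Ad_mult: assumes "g \<in> GLm m" "A \<in> carrier_mat m m" "B \<in> carrier_mat m m"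
  shows "Ad g (A * B) = Ad g A * Ad g B"
proof -
  have [simp]: "g \<in> carrier_mat m m" using assms GLm_carrier by auto
  have "Ad g A * Ad g B = g * A * (minv g * g) * B * minv g"
    using assms by (simp add: Ad_def assoc_mult_mat[of _ m m _ m _ m] mult_carrier_mat[of _ m m])
  then show ?thesis
    using assms by (simp add: minv_left Ad_def assoc_mult_mat[of _ m m _ m _ m] mult_carrier_mat[of _ m m] left_mult_one_mat[of _ m m])
qed

lemma Ad_minv: assumes "g \<in> GLm m" "E \<in> carrier_mat m m"
  shows "Ad g (Ad (minv g) E) = E" "Ad (minv g) (Ad g E) = E"
  using assms by (simp_all add: Ad_comp[symmetric, of _ m] GLm_minv minv_right minv_left)

lemma Ad_eq_iff: assumes "g \<in> GLm m" "E \<in> carrier_mat m m" "E' \<in> carrier_mat m m"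
  shows "Ad g E = E' \<longleftrightarrow> g * E = E' * g"
proof
  have [simp]: "g \<in> carrier_mat m m" using assms GLm_carrier by auto
  assume "Ad g E = E'"
  then have "E' * g = g * E * (minv g * g)" using assms
    by (auto simp: Ad_def assoc_mult_mat[of _ m m _ m _ m] mult_carrier_mat[of _ m m])
  then show "g * E = E' * g" using assms by (simp add: minv_left mult_carrier_mat[of _ m m] right_mult_one_mat[of _ m m])
next
  have [simp]: "g \<in> carrier_mat m m" using assms GLm_carrier by auto
  assume "g * E = E' * g"
  then have "Ad g E = E' * (g * minv g)" using assms
    by (simp add: Ad_def assoc_mult_mat[of _ m m _ m _ m])
  then show "Ad g E = E'" using assms by (simp add: minv_right right_mult_one_mat[of _ m m])
qed

lemma Ad_add: assumes "g \<in> carrier_mat m m" "A \<in> carrier_mat m m" "B \<in> carrier_mat m m"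
  shows "Ad g (A + B) = Ad g A + Ad g B"
  using assms by (simp add: Ad_def mult_add_distrib_mat[of _ m m _ m] add_mult_distrib_mat[of _ m m _ _ m] mult_carrier_mat[of _ m m])

lemma Ad_minus: assumes "g \<in> carrier_mat m m" "A \<in> carrier_mat m m" "B \<in> carrier_mat m m"
  shows "Ad g (A - B) = Ad g A - Ad g B"
  using assms by (simp add: Ad_def mult_minus_distrib_mat[of _ m m _ m] minus_mult_distrib_mat[of _ m m _ _ m] mult_carrier_mat[of _ m m])

lemma Ad_smult: assumes "g \<in> carrier_mat m m" "A \<in> carrier_mat m m"
  shows "Ad g (c \<cdot>\<^sub>m A) = c \<cdot>\<^sub>m Ad g A"
  using assms by (simp add: Ad_def mult_smult_distrib[of _ m m _ m] mult_smult_assoc_mat[of _ m m _ m] mult_carrier_mat[of _ m m])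

section \<open>Matrix units and the trace\<close>

lemma matunit_carrier [simp]: "matunit m i j \<in> carrier_mat m m"
  by (simp add: matunit_def)

lemma index_matunit [simp]: "a < m \<Longrightarrow> b < m \<Longrightarrow> matunit m i j $$ (a, b) = (if a = i \<and> b = j then 1 else 0)"
  by (simp add: matunit_def)

lemma dim_matunit [simp]: "dim_row (matunit m i j) = m" "dim_col (matunit m i j) = m"
  by (simp_all add: matunit_def)

lemma index_mult_mat': assumes "A \<in> carrier_mat k l" "B \<in> carrier_mat l n" "i < k" "j < n"
  shows "(A * B) $$ (i, j) = (\<Sum>a<l. A $$ (i, a) * B $$ (a, j))"
  using assms by (auto simp: scalar_prod_def atLeast0LessThan intro!: sum.cong)

lemma matunit_mult_left: assumes "A \<in> carrier_mat m k" "j < m"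
  shows "matunit m i j * A = mat m k (\<lambda>(a, b). if a = i then A $$ (j, b) else 0)"
proof (rule eq_matI)
  fix a b assume "a < dim_row (mat m k (\<lambda>(a, b). if a = i then A $$ (j, b) else 0))"
    "b < dim_col (mat m k (\<lambda>(a, b). if a = i then A $$ (j, b) else 0))"
  then have ab: "a < m" "b < k" by auto
  have "(matunit m i j * A) $$ (a, b) = (\<Sum>c<m. (if a = i \<and> c = j then 1 else 0) * A $$ (c, b))"
    using ab by (subst index_mult_mat'[OF matunit_carrier assms(1)]) auto
  also have "\<dots> = (\<Sum>c<m. if c = j then (if a = i then A $$ (j, b) else 0) else 0)"
    by (rule sum.cong) auto
  also have "\<dots> = (if a = i then A $$ (j, b) else 0)" using assms(2) by (subst sum.delta) auto
  finally show "(matunit m i j * A) $$ (a, b) = mat m k (\<lambda>(a, b). if a = i then A $$ (j, b) else 0) $$ (a, b)"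
    using ab by simp
qed (use assms in auto)

lemma matunit_mult_right: assumes "A \<in> carrier_mat k m" "i < m"
  shows "A * matunit m i j = mat k m (\<lambda>(a, b). if b = j then A $$ (a, i) else 0)"
proof (rule eq_matI)
  fix a b assume "a < dim_row (mat k m (\<lambda>(a, b). if b = j then A $$ (a, i) else 0))"
    "b < dim_col (mat k m (\<lambda>(a, b). if b = j then A $$ (a, i) else 0))"
  then have ab: "a < k" "b < m" by auto
  have "(A * matunit m i j) $$ (a, b) = (\<Sum>c<m. A $$ (a, c) * (if c = i \<and> b = j then 1 else 0))"
    using ab by (subst index_mult_mat'[OF assms(1) matunit_carrier]) auto
  also have "\<dots> = (\<Sum>c<m. if c = i then (if b = j then A $$ (a, i) else 0) else 0)"
    by (rule sum.cong) auto
  also have "\<dots> = (if b = j then A $$ (a, i) else 0)" using assms(2) by (subst sum.delta) auto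
  finally show "(A * matunit m i j) $$ (a, b) = mat k m (\<lambda>(a, b). if b = j then A $$ (a, i) else 0) $$ (a, b)"
    using ab by simp
qed (use assms in auto)

lemma matunit_mult: "j < m \<Longrightarrow> k < m \<Longrightarrow> i < m \<Longrightarrow> l < m \<Longrightarrow>
    matunit m i j * matunit m k l = (if j = k then matunit m i l else 0\<^sub>m m m)"
  by (subst matunit_mult_left[of _ m m]) (auto intro!: eq_matI)

text \<open>Comparing the entries at (0, b) for E_0b equates the diagonal entries; those at (a, b)
  for E_aa kill the off-diagonal ones.\<close>

lemma commute_matunits_scalar:
  assumes A: "A \<in> carrier_mat m m" and m: "0 < m"
    and comm: "\<And>i j. i < m \<Longrightarrow> j < m \<Longrightarrow> matunit m i j * A = A * matunit m i j"
  shows "A = A $$ (0, 0) \<cdot>\<^sub>m 1\<^sub>m m"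
proof (rule eq_matI)
  fix a b assume "a < dim_row (A $$ (0, 0) \<cdot>\<^sub>m 1\<^sub>m m)" "b < dim_col (A $$ (0, 0) \<cdot>\<^sub>m 1\<^sub>m m)"
  then have ab: "a < m" "b < m" by auto
  have "(matunit m 0 b * A) $$ (0, b) = A $$ (b, b)"
    "(A * matunit m 0 b) $$ (0, b) = A $$ (0, 0)"
    using ab m by (simp_all add: matunit_mult_left[OF A] matunit_mult_right[OF A])
  then have 1: "A $$ (b, b) = A $$ (0, 0)" using comm[OF m ab(2)] by simp
  have 2: "A $$ (a, b) = 0" if "a \<noteq> b"
  proof -
    have "(matunit m a a * A) $$ (a, b) = A $$ (a, b)" "(A * matunit m a a) $$ (a, b) = 0"
      using ab that by (simp_all add: matunit_mult_left[OF A] matunit_mult_right[OF A])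
    then show ?thesis using comm[OF ab(1) ab(1)] by simp
  qed
  show "A $$ (a, b) = (A $$ (0, 0) \<cdot>\<^sub>m 1\<^sub>m m) $$ (a, b)"
    using ab 1 2 by auto
qed (use A in auto)

lemma mtrace_add: "A \<in> carrier_mat m m \<Longrightarrow> B \<in> carrier_mat m m \<Longrightarrow> mtrace (A + B) = mtrace A + mtrace B"
  by (auto simp: mtrace_def sum.distrib)

lemma mtrace_minus: "A \<in> carrier_mat m m \<Longrightarrow> B \<in> carrier_mat m m \<Longrightarrow> mtrace (A - B) = mtrace A - mtrace B"
  by (auto simp: mtrace_def sum_subtractf)

lemma mtrace_smult: "A \<in> carrier_mat m m \<Longrightarrow> mtrace (c \<cdot>\<^sub>m A) = c * mtrace A"
  by (auto simp: mtrace_def sum_distrib_left)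

lemma mtrace_one: "mtrace (1\<^sub>m m) = of_nat m"
  by (simp add: mtrace_def)

lemma mtrace_comm: assumes "A \<in> carrier_mat m k" "B \<in> carrier_mat k m"
  shows "mtrace (A * B) = mtrace (B * A)"
proof -
  have "mtrace (A * B) = (\<Sum>i<m. \<Sum>j<k. A $$ (i, j) * B $$ (j, i))"
    using assms by (auto simp: mtrace_def index_mult_mat'[OF assms] simp del: index_mult_mat(1) intro!: sum.cong)
  also have "\<dots> = (\<Sum>j<k. \<Sum>i<m. B $$ (j, i) * A $$ (i, j))"
    by (subst sum.swap) (simp add: mult.commute)
  also have "\<dots> = mtrace (B * A)"
    using assms by (auto simp: mtrace_def index_mult_mat'[OF assms(2,1)] simp del: index_mult_mat(1) intro!: sum.cong)
  finally show ?thesis .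
qed

lemma mtrace_Ad: assumes "g \<in> GLm m" "A \<in> carrier_mat m m" shows "mtrace (Ad g A) = mtrace A"
proof -
  have [simp]: "g \<in> carrier_mat m m" using assms GLm_carrier by auto
  have "mtrace (Ad g A) = mtrace (minv g * (g * A))"
    unfolding Ad_def by (rule mtrace_comm[of _ m m]) (use assms in \<open>auto simp: mult_carrier_mat[of _ m m]\<close>)
  also have "minv g * (g * A) = A" using assms
    by (simp add: assoc_mult_mat[of _ m m _ m _ m, symmetric] minv_left left_mult_one_mat[of _ m m])
  finally show ?thesis .
qed

text \<open>For distinct \<open>i\<close> and \<open>j\<close> these are the elements of the root
  subgroup of GL_m at the root e_i - e_j.\<close>

definition trv :: "nat \<Rightarrow> nat \<Rightarrow> nat \<Rightarrow> 'a::field \<Rightarrow> 'a mat" where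
  "trv m i j x = 1\<^sub>m m + x \<cdot>\<^sub>m matunit m i j"

lemma trv_carrier [simp]: "trv m i j x \<in> carrier_mat m m"
  and dim_trv [simp]: "dim_row (trv m i j x) = m" "dim_col (trv m i j x) = m"
  by (simp_all add: trv_def)

lemma index_trv: "a < m \<Longrightarrow> b < m \<Longrightarrow>
    trv m i j x $$ (a, b) = (if a = b then 1 else 0) + (if a = i \<and> b = j then x else 0)"
  by (auto simp: trv_def matunit_def)

lemma trv_mult_left: assumes "A \<in> carrier_mat m m" "j < m"
  shows "trv m i j x * A = mat m m (\<lambda>(a, b). A $$ (a, b) + (if a = i then x * A $$ (j, b) else 0))"
  using assms by (auto intro!: eq_matI simp: trv_def add_mult_distrib_mat[of _ m m] mult_smult_assoc_mat[of _ m m _ m]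
      matunit_mult_left[of _ m m] left_mult_one_mat[of _ m m])

lemma trv_add: assumes "i \<noteq> j" "i < m" "j < m" shows "trv m i j (x + y) = trv m i j x * trv m i j y"
  using assms by (subst trv_mult_left) (auto intro!: eq_matI simp: index_trv)

lemma trv_0: "trv m i j 0 = 1\<^sub>m m"
  by (auto intro!: eq_matI simp: trv_def matunit_def)

lemma trv_inverse: assumes "i \<noteq> j" "i < m" "j < m"
  shows "trv m i j x \<in> GLm m" "minv (trv m i j x) = trv m i j (- x)"
proof -
  have "trv m i j x * trv m i j (- x) = 1\<^sub>m m"
    using trv_add[OF assms, of x "- x"] by (simp add: trv_0)
  from GLmI(1)[OF _ _ this] minv_unique(1)[OF _ _ this]
  show "trv m i j x \<in> GLm m" "minv (trv m i j x) = trv m i j (- x)" by auto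
qed

lemma mat_diag_GLm: assumes "\<And>i. i < m \<Longrightarrow> s i \<noteq> 0"
  shows "mat_diag m s \<in> GLm m" "minv (mat_diag m s) = mat_diag m (\<lambda>i. inverse (s i))"
proof -
  have "mat_diag m s * mat_diag m (\<lambda>i. inverse (s i)) = 1\<^sub>m m"
    unfolding mat_diag_diag by (auto intro!: eq_matI simp: mat_diag_def assms)
  from GLmI(1)[OF _ _ this] minv_unique(1)[OF _ _ this]
  show "mat_diag m s \<in> GLm m" "minv (mat_diag m s) = mat_diag m (\<lambda>i. inverse (s i))" by auto
qed

text \<open>The diagonal torus acts on the root subgroup (i, j) through the character s_i / s_j.
  Roots are recognised by these characters later.\<close>

lemma mat_diag_trv: assumes "i < m" "j < m" "\<And>k. k < m \<Longrightarrow> s k \<noteq> 0"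
  shows "mat_diag m s * trv m i j x = trv m i j (s i / s j * x) * mat_diag m s"
  using assms by (auto intro!: eq_matI simp: mat_diag_mult_left[of _ m m] mat_diag_mult_right[of _ m m] index_trv)

section \<open>One-parameter groups in the adjoint representation\<close>

text \<open>A polynomial curve of matrices is stored as a matrix of polynomials, so that its
  derivative \<open>mderiv\<close> is formal.\<close>

definition evalm :: "'a::comm_ring_1 poly mat \<Rightarrow> 'a \<Rightarrow> 'a mat" where
  "evalm R t = map_mat (\<lambda>p. poly p t) R"

definition mderiv :: "'a::field_char_0 poly mat \<Rightarrow> 'a poly mat" where
  "mderiv R = map_mat pderiv R"

lemma evalm_carrier [simp]: "R \<in> carrier_mat m m \<Longrightarrow> evalm R t \<in> carrier_mat m m"
  by (simp add: evalm_def)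

lemma mderiv_carrier [simp]: "R \<in> carrier_mat m m \<Longrightarrow> mderiv R \<in> carrier_mat m m"
  by (simp add: mderiv_def)

lemma index_evalm [simp]: "R \<in> carrier_mat m m \<Longrightarrow> a < m \<Longrightarrow> b < m \<Longrightarrow> evalm R t $$ (a, b) = poly (R $$ (a, b)) t"
  by (auto simp: evalm_def)

lemma index_mderiv [simp]: "R \<in> carrier_mat m m \<Longrightarrow> a < m \<Longrightarrow> b < m \<Longrightarrow> mderiv R $$ (a, b) = pderiv (R $$ (a, b))"
  by (auto simp: mderiv_def)

lemma poly_ext: "(\<And>t. poly p t = poly q t) \<Longrightarrow> p = q" for p q :: "'a::field_char_0 poly"
  using poly_eq_poly_eq_iff[of p q] by auto

lemma evalm_ext: fixes R :: "'a::field_char_0 poly mat"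
  assumes "R \<in> carrier_mat m m" "S \<in> carrier_mat m m" "\<And>t. evalm R t = evalm S t"
  shows "R = S"
proof (rule eq_matI)
  fix a b assume "a < dim_row S" "b < dim_col S"
  then have ab: "a < m" "b < m" using assms by auto
  show "R $$ (a, b) = S $$ (a, b)"
    by (rule poly_ext) (metis index_evalm assms ab)
qed (use assms in auto)

text \<open>Translation of the parameter commutes with the formal derivative. This turns the group
  law of a one-parameter group into a differential equation.\<close>

lemma pderiv_shift:
  assumes "\<And>s. poly p (s + t) = poly q s"
  shows "poly (pderiv p) t = poly (pderiv q) (0::'a::field_char_0)"
proof -
  have "pcompose p [:t, 1:] = q"
    by (rule poly_ext) (simp add: poly_pcompose assms add.commute)
  then have "poly (pderiv (pcompose p [:t, 1:])) 0 = poly (pderiv q) 0" by simp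
  then show ?thesis by (simp add: pderiv_pcompose poly_pcompose pderiv_pCons)
qed

text \<open>Scalars disappear under \<open>Ad\<close>, so t -> Ad (r t) is an honest polynomial
  one-parameter group of automorphisms of the matrix algebra. Its derivative at 0 is a derivation,
  derivations of a matrix algebra are inner, and trace 0 singles out one inner generator.\<close>

lemma one_param_generator:
  fixes r :: "'a::field_char_0 \<Rightarrow> 'a mat"
  assumes m: "0 < m" and r: "\<And>t. r t \<in> GLm m"
    and rel: "\<And>s t. \<exists>k. k \<noteq> 0 \<and> r (s + t) = k \<cdot>\<^sub>m (r s * r t)"
    and pol: "\<And>E. E \<in> carrier_mat m m \<Longrightarrow> \<exists>R\<in>carrier_mat m m. \<forall>t. Ad (r t) E = evalm R t"
  obtains N where "N \<in> carrier_mat m m" "mtrace N = 0"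
    "\<And>E R. E \<in> carrier_mat m m \<Longrightarrow> R \<in> carrier_mat m m \<Longrightarrow> (\<And>t. Ad (r t) E = evalm R t) \<Longrightarrow>
       evalm R 0 = E \<and> (\<forall>t. evalm (mderiv R) t = N * evalm R t - evalm R t * N)"
proof -
  have rc [simp]: "r t \<in> carrier_mat m m" for t using r GLm_carrier by auto
  have "\<forall>E. \<exists>R. E \<in> carrier_mat m m \<longrightarrow> R \<in> carrier_mat m m \<and> (\<forall>t. Ad (r t) E = evalm R t)"
    using pol by blast
  then obtain Rf where Rf [simp]: "E \<in> carrier_mat m m \<Longrightarrow> Rf E \<in> carrier_mat m m"
    and AdRf: "E \<in> carrier_mat m m \<Longrightarrow> Ad (r t) E = evalm (Rf E) t" for E t
    by metis
  define p where "p E a b = Rf E $$ (a, b)" for E a b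
  have p: "Ad (r t) E $$ (a, b) = poly (p E a b) t"
    if "E \<in> carrier_mat m m" "a < m" "b < m" for E a b t
    using AdRf[OF that(1)] index_evalm[OF Rf[OF that(1)] that(2,3)] by (simp add: p_def)
  have comp: "Ad (r (s + t)) E = Ad (r s) (Ad (r t) E)" if "E \<in> carrier_mat m m" for E s t
    using rel[of s t] that r by (auto simp: Ad_smult_left[of _ _ m] GLm_mult Ad_comp[of _ m])
  \<comment> \<open>By the group law \<open>Ad (r 0)\<close> is idempotent; being invertible, it is
    the identity.\<close>
  have r0: "Ad (r 0) E = E" if E: "E \<in> carrier_mat m m" for E
  proof -
    have "Ad (r 0) E = Ad (r 0) (Ad (r 0) E)" using comp[OF E, of 0 0] by simp
    then have "Ad (minv (r 0)) (Ad (r 0) E) = Ad (minv (r 0)) (Ad (r 0) (Ad (r 0) E))" by simp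
    then show ?thesis by (simp add: Ad_minv(2)[OF r] E)
  qed
  define D where "D E = mat m m (\<lambda>(a, b). poly (pderiv (p E a b)) 0)" for E
  have D [simp]: "D E \<in> carrier_mat m m" for E by (simp add: D_def)
  \<comment> \<open>Translating the curve of \<open>E\<close> by t gives the curve of
    \<open>Ad (r t) E\<close>, so the derivative at t is \<open>D\<close> applied to the current
    point.\<close>
  have F1: "poly (pderiv (p E a b)) t = D (Ad (r t) E) $$ (a, b)"
    if "E \<in> carrier_mat m m" "a < m" "b < m" for E a b t
  proof -
    have "poly (p E a b) (s + t) = poly (p (Ad (r t) E) a b) s" for s
      using that by (simp add: p[symmetric] comp)
    from pderiv_shift[OF this] show ?thesis using that by (simp add: D_def)
  qed
  have p0: "poly (p E a b) 0 = E $$ (a, b)" if "E \<in> carrier_mat m m" "a < m" "b < m" for E a b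
    using p[OF that, of 0] r0[OF that(1)] by simp
  \<comment> \<open>Leibniz rule: \<open>D\<close> is the derivative at 0 of a family of algebra
    automorphisms that starts at the identity.\<close>
  have F2: "D (E * E') = D E * E' + E * D E'" if E: "E \<in> carrier_mat m m" "E' \<in> carrier_mat m m" for E E'
  proof (rule eq_matI)
    fix a b assume "a < dim_row (D E * E' + E * D E')" "b < dim_col (D E * E' + E * D E')"
    then have ab: "a < m" "b < m" using E by (auto simp: D_def)
    have "p (E * E') a b = (\<Sum>c<m. p E a c * p E' c b)"
    proof (rule poly_ext)
      fix t
      have "poly (p (E * E') a b) t = (Ad (r t) E * Ad (r t) E') $$ (a, b)"
        using E ab by (simp add: p[symmetric] Ad_mult[OF r])
      also have "\<dots> = (\<Sum>c<m. Ad (r t) E $$ (a, c) * Ad (r t) E' $$ (c, b))"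
        by (rule index_mult_mat'[of _ m m]) (use E ab in auto)
      also have "\<dots> = poly (\<Sum>c<m. p E a c * p E' c b) t"
        using E ab by (simp add: poly_sum p)
      finally show "poly (p (E * E') a b) t = poly (\<Sum>c<m. p E a c * p E' c b) t" .
    qed
    then have "D (E * E') $$ (a, b) = (\<Sum>c<m. D E $$ (a, c) * E' $$ (c, b) + E $$ (a, c) * D E' $$ (c, b))"
      using ab E by (auto simp: D_def pderiv_sum pderiv_mult poly_sum p0 intro!: sum.cong)
    also have "\<dots> = (D E * E' + E * D E') $$ (a, b)"
      using E ab carrier_matD[OF E(1)] carrier_matD[OF E(2)] carrier_matD[OF D]
      by (simp add: index_mult_mat'[of _ m m _ m] sum.distrib del: index_mult_mat(1))
    finally show "D (E * E') $$ (a, b) = (D E * E' + E * D E') $$ (a, b)" .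
  qed (use E in \<open>auto simp: D_def\<close>)
  \<comment> \<open>The one instance of linearity of \<open>D\<close> that is used: Y E_q0 is the
    combination of the E_k0 with coefficients Y_kq.\<close>
  have F3: "(D (Y * matunit m q 0)) $$ (a, 0) = (\<Sum>k<m. Y $$ (k, q) * (D (matunit m k 0) $$ (a, 0)))"
    if Y: "Y \<in> carrier_mat m m" and aq: "a < m" "q < m" for Y a q
  proof -
    have e: "Ad (r t) (Y * matunit m q 0) $$ (a, 0) = (\<Sum>k<m. Y $$ (k, q) * Ad (r t) (matunit m k 0) $$ (a, 0))" for t
    proof -
      have 1: "(r t * A * minv (r t)) $$ (a, 0) = (\<Sum>l<m. (\<Sum>k<m. r t $$ (a, k) * A $$ (k, l)) * minv (r t) $$ (l, 0))"
        if "A \<in> carrier_mat m m" for A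
        using that aq m by (simp add: index_mult_mat'[of _ m m _ m] del: index_mult_mat(1))
      have 2: "(\<Sum>l<m. (\<Sum>k<m. r t $$ (a, k) * matunit m k' 0 $$ (k, l)) * minv (r t) $$ (l, 0)) =
          r t $$ (a, k') * minv (r t) $$ (0, 0)" if "k' < m" for k'
      proof -
        have "(\<Sum>k<m. r t $$ (a, k) * matunit m k' 0 $$ (k, l)) = (if l = 0 then r t $$ (a, k') else 0)" if "l < m" for l
        proof -
          have "(\<Sum>k<m. r t $$ (a, k) * matunit m k' 0 $$ (k, l)) = (\<Sum>k<m. if k = k' then (if l = 0 then r t $$ (a, k') else 0) else 0)"
            by (rule sum.cong) (use that in auto)
          then show ?thesis using \<open>k' < m\<close> by simp
        qed
        then have "(\<Sum>l<m. (\<Sum>k<m. r t $$ (a, k) * matunit m k' 0 $$ (k, l)) * minv (r t) $$ (l, 0)) =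
          (\<Sum>l<m. if l = 0 then r t $$ (a, k') * minv (r t) $$ (0, 0) else 0)"
          by (intro sum.cong) auto
        then show ?thesis using m by simp
      qed
      have 3: "(\<Sum>l<m. (\<Sum>k<m. r t $$ (a, k) * (Y * matunit m q 0) $$ (k, l)) * minv (r t) $$ (l, 0)) =
          (\<Sum>k<m. r t $$ (a, k) * Y $$ (k, q)) * minv (r t) $$ (0, 0)"
      proof -
        have "(\<Sum>l<m. (\<Sum>k<m. r t $$ (a, k) * (Y * matunit m q 0) $$ (k, l)) * minv (r t) $$ (l, 0)) =
          (\<Sum>l<m. if l = 0 then (\<Sum>k<m. r t $$ (a, k) * Y $$ (k, q)) * minv (r t) $$ (0, 0) else 0)"
          by (rule sum.cong) (use aq in \<open>auto simp: matunit_mult_right[OF Y]\<close>)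
        then show ?thesis using m by simp
      qed
      have "Ad (r t) (Y * matunit m q 0) $$ (a, 0) = (\<Sum>k<m. r t $$ (a, k) * Y $$ (k, q)) * minv (r t) $$ (0, 0)"
        unfolding Ad_def using 1[of "Y * matunit m q 0"] 3 Y by simp
      moreover have "Ad (r t) (matunit m k 0) $$ (a, 0) = r t $$ (a, k) * minv (r t) $$ (0, 0)" if "k < m" for k
        unfolding Ad_def using 1[of "matunit m k 0"] 2[OF that] by simp
      ultimately show ?thesis by (simp add: sum_distrib_right) (simp add: mult_ac)
    qed
    have "p (Y * matunit m q 0) a 0 = (\<Sum>k<m. smult (Y $$ (k, q)) (p (matunit m k 0) a 0))"
    proof (rule poly_ext)
      fix t show "poly (p (Y * matunit m q 0) a 0) t = poly (\<Sum>k<m. smult (Y $$ (k, q)) (p (matunit m k 0) a 0)) t"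
        using e[of t] Y aq m by (simp add: p poly_sum)
    qed
    then show ?thesis using aq m by (simp add: D_def pderiv_sum pderiv_smult poly_sum)
  qed
  \<comment> \<open>\<open>N0\<close> is the sum over q of D(E_q0) E_0q. Column 0 of the Leibniz
    rule for Y E_q0 then reads N0 Y = D Y + Y N0 in column q.\<close>
  define N0 where "N0 = mat m m (\<lambda>(a, q). D (matunit m q 0) $$ (a, 0))"
  have N0 [simp]: "N0 \<in> carrier_mat m m" by (simp add: N0_def)
  have N0D: "N0 * Y - Y * N0 = D Y" if Y: "Y \<in> carrier_mat m m" for Y
  proof (rule eq_matI)
    fix a q assume "a < dim_row (D Y)" "q < dim_col (D Y)"
    then have aq: "a < m" "q < m" by (auto simp: D_def)
    have "(N0 * Y) $$ (a, q) = (\<Sum>k<m. Y $$ (k, q) * (D (matunit m k 0) $$ (a, 0)))"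
      using aq Y by (simp add: index_mult_mat'[of _ m m _ m] N0_def mult.commute del: index_mult_mat(1))
    also have "\<dots> = D (Y * matunit m q 0) $$ (a, 0)" using F3[OF Y aq] by simp
    also have "\<dots> = (D Y * matunit m q 0) $$ (a, 0) + (Y * D (matunit m q 0)) $$ (a, 0)"
      using aq Y m carrier_matD[OF D] by (simp add: F2[OF Y matunit_carrier] del: index_mult_mat(1))
    also have "(D Y * matunit m q 0) $$ (a, 0) = D Y $$ (a, q)"
      using aq m by (simp add: matunit_mult_right[OF D])
    also have "(Y * D (matunit m q 0)) $$ (a, 0) = (Y * N0) $$ (a, q)"
      using aq m Y by (simp add: index_mult_mat'[of _ m m _ m] N0_def del: index_mult_mat(1))
    finally show "(N0 * Y - Y * N0) $$ (a, q) = D Y $$ (a, q)" using aq Y carrier_matD[OF N0] by (simp del: index_mult_mat(1))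
  qed (use Y carrier_matD[OF N0] in \<open>auto simp: D_def\<close>)
  \<comment> \<open>Subtracting a scalar matrix leaves all brackets unchanged; this one makes the
    trace 0, which uses characteristic 0.\<close>
  define N where "N = N0 - (mtrace N0 / of_nat m) \<cdot>\<^sub>m 1\<^sub>m m"
  have N [simp]: "N \<in> carrier_mat m m" by (simp add: N_def)
  have ND: "N * Y - Y * N = D Y" if Y: "Y \<in> carrier_mat m m" for Y
  proof -
    let ?c = "mtrace N0 / of_nat m"
    have one: "?c \<cdot>\<^sub>m 1\<^sub>m m \<in> carrier_mat m m" by simp
    have "N * Y = N0 * Y - ?c \<cdot>\<^sub>m Y"
      using Y by (simp add: N_def minus_mult_distrib_mat[OF N0 one Y] mult_smult_assoc_mat[of _ m m _ m] left_mult_one_mat[of _ m m])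
    moreover have "Y * N = Y * N0 - ?c \<cdot>\<^sub>m Y"
      using Y by (simp add: N_def mult_minus_distrib_mat[OF Y N0 one] mult_smult_distrib[of _ m m _ m] right_mult_one_mat[of _ m m])
    ultimately have "N * Y - Y * N = N0 * Y - Y * N0"
      using Y carrier_matD[OF N0] by (auto intro!: eq_matI simp del: index_mult_mat(1))
    then show ?thesis using N0D[OF Y] by simp
  qed
  show ?thesis
  proof (rule that[OF N])
    show "mtrace N = 0" using m by (simp add: N_def mtrace_minus[of _ m] mtrace_smult[of _ m] mtrace_one)
  next
    fix E R assume E: "E \<in> carrier_mat m m" and R: "R \<in> carrier_mat m m" and A: "\<And>t. Ad (r t) E = evalm R t"
    have RR: "R = Rf E" by (rule evalm_ext[OF R Rf[OF E]]) (simp add: A[symmetric] AdRf[OF E])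
    have "evalm (mderiv R) t = D (evalm R t)" for t
    proof (rule eq_matI)
      fix a b assume "a < dim_row (D (evalm R t))" "b < dim_col (D (evalm R t))"
      then have ab: "a < m" "b < m" by (auto simp: D_def)
      then show "evalm (mderiv R) t $$ (a, b) = D (evalm R t) $$ (a, b)"
        using F1[OF E ab, of t] R by (simp add: RR p_def AdRf[OF E] index_evalm[of _ m] index_mderiv[of _ m])
    qed (use R in \<open>auto simp: D_def evalm_def mderiv_def\<close>)
    moreover have "N * evalm R t - evalm R t * N = D (evalm R t)" for t
      by (rule ND) (use R in simp)
    moreover have "evalm R 0 = E" using A[of 0] r0[OF E] by simp
    ultimately show "evalm R 0 = E \<and> (\<forall>t. evalm (mderiv R) t = N * evalm R t - evalm R t * N)" by simp
  qed
qed

section \<open>Simultaneous eigenvectors of conjugation\<close>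

text \<open>Coprimality phrased by roots. Since \<open>p\<close> splits into linear factors, they
  can be cancelled one at a time: each divides \<open>w\<close>, because \<open>q\<close> does not
  vanish at its root.\<close>

lemma dvd_of_no_common_root:
  fixes p q w :: "'a::field poly"
  assumes split: "\<And>p::'a poly. 0 < degree p \<Longrightarrow> \<exists>x. poly p x = 0"
  shows "p \<noteq> 0 \<Longrightarrow> (\<And>x. poly p x = 0 \<Longrightarrow> poly q x \<noteq> 0) \<Longrightarrow> p dvd w * q \<Longrightarrow> p dvd w"
proof (induction "degree p" arbitrary: p w)
  case 0
  then show ?case by (metis dvd_trans is_unit_iff_degree one_dvd)
next
  case (Suc n)
  then obtain a where a: "poly p a = 0" using split by (metis zero_less_Suc)
  then obtain p' where p': "p = [:-a, 1:] * p'" by (auto simp: poly_eq_0_iff_dvd)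
  have "p' \<noteq> 0" using Suc.prems(1) p' by auto
  then have deg: "n = degree p'" using Suc.hyps(2) by (simp add: p' degree_mult_eq del: mult_pCons_left)
  obtain k where "w * q = p * k" using Suc.prems(3) by blast
  then have "poly (w * q) a = 0" using a by (metis mult_zero_left poly_mult)
  then have "poly w a = 0" using Suc.prems(2)[OF a] by simp
  then obtain w' where w': "w = [:-a, 1:] * w'" by (auto simp: poly_eq_0_iff_dvd)
  have "[:-a, 1:] * p' dvd [:-a, 1:] * (w' * q)" using Suc.prems(3) by (simp only: p' w' mult.assoc)
  then have "p' dvd w' * q" by (subst (asm) dvd_times_left_cancel_iff) auto
  moreover have "poly q x \<noteq> 0" if "poly p' x = 0" for x
    using Suc.prems(2)[of x] that by (simp add: p')
  ultimately have "p' dvd w'" using Suc.hyps(1)[OF deg \<open>p' \<noteq> 0\<close>] by blast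
  then show ?case unfolding p' w' by (rule mult_dvd_mono[OF dvd_refl])
qed

text \<open>The entries of the adjugate are, up to sign, minors of size m - 1 of a matrix with
  entries of degree at most 1. The strict bound forces such an entry to vanish when the
  characteristic polynomial divides it.\<close>

lemma degree_adj_char_poly_matrix:
  fixes G :: "'a::field mat"
  assumes G: "G \<in> carrier_mat m m" and ij: "i < m" "j < m"
  shows "degree (adj_mat (char_poly_matrix G) $$ (i, j)) < m"
proof -
  let ?C = "char_poly_matrix G"
  have C: "?C \<in> carrier_mat m m" using G by simp
  have dC: "dim_row ?C = m" "dim_col ?C = m" using C by auto
  have dG: "dim_row G = m" "dim_col G = m" using G by auto
  have dM: "mat_delete ?C j i \<in> carrier_mat (m - 1) (m - 1)" using dC by (auto simp: mat_delete_def)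
  have "degree (mat_delete ?C j i $$ (a, b)) \<le> 1" if "a < m - 1" "b < m - 1" for a b
  proof -
    have "degree (?C $$ (k, l)) \<le> 1" if "k < m" "l < m" for k l
      using that dG by (auto simp: char_poly_matrix_def)
    then show ?thesis using that by (auto simp: mat_delete_def dC)
  qed
  from degree_det_le[OF this dM] have "degree (det (mat_delete ?C j i)) \<le> m - 1" by simp
  moreover have "degree ((-1) ^ (j + i) * det (mat_delete ?C j i)) = degree (det (mat_delete ?C j i))"
    by (cases "even (j + i)") auto
  ultimately show ?thesis using ij by (simp add: adj_mat_def cofactor_def dC)
qed

lemma const_poly_neg_sum: "[:- sum f A:] = (\<Sum>x\<in>A. [:- f x:])" for f :: "'b \<Rightarrow> 'a::comm_ring_1"
proof (induction A rule: infinite_finite_induct)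
  case (insert x F)
  have "[:- sum f (insert x F):] = [:- f x:] + [:- sum f F:]" using insert.hyps by simp
  then show ?case using insert by simp
qed auto

text \<open>As for Sylvester equations: without a common eigenvalue of \<open>G\<close> and
  \<open>c G\<close> the intertwiner would be 0. The relation intertwines their characteristic
  matrices, and multiplying by both adjugates shows that the characteristic polynomial of
  \<open>G\<close> divides that of \<open>c G\<close> times each entry of \<open>W\<close>. If the
  two had no common root, it would divide entries of degree below m, so \<open>W\<close> and then
  \<open>N\<close> would vanish.\<close>

lemma eigenvalues_of_intertwiner:
  fixes G N :: "'a::field mat"
  assumes split: "\<And>p::'a poly. 0 < degree p \<Longrightarrow> \<exists>x. poly p x = 0"
    and G: "G \<in> carrier_mat m m" and N: "N \<in> carrier_mat m m" "N \<noteq> 0\<^sub>m m m"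
    and rel: "G * N = c \<cdot>\<^sub>m (N * G)" and c: "c \<noteq> 0"
  shows "\<exists>l. eigenvalue G l \<and> eigenvalue G (c * l)"
proof (rule ccontr)
  assume neg: "\<not> ?thesis"
  let ?n = "map_mat (\<lambda>x. [:x:]) N"
  let ?C = "char_poly_matrix G" and ?C2 = "char_poly_matrix (c \<cdot>\<^sub>m G)"
  let ?p = "char_poly G" and ?q = "char_poly (c \<cdot>\<^sub>m G)"
  have cG: "c \<cdot>\<^sub>m G \<in> carrier_mat m m" using G by simp
  have [simp]: "N \<in> carrier_mat m m" "dim_row N = m" "dim_col N = m" using N by auto
  have carr [simp]: "?n \<in> carrier_mat m m" "?C \<in> carrier_mat m m" "?C2 \<in> carrier_mat m m" "adj_mat ?C \<in> carrier_mat m m"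
    "adj_mat ?C2 \<in> carrier_mat m m"
    using G cG N by (auto simp: adj_mat(1)[of _ m])
  have int: "?C * ?n = ?n * ?C2"
  proof (rule eq_matI)
    fix a b assume "a < dim_row (?n * ?C2)" "b < dim_col (?n * ?C2)"
    then have ab: "a < m" "b < m" using N carrier_matD[OF carr(3)] by auto
    have rel': "(\<Sum>k<m. G $$ (a, k) * N $$ (k, b)) = c * (\<Sum>k<m. N $$ (a, k) * G $$ (k, b))"
      using arg_cong[OF rel, of "\<lambda>A. A $$ (a, b)"] ab G N
      by (simp add: index_mult_mat'[of _ m m _ m] del: index_mult_mat(1))
    have "(?C * ?n) $$ (a, b) = (\<Sum>k<m. ((if a = k then [:0, 1:] else 0) + [:- G $$ (a, k):]) * [:N $$ (k, b):])"
      unfolding index_mult_mat'[OF carr(2,1) ab] using ab G N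
      by (intro sum.cong) (auto simp: char_poly_matrix_def)
    also have "\<dots> = (\<Sum>k<m. (if a = k then [:0, N $$ (k, b):] else 0)) + [:- (\<Sum>k<m. G $$ (a, k) * N $$ (k, b)):]"
    proof -
      have "[:- (\<Sum>k<m. G $$ (a, k) * N $$ (k, b)):] = (\<Sum>k<m. [:- (G $$ (a, k) * N $$ (k, b)):])"
        by (rule const_poly_neg_sum)
      then show ?thesis by (simp only: sum.distrib[symmetric]) (rule sum.cong, auto)
    qed
    also have "(\<Sum>k<m. (if a = k then [:0, N $$ (k, b):] else 0)) = (\<Sum>k<m. (if k = b then [:0, N $$ (a, k):] else 0))"
      using ab by simp
    also have "\<dots> + [:- (\<Sum>k<m. G $$ (a, k) * N $$ (k, b)):] = (\<Sum>k<m. [:N $$ (a, k):] * ((if k = b then [:0, 1:] else 0) + [:- (c * G $$ (k, b)):]))"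
    proof -
      have "[:- (\<Sum>k<m. G $$ (a, k) * N $$ (k, b)):] = (\<Sum>k<m. [:- (c * (N $$ (a, k) * G $$ (k, b))):])"
        unfolding rel' sum_distrib_left by (rule const_poly_neg_sum)
      then show ?thesis by (simp only: sum.distrib[symmetric]) (rule sum.cong, auto)
    qed
    also have "\<dots> = (?n * ?C2) $$ (a, b)"
      unfolding index_mult_mat'[OF carr(1,3) ab] using ab G N
      by (intro sum.cong) (auto simp: char_poly_matrix_def)
    finally show "(?C * ?n) $$ (a, b) = (?n * ?C2) $$ (a, b)" .
  qed (use N carrier_matD[OF carr(2)] carrier_matD[OF carr(3)] in auto)
  define W where "W = adj_mat ?C * ?n"
  have W [simp]: "W \<in> carrier_mat m m" by (simp add: W_def)
  have "?p \<cdot>\<^sub>m ?n = adj_mat ?C * ?C * ?n"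
    by (simp add: adj_mat(3)[of _ m] char_poly_def mult_smult_assoc_mat[of _ m m _ m] left_mult_one_mat[of _ m m])
  also have "\<dots> = W * ?C2" by (simp add: W_def assoc_mult_mat[of _ m m _ m _ m] int)
  finally have pn: "?p \<cdot>\<^sub>m ?n = W * ?C2" .
  then have "(?p \<cdot>\<^sub>m ?n) * adj_mat ?C2 = W * (?C2 * adj_mat ?C2)"
    by (simp add: assoc_mult_mat[of _ m m _ m _ m])
  then have WW: "?p \<cdot>\<^sub>m (?n * adj_mat ?C2) = ?q \<cdot>\<^sub>m W"
    by (simp add: adj_mat(2)[of _ m] char_poly_def mult_smult_assoc_mat[of _ m m _ m] mult_smult_distrib[of _ m m _ m] right_mult_one_mat[of _ m m])
  have degp: "degree ?p = m" "?p \<noteq> 0" using degree_monic_char_poly[OF G] by auto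
  have "W $$ (i, j) = 0" if ij: "i < m" "j < m" for i j
  proof -
    have "?p * (?n * adj_mat ?C2) $$ (i, j) = ?q * W $$ (i, j)"
      using arg_cong[OF WW, of "\<lambda>A. A $$ (i, j)"] ij carrier_matD[OF W] carrier_matD[OF carr(5)]
      by (simp del: index_mult_mat(1))
    then have "?p dvd W $$ (i, j) * ?q" by (metis dvd_triv_left mult.commute)
    moreover have "poly ?q x \<noteq> 0" if "poly ?p x = 0" for x
    proof
      assume "poly ?q x = 0"
      then have "eigenvalue (c \<cdot>\<^sub>m G) x" by (simp add: eigenvalue_root_char_poly[OF cG])
      then obtain v where v: "v \<in> carrier_vec m" "v \<noteq> 0\<^sub>v m" "(c \<cdot>\<^sub>m G) *\<^sub>v v = x \<cdot>\<^sub>v v"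
        using G by (auto simp: eigenvalue_def eigenvector_def)
      have "c \<cdot>\<^sub>v (G *\<^sub>v v) = (c \<cdot>\<^sub>m G) *\<^sub>v v"
        using v(1) G by (auto intro!: eq_vecI simp: scalar_prod_def sum_distrib_left mult.assoc)
      then have "c \<cdot>\<^sub>v (G *\<^sub>v v) = x \<cdot>\<^sub>v v" using v by simp
      then have "inverse c \<cdot>\<^sub>v (c \<cdot>\<^sub>v (G *\<^sub>v v)) = inverse c \<cdot>\<^sub>v (x \<cdot>\<^sub>v v)" by simp
      then have "G *\<^sub>v v = (x / c) \<cdot>\<^sub>v v" using c by (simp add: smult_smult_assoc field_simps)
      then have "eigenvalue G (x / c)" using v G by (auto simp: eigenvalue_def eigenvector_def)
      moreover have "eigenvalue G (c * (x / c))" using that c by (simp add: eigenvalue_root_char_poly[OF G])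
      ultimately show False using neg by blast
    qed
    ultimately have "?p dvd W $$ (i, j)" using dvd_of_no_common_root[OF split degp(2)] by blast
    moreover have "degree (W $$ (i, j)) < m"
    proof -
      have "degree (adj_mat ?C $$ (i, k) * ?n $$ (k, j)) \<le> m - 1" if "k < m" for k
        using degree_mult_le[of "adj_mat ?C $$ (i, k)" "?n $$ (k, j)"]
          degree_adj_char_poly_matrix[OF G ij(1) that] that ij N by auto
      then have "degree (\<Sum>k<m. adj_mat ?C $$ (i, k) * ?n $$ (k, j)) \<le> m - 1"
        by (intro degree_sum_le) auto
      then show ?thesis using ij by (simp add: W_def index_mult_mat'[of _ m m _ m] del: index_mult_mat(1))
    qed
    ultimately show ?thesis using degp by (metis dvd_imp_degree_le not_less)
  qed
  then have "W = 0\<^sub>m m m" using carrier_matD[OF W] by (intro eq_matI) auto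
  then have z: "?p \<cdot>\<^sub>m ?n = 0\<^sub>m m m" using pn left_mult_zero_mat[OF carr(3), of m] by simp
  have "N = 0\<^sub>m m m"
  proof (rule eq_matI)
    fix i j assume "i < dim_row (0\<^sub>m m m :: 'a mat)" "j < dim_col (0\<^sub>m m m :: 'a mat)"
    then have ij: "i < m" "j < m" by auto
    have "?p * [:N $$ (i, j):] = 0" using arg_cong[OF z, of "\<lambda>A. A $$ (i, j)"] ij N by simp
    then show "N $$ (i, j) = 0\<^sub>m m m $$ (i, j)" using degp ij by simp
  qed (use N in auto)
  then show False using N by simp
qed

lemma eigenbasis_GLm:
  fixes G :: "'a::field mat"
  assumes G: "G \<in> carrier_mat m m" and inj: "inj_on b {..<m}"
    and w: "\<And>i. i < m \<Longrightarrow> w i \<in> carrier_vec m \<and> w i \<noteq> 0\<^sub>v m \<and> G *\<^sub>v w i = b i \<cdot>\<^sub>v w i"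
  defines "Q \<equiv> mat m m (\<lambda>(a, i). w i $ a)"
  shows "Q \<in> GLm m" "G * Q = Q * mat_diag m b"
proof -
  have Q [simp]: "Q \<in> carrier_mat m m" by (simp add: Q_def)
  have Gw: "(\<Sum>k<m. G $$ (a, k) * w i $ k) = b i * w i $ a" if "i < m" "a < m" for a i
  proof -
    have "(G *\<^sub>v w i) $ a = (\<Sum>k<m. G $$ (a, k) * w i $ k)"
      using that G w[OF that(1), THEN conjunct1] by (auto simp: scalar_prod_def atLeast0LessThan intro!: sum.cong)
    moreover have "(G *\<^sub>v w i) $ a = b i * w i $ a" using w[OF that(1)] that by auto
    ultimately show ?thesis by simp
  qed
  show "G * Q = Q * mat_diag m b"
  proof (rule eq_matI)
    fix a i assume "a < dim_row (Q * mat_diag m b)" "i < dim_col (Q * mat_diag m b)"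
    then have ai: "a < m" "i < m" by (auto simp: Q_def mat_diag_def)
    have "(G * Q) $$ (a, i) = (\<Sum>k<m. G $$ (a, k) * w i $ k)"
      unfolding index_mult_mat'[OF G Q ai] by (rule sum.cong) (use ai in \<open>auto simp: Q_def\<close>)
    then show "(G * Q) $$ (a, i) = (Q * mat_diag m b) $$ (a, i)"
      using ai Gw[OF ai(2,1)] by (simp add: mat_diag_mult_right[OF Q] del: index_mult_mat(1)) (simp add: Q_def)
  qed (use G in \<open>auto simp: Q_def mat_diag_def\<close>)
  have "det Q \<noteq> 0"
  proof
    assume "det Q = 0"
    then obtain c where c: "c \<in> carrier_vec m" "c \<noteq> 0\<^sub>v m" "Q *\<^sub>v c = 0\<^sub>v m"
      using det_0_iff_vec_prod_zero[OF Q] by blast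
    have base: "(\<Sum>i<m. c $ i * w i $ a) = 0" if "a < m" for a
    proof -
      have "(Q *\<^sub>v c) $ a = (\<Sum>i<m. w i $ a * c $ i)"
        using that c(1) by (auto simp: Q_def scalar_prod_def atLeast0LessThan intro!: sum.cong)
      then show ?thesis using that c(3) by (simp add: mult.commute)
    qed
    \<comment> \<open>Applying the product of all G - b_j with j in \<open>S\<close> to the relation
      multiplies its i-th coefficient by the product of the b_i - b_j. With all indices but one in
      \<open>S\<close>, a single term survives.\<close>
    have step: "(\<Sum>i<m. (\<Prod>j\<in>S. b i - b j) * c $ i * w i $ a) = 0" if "finite S" "a < m" for S a
      using that
    proof (induction S arbitrary: a rule: finite_induct)
      case empty
      then show ?case using base by simp
    next
      case (insert s S)
      have "0 = (\<Sum>k<m. G $$ (a, k) * (\<Sum>i<m. (\<Prod>j\<in>S. b i - b j) * c $ i * w i $ k))"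
        using insert.IH by simp
      also have "\<dots> = (\<Sum>i<m. (\<Prod>j\<in>S. b i - b j) * c $ i * (\<Sum>k<m. G $$ (a, k) * w i $ k))"
        unfolding sum_distrib_left by (subst sum.swap) (simp add: mult_ac)
      also have "\<dots> = (\<Sum>i<m. (\<Prod>j\<in>S. b i - b j) * c $ i * (b i * w i $ a))"
        using Gw insert.prems by simp
      finally have 1: "(\<Sum>i<m. (\<Prod>j\<in>S. b i - b j) * c $ i * (b i * w i $ a)) = 0" by simp
      have "(\<Sum>i<m. (\<Prod>j\<in>insert s S. b i - b j) * c $ i * w i $ a) =
        (\<Sum>i<m. (\<Prod>j\<in>S. b i - b j) * c $ i * (b i * w i $ a)) - b s * (\<Sum>i<m. (\<Prod>j\<in>S. b i - b j) * c $ i * w i $ a)"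
        unfolding sum_distrib_left sum_subtractf[symmetric]
        by (rule sum.cong) (use insert.hyps in \<open>auto simp: algebra_simps\<close>)
      then show ?case using 1 insert.IH[OF insert.prems] by simp
    qed
    obtain i0 where i0: "i0 < m" "c $ i0 \<noteq> 0"
      using c by (metis carrier_vecD eq_vecI index_zero_vec(1) index_zero_vec(2))
    let ?p = "\<Prod>j\<in>{..<m} - {i0}. b i0 - b j"
    have "?p \<noteq> 0" using inj i0 by (auto simp: inj_on_def)
    moreover have "?p * c $ i0 * w i0 $ a = 0" if "a < m" for a
    proof -
      have "(\<Sum>i<m. (\<Prod>j\<in>{..<m} - {i0}. b i - b j) * c $ i * w i $ a) =
        (\<Sum>i<m. if i = i0 then ?p * c $ i0 * w i0 $ a else 0)"
      proof (rule sum.cong)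
        fix i assume i: "i \<in> {..<m}"
        have "(\<Prod>j\<in>{..<m} - {i0}. b i - b j) = 0" if "i \<noteq> i0"
          by (rule prod_zero) (use that i in auto)
        then show "(\<Prod>j\<in>{..<m} - {i0}. b i - b j) * c $ i * w i $ a = (if i = i0 then ?p * c $ i0 * w i0 $ a else 0)"
          by auto
      qed simp
      then show ?thesis using step[of "{..<m} - {i0}" a] that i0 by simp
    qed
    ultimately have "w i0 $ a = 0" if "a < m" for a using that i0 by simp
    then have "w i0 = 0\<^sub>v m" using w[OF i0(1)] by (intro eq_vecI) auto
    then show False using w[OF i0(1)] by simp
  qed
  then show "Q \<in> GLm m" by (simp add: GLm_def)
qed

text \<open>Over \<open>{..<m}\<close> these pairs index the roots of GL_m; over a set of nonzero
  eigenvalues they are the pairs whose ratio is not 1. Comparing the two cardinalities is the point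
  of \<open>split_diagonalization\<close>.\<close>

definition offd :: "'b set \<Rightarrow> ('b \<times> 'b) set" where
  "offd B = (SIGMA i:B. B - {i})"

lemma offd_iff: "(i, j) \<in> offd B \<longleftrightarrow> i \<in> B \<and> j \<in> B \<and> i \<noteq> j"
  by (auto simp: offd_def)

lemma finite_offd: "finite B \<Longrightarrow> finite (offd B)"
  by (simp add: offd_def)

lemma card_offd: "finite B \<Longrightarrow> card (offd B) = card B * (card B - 1)"
  by (simp add: offd_def)

text \<open>Each of the m (m - 1) distinct numbers \<open>al e\<close> is the ratio of two distinct
  eigenvalues of \<open>G\<close>. Fewer than m eigenvalues have too few ratios, so there are m of
  them and \<open>G\<close> is diagonalizable. Each ratio is then attained by one pair only, so each
  \<open>N e\<close> has one nonzero entry in the eigenbasis.\<close>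

lemma split_diagonalization:
  fixes G :: "'a::field mat" and N :: "nat \<times> nat \<Rightarrow> 'a mat"
  assumes split: "\<And>p::'a poly. 0 < degree p \<Longrightarrow> \<exists>x. poly p x = 0"
    and G: "G \<in> GLm m" and m: "2 \<le> m"
    and N: "\<And>e. e \<in> offd {..<m} \<Longrightarrow> N e \<in> carrier_mat m m \<and> N e \<noteq> 0\<^sub>m m m \<and> Ad G (N e) = al e \<cdot>\<^sub>m N e"
    and al: "inj_on al (offd {..<m})" "\<And>e. e \<in> offd {..<m} \<Longrightarrow> al e \<noteq> 0 \<and> al e \<noteq> 1"
  obtains Q sg c where "Q \<in> GLm m" "bij_betw sg (offd {..<m}) (offd {..<m})"
    "\<And>e. e \<in> offd {..<m} \<Longrightarrow> c e \<noteq> 0 \<and> N e = Ad Q (c e \<cdot>\<^sub>m matunit m (fst (sg e)) (snd (sg e)))"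
proof -
  have Gc [simp]: "G \<in> carrier_mat m m" using G GLm_carrier by auto
  let ?O = "offd {..<m}"
  define B where "B = {l. eigenvalue G l}"
  have deg: "degree (char_poly G) = m" "char_poly G \<noteq> 0" using degree_monic_char_poly[OF Gc] m by auto
  have Beq: "B = {x. poly (char_poly G) x = 0}" by (auto simp: B_def eigenvalue_root_char_poly[OF Gc])
  then have finB: "finite B" and cardB: "card B \<le> m"
    using poly_roots_finite[OF deg(2)] card_poly_roots_bound[OF deg(2)] deg(1) by auto
  have B0: "0 \<notin> B"
  proof
    assume "0 \<in> B"
    then obtain v where v: "v \<in> carrier_vec m" "v \<noteq> 0\<^sub>v m" "G *\<^sub>v v = 0 \<cdot>\<^sub>v v"
      by (auto simp: B_def eigenvalue_def eigenvector_def carrier_matD[OF Gc])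
    then have "G *\<^sub>v v = 0\<^sub>v m" by auto
    then have "det G = 0" using det_0_iff_vec_prod_zero[OF Gc] v by blast
    then show False using G by (simp add: GLm_def)
  qed
  have "\<exists>l. l \<in> B \<and> al e * l \<in> B" if e: "e \<in> ?O" for e
  proof -
    have "G * N e = (al e \<cdot>\<^sub>m N e) * G"
      using Ad_eq_iff[OF G, of "N e" "al e \<cdot>\<^sub>m N e"] N[OF e] by auto
    then have "G * N e = al e \<cdot>\<^sub>m (N e * G)" using N[OF e] by (simp add: mult_smult_assoc_mat[of _ m m _ m])
    from eigenvalues_of_intertwiner[OF split Gc _ _ this] show ?thesis
      using N[OF e] al(2)[OF e] by (auto simp: B_def)
  qed
  then obtain l where l: "e \<in> ?O \<Longrightarrow> l e \<in> B \<and> al e * l e \<in> B" for e by metis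
  have lB: "(al e * l e, l e) \<in> offd B" if "e \<in> ?O" for e
    using l[OF that] al(2)[OF that] B0 by (auto simp: offd_iff)
  \<comment> \<open>The pair determines \<open>al e\<close> as a quotient, because 0 is not an
    eigenvalue.\<close>
  have "inj_on (\<lambda>e. (al e * l e, l e)) ?O"
  proof (rule inj_onI)
    fix e e' assume e: "e \<in> ?O" "e' \<in> ?O" and eq: "(al e * l e, l e) = (al e' * l e', l e')"
    then have "al e = al e'" using l[OF e(1)] B0 by auto
    then show "e = e'" using al(1) e by (auto simp: inj_on_def)
  qed
  then have "card ?O \<le> card (offd B)" using lB by (intro card_inj_on_le) (auto simp: finite_offd finB)
  then have "m * (m - 1) \<le> card B * (card B - 1)" by (simp add: card_offd finB)
  moreover have "card B * (card B - 1) < m * (m - 1)" if "card B < m"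
  proof -
    have "card B * (card B - 1) \<le> card B * (m - 1)" using that by (intro mult_left_mono) auto
    also have "\<dots> < m * (m - 1)" using that m by (intro mult_strict_right_mono) auto
    finally show ?thesis .
  qed
  ultimately have cB: "card B = m" using cardB by (metis le_neq_implies_less not_le)
  obtain b where b: "bij_betw b {..<m} B"
    using ex_bij_betw_nat_finite[OF finB] cB by (auto simp: atLeast0LessThan)
  have "\<exists>v. v \<in> carrier_vec m \<and> v \<noteq> 0\<^sub>v m \<and> G *\<^sub>v v = b i \<cdot>\<^sub>v v" if "i < m" for i
  proof -
    have "b i \<in> B" using b that by (auto simp: bij_betw_def)
    then show ?thesis by (auto simp: B_def eigenvalue_def eigenvector_def carrier_matD[OF Gc])
  qed
  then obtain w where w: "i < m \<Longrightarrow> w i \<in> carrier_vec m \<and> w i \<noteq> 0\<^sub>v m \<and> G *\<^sub>v w i = b i \<cdot>\<^sub>v w i" for i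
    by metis
  define Q where "Q = mat m m (\<lambda>(a, i). w i $ a)"
  have injb: "inj_on b {..<m}" using b by (simp add: bij_betw_def)
  note Qf = eigenbasis_GLm[OF Gc injb w, folded Q_def]
  have Q: "Q \<in> GLm m" "G * Q = Q * mat_diag m b" using Qf by auto
  have Qc [simp]: "Q \<in> carrier_mat m m" using Q GLm_carrier by auto
  have bn0: "b i \<noteq> 0" if "i < m" for i using b that B0 by (auto simp: bij_betw_def)
  define N' where "N' e = Ad (minv Q) (N e)" for e
  have N' [simp]: "N' e \<in> carrier_mat m m" if "e \<in> ?O" for e using N[OF that] by (simp add: N'_def)
  have NN': "N e = Ad Q (N' e)" if "e \<in> ?O" for e using N[OF that] by (simp add: N'_def Ad_minv[OF Q(1)])
  \<comment> \<open>In the eigenbasis, conjugation by \<open>G\<close> multiplies the entry at (a,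
    a') by b_a / b_a'; a nonzero entry of \<open>N' e\<close> forces this ratio to be
    \<open>al e\<close>.\<close>
  have rel: "b a * N' e $$ (a, a') = al e * N' e $$ (a, a') * b a'" if e: "e \<in> ?O" and a: "a < m" "a' < m" for e a a'
  proof -
    have D: "mat_diag m b \<in> GLm m" using mat_diag_GLm bn0 by blast
    have "G = Q * mat_diag m b * minv Q"
    proof -
      have "G * (Q * minv Q) = Q * mat_diag m b * minv Q"
        by (simp add: assoc_mult_mat[of _ m m _ m _ m, symmetric] Q(2))
      then show ?thesis by (simp add: minv_right[OF Q(1)] right_mult_one_mat[of _ m m])
    qed
    then have "al e \<cdot>\<^sub>m N e = Ad (Q * mat_diag m b * minv Q) (N e)" using N[OF e] by simp
    also have "\<dots> = Ad Q (Ad (mat_diag m b) (N' e))"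
      using N[OF e] by (simp add: Ad_comp[of _ m] GLm_mult GLm_minv Q D N'_def assoc_mult_mat[of _ m m _ m _ m])
    finally have "Ad (minv Q) (al e \<cdot>\<^sub>m N e) = Ad (minv Q) (Ad Q (Ad (mat_diag m b) (N' e)))" by simp
    then have "al e \<cdot>\<^sub>m N' e = Ad (mat_diag m b) (N' e)"
      using N[OF e] e by (simp add: Ad_minv[OF Q(1)] Ad_smult[of _ m] N'_def)
    then have "mat_diag m b * N' e = (al e \<cdot>\<^sub>m N' e) * mat_diag m b"
      using Ad_eq_iff[OF D, of "N' e" "al e \<cdot>\<^sub>m N' e"] e by simp
    from arg_cong[OF this, of "\<lambda>A. A $$ (a, a')"] show ?thesis
      using a N'[OF e] by (simp add: mat_diag_mult_left[of _ m m] mat_diag_mult_right[of _ m m])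
  qed
  have "\<exists>a a'. a < m \<and> a' < m \<and> N' e $$ (a, a') \<noteq> 0" if e: "e \<in> ?O" for e
  proof (rule ccontr)
    assume "\<not> ?thesis"
    then have "N' e = 0\<^sub>m m m" using N'[OF e] by (intro eq_matI) auto
    then have "N e = 0\<^sub>m m m" using NN'[OF e] by (simp add: Ad_def right_mult_zero_mat[of _ m m] left_mult_zero_mat[of _ m m])
    then show False using N[OF e] by simp
  qed
  then obtain s1 s2 where s: "e \<in> ?O \<Longrightarrow> s1 e < m \<and> s2 e < m \<and> N' e $$ (s1 e, s2 e) \<noteq> 0" for e by metis
  define sg where "sg e = (s1 e, s2 e)" for e
  have sal: "b (s1 e) = al e * b (s2 e)" if "e \<in> ?O" for e
    using rel[OF that, of "s1 e" "s2 e"] s[OF that] by (simp add: mult.commute)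
  have sO: "sg e \<in> ?O" if "e \<in> ?O" for e
    using s[OF that] sal[OF that] al(2)[OF that] bn0 by (auto simp: sg_def offd_iff)
  have inj: "inj_on sg ?O"
  proof (rule inj_onI)
    fix e e' assume e: "e \<in> ?O" "e' \<in> ?O" and eq: "sg e = sg e'"
    then have s': "s1 e = s1 e'" "s2 e = s2 e'" by (auto simp: sg_def)
    have "al e * b (s2 e) = al e' * b (s2 e)" using sal[OF e(1)] sal[OF e(2)] unfolding s' by (rule trans[OF sym])
    moreover have "b (s2 e) \<noteq> 0" using bn0[of "s2 e"] s[OF e(1)] by simp
    ultimately have "al e = al e'" by (metis mult_right_cancel)
    then show "e = e'" using al(1) e by (auto simp: inj_on_def)
  qed
  have surj: "sg ` ?O = ?O"
    by (rule card_subset_eq) (use sO in \<open>auto simp: finite_offd card_image[OF inj]\<close>)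
  \<comment> \<open>A nonzero entry at another position would be at \<open>sg e'\<close> for some
    \<open>e'\<close> with \<open>al e' = al e\<close>, against the injectivity of
    \<open>al\<close>.\<close>
  have ent: "N' e = N' e $$ sg e \<cdot>\<^sub>m matunit m (s1 e) (s2 e)" if e: "e \<in> ?O" for e
  proof (rule eq_matI)
    fix a a' assume "a < dim_row (N' e $$ sg e \<cdot>\<^sub>m matunit m (s1 e) (s2 e))" "a' < dim_col (N' e $$ sg e \<cdot>\<^sub>m matunit m (s1 e) (s2 e))"
    then have a: "a < m" "a' < m" by auto
    have "N' e $$ (a, a') = 0" if ne: "(a, a') \<noteq> (s1 e, s2 e)"
    proof (rule ccontr)
      assume "N' e $$ (a, a') \<noteq> 0"
      then have 1: "b a = al e * b a'" using rel[OF e a] by (simp add: mult.commute)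
      then have "a \<noteq> a'" using al(2)[OF e] bn0[OF a(1)] by auto
      then have "(a, a') \<in> sg ` ?O" using a surj by (simp add: offd_iff)
      then obtain e' where e': "e' \<in> ?O" "sg e' = (a, a')" by auto
      then have "b a = al e' * b a'" using sal[OF e'(1)] by (simp add: sg_def)
      then have "al e = al e'" using 1 bn0[OF a(2)] by simp
      then have "e = e'" using al(1) e e' by (auto simp: inj_on_def)
      then show False using ne e' by (simp add: sg_def)
    qed
    then show "N' e $$ (a, a') = (N' e $$ sg e \<cdot>\<^sub>m matunit m (s1 e) (s2 e)) $$ (a, a')"
      using a by (auto simp: sg_def)
  qed (use carrier_matD[OF N'[OF e]] in auto)
  show ?thesis
  proof (rule that[OF Q(1)])
    show "bij_betw sg ?O ?O" using inj surj by (simp add: bij_betw_def)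
    fix e assume e: "e \<in> ?O"
    show "N' e $$ sg e \<noteq> 0 \<and> N e = Ad Q (N' e $$ sg e \<cdot>\<^sub>m matunit m (fst (sg e)) (snd (sg e)))"
      using NN'[OF e] ent[OF e] s[OF e] by (simp add: sg_def)
  qed
qed

text \<open>The larger exponent is determined by size alone, because 2^a + 2^b is at most 2^(b + 1)
  when a <= b.\<close>

lemma two_power_sum_unique:
  assumes "(2::nat) ^ a + 2 ^ b = 2 ^ c + 2 ^ d" "a \<le> b" "c \<le> d"
  shows "a = c \<and> b = d"
proof -
  have less: False if eq: "(2::nat) ^ a + 2 ^ b = 2 ^ c + 2 ^ d" and "a \<le> b" "b < d" for a b c d :: nat
  proof -
    have "(2::nat) ^ a \<le> 2 ^ b" using that by simp
    moreover have "(2::nat) ^ Suc b \<le> 2 ^ d" using that by (intro power_increasing) auto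
    moreover have "(2::nat) ^ c > 0" by simp
    ultimately show False using eq unfolding power_Suc by linarith
  qed
  have "b = d" using less[of a b c d] less[of c d a b] assms by (metis linorder_neqE_nat)
  then show ?thesis using assms by simp
qed

lemma two_power_ratio_unique:
  assumes "(2::nat) ^ i + 2 ^ l = 2 ^ k + 2 ^ j" "i \<noteq> j"
  shows "i = k \<and> j = l"
  using two_power_sum_unique[of i l k j] two_power_sum_unique[of l i k j]
    two_power_sum_unique[of i l j k] two_power_sum_unique[of l i j k] assms
  by (metis add.commute nat_le_linear)

text \<open>The double exponent turns t_i / t_j = t_k / t_l into 2^i + 2^l = 2^k + 2^j, so
  uniqueness of sums of two powers of 2 separates all off-diagonal ratios. Characteristic 0 carries
  this into the field.\<close>

lemma generic_ratio:
  fixes t :: "nat \<Rightarrow> 'a::field_char_0"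
  defines "t \<equiv> \<lambda>i. of_nat (2 ^ (2 ^ i))"
  shows "t i \<noteq> 0" "i \<noteq> j \<Longrightarrow> t i / t j \<noteq> 1"
    "i \<noteq> j \<Longrightarrow> t i / t j = t k / t l \<Longrightarrow> i = k \<and> j = l"
proof -
  show t0: "t i \<noteq> 0" for i by (simp add: t_def)
  have t_eq: "i = k \<and> j = l" if "t i * t l = t k * t j" "i \<noteq> j" for i j k l
  proof -
    have "of_nat (2 ^ (2 ^ i + 2 ^ l)) = (of_nat (2 ^ (2 ^ k + 2 ^ j)) :: 'a)"
      using that(1) by (simp only: t_def of_nat_mult[symmetric] power_add[symmetric])
    then have "(2::nat) ^ (2 ^ i + 2 ^ l) = 2 ^ (2 ^ k + 2 ^ j)" by (simp only: of_nat_eq_iff)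
    then have "(2::nat) ^ i + 2 ^ l = 2 ^ k + 2 ^ j" by (subst (asm) power_inject_exp) simp_all
    then show ?thesis using two_power_ratio_unique that(2) by blast
  qed
  show "i \<noteq> j \<Longrightarrow> t i / t j \<noteq> 1"
    using t_eq[of i j j j] t0 by (auto simp: field_simps)
  show "i \<noteq> j \<Longrightarrow> t i / t j = t k / t l \<Longrightarrow> i = k \<and> j = l"
    using t_eq[of i l k j] t0 by (auto simp: frac_eq_eq)
qed

section \<open>Polynomial homomorphisms between projective linear groups\<close>

definition peq :: "'a::field mat \<Rightarrow> 'a mat \<Rightarrow> bool" (infix "\<approx>" 50) where
  "A \<approx> B \<longleftrightarrow> (\<exists>k. k \<noteq> 0 \<and> A = k \<cdot>\<^sub>m B)"

lemma peqI: "k \<noteq> 0 \<Longrightarrow> A = k \<cdot>\<^sub>m B \<Longrightarrow> A \<approx> B"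
  by (auto simp: peq_def)

lemma peq_refl [simp]: "A \<approx> A"
  by (rule peqI[of 1]) auto

lemma peq_sym: "A \<approx> B \<Longrightarrow> B \<approx> A"
  unfolding peq_def by (metis inverse_nonzero_iff_nonzero left_inverse smult_one_sq smult_smult_sq)

lemma peq_trans [trans]: "A \<approx> B \<Longrightarrow> B \<approx> C \<Longrightarrow> A \<approx> C"
  unfolding peq_def by (metis mult_eq_0_iff smult_smult_sq)

lemma peq_mult: assumes "A \<in> carrier_mat m m" "B \<in> carrier_mat m m" "A \<approx> A'" "B \<approx> B'"
  shows "A * B \<approx> A' * B'"
proof -
  obtain k l where k: "k \<noteq> 0" "A = k \<cdot>\<^sub>m A'" "l \<noteq> 0" "B = l \<cdot>\<^sub>m B'" using assms by (auto simp: peq_def)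
  have "A' \<in> carrier_mat m m" using assms(1) unfolding k(2) by (metis carrier_matD carrier_matI index_smult_mat(2,3))
  moreover have "B' \<in> carrier_mat m m" using assms(2) unfolding k(4) by (metis carrier_matD carrier_matI index_smult_mat(2,3))
  ultimately show ?thesis
    by (intro peqI[of "k * l"]) (use k in \<open>simp_all add: mult_smult_distrib[of _ m m _ m] mult_smult_assoc_mat[of _ m m _ m] smult_smult_sq mult.commute\<close>)
qed

lemma peq_minv: assumes "B \<in> GLm m" "A \<approx> B" shows "minv A \<approx> minv B"
proof -
  obtain k where k: "k \<noteq> 0" "A = k \<cdot>\<^sub>m B" using assms by (auto simp: peq_def)
  show ?thesis by (rule peqI[of "inverse k"]) (use k assms in \<open>simp_all add: minv_smult[of _ _ m]\<close>)
qed

lemma peq_transpose: "A \<approx> B \<Longrightarrow> A\<^sup>T \<approx> B\<^sup>T"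
proof -
  assume "A \<approx> B"
  then obtain k where "k \<noteq> 0" "A = k \<cdot>\<^sub>m B" by (auto simp: peq_def)
  then show ?thesis by (intro peqI[of k]) (auto intro!: eq_matI)
qed

lemma peq_Ad: assumes "g \<in> carrier_mat m m" "B \<in> carrier_mat m m" "A \<approx> B" shows "Ad g A \<approx> Ad g B"
  using assms by (auto simp: peq_def Ad_smult[of _ m])

lemma Ad_peq: "h \<in> GLm m \<Longrightarrow> g \<approx> h \<Longrightarrow> E \<in> carrier_mat m m \<Longrightarrow> Ad g E = Ad h E"
  by (auto simp: peq_def Ad_smult_left[of _ _ m])

lemma commute_all_imp_scalar:
  fixes A :: "'a::field mat"
  assumes A: "A \<in> carrier_mat m m" and m: "0 < m"
    and comm: "\<And>E. E \<in> carrier_mat m m \<Longrightarrow> E * A = A * E"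
  shows "A = A $$ (0, 0) \<cdot>\<^sub>m 1\<^sub>m m"
  by (rule commute_matunits_scalar[OF A m]) (simp add: comm)

text \<open>The quotient \<open>minv h * g\<close> commutes with every matrix, hence is scalar; it
  is not 0 because \<open>g\<close> is invertible.\<close>

lemma Ad_eq_imp_peq:
  assumes g: "g \<in> GLm m" and h: "h \<in> GLm m" and m: "0 < m"
    and eq: "\<And>E. E \<in> carrier_mat m m \<Longrightarrow> Ad g E = Ad h E"
  shows "g \<approx> h"
proof -
  have [simp]: "g \<in> carrier_mat m m" "h \<in> carrier_mat m m" using g h GLm_carrier by auto
  let ?A = "minv h * g"
  have A: "?A \<in> GLm m" using g h by (simp add: GLm_mult GLm_minv)
  have "E * ?A = ?A * E" if E: "E \<in> carrier_mat m m" for E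
  proof -
    have "Ad ?A E = E" using eq[OF E] E by (simp add: Ad_comp[of _ m] g h GLm_minv Ad_minv[OF h])
    then show ?thesis using Ad_eq_iff[OF A E E] by simp
  qed
  from commute_all_imp_scalar[OF _ m this]
  have s: "?A = ?A $$ (0, 0) \<cdot>\<^sub>m 1\<^sub>m m" by simp
  have "h * ?A = (?A $$ (0, 0)) \<cdot>\<^sub>m h" by (subst s) (simp add: mult_smult_distrib[of _ m m _ m] right_mult_one_mat[of _ m m])
  then have g': "g = (?A $$ (0, 0)) \<cdot>\<^sub>m h"
    by (simp add: assoc_mult_mat[of _ m m _ m _ m, symmetric] minv_right[OF h] left_mult_one_mat[of _ m m])
  have "?A $$ (0, 0) \<noteq> 0"
  proof
    assume "?A $$ (0, 0) = 0"
    then have "det g = 0" using g' m by (metis det_smult \<open>h \<in> carrier_mat m m\<close> carrier_matD(2) mult_eq_0_iff power_eq_0_iff)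
    then show False using g by (simp add: GLm_def)
  qed
  then show ?thesis using g' by (rule peqI)
qed

section \<open>Calculus with polynomial matrices\<close>

definition constm :: "'a::comm_ring_1 mat \<Rightarrow> 'a poly mat" where
  "constm A = map_mat (\<lambda>x. [:x:]) A"

lemma constm_carrier [simp]: "A \<in> carrier_mat m m \<Longrightarrow> constm A \<in> carrier_mat m m"
  by (simp add: constm_def)

lemma evalm_constm: "A \<in> carrier_mat m m \<Longrightarrow> evalm (constm A) t = A"
  by (auto intro!: eq_matI simp: evalm_def constm_def)

lemma mderiv_constm: "A \<in> carrier_mat m m \<Longrightarrow> mderiv (constm A) = 0\<^sub>m m m"
  by (auto intro!: eq_matI simp: mderiv_def constm_def pderiv_pCons)

lemma evalm_add: "A \<in> carrier_mat m m \<Longrightarrow> B \<in> carrier_mat m m \<Longrightarrow> evalm (A + B) t = evalm A t + evalm B t"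
  by (auto intro!: eq_matI simp: evalm_def)

lemma evalm_smult: "A \<in> carrier_mat m m \<Longrightarrow> evalm (p \<cdot>\<^sub>m A) t = poly p t \<cdot>\<^sub>m evalm A t"
  by (auto intro!: eq_matI simp: evalm_def)

lemma evalm_mult: assumes "A \<in> carrier_mat m m" "B \<in> carrier_mat m m"
  shows "evalm (A * B) t = evalm A t * evalm B t"
proof (rule eq_matI)
  fix i j assume "i < dim_row (evalm A t * evalm B t)" "j < dim_col (evalm A t * evalm B t)"
  then have ij: "i < m" "j < m" using assms by (auto simp: evalm_def)
  show "evalm (A * B) t $$ (i, j) = (evalm A t * evalm B t) $$ (i, j)"
    using assms ij by (simp add: index_evalm[of _ m] index_mult_mat'[of _ m m _ m] poly_sum del: index_mult_mat(1))
qed (use assms in \<open>auto simp: evalm_def\<close>)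

lemma mderiv_mult: assumes "A \<in> carrier_mat m m" "B \<in> carrier_mat m m"
  shows "mderiv (A * B) = mderiv A * B + A * mderiv B"
proof (rule eq_matI)
  fix i j assume "i < dim_row (mderiv A * B + A * mderiv B)" "j < dim_col (mderiv A * B + A * mderiv B)"
  then have ij: "i < m" "j < m" using assms by (auto simp: mderiv_def)
  have dB: "dim_row (mderiv B) = m" "dim_col (mderiv B) = m" using assms by (auto simp: mderiv_def)
  show "mderiv (A * B) $$ (i, j) = (mderiv A * B + A * mderiv B) $$ (i, j)"
    using assms ij carrier_matD[OF assms(1)] carrier_matD[OF assms(2)] dB
    by (simp add: index_mderiv[of _ m] index_mult_mat'[of _ m m _ m] pderiv_sum pderiv_mult sum.distrib
        add.commute mult.commute del: index_mult_mat(1))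
qed (use assms in \<open>auto simp: mderiv_def\<close>)

lemma evalm_const_of_deriv0:
  fixes R :: "'a::field_char_0 poly mat"
  assumes "R \<in> carrier_mat m m" "\<And>t. evalm (mderiv R) t = 0\<^sub>m m m"
  shows "evalm R t = evalm R s"
proof (rule eq_matI)
  fix i j assume "i < dim_row (evalm R s)" "j < dim_col (evalm R s)"
  then have ij: "i < m" "j < m" using assms by (auto simp: evalm_def)
  have "pderiv (R $$ (i, j)) = 0"
  proof (rule poly_ext)
    fix t
    show "poly (pderiv (R $$ (i, j))) t = poly 0 t"
      using arg_cong[OF assms(2)[of t], of "\<lambda>A. A $$ (i, j)"] ij assms(1) by (simp add: index_evalm[of _ m] index_mderiv[of _ m])
  qed
  then have "degree (R $$ (i, j)) = 0" by (simp add: pderiv_eq_0_iff)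
  then obtain c where "R $$ (i, j) = [:c:]" by (metis degree_eq_zeroE)
  then show "evalm R t $$ (i, j) = evalm R s $$ (i, j)" using ij assms(1) by (simp add: index_evalm[of _ m])
qed (use assms in \<open>auto simp: evalm_def\<close>)

text \<open>When the curves Ad (r t) E are polynomial, this says formally that Ad (r t) is the
  exponential of t times the bracket with \<open>N\<close>. The trace condition removes the
  ambiguity of \<open>N\<close> by scalars.\<close>

definition generates :: "nat \<Rightarrow> ('a::field_char_0 \<Rightarrow> 'a mat) \<Rightarrow> 'a mat \<Rightarrow> bool" where
  "generates m r N \<longleftrightarrow> N \<in> carrier_mat m m \<and> mtrace N = 0 \<and>
     (\<forall>E R. E \<in> carrier_mat m m \<longrightarrow> R \<in> carrier_mat m m \<longrightarrow> (\<forall>t. Ad (r t) E = evalm R t) \<longrightarrow>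
       evalm R 0 = E \<and> (\<forall>t. evalm (mderiv R) t = N * evalm R t - evalm R t * N))"

text \<open>When \<open>N\<close> squares to 0, the exponential of t N is 1 + t N. Conjugating the
  curve Ad (r t) E back by it gives a curve with derivative 0, which is constantly
  \<open>E\<close>.\<close>

lemma generates_square_zero:
  assumes N: "generates m r N" and sq: "N * N = 0\<^sub>m m m" and m: "0 < m"
    and r: "\<And>t. r t \<in> GLm m"
    and pol: "\<And>E. E \<in> carrier_mat m m \<Longrightarrow> \<exists>R\<in>carrier_mat m m. \<forall>t. Ad (r t) E = evalm R t"
  shows "r t \<approx> 1\<^sub>m m + t \<cdot>\<^sub>m N"
proof -
  have Nc [simp]: "N \<in> carrier_mat m m" using N by (simp add: generates_def)
  have inv: "(1\<^sub>m m + t \<cdot>\<^sub>m N) * (1\<^sub>m m + (- t) \<cdot>\<^sub>m N) = 1\<^sub>m m" for t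
  proof -
    have "(1\<^sub>m m + t \<cdot>\<^sub>m N) * (1\<^sub>m m + (- t) \<cdot>\<^sub>m N) = (1\<^sub>m m + t \<cdot>\<^sub>m N) + (- t) \<cdot>\<^sub>m (N + t \<cdot>\<^sub>m (N * N))"
      by (simp add: mult_add_distrib_mat[of _ m m _ m] add_mult_distrib_mat[of _ m m _ _ m] mult_smult_distrib[of _ m m _ m]
        mult_smult_assoc_mat[of _ m m _ m] smult_smult_sq left_mult_one_mat[of _ m m] right_mult_one_mat[of _ m m] mult.commute)
    then show ?thesis unfolding sq using carrier_matD[OF Nc] by (auto intro!: eq_matI)
  qed
  have U: "1\<^sub>m m + t \<cdot>\<^sub>m N \<in> GLm m" "minv (1\<^sub>m m + t \<cdot>\<^sub>m N) = 1\<^sub>m m + (- t) \<cdot>\<^sub>m N" for t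
    using GLmI(1)[OF _ _ inv] minv_unique(1)[OF _ _ inv] by auto
  show ?thesis
  proof (rule Ad_eq_imp_peq[OF r U(1) m])
    fix E :: "'a mat" assume E [simp]: "E \<in> carrier_mat m m"
    obtain R where R [simp]: "R \<in> carrier_mat m m" and AR: "\<And>t. Ad (r t) E = evalm R t" using pol[OF E] by blast
    have R0: "evalm R 0 = E" and R': "evalm (mderiv R) t = N * evalm R t - evalm R t * N" for t
      using N R E AR unfolding generates_def by blast+
    define P where "P = constm (1\<^sub>m m) + [:0, -1:] \<cdot>\<^sub>m constm N"
    define P' where "P' = constm (1\<^sub>m m) + [:0, 1:] \<cdot>\<^sub>m constm N"
    have P [simp]: "P \<in> carrier_mat m m" "P' \<in> carrier_mat m m" by (simp_all add: P_def P'_def)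
    have dP: "mderiv P = - constm N" "mderiv P' = constm N"
      using carrier_matD[OF Nc] by (auto intro!: eq_matI simp: P_def P'_def mderiv_def constm_def pderiv_pCons pderiv_add pderiv_minus pderiv_smult)
    have eP: "evalm P t = 1\<^sub>m m + (- t) \<cdot>\<^sub>m N" "evalm P' t = 1\<^sub>m m + t \<cdot>\<^sub>m N" for t
      by (simp_all add: P_def P'_def evalm_add[of _ m] evalm_smult[of _ m] evalm_constm[of _ m])
    have eN: "evalm (- constm N) t = - N" "evalm (constm N) t = N" for t
      using carrier_matD[OF Nc] by (auto intro!: eq_matI simp: evalm_def constm_def)
    define S where "S = P * R * P'"
    have S [simp]: "S \<in> carrier_mat m m" by (simp add: S_def)
    have uN: "(1\<^sub>m m + s \<cdot>\<^sub>m N) * N = N" "N * (1\<^sub>m m + s \<cdot>\<^sub>m N) = N" for s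
      by (simp_all add: mult_add_distrib_mat[of _ m m _ m] add_mult_distrib_mat[of _ m m _ _ m] mult_smult_distrib[of _ m m _ m]
        mult_smult_assoc_mat[of _ m m _ m] left_mult_one_mat[of _ m m] right_mult_one_mat[of _ m m] sq)
    have "evalm (mderiv S) t = 0\<^sub>m m m" for t
    proof -
      let ?V = "1\<^sub>m m + (- t) \<cdot>\<^sub>m N" and ?W = "1\<^sub>m m + t \<cdot>\<^sub>m N" and ?R = "evalm R t"
      have [simp]: "- constm N \<in> carrier_mat m m" "- N \<in> carrier_mat m m" by auto
      have "evalm (mderiv S) t = ((- N) * ?R + ?V * (N * ?R - ?R * N)) * ?W + ?V * ?R * N"
        by (simp add: S_def mderiv_mult[of _ m] dP evalm_add[of _ m] evalm_mult[of _ m] eP eN R')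
      also have "?V * (N * ?R - ?R * N) = N * ?R - ?V * ?R * N"
        by (simp add: mult_minus_distrib_mat[of _ m m _ m] assoc_mult_mat[of _ m m _ m _ m, symmetric] uN)
      also have "(- N) * ?R + (N * ?R - ?V * ?R * N) = - (?V * ?R * N)"
      proof -
        have "(- N) * ?R = - (N * ?R)"
          by (rule uminus_mult_left_mat) (use carrier_matD[OF Nc] carrier_matD[OF evalm_carrier[OF R, of t]] in auto)
        then show ?thesis by (intro eq_matI) (use carrier_matD[OF Nc] carrier_matD[OF evalm_carrier[OF R, of t]] in \<open>auto simp del: index_mult_mat(1)\<close>)
      qed
      also have "- (?V * ?R * N) * ?W = - (?V * ?R * (N * ?W))"
        by (subst uminus_mult_left_mat) (simp_all add: assoc_mult_mat[of _ m m _ m _ m] carrier_matD[OF Nc])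
      also have "\<dots> = - (?V * ?R * N)" by (simp add: uN)
      also have "- (?V * ?R * N) + ?V * ?R * N = 0\<^sub>m m m"
        by (intro eq_matI) (use carrier_matD[OF Nc] in \<open>auto simp del: index_mult_mat(1)\<close>)
      finally show ?thesis .
    qed
    from evalm_const_of_deriv0[OF S this] have "evalm S t = evalm S 0" .
    moreover have "1\<^sub>m m + (- 0) \<cdot>\<^sub>m N = 1\<^sub>m m" "1\<^sub>m m + 0 \<cdot>\<^sub>m N = 1\<^sub>m m" using carrier_matD[OF Nc] by (auto intro!: eq_matI)
    ultimately have "(1\<^sub>m m + (- t) \<cdot>\<^sub>m N) * evalm R t * (1\<^sub>m m + t \<cdot>\<^sub>m N) = E"
      by (simp add: S_def evalm_mult[of _ m] eP R0 left_mult_one_mat[of _ m m] right_mult_one_mat[of _ m m])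
    then have "Ad (minv (1\<^sub>m m + t \<cdot>\<^sub>m N)) (evalm R t) = E"
      unfolding Ad_def by (simp add: minv_minv[OF U(1)] U(2))
    then have "Ad (1\<^sub>m m + t \<cdot>\<^sub>m N) E = evalm R t" using Ad_minv(1)[OF U(1)] by (metis R evalm_carrier)
    then show "Ad (r t) E = Ad (1\<^sub>m m + t \<cdot>\<^sub>m N) E" using AR by simp
  qed
qed

text \<open>\<open>f\<close> represents a homomorphism from GL_m to PGL_m with kernel inside the
  scalars, by an arbitrary choice of matrices. Regularity is recorded along root subgroups and for
  \<open>Ad (f A)\<close>, which does not depend on that choice.\<close>

locale pgl_hom =
  fixes m :: nat and f :: "'a::field_char_0 mat \<Rightarrow> 'a mat"
  assumes split: "\<And>p::'a poly. 0 < degree p \<Longrightarrow> \<exists>x. poly p x = 0"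
    and m2: "2 \<le> m"
    and f_GLm: "A \<in> GLm m \<Longrightarrow> f A \<in> GLm m"
    and f_mult: "A \<in> GLm m \<Longrightarrow> B \<in> GLm m \<Longrightarrow> f (A * B) \<approx> f A * f B"
    and f_scalar: "A \<in> GLm m \<Longrightarrow> f A \<approx> 1\<^sub>m m \<Longrightarrow> A \<approx> 1\<^sub>m m"
    and f_poly: "i < m \<Longrightarrow> j < m \<Longrightarrow> i \<noteq> j \<Longrightarrow> E \<in> carrier_mat m m \<Longrightarrow>
      \<exists>R\<in>carrier_mat m m. \<forall>t. Ad (f (trv m i j t)) E = evalm R t"
begin

lemma Ad_f_mult: "A \<in> GLm m \<Longrightarrow> B \<in> GLm m \<Longrightarrow> E \<in> carrier_mat m m \<Longrightarrow> Ad (f (A * B)) E = Ad (f A) (Ad (f B) E)"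
  by (subst Ad_peq[OF GLm_mult[OF f_GLm f_GLm] f_mult]) (simp_all add: f_GLm Ad_comp[of _ m])

text \<open>If the generator from \<open>one_param_generator\<close> were 0, the image of the
  transvection with t = 1 would be scalar, against \<open>f_scalar\<close>.\<close>

lemma ex_generator:
  assumes ij: "i < m" "j < m" "i \<noteq> j"
  shows "\<exists>N. generates m (\<lambda>t. f (trv m i j t)) N \<and> N \<noteq> 0\<^sub>m m m"
proof -
  have m0: "0 < m" using m2 by simp
  have r: "f (trv m i j t) \<in> GLm m" for t using f_GLm trv_inverse(1)[OF ij(3,1,2)] by blast
  have rel: "\<exists>k. k \<noteq> 0 \<and> f (trv m i j (s + t)) = k \<cdot>\<^sub>m (f (trv m i j s) * f (trv m i j t))" for s t
    using f_mult[OF trv_inverse(1)[OF ij(3,1,2)] trv_inverse(1)[OF ij(3,1,2)], of s t]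
    unfolding trv_add[OF ij(3,1,2), of s t] peq_def .
  obtain N where N: "N \<in> carrier_mat m m" "mtrace N = 0"
    "\<And>E R. E \<in> carrier_mat m m \<Longrightarrow> R \<in> carrier_mat m m \<Longrightarrow> (\<And>t. Ad (f (trv m i j t)) E = evalm R t) \<Longrightarrow>
       evalm R 0 = E \<and> (\<forall>t. evalm (mderiv R) t = N * evalm R t - evalm R t * N)"
    using one_param_generator[OF m0 r rel f_poly[OF ij]] by metis
  then have gen: "generates m (\<lambda>t. f (trv m i j t)) N" by (simp add: generates_def)
  moreover have "N \<noteq> 0\<^sub>m m m"
  proof
    assume z: "N = 0\<^sub>m m m"
    have "f (trv m i j 1) \<approx> 1\<^sub>m m + 1 \<cdot>\<^sub>m N"
      by (rule generates_square_zero[OF gen _ m0 r f_poly[OF ij]]) (auto simp: z)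
    then have "f (trv m i j 1) \<approx> 1\<^sub>m m" by (simp add: z)
    then have "trv m i j 1 \<approx> (1\<^sub>m m :: 'a mat)" using f_scalar trv_inverse(1)[OF ij(3,1,2)] by blast
    then obtain k where "trv m i j 1 = k \<cdot>\<^sub>m (1\<^sub>m m :: 'a mat)" by (auto simp: peq_def)
    from arg_cong[OF this, of "\<lambda>A. A $$ (i, j)"] show False using ij by (simp add: index_trv)
  qed
  ultimately show ?thesis by blast
qed

text \<open>Conjugation by a diagonal matrix rescales the parameter of the root subgroup by s_i /
  s_j. Differentiating at 0 gives the equation up to a scalar matrix, which vanishes because
  \<open>N\<close> has trace 0.\<close>

lemma generator_torus:
  assumes ij: "i < m" "j < m" "i \<noteq> j" and gen: "generates m (\<lambda>t. f (trv m i j t)) N"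
    and s: "\<And>k. k < m \<Longrightarrow> s k \<noteq> 0"
  shows "Ad (f (mat_diag m s)) N = (s i / s j) \<cdot>\<^sub>m N"
proof -
  let ?G = "f (mat_diag m s)" and ?a = "s i / s j"
  have m0: "0 < m" using m2 by simp
  have D: "mat_diag m s \<in> GLm m" using mat_diag_GLm(1) s by blast
  have G: "?G \<in> GLm m" using f_GLm[OF D] .
  have Gc [simp]: "?G \<in> carrier_mat m m" using G GLm_carrier by auto
  have Nc [simp]: "N \<in> carrier_mat m m" using gen by (simp add: generates_def)
  have T: "trv m i j t \<in> GLm m" for t :: 'a using trv_inverse(1)[OF ij(3,1,2)] .
  have key: "Ad ?G (N * E - E * N) = ?a \<cdot>\<^sub>m (N * Ad ?G E - Ad ?G E * N)" if E [simp]: "E \<in> carrier_mat m m" for E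
  proof -
    obtain R where R [simp]: "R \<in> carrier_mat m m" and AR: "\<And>t. Ad (f (trv m i j t)) E = evalm R t"
      using f_poly[OF ij E] by blast
    obtain R' where R' [simp]: "R' \<in> carrier_mat m m" and AR': "\<And>t. Ad (f (trv m i j t)) (Ad ?G E) = evalm R' t"
      using f_poly[OF ij, of "Ad ?G E"] by auto
    have d: "evalm (mderiv R) 0 = N * E - E * N" "evalm (mderiv R') 0 = N * Ad ?G E - Ad ?G E * N"
      using gen R R' E AR AR' Ad_carrier[OF Gc E] unfolding generates_def by metis+
    \<comment> \<open>The two sides of the conjugation relation as polynomial curves. Substituting a
      t for the parameter in \<open>S'\<close> is what produces the factor a in the
      derivative.\<close>
    define S where "S = constm ?G * R * constm (minv ?G)"
    define S' where "S' = map_mat (\<lambda>p. pcompose p [:0, ?a:]) R'"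
    have S [simp]: "S \<in> carrier_mat m m" "S' \<in> carrier_mat m m" by (simp_all add: S_def S'_def)
    have "S = S'"
    proof (rule evalm_ext[OF S])
      fix t
      have "evalm S t = Ad ?G (Ad (f (trv m i j t)) E)"
        unfolding AR by (simp add: S_def evalm_mult[of _ m] evalm_constm[of _ m] Ad_def)
      also have "\<dots> = Ad (f (trv m i j (?a * t))) (Ad ?G E)"
      proof -
        have comm: "mat_diag m s * trv m i j t = trv m i j (?a * t) * mat_diag m s"
          by (rule mat_diag_trv[OF ij(1,2) s])
        show ?thesis unfolding Ad_f_mult[OF D T E, symmetric] comm Ad_f_mult[OF T D E] ..
      qed
      also have "\<dots> = evalm S' t"
        using AR'[of "?a * t"] carrier_matD[OF R'] by (auto intro!: eq_matI simp: S'_def evalm_def poly_pcompose mult.commute)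
      finally show "evalm S t = evalm S' t" .
    qed
    then have "evalm (mderiv S) 0 = evalm (mderiv S') 0" by simp
    moreover have "evalm (mderiv S) 0 = Ad ?G (evalm (mderiv R) 0)"
    proof -
      have "mderiv S = constm ?G * mderiv R * constm (minv ?G)"
        by (simp add: S_def mderiv_mult[of _ m] mderiv_constm[of _ m] left_mult_zero_mat[of _ m m] right_mult_zero_mat[of _ m m]
          left_add_zero_mat[of _ m m] right_add_zero_mat[of _ m m])
      then show ?thesis by (simp add: evalm_mult[of _ m] evalm_constm[of _ m] Ad_def)
    qed
    moreover have "evalm (mderiv S') 0 = ?a \<cdot>\<^sub>m evalm (mderiv R') 0"
      using carrier_matD[OF R'] by (auto intro!: eq_matI simp: S'_def evalm_def mderiv_def pderiv_pcompose poly_pcompose pderiv_pCons)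
    ultimately show ?thesis using d by simp
  qed
  define Z where "Z = Ad ?G N - ?a \<cdot>\<^sub>m N"
  have Z [simp]: "Z \<in> carrier_mat m m" by (simp add: Z_def)
  have "E * Z = Z * E" if E [simp]: "E \<in> carrier_mat m m" for E
  proof -
    let ?E = "Ad (minv ?G) E"
    have [simp]: "?E \<in> carrier_mat m m" by simp
    have "Ad ?G N * E - E * Ad ?G N = ?a \<cdot>\<^sub>m (N * E - E * N)"
      using key[of ?E] by (simp add: Ad_minus[of _ m] Ad_mult[OF G] Ad_minv(1)[OF G])
    then have e: "(Ad ?G N * E - E * Ad ?G N) $$ (a, b) = (?a \<cdot>\<^sub>m (N * E - E * N)) $$ (a, b)" for a b by simp
    have dA: "dim_row (Ad ?G N) = m" "dim_col (Ad ?G N) = m" using carrier_matD[OF Ad_carrier[OF Gc Nc]] by auto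
    have 1: "E * Z = E * Ad ?G N - ?a \<cdot>\<^sub>m (E * N)" "Z * E = Ad ?G N * E - ?a \<cdot>\<^sub>m (N * E)"
      unfolding Z_def
      by (simp_all add: mult_minus_distrib_mat[of _ m m _ m] minus_mult_distrib_mat[of _ m m _ _ m] mult_smult_distrib[of _ m m _ m] mult_smult_assoc_mat[of _ m m _ m])
    show ?thesis unfolding 1
    proof (rule eq_matI)
      fix a b assume "a < dim_row (Ad ?G N * E - ?a \<cdot>\<^sub>m (N * E))" "b < dim_col (Ad ?G N * E - ?a \<cdot>\<^sub>m (N * E))"
      then show "(E * Ad ?G N - ?a \<cdot>\<^sub>m (E * N)) $$ (a, b) = (Ad ?G N * E - ?a \<cdot>\<^sub>m (N * E)) $$ (a, b)"
        using e[of a b] dA carrier_matD[OF E] carrier_matD[OF Nc] by (simp add: algebra_simps del: index_mult_mat(1))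
    qed (use dA carrier_matD[OF E] carrier_matD[OF Nc] in auto)
  qed
  from commute_all_imp_scalar[OF Z m0 this] have sc: "Z = Z $$ (0, 0) \<cdot>\<^sub>m 1\<^sub>m m" by simp
  have "mtrace Z = 0"
    using gen by (simp add: Z_def mtrace_minus[of _ m] mtrace_smult[of _ m] mtrace_Ad[OF G] generates_def)
  moreover have "mtrace Z = Z $$ (0, 0) * of_nat m" by (subst sc) (simp add: mtrace_smult[of _ m] mtrace_one)
  ultimately have "Z $$ (0, 0) = 0" using m0 by simp
  moreover have "0 \<cdot>\<^sub>m 1\<^sub>m m = (0\<^sub>m m m :: 'a mat)" by (intro eq_matI) auto
  ultimately have Z0: "Z = 0\<^sub>m m m" using sc by simp
  show ?thesis
  proof (rule eq_matI)
    fix a b assume "a < dim_row (?a \<cdot>\<^sub>m N)" "b < dim_col (?a \<cdot>\<^sub>m N)"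
    then have "a < m" "b < m" using carrier_matD[OF Nc] by auto
    then show "Ad ?G N $$ (a, b) = (?a \<cdot>\<^sub>m N) $$ (a, b)"
      using arg_cong[OF Z0, of "\<lambda>A. A $$ (a, b)"] carrier_matD[OF Nc] by (simp add: Z_def)
  qed (use carrier_matD[OF Nc] carrier_matD[OF Ad_carrier[OF Gc Nc]] in auto)
qed

end

text \<open>A combinatorial form of the fact that automorphisms of the root system of type A are
  permutations up to sign. \<open>H\<close> says that \<open>sg\<close> comes from tori: for each s
  there is a y such that the root \<open>sg (i, j)\<close> takes at y the value of (i, j) at s. It
  is tested on a generic s and on those s that are 2 at one index and 1 elsewhere.\<close>

lemma root_permutation:
  fixes sg :: "nat \<times> nat \<Rightarrow> nat \<times> nat" and m :: nat
  defines "Rt \<equiv> offd {..<m}"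
  assumes m: "2 \<le> m" and bij: "bij_betw sg Rt Rt"
    and H: "\<And>s :: nat \<Rightarrow> 'a::field_char_0. \<forall>k<m. s k \<noteq> 0 \<Longrightarrow>
      \<exists>y. (\<forall>k<m. y k \<noteq> 0) \<and> (\<forall>i j. (i, j) \<in> Rt \<longrightarrow> y (fst (sg (i, j))) * s j = s i * y (snd (sg (i, j))))"
  obtains p where "bij_betw p {..<m} {..<m}"
    "(\<forall>(i, j)\<in>Rt. sg (i, j) = (p i, p j)) \<or> (\<forall>(i, j)\<in>Rt. sg (i, j) = (p j, p i))"
proof -
  note goal = that
  have Rt: "(i, j) \<in> Rt \<longleftrightarrow> i < m \<and> j < m \<and> i \<noteq> j" for i j by (simp add: Rt_def offd_iff)
  have sgO: "sg e \<in> Rt" if "e \<in> Rt" for e using bij that by (auto simp: bij_betw_def)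
  have inj: "sg e = sg e' \<Longrightarrow> e = e'" if "e \<in> Rt" "e' \<in> Rt" for e e' using bij that by (auto simp: bij_betw_def inj_on_def)
  have surj: "\<exists>e\<in>Rt. sg e = u" if "u \<in> Rt" for u using bij that unfolding bij_betw_def by (metis imageE)
  \<comment> \<open>Opposite roots take inverse values, and at a generic element the value
    identifies the root; so \<open>sg\<close> respects opposites.\<close>
  have rev: "sg (j, i) = (snd (sg (i, j)), fst (sg (i, j)))" if ij: "(i, j) \<in> Rt" for i j
  proof -
    let ?t = "\<lambda>i. of_nat (2 ^ (2 ^ i)) :: 'a"
    obtain y where y: "\<And>k. k < m \<Longrightarrow> y k \<noteq> 0" and
      yt: "\<And>i j. (i, j) \<in> Rt \<Longrightarrow> y (fst (sg (i, j))) * ?t j = ?t i * y (snd (sg (i, j)))"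
      using H[of ?t] by (auto simp: generic_ratio(1))
    obtain a b where ab: "sg (i, j) = (a, b)" by fastforce
    have abR: "(a, b) \<in> Rt" using sgO[OF ij] ab by simp
    then have "(b, a) \<in> Rt" by (auto simp: Rt)
    from surj[OF this] obtain i' j' where ij': "(i', j') \<in> Rt" "sg (i', j') = (b, a)" by auto
    have 1: "y a * ?t j = ?t i * y b" using yt[OF ij] ab by simp
    have 2: "y b * ?t j' = ?t i' * y a" using yt[OF ij'(1)] ij'(2) by simp
    have n: "y a \<noteq> 0" "y b \<noteq> 0" using y abR by (auto simp: Rt)
    have "?t j / ?t i = y b / y a" using 1 n generic_ratio(1)[of i] by (simp add: field_simps del: of_nat_power)
    moreover have "?t i' / ?t j' = y b / y a" using 2 n generic_ratio(1)[of j'] by (simp add: field_simps del: of_nat_power)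
    ultimately have eqq: "?t j / ?t i = ?t i' / ?t j'" by (rule trans[OF _ sym])
    have "j = i' \<and> i = j'"
      by (rule generic_ratio(3)[OF _ eqq]) (use ij in \<open>auto simp: Rt\<close>)
    then show ?thesis using ij' ab by simp
  qed
  have star: "(\<exists>a. \<forall>j. j < m \<longrightarrow> j \<noteq> k \<longrightarrow> fst (sg (k, j)) = a) \<or> (\<exists>a. \<forall>j. j < m \<longrightarrow> j \<noteq> k \<longrightarrow> snd (sg (k, j)) = a)"
    if k: "k < m" for k
  proof -
    \<comment> \<open>At this element exactly the m - 1 roots (k, j) take the value 2, so their
      images are the pairs on which y has ratio 2.\<close>
    let ?s = "\<lambda>i. if i = k then 2 else 1 :: 'a"
    obtain y where y: "\<And>k. k < m \<Longrightarrow> y k \<noteq> 0" and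
      ys: "\<And>i j. (i, j) \<in> Rt \<Longrightarrow> y (fst (sg (i, j))) * ?s j = ?s i * y (snd (sg (i, j)))"
    proof -
      have "?s i \<noteq> 0" for i by simp
      then show ?thesis using H[of ?s] that by blast
    qed
    have tri: "y a = y b \<or> y a = 2 * y b \<or> y b = 2 * y a" if ab: "a < m" "b < m" for a b
    proof (cases "a = b")
      case False
      then obtain i j where ij: "(i, j) \<in> Rt" "sg (i, j) = (a, b)" using surj[of "(a, b)"] ab by (auto simp: Rt)
      then have e: "y a * ?s j = ?s i * y b" using ys[OF ij(1)] by simp
      show ?thesis
      proof (cases "i = k")
        case True
        then have "j \<noteq> k" using ij(1) by (simp add: Rt)
        then show ?thesis using e True by simp
      next
        case False
        then show ?thesis using e by (cases "j = k") (simp_all add: mult.commute[of _ 2])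
      qed
    qed simp
    define P where "P = {(a, b). (a, b) \<in> Rt \<and> y a = 2 * y b}"
    have Pk: "(a, b) \<in> P \<longleftrightarrow> (\<exists>j. j < m \<and> j \<noteq> k \<and> sg (k, j) = (a, b))" for a b
    proof
      assume "(a, b) \<in> P"
      then have ab: "(a, b) \<in> Rt" "y a = 2 * y b" by (auto simp: P_def)
      then obtain i j where ij: "(i, j) \<in> Rt" "sg (i, j) = (a, b)" using surj[of "(a, b)"] by auto
      have "y b \<noteq> 0" using y ab by (auto simp: Rt)
      then have "i = k" using ys[OF ij(1)] ij ab by (auto simp: Rt split: if_splits)
      then show "\<exists>j. j < m \<and> j \<noteq> k \<and> sg (k, j) = (a, b)" using ij by (auto simp: Rt)
    next
      assume "\<exists>j. j < m \<and> j \<noteq> k \<and> sg (k, j) = (a, b)"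
      then obtain j where j: "j < m" "j \<noteq> k" "sg (k, j) = (a, b)" by blast
      have kj: "(k, j) \<in> Rt" using j k by (simp add: Rt)
      show "(a, b) \<in> P" using ys[OF kj] sgO[OF kj] j by (simp add: P_def)
    qed
    have cardP: "card P = m - 1"
    proof -
      have "P = (\<lambda>j. sg (k, j)) ` ({..<m} - {k})"
      proof (rule Set.set_eqI)
        fix u :: "nat \<times> nat"
        show "u \<in> P \<longleftrightarrow> u \<in> (\<lambda>j. sg (k, j)) ` ({..<m} - {k})"
          using Pk[of "fst u" "snd u"] unfolding image_iff Bex_def Diff_iff lessThan_iff prod.collapse by (metis singletonD singletonI)
      qed
      then have "P = sg ` (Pair k ` ({..<m} - {k}))" by (simp only: image_image)
      moreover have "inj_on sg (Pair k ` ({..<m} - {k}))" by (rule inj_onI, rule inj) (use k in \<open>auto simp: Rt\<close>)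
      moreover have "card (Pair k ` ({..<m} - {k})) = m - 1" using k by (subst card_image) (auto simp: inj_on_def)
      ultimately show ?thesis by (simp add: card_image)
    qed
    define A where "A = fst ` P"
    define B where "B = snd ` P"
    \<comment> \<open>By \<open>tri\<close> the ratios of values of y are 1, 2 or 1/2, so y has only
      two values once some ratio is 2. The pairs of ratio 2 therefore form a full rectangle.\<close>
    have PAB: "P = A \<times> B"
    proof
      show "A \<times> B \<subseteq> P"
      proof
        fix u assume "u \<in> A \<times> B"
        then obtain a b a' b' where u: "u = (a, b)" and ab': "(a, b') \<in> P" "(a', b) \<in> P" by (auto simp: A_def B_def)
        then have e: "y a = 2 * y b'" "y a' = 2 * y b" "a < m" "b < m" "a' < m" "b' < m" by (auto simp: P_def Rt)
        have "y b \<noteq> 0" "y b' \<noteq> 0" using y e by auto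
        have ar: "2 * z' = 2 * z" if "2 * z' = z \<or> 2 * z' = 2 * z \<or> z = 2 * (2 * z')"
          "2 * z = z' \<or> 2 * z = 2 * z' \<or> z' = 2 * (2 * z)" "z \<noteq> 0" "z' \<noteq> 0" for z z' :: 'a
          using that by auto
        have "y a = 2 * y b" unfolding e(1)
          by (rule ar[OF tri[OF e(3,4), unfolded e(1)] tri[OF e(5,6), unfolded e(2)] \<open>y b \<noteq> 0\<close> \<open>y b' \<noteq> 0\<close>])
        then show "u \<in> P" using e \<open>y b \<noteq> 0\<close> u by (auto simp: P_def Rt)
      qed
    qed (auto simp: A_def B_def rev_image_eqI)
    have disj: "A \<inter> B = {}"
    proof (rule ccontr)
      assume "A \<inter> B \<noteq> {}"
      then obtain a where "(a, a) \<in> P" using PAB by auto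
      then show False by (auto simp: P_def Rt)
    qed
    have sub: "A \<subseteq> {..<m}" "B \<subseteq> {..<m}" by (auto simp: A_def B_def P_def Rt)
    then have fin: "finite A" "finite B" by (auto intro: finite_subset)
    have un: "A \<union> B = {..<m}"
    proof
      show "{..<m} \<subseteq> A \<union> B"
      proof
        fix c assume c: "c \<in> {..<m}"
        have "P \<noteq> {}" using cardP m by auto
        then obtain a b where ab: "(a, b) \<in> P" by auto
        then have e: "a < m" "b < m" "y a = 2 * y b" by (auto simp: P_def Rt)
        have nb: "y b \<noteq> 0" "y c \<noteq> 0" using y e c by auto
        have "y c = y b \<or> y c = 2 * y b"
        proof -
          have ar: "x = z \<or> x = 2 * z" if "x = z \<or> x = 2 * z \<or> z = 2 * x"
            "x = 2 * z \<or> x = 2 * (2 * z) \<or> 2 * z = 2 * x" "z \<noteq> 0" for x z :: 'a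
            using that by auto
          show ?thesis
            by (rule ar[OF tri[of c b] tri[of c a, unfolded e(3)] nb(1)]) (use c e in auto)
        qed
        then show "c \<in> A \<union> B"
        proof
          assume "y c = y b"
          then have "(a, c) \<in> P" using e c nb by (auto simp: P_def Rt)
          then show ?thesis by (auto simp: B_def rev_image_eqI)
        next
          assume "y c = 2 * y b"
          then have "(c, b) \<in> P" using e c nb by (auto simp: P_def Rt)
          then show ?thesis by (auto simp: A_def rev_image_eqI)
        qed
      qed
    qed (use sub in auto)
    have "card A + card B = m" using un disj fin by (metis card_Un_disjoint card_lessThan)
    moreover have "card A * card B = m - 1" using cardP PAB by (simp add: card_cartesian_product)
    \<comment> \<open>From x + y = m and x y = m - 1 one gets (x - 1) (y - 1) = 0.\<close>
    ultimately have "card A = 1 \<or> card B = 1"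
    proof -
      assume s: "card A + card B = m" and p: "card A * card B = m - 1"
      obtain a b where ab: "card A = Suc a" "card B = Suc b"
        using p m by (metis One_nat_def Suc_diff_le diff_is_0_eq' less_eq_nat.simps(2) mult_is_0 nat.exhaust not_less_eq_eq numeral_2_eq_2 old.nat.distinct(1) diff_Suc_1)
      have "Suc a * Suc b = Suc a + Suc b - 1" using s p ab by simp
      then have "a * b = 0" by simp
      then show ?thesis using ab by auto
    qed
    then show ?thesis
    proof
      assume "card A = 1"
      then obtain a where a: "A = {a}" by (auto simp: card_1_singleton_iff)
      have "fst (sg (k, j)) = a" if "j < m" "j \<noteq> k" for j
      proof -
        have "sg (k, j) \<in> P" using Pk[of "fst (sg (k, j))" "snd (sg (k, j))"] that by auto
        then show ?thesis using a by (auto simp: A_def)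
      qed
      then show ?thesis by blast
    next
      assume "card B = 1"
      then obtain a where a: "B = {a}" by (auto simp: card_1_singleton_iff)
      have "snd (sg (k, j)) = a" if "j < m" "j \<noteq> k" for j
      proof -
        have "sg (k, j) \<in> P" using Pk[of "fst (sg (k, j))" "snd (sg (k, j))"] that by auto
        then show ?thesis using a by (auto simp: B_def)
      qed
      then show ?thesis by blast
    qed
  qed
  define T1 where "T1 k a \<longleftrightarrow> (\<forall>j. j < m \<longrightarrow> j \<noteq> k \<longrightarrow> fst (sg (k, j)) = a)" for k a
  define T2 where "T2 k a \<longleftrightarrow> (\<forall>j. j < m \<longrightarrow> j \<noteq> k \<longrightarrow> snd (sg (k, j)) = a)" for k a
  have T12: "(\<exists>a. T1 k a) \<or> (\<exists>a. T2 k a)" if "k < m" for k using star[OF that] by (auto simp: T1_def T2_def)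
  have bijp: "bij_betw p {..<m} {..<m}" if "\<And>k j. k < m \<Longrightarrow> j < m \<Longrightarrow> k \<noteq> j \<Longrightarrow> (p k, p j) \<in> Rt" for p
  proof -
    have "inj_on p {..<m}" using that by (auto simp: inj_on_def Rt)
    moreover have "p ` {..<m} \<subseteq> {..<m}"
    proof
      fix x assume "x \<in> p ` {..<m}"
      then obtain k where k: "k < m" "x = p k" by auto
      obtain j where "j < m" "j \<noteq> k"
      proof (rule that)
        show "(if k = 0 then 1 else 0) < m" "(if k = 0 then 1 else 0) \<noteq> k" using m by auto
      qed
      then show "x \<in> {..<m}" using that[of k j] k by (auto simp: Rt)
    qed
    ultimately show ?thesis using endo_inj_surj[of "{..<m}" p] by (simp add: bij_betw_def)
  qed
  have all1: thesis if A: "\<And>k. k < m \<Longrightarrow> \<exists>a. T1 k a"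
  proof -
    obtain p where p: "\<And>k. k < m \<Longrightarrow> T1 k (p k)" using A by metis
    have eq: "sg (k, j) = (p k, p j)" if "k < m" "j < m" "k \<noteq> j" for k j
    proof -
      have "fst (sg (k, j)) = p k" "fst (sg (j, k)) = p j" using p that by (auto simp: T1_def)
      then show ?thesis using rev[of k j] that by (auto simp: Rt prod_eq_iff)
    qed
    have "bij_betw p {..<m} {..<m}" by (rule bijp) (metis eq sgO Rt)
    then show thesis by (rule goal) (use eq in \<open>auto simp: Rt\<close>)
  qed
  have all2: thesis if A: "\<And>k. k < m \<Longrightarrow> \<exists>a. T2 k a"
  proof -
    obtain p where p: "\<And>k. k < m \<Longrightarrow> T2 k (p k)" using A by metis
    have eq: "sg (k, j) = (p j, p k)" if "k < m" "j < m" "k \<noteq> j" for k j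
    proof -
      have "snd (sg (k, j)) = p k" "snd (sg (j, k)) = p j" using p that by (auto simp: T2_def)
      then show ?thesis using rev[of k j] that by (auto simp: Rt prod_eq_iff)
    qed
    have "bij_betw p {..<m} {..<m}" by (rule bijp) (metis eq sgO Rt)
    then show thesis by (rule goal) (use eq in \<open>auto simp: Rt\<close>)
  qed
  show thesis
  proof (cases "m = 2")
    case True
    \<comment> \<open>For m = 2 there is only one j, so the first alternative can always be
      chosen.\<close>
    have "\<exists>a. T1 k a" if "k < m" for k
    proof -
      have "\<exists>j0. \<forall>j. j < m \<longrightarrow> j \<noteq> k \<longrightarrow> j = j0" using that True by (intro exI[of _ "1 - k"]) auto
      then show ?thesis unfolding T1_def by metis
    qed
    then show thesis by (rule all1)
  next
    case False
    \<comment> \<open>If k is of the first kind and k' of the second, reversing the root (k, k')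
      makes the two common indices agree. A third index l can then be of neither kind, since an
      image root would have two equal indices.\<close>
    have no_mix: False if k: "k < m" "k' < m" "k \<noteq> k'" and t: "T1 k a" "T2 k' a'" for k k' a a'
    proof -
      obtain l where l: "l < m" "l \<noteq> k" "l \<noteq> k'"
      proof -
        have "card ({..<m} - {k, k'}) > 0" using k m False by (subst card_Diff_subset) auto
        then have "{..<m} - {k, k'} \<noteq> {}" by (metis card.empty less_numeral_extra(3))
        then show ?thesis using that by blast
      qed
      have 1: "fst (sg (k, k')) = a" "snd (sg (k', k)) = a'" "fst (sg (k, l)) = a" "snd (sg (k', l)) = a'"
        using t k l by (auto simp: T1_def T2_def)
      have r: "sg (k', k) = (snd (sg (k, k')), fst (sg (k, k')))" "sg (l, k) = (snd (sg (k, l)), fst (sg (k, l)))"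
        "sg (l, k') = (snd (sg (k', l)), fst (sg (k', l)))"
        by (rule rev; use k l in \<open>simp add: Rt\<close>)+
      then have aa: "a' = a" using 1 by simp
      have R: "sg (k, l) \<in> Rt" "sg (k', l) \<in> Rt" using sgO k l by (auto simp: Rt)
      then have ne: "fst (sg (k, l)) \<noteq> snd (sg (k, l))" "fst (sg (k', l)) \<noteq> snd (sg (k', l))"
        by (auto simp: Rt_def offd_def)
      show False
        using T12[OF l(1)]
      proof
        assume "\<exists>c. T1 l c"
        then have "fst (sg (l, k)) = fst (sg (l, k'))" using k l by (auto simp: T1_def)
        then show False using r 1 aa ne by simp
      next
        assume "\<exists>c. T2 l c"
        then have "snd (sg (l, k)) = snd (sg (l, k'))" using k l by (auto simp: T2_def)
        then show False using r 1 aa ne by simp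
      qed
    qed
    show thesis
    proof (cases "\<forall>k<m. \<exists>a. T1 k a")
      case True
      then show thesis using all1 by blast
    next
      case False
      then obtain k' where k': "k' < m" "\<not> (\<exists>a. T1 k' a)" by blast
      then obtain a' where a': "T2 k' a'" using T12 by blast
      have "\<exists>a. T2 k a" if "k < m" for k
        using no_mix[OF that k'(1) _ _ a'] T12[OF that] a' by blast
      then show thesis by (rule all2)
    qed
  qed
qed

context pgl_hom
begin

text \<open>One generic diagonal matrix supplies the eigenbasis \<open>Q\<close> and the bijection
  \<open>sg\<close>. The image of any other diagonal matrix rescales, in this basis, every matrix
  unit off the diagonal, and this forces it to be diagonal there too.\<close>

lemma root_structure:
  obtains Q sg c where "Q \<in> GLm m" "bij_betw sg (offd {..<m}) (offd {..<m})"
    "\<And>e. e \<in> offd {..<m} \<Longrightarrow> c e \<noteq> 0"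
    "\<And>i j x. (i, j) \<in> offd {..<m} \<Longrightarrow> f (trv m i j x) \<approx> Ad Q (trv m (fst (sg (i, j))) (snd (sg (i, j))) (c (i, j) * x))"
    "\<And>s. \<forall>k<m. s k \<noteq> 0 \<Longrightarrow> \<exists>y. (\<forall>k<m. y k \<noteq> 0) \<and> f (mat_diag m s) \<approx> Ad Q (mat_diag m y) \<and>
       (\<forall>i j. (i, j) \<in> offd {..<m} \<longrightarrow> y (fst (sg (i, j))) * s j = s i * y (snd (sg (i, j))))"
proof -
  let ?O = "offd {..<m}"
  have m0: "0 < m" using m2 by simp
  have "\<exists>N. generates m (\<lambda>t. f (trv m (fst e) (snd e) t)) N \<and> N \<noteq> 0\<^sub>m m m" if "e \<in> ?O" for e
    using ex_generator[of "fst e" "snd e"] that by (cases e) (auto simp: offd_iff)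
  then obtain N where N: "e \<in> ?O \<Longrightarrow> generates m (\<lambda>t. f (trv m (fst e) (snd e) t)) (N e) \<and> N e \<noteq> 0\<^sub>m m m" for e by metis
  define t :: "nat \<Rightarrow> 'a" where "t i = of_nat (2 ^ (2 ^ i))" for i
  note gr = generic_ratio[where 'a = 'a, folded t_def]
  define al where "al e = t (fst e) / t (snd e)" for e
  have tors: "Ad (f (mat_diag m s)) (N e) = (s (fst e) / s (snd e)) \<cdot>\<^sub>m N e"
    if "e \<in> ?O" "\<And>k. k < m \<Longrightarrow> s k \<noteq> 0" for e s
    using generator_torus[of "fst e" "snd e" "N e" s] N[OF that(1)] that by (cases e) (auto simp: offd_iff)
  have D: "mat_diag m t \<in> GLm m" using mat_diag_GLm(1) gr(1) by blast
  obtain Q sg c where Q: "Q \<in> GLm m" "bij_betw sg ?O ?O"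
    and NQ: "\<And>e. e \<in> ?O \<Longrightarrow> c e \<noteq> 0 \<and> N e = Ad Q (c e \<cdot>\<^sub>m matunit m (fst (sg e)) (snd (sg e)))"
  proof (rule split_diagonalization[where G = "f (mat_diag m t)" and m = m and N = N and al = al])
    show "\<exists>x. poly p x = 0" if "0 < degree p" for p :: "'a poly" using split[OF that] .
    show "f (mat_diag m t) \<in> GLm m" "2 \<le> m" using f_GLm[OF D] m2 by auto
    show "N e \<in> carrier_mat m m \<and> N e \<noteq> 0\<^sub>m m m \<and> Ad (f (mat_diag m t)) (N e) = al e \<cdot>\<^sub>m N e" if "e \<in> ?O" for e
      using N[OF that] tors[OF that gr(1)] by (auto simp: generates_def al_def)
    show "inj_on al ?O"
    proof (rule inj_onI)
      fix e e' assume "e \<in> ?O" "e' \<in> ?O" "al e = al e'"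
      then show "e = e'" using gr(3)[of "fst e" "snd e" "fst e'" "snd e'"]
        by (cases e; cases e') (auto simp: offd_iff al_def)
    qed
    show "al e \<noteq> 0 \<and> al e \<noteq> 1" if "e \<in> ?O" for e
      using gr(1)[of "fst e"] gr(1)[of "snd e"] gr(2)[of "fst e" "snd e"] that by (cases e) (auto simp: offd_iff al_def)
    fix Q sg c assume a: "Q \<in> GLm m" "bij_betw sg ?O ?O"
      and b: "\<And>e. e \<in> ?O \<Longrightarrow> c e \<noteq> 0 \<and> N e = Ad Q (c e \<cdot>\<^sub>m matunit m (fst (sg e)) (snd (sg e)))"
    show thesis by (rule that[OF a b])
  qed
  have Qc [simp]: "Q \<in> carrier_mat m m" using Q GLm_carrier by auto
  have sgO: "sg e \<in> ?O" if "e \<in> ?O" for e using Q(2) that by (auto simp: bij_betw_def)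
  show thesis
  proof (rule that[OF Q])
    show "c e \<noteq> 0" if "e \<in> ?O" for e using NQ that by blast
    fix i j x assume ij: "(i, j) \<in> ?O"
    let ?a = "fst (sg (i, j))" and ?b = "snd (sg (i, j))"
    have ab: "?a < m" "?b < m" "?a \<noteq> ?b" using sgO[OF ij] by (auto simp: offd_def)
    have Nij: "N (i, j) = Ad Q (c (i, j) \<cdot>\<^sub>m matunit m ?a ?b)" using NQ[OF ij] by simp
    \<comment> \<open>The two indices of a root differ, so the generator squares to 0 and
      \<open>generates_square_zero\<close> gives the image as a transvection.\<close>
    have sq: "N (i, j) * N (i, j) = 0\<^sub>m m m"
    proof -
      have "N (i, j) * N (i, j) = Ad Q ((c (i, j) \<cdot>\<^sub>m matunit m ?a ?b) * (c (i, j) \<cdot>\<^sub>m matunit m ?a ?b))"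
        unfolding Nij by (rule Ad_mult[OF Q(1), symmetric]) auto
      also have "(c (i, j) \<cdot>\<^sub>m matunit m ?a ?b) * (c (i, j) \<cdot>\<^sub>m matunit m ?a ?b) = 0\<^sub>m m m"
        using ab by (simp add: mult_smult_distrib[of _ m m _ m] mult_smult_assoc_mat[of _ m m _ m] matunit_mult)
      finally show ?thesis by (simp add: Ad_def right_mult_zero_mat[of _ m m] left_mult_zero_mat[of _ m m])
    qed
    have ij': "i < m" "j < m" "i \<noteq> j" using ij by (auto simp: offd_iff)
    have "f (trv m i j x) \<approx> 1\<^sub>m m + x \<cdot>\<^sub>m N (i, j)"
    proof (rule generates_square_zero[OF _ sq m0 _ f_poly[OF ij']])
      show "generates m (\<lambda>t. f (trv m i j t)) (N (i, j))" using N[OF ij] by simp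
      show "f (trv m i j t) \<in> GLm m" for t using f_GLm trv_inverse(1)[OF ij'(3,1,2)] by blast
    qed
    also have "1\<^sub>m m + x \<cdot>\<^sub>m N (i, j) = Ad Q (trv m ?a ?b (c (i, j) * x))"
      unfolding trv_def Nij
      by (simp add: Ad_add[of _ m] Ad_smult[of _ m] smult_smult_sq mult.commute)
        (simp add: Ad_def right_mult_one_mat[of _ m m] minv_right[OF Q(1)])
    finally show "f (trv m i j x) \<approx> Ad Q (trv m ?a ?b (c (i, j) * x))" .
  next
    fix s :: "nat \<Rightarrow> 'a" assume "\<forall>k<m. s k \<noteq> 0"
    then have s: "\<And>k. k < m \<Longrightarrow> s k \<noteq> 0" by blast
    let ?G = "f (mat_diag m s)"
    have G: "?G \<in> GLm m" using f_GLm mat_diag_GLm(1) s by blast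
    have Gc [simp]: "?G \<in> carrier_mat m m" using G GLm_carrier by auto
    define Y where "Y = Ad (minv Q) ?G"
    have Y: "Y \<in> GLm m" using G Q by (simp add: Y_def Ad_def GLm_mult GLm_minv minv_minv)
    have Yc [simp]: "Y \<in> carrier_mat m m" using Y GLm_carrier by auto
    have GY: "?G = Q * Y * minv Q" using Ad_minv(1)[OF Q(1) Gc] by (simp add: Y_def Ad_def)
    have YE: "Y * matunit m a b = (s i / s j) \<cdot>\<^sub>m (matunit m a b * Y)"
      if ij: "(i, j) \<in> ?O" and ab: "sg (i, j) = (a, b)" for i j a b
    proof -
      let ?E = "matunit m a b :: 'a mat"
      have n: "N (i, j) = Ad Q (c (i, j) \<cdot>\<^sub>m ?E)" "c (i, j) \<noteq> 0" using NQ[OF ij] ab by auto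
      have "Ad Q (Ad Y (c (i, j) \<cdot>\<^sub>m ?E)) = Ad ?G (N (i, j))"
        unfolding GY n using Q Y by (simp add: Ad_comp[of _ m] GLm_mult GLm_minv Ad_minv(2)[OF Q(1)])
      also have "\<dots> = (s i / s j) \<cdot>\<^sub>m Ad Q (c (i, j) \<cdot>\<^sub>m ?E)" using tors[OF ij s] n by simp
      finally have "Ad (minv Q) (Ad Q (Ad Y (c (i, j) \<cdot>\<^sub>m ?E))) = Ad (minv Q) (Ad Q ((s i / s j) \<cdot>\<^sub>m (c (i, j) \<cdot>\<^sub>m ?E)))"
        by (simp add: Ad_smult[of _ m])
      then have "c (i, j) \<cdot>\<^sub>m Ad Y ?E = (s i / s j) \<cdot>\<^sub>m (c (i, j) \<cdot>\<^sub>m ?E)"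
        by (simp add: Ad_minv(2)[OF Q(1)] Ad_smult[of _ m])
      then have "inverse (c (i, j)) \<cdot>\<^sub>m (c (i, j) \<cdot>\<^sub>m Ad Y ?E) = inverse (c (i, j)) \<cdot>\<^sub>m ((s i / s j) \<cdot>\<^sub>m (c (i, j) \<cdot>\<^sub>m ?E))" by simp
      then have "Ad Y ?E = (s i / s j) \<cdot>\<^sub>m ?E" using n(2) by (simp add: smult_smult_sq field_simps)
      then have "Y * ?E = ((s i / s j) \<cdot>\<^sub>m ?E) * Y" using Ad_eq_iff[OF Y, of ?E "(s i / s j) \<cdot>\<^sub>m ?E"] by simp
      then show ?thesis by (simp add: mult_smult_assoc_mat[of _ m m _ m])
    qed
    \<comment> \<open>Column b of the relation \<open>YE\<close> compares column a of
      \<open>Y\<close> with a column whose only nonzero entry can be Y_bb, in row a.\<close>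
    have ents: "Y $$ (k, a) = (if k = a then s i / s j * Y $$ (b, b) else 0)"
      if ij: "(i, j) \<in> ?O" and ab: "sg (i, j) = (a, b)" and k: "k < m" for i j a b k
    proof -
      have "a < m" "b < m" using sgO[OF ij] ab by (auto simp: offd_iff)
      then show ?thesis
        using arg_cong[OF YE[OF ij ab], of "\<lambda>A. A $$ (k, b)"] k
        by (simp add: matunit_mult_left[OF Yc] matunit_mult_right[OF Yc])
    qed
    define y where "y a = Y $$ (a, a)" for a
    have Yd: "Y = mat_diag m y"
    proof (rule eq_matI)
      fix k a assume "k < dim_row (mat_diag m y)" "a < dim_col (mat_diag m y)"
      then have ka: "k < m" "a < m" by (auto simp: mat_diag_def)
      obtain b where "b < m" "b \<noteq> a"
      proof (rule that)
        show "(if a = 0 then 1 else 0) < m" "(if a = 0 then 1 else 0) \<noteq> a" using m2 by auto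
      qed
      then have "(a, b) \<in> ?O" using ka by (auto simp: offd_iff)
      then have "(a, b) \<in> sg ` ?O" using Q(2) by (simp add: bij_betw_def)
      then obtain i j where "(i, j) \<in> ?O" "sg (i, j) = (a, b)" by (metis imageE surj_pair)
      from ents[OF this ka(1)] show "Y $$ (k, a) = mat_diag m y $$ (k, a)"
        using ka by (auto simp: mat_diag_def y_def)
    qed (auto simp: mat_diag_def carrier_matD[OF Yc])
    have y0: "y a \<noteq> 0" if a: "a < m" for a
    proof -
      have "(Y * minv Y) $$ (a, a) = 1" using a by (simp add: minv_right[OF Y])
      moreover have "(Y * minv Y) $$ (a, a) = y a * minv Y $$ (a, a)"
        by (subst (1) Yd) (use a in \<open>simp add: mat_diag_mult_left[of _ m m]\<close>)
      ultimately show ?thesis by auto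
    qed
    show "\<exists>y. (\<forall>k<m. y k \<noteq> 0) \<and> ?G \<approx> Ad Q (mat_diag m y) \<and>
       (\<forall>i j. (i, j) \<in> ?O \<longrightarrow> y (fst (sg (i, j))) * s j = s i * y (snd (sg (i, j))))"
    proof (intro exI[of _ y] conjI allI impI)
      show "y k \<noteq> 0" if "k < m" for k using y0 that .
      show "?G \<approx> Ad Q (mat_diag m y)" using GY Yd by (simp add: Ad_def)
      fix i j assume ij: "(i, j) \<in> ?O"
      obtain a b where ab: "sg (i, j) = (a, b)" by fastforce
      have "a < m" "j < m" using sgO[OF ij] ab ij by (auto simp: offd_iff)
      then show "y (fst (sg (i, j))) * s j = s i * y (snd (sg (i, j)))"
        using ents[OF ij ab, of a] s[of j] by (simp add: ab y_def)
    qed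
  qed
qed

end

section \<open>Normalizing the images of root subgroups\<close>

lemma trv_mult_right: assumes "A \<in> carrier_mat m m" "i < m"
  shows "A * trv m i j x = mat m m (\<lambda>(a, b). A $$ (a, b) + (if b = j then x * A $$ (a, i) else 0))"
  using assms by (auto intro!: eq_matI simp: trv_def mult_add_distrib_mat[of _ m m _ m] mult_smult_distrib[of _ m m _ m]
      matunit_mult_right[of _ m m] right_mult_one_mat[of _ m m])

lemma transpose_trv: "(trv m i j x)\<^sup>T = trv m j i x"
  by (rule eq_matI) (auto simp: index_trv)

lemma transpose_mat_diag: "(mat_diag m s)\<^sup>T = mat_diag m s"
  by (rule eq_matI) (auto simp: mat_diag_def)

lemma Ad_peq_cancel: assumes "Q \<in> GLm m" "A \<in> carrier_mat m m" "B \<in> carrier_mat m m" "Ad Q A \<approx> Ad Q B"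
  shows "A \<approx> B"
  using peq_Ad[of "minv Q" m "Ad Q B" "Ad Q A"] assms by (simp add: Ad_minv GLm_carrier)

lemma Ad_GLm: "g \<in> GLm m \<Longrightarrow> A \<in> GLm m \<Longrightarrow> Ad g A \<in> GLm m"
  by (simp add: Ad_def GLm_mult GLm_minv)

lemma minv_Ad: "g \<in> GLm m \<Longrightarrow> A \<in> GLm m \<Longrightarrow> minv (Ad g A) = Ad g (minv A)"
  by (simp add: Ad_def minv_mult[of _ m] GLm_mult GLm_minv minv_minv assoc_mult_mat[of _ m m _ m _ m] GLm_carrier)

lemma transpose_Ad: assumes "g \<in> GLm m" "A \<in> carrier_mat m m"
  shows "(Ad g A)\<^sup>T = Ad ((minv g)\<^sup>T) (A\<^sup>T)"
proof -
  have [simp]: "g \<in> carrier_mat m m" using assms GLm_carrier by auto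
  have "(Ad g A)\<^sup>T = (minv g)\<^sup>T * (A\<^sup>T * g\<^sup>T)"
    using assms(2) by (simp add: Ad_def transpose_mult[of _ m m _ m])
  moreover have "minv ((minv g)\<^sup>T) = g\<^sup>T" by (simp add: minv_transpose[OF GLm_minv[OF assms(1)]] minv_minv[OF assms(1)])
  ultimately show ?thesis using assms(2) by (simp add: Ad_def assoc_mult_mat[of _ m m _ m _ m])
qed

text \<open>The outcome of \<open>root_structure\<close> in the case where \<open>p\<close> permutes
  the roots without exchanging their two indices.\<close>

definition normal_form :: "nat \<Rightarrow> ('a::field_char_0 mat \<Rightarrow> 'a mat) \<Rightarrow> 'a mat \<Rightarrow> (nat \<Rightarrow> nat) \<Rightarrow> (nat \<times> nat \<Rightarrow> 'a) \<Rightarrow> bool" where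
  "normal_form m f Q p c \<longleftrightarrow> Q \<in> GLm m \<and> bij_betw p {..<m} {..<m} \<and>
     (\<forall>i j x. (i, j) \<in> offd {..<m} \<longrightarrow> c (i, j) \<noteq> 0 \<and> f (trv m i j x) \<approx> Ad Q (trv m (p i) (p j) (c (i, j) * x))) \<and>
     (\<forall>s. (\<forall>k<m. s k \<noteq> 0) \<longrightarrow> (\<exists>y. (\<forall>k<m. y k \<noteq> 0) \<and> f (mat_diag m s) \<approx> Ad Q (mat_diag m y) \<and>
       (\<forall>i j. (i, j) \<in> offd {..<m} \<longrightarrow> y (p i) * s j = s i * y (p j))))"

text \<open>A monomial matrix built from \<open>p\<close> and the constants c (0, j) absorbs the
  permutation and the rescaling of the root subgroups (0, j). It normalizes the subgroups (j, 0) at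
  the same time, because c (0, j) and c (j, 0) are inverse to each other by a relation in
  SL_2.\<close>

lemma normal_form_blocks:
  fixes f :: "'a::field_char_0 mat \<Rightarrow> 'a mat"
  assumes nf: "normal_form m f Q p c" and m: "2 \<le> m"
    and f_GLm: "\<And>A. A \<in> GLm m \<Longrightarrow> f A \<in> GLm m"
    and f_mult: "\<And>A B. A \<in> GLm m \<Longrightarrow> B \<in> GLm m \<Longrightarrow> f (A * B) \<approx> f A * f B"
  obtains P where "P \<in> GLm m"
    "\<And>j x s y. 0 < j \<Longrightarrow> j < m \<Longrightarrow> \<forall>k<m. s k \<noteq> 0 \<Longrightarrow>
      f (trv m j 0 x * mat_diag m s * trv m 0 j y) \<approx> Ad P (trv m j 0 x * mat_diag m s * trv m 0 j y)"
proof -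
  have Q: "Q \<in> GLm m" and p: "bij_betw p {..<m} {..<m}" using nf by (auto simp: normal_form_def)
  have Qc [simp]: "Q \<in> carrier_mat m m" using Q GLm_carrier by auto
  have u: "c (i, j) \<noteq> 0" "f (trv m i j x) \<approx> Ad Q (trv m (p i) (p j) (c (i, j) * x))" if "i < m" "j < m" "i \<noteq> j" for i j x
    using nf that by (auto simp: normal_form_def offd_iff)
  have dg: "\<exists>y. (\<forall>k<m. y k \<noteq> 0) \<and> f (mat_diag m s) \<approx> Ad Q (mat_diag m y) \<and>
       (\<forall>i<m. \<forall>j<m. y (p i) * s j = s i * y (p j))" if "\<forall>k<m. s k \<noteq> 0" for s
  proof -
    have "\<exists>y. (\<forall>k<m. y k \<noteq> 0) \<and> f (mat_diag m s) \<approx> Ad Q (mat_diag m y) \<and>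
       (\<forall>i j. (i, j) \<in> offd {..<m} \<longrightarrow> y (p i) * s j = s i * y (p j))"
      using nf that unfolding normal_form_def by simp
    then obtain y where y: "\<forall>k<m. y k \<noteq> 0" "f (mat_diag m s) \<approx> Ad Q (mat_diag m y)"
      "\<And>i j. (i, j) \<in> offd {..<m} \<Longrightarrow> y (p i) * s j = s i * y (p j)" by blast
    have "y (p i) * s j = s i * y (p j)" if "i < m" "j < m" for i j
      using y(3)[of i j] that by (cases "i = j") (auto simp: offd_iff mult.commute)
    then show ?thesis using y by blast
  qed
  have pm: "p i < m" if "i < m" for i using p that by (auto simp: bij_betw_def)
  have pinj: "p i = p j \<longleftrightarrow> i = j" if "i < m" "j < m" for i j using p that by (auto simp: bij_betw_def inj_on_def)
  have T: "trv m i j x \<in> GLm m" if "i < m" "j < m" "i \<noteq> j" for i j and x :: 'a using trv_inverse(1) that by blast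
  have rep_mult: "f (A * B) \<approx> Ad P (A' * B')"
    if "A \<in> GLm m" "B \<in> GLm m" "P \<in> GLm m" "A' \<in> carrier_mat m m" "B' \<in> carrier_mat m m" "f A \<approx> Ad P A'" "f B \<approx> Ad P B'" for A B A' B' P
  proof -
    note f_mult[OF that(1,2)]
    also have "f A * f B \<approx> Ad P A' * Ad P B'"
      by (rule peq_mult[of _ m]) (use that f_GLm GLm_carrier in auto)
    also have "\<dots> = Ad P (A' * B')" using Ad_mult[OF that(3-5)] by simp
    finally show ?thesis .
  qed
  have c1: "c (0, j) * c (j, 0) = 1" if j: "0 < j" "j < m" for j
  proof -
    \<comment> \<open>The matrix with rows (2, 1) and (1, 1) is an upper times a lower unipotent
      matrix; its factorization as lower times diagonal times upper has the pivots 2 and 1/2. The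
      images of both factorizations are compared.\<close>
    let ?s = "\<lambda>k. if k = 0 then 2 else if k = j then 1 / 2 else 1 :: 'a"
    let ?a = "p 0" and ?b = "p j" and ?c = "c (0, j)" and ?d = "c (j, 0)"
    have m0: "0 < m" using m by simp
    have ab: "?a < m" "?b < m" "?a \<noteq> ?b" using pm pinj j m0 by auto
    have D: "mat_diag m ?s \<in> GLm m" by (rule mat_diag_GLm(1)) auto
    have "\<forall>k<m. ?s k \<noteq> 0" by simp
    from dg[OF this] obtain y where y: "\<forall>k<m. y k \<noteq> 0" "f (mat_diag m ?s) \<approx> Ad Q (mat_diag m y)" by blast
    have rel: "trv m 0 j 1 * trv m j 0 1 = trv m j 0 (1 / 2) * mat_diag m ?s * trv m 0 j (1 / 2)"
      using j by (intro eq_matI) (auto simp: trv_mult_left[of _ m] trv_mult_right[of _ m] mat_diag_mult_right[of _ m m] index_trv)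
    have j0: "j \<noteq> 0" "0 \<noteq> j" using j by auto
    have T1: "trv m 0 j x \<in> GLm m" "trv m j 0 x \<in> GLm m" for x :: 'a using T j m0 j0 by auto
    have r1: "f (trv m 0 j 1 * trv m j 0 1) \<approx> Ad Q (trv m ?a ?b (?c * 1) * trv m ?b ?a (?d * 1))"
      by (rule rep_mult[OF T1(1) T1(2) Q trv_carrier trv_carrier u(2)[OF m0 j(2) j0(2)] u(2)[OF j(2) m0 j0(1)]])
    have r2: "f (trv m j 0 (1 / 2) * mat_diag m ?s) \<approx> Ad Q (trv m ?b ?a (?d * (1 / 2)) * mat_diag m y)"
      by (rule rep_mult[OF T1(2) D Q trv_carrier mat_diag_dim u(2)[OF j(2) m0 j0(1)] y(2)])
    have r3: "f (trv m j 0 (1 / 2) * mat_diag m ?s * trv m 0 j (1 / 2)) \<approx> Ad Q (trv m ?b ?a (?d * (1 / 2)) * mat_diag m y * trv m ?a ?b (?c * (1 / 2)))"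
      by (rule rep_mult[OF GLm_mult[OF T1(2) D] T1(1) Q _ trv_carrier r2 u(2)[OF m0 j(2) j0(2)]]) simp
    have r4: "Ad Q (trv m ?a ?b ?c * trv m ?b ?a ?d) \<approx> Ad Q (trv m ?b ?a (?d / 2) * mat_diag m y * trv m ?a ?b (?c / 2))"
      using peq_trans[OF peq_sym[OF r1[unfolded rel]] r3] by simp
    have "trv m ?a ?b ?c * trv m ?b ?a ?d \<approx> trv m ?b ?a (?d / 2) * mat_diag m y * trv m ?a ?b (?c / 2)"
      by (rule Ad_peq_cancel[OF Q _ _ r4]) auto
    then obtain k where k: "trv m ?a ?b ?c * trv m ?b ?a ?d = k \<cdot>\<^sub>m (trv m ?b ?a (?d / 2) * mat_diag m y * trv m ?a ?b (?c / 2))"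
      by (auto simp: peq_def)
    have "1 + ?d * ?c = k * y ?a"
      using arg_cong[OF k, of "\<lambda>A. A $$ (?a, ?a)"] ab
      by (simp add: trv_mult_left[of _ m] trv_mult_right[of _ m] mat_diag_mult_right[of _ m m] index_trv)
    moreover have "?c = k * (y ?a * ?c / 2)"
      using arg_cong[OF k, of "\<lambda>A. A $$ (?a, ?b)"] ab
      by (simp add: trv_mult_left[of _ m] trv_mult_right[of _ m] mat_diag_mult_right[of _ m m] index_trv)
    then have "k * y ?a = 2" using u(1)[of 0 j] j m0 by (simp add: field_simps)
    ultimately show ?thesis by (simp add: mult.commute)
  qed
  \<comment> \<open>For \<open>M\<close> to carry E_0j to c (0, j) times the matrix unit at (p 0, p
    j), one needs ga 0 = c (0, j) ga j; the value at 0 is normalized to 1.\<close>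
  define ga where "ga i = (if i = 0 then 1 else inverse (c (0, i)))" for i
  have ga0: "ga i \<noteq> 0" if "i < m" for i using u(1)[of 0 i] that by (auto simp: ga_def)
  define M where "M = mat m m (\<lambda>(a, i). if a = p i then ga i else 0)"
  define M' where "M' = mat m m (\<lambda>(i, a). if a = p i then inverse (ga i) else 0)"
  have Mc [simp]: "M \<in> carrier_mat m m" "M' \<in> carrier_mat m m" by (simp_all add: M_def M'_def)
  have "M' * M = 1\<^sub>m m"
  proof (rule eq_matI)
    fix i j assume "i < dim_row (1\<^sub>m m :: 'a mat)" "j < dim_col (1\<^sub>m m :: 'a mat)"
    then have ij: "i < m" "j < m" by auto
    have "(M' * M) $$ (i, j) = (\<Sum>a<m. if a = p i then (if i = j then 1 else 0) else 0)"
      unfolding index_mult_mat'[OF Mc(2,1) ij] by (rule sum.cong) (use ij ga0 pinj in \<open>auto simp: M_def M'_def\<close>)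
    then show "(M' * M) $$ (i, j) = 1\<^sub>m m $$ (i, j)" using pm[OF ij(1)] ij by simp
  qed (auto simp: M_def M'_def)
  from GLmI(2)[OF _ _ this] have M: "M \<in> GLm m" by simp
  have dM [simp]: "dim_row M = m" "dim_col M = m" by (simp_all add: M_def)
  have Mix: "M $$ (a, i) = (if a = p i then ga i else 0)" if "a < m" "i < m" for a i using that by (simp add: M_def)
  have P: "Q * M \<in> GLm m" using Q M by (rule GLm_mult)
  have AdP: "Ad (Q * M) A = Ad Q (Ad M A)" if "A \<in> carrier_mat m m" for A using Ad_comp[OF Q M that] .
  have up: "f (trv m 0 j x) \<approx> Ad (Q * M) (trv m 0 j x)" if j: "0 < j" "j < m" for j x
  proof -
    have "M * trv m 0 j x = trv m (p 0) (p j) (c (0, j) * x) * M"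
      using j u(1)[of 0 j] pm pinj by (intro eq_matI) (auto simp: trv_mult_left[of _ m] trv_mult_right[of _ m] Mix ga_def)
    then have "Ad M (trv m 0 j x) = trv m (p 0) (p j) (c (0, j) * x)" using Ad_eq_iff[OF M] by simp
    then show ?thesis using u(2)[of 0 j x] j by (simp add: AdP)
  qed
  have low: "f (trv m j 0 x) \<approx> Ad (Q * M) (trv m j 0 x)" if j: "0 < j" "j < m" for j x
  proof -
    have "c (j, 0) = inverse (c (0, j))" using c1[OF j] by (metis inverse_unique)
    then have "M * trv m j 0 x = trv m (p j) (p 0) (c (j, 0) * x) * M"
      using j pm pinj by (intro eq_matI) (auto simp: trv_mult_left[of _ m] trv_mult_right[of _ m] Mix ga_def)
    then have "Ad M (trv m j 0 x) = trv m (p j) (p 0) (c (j, 0) * x)" using Ad_eq_iff[OF M] by simp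
    then show ?thesis using u(2)[of j 0 x] j by (simp add: AdP)
  qed
  have dia: "f (mat_diag m s) \<approx> Ad (Q * M) (mat_diag m s)" if s: "\<And>k. k < m \<Longrightarrow> s k \<noteq> 0" for s
  proof -
    obtain y where y: "\<forall>k<m. y k \<noteq> 0" "f (mat_diag m s) \<approx> Ad Q (mat_diag m y)"
      "\<And>i j. i < m \<Longrightarrow> j < m \<Longrightarrow> y (p i) * s j = s i * y (p j)" using dg[of s] s by auto
    have m0: "0 < m" using m by simp
    define k where "k = y (p 0) / s 0"
    have k: "k \<noteq> 0" using y(1) s[OF m0] pm[OF m0] by (simp add: k_def)
    have ys: "y (p i) = k * s i" if "i < m" for i using y(3)[OF that m0] s[OF m0] by (simp add: k_def field_simps)
    have "mat_diag m y * M = M * (k \<cdot>\<^sub>m mat_diag m s)"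
      using ys by (intro eq_matI) (auto simp: mat_diag_mult_left[of _ m m] mat_diag_mult_right[of _ m m] Mix mult_smult_distrib[of _ m m _ m])
    then have "Ad M (k \<cdot>\<^sub>m mat_diag m s) = mat_diag m y" using Ad_eq_iff[OF M] by simp
    then have "Ad Q (mat_diag m y) = k \<cdot>\<^sub>m Ad (Q * M) (mat_diag m s)"
      by (simp add: AdP Ad_smult[of _ m, symmetric])
    then show ?thesis using y(2) k by (metis peqI peq_trans)
  qed
  show thesis
  proof (rule that[OF P])
    fix j x y and s :: "nat \<Rightarrow> 'a" assume j: "0 < j" "j < m" and "\<forall>k<m. s k \<noteq> 0"
    then have s: "\<And>k. k < m \<Longrightarrow> s k \<noteq> 0" by blast
    show "f (trv m j 0 x * mat_diag m s * trv m 0 j y) \<approx> Ad (Q * M) (trv m j 0 x * mat_diag m s * trv m 0 j y)"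
    proof -
      have m0: "0 < m" using m by simp
      have j0: "j \<noteq> 0" "0 \<noteq> j" using j by auto
      have D: "mat_diag m s \<in> GLm m" using mat_diag_GLm(1) s by blast
      have T1: "trv m 0 j x \<in> GLm m" "trv m j 0 x \<in> GLm m" for x :: 'a using T j m0 j0 by auto
      show ?thesis
        by (rule rep_mult[OF GLm_mult[OF T1(2) D] T1(1) P _ trv_carrier
            rep_mult[OF T1(2) D P trv_carrier mat_diag_dim low[OF j] dia[OF s]] up[OF j]]) auto
    qed
  qed
qed

text \<open>When the roots are exchanged, the inverse transpose exchanges the indices of every
  transvection back, changing the sign of c, and it inverts the diagonal matrices. So the exchanged
  case is the normal form of the dual map.\<close>

lemma (in pgl_hom) blocks_up_to_duality:
  obtains g P where "g = f \<or> g = (\<lambda>A. (minv (f A))\<^sup>T)" "P \<in> GLm m"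
    "\<And>j x s y. 0 < j \<Longrightarrow> j < m \<Longrightarrow> \<forall>k<m. s k \<noteq> 0 \<Longrightarrow>
      g (trv m j 0 x * mat_diag m s * trv m 0 j y) \<approx> Ad P (trv m j 0 x * mat_diag m s * trv m 0 j y)"
proof -
  let ?O = "offd {..<m}"
  obtain Q sg c where Q: "Q \<in> GLm m" and sg: "bij_betw sg ?O ?O" and c: "\<And>e. e \<in> ?O \<Longrightarrow> c e \<noteq> 0"
    and T: "\<And>i j x. (i, j) \<in> ?O \<Longrightarrow> f (trv m i j x) \<approx> Ad Q (trv m (fst (sg (i, j))) (snd (sg (i, j))) (c (i, j) * x))"
    and D: "\<And>s. \<forall>k<m. s k \<noteq> 0 \<Longrightarrow> \<exists>y. (\<forall>k<m. y k \<noteq> 0) \<and> f (mat_diag m s) \<approx> Ad Q (mat_diag m y) \<and>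
       (\<forall>i j. (i, j) \<in> ?O \<longrightarrow> y (fst (sg (i, j))) * s j = s i * y (snd (sg (i, j))))"
    by (rule root_structure, rule that)
  have "\<exists>y. (\<forall>k<m. y k \<noteq> 0) \<and> (\<forall>i j. (i, j) \<in> ?O \<longrightarrow> y (fst (sg (i, j))) * s j = s i * y (snd (sg (i, j))))"
    if "\<forall>k<m. s k \<noteq> 0" for s :: "nat \<Rightarrow> 'a" using D[OF that] by blast
  note star = this
  obtain p where p: "bij_betw p {..<m} {..<m}" and
    alt: "(\<forall>(i, j)\<in>?O. sg (i, j) = (p i, p j)) \<or> (\<forall>(i, j)\<in>?O. sg (i, j) = (p j, p i))"
    by (rule root_permutation[OF m2 sg star], assumption, rule that)
  have pm: "p i < m" if "i < m" for i using p that by (auto simp: bij_betw_def)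
  from alt show thesis
  proof
    assume A: "\<forall>(i, j)\<in>?O. sg (i, j) = (p i, p j)"
    have "normal_form m f Q p c"
      unfolding normal_form_def
    proof (intro conjI allI impI)
      fix i j x assume ij: "(i, j) \<in> ?O"
      show "c (i, j) \<noteq> 0" using c[OF ij] .
      show "f (trv m i j x) \<approx> Ad Q (trv m (p i) (p j) (c (i, j) * x))" using T[OF ij, of x] A ij by auto
    next
      fix s :: "nat \<Rightarrow> 'a" assume "\<forall>k<m. s k \<noteq> 0"
      then show "\<exists>y. (\<forall>k<m. y k \<noteq> 0) \<and> f (mat_diag m s) \<approx> Ad Q (mat_diag m y) \<and> (\<forall>i j. (i, j) \<in> ?O \<longrightarrow> y (p i) * s j = s i * y (p j))"
      proof -
        assume "\<forall>k<m. s k \<noteq> 0"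
        from D[OF this] obtain y where y: "\<forall>k<m. y k \<noteq> 0" "f (mat_diag m s) \<approx> Ad Q (mat_diag m y)"
          and ys: "\<And>i j. (i, j) \<in> ?O \<Longrightarrow> y (fst (sg (i, j))) * s j = s i * y (snd (sg (i, j)))" by blast
        have "y (p i) * s j = s i * y (p j)" if "(i, j) \<in> ?O" for i j
          using ys[OF that] bspec[OF A that] by simp
        then show ?thesis using y by blast
      qed
    qed (use Q p in auto)
    from normal_form_blocks[OF this m2 f_GLm f_mult] obtain P where P: "P \<in> GLm m"
      "\<And>j x s y. 0 < j \<Longrightarrow> j < m \<Longrightarrow> \<forall>k<m. s k \<noteq> 0 \<Longrightarrow>
        f (trv m j 0 x * mat_diag m s * trv m 0 j y) \<approx> Ad P (trv m j 0 x * mat_diag m s * trv m 0 j y)" by blast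
    show thesis by (rule that[OF _ P]) simp_all
  next
    assume A: "\<forall>(i, j)\<in>?O. sg (i, j) = (p j, p i)"
    define g where "g B = (minv (f B))\<^sup>T" for B
    let ?Q = "(minv Q)\<^sup>T"
    have Q': "?Q \<in> GLm m" using Q by (simp add: GLm_minv GLm_transpose)
    have fg: "g B \<approx> Ad ?Q ((minv C)\<^sup>T)" if "B \<in> GLm m" "C \<in> GLm m" "f B \<approx> Ad Q C" for B C
    proof -
      have "minv (f B) \<approx> minv (Ad Q C)" by (rule peq_minv[OF Ad_GLm[OF Q that(2)] that(3)])
      then have "g B \<approx> (minv (Ad Q C))\<^sup>T" unfolding g_def by (rule peq_transpose)
      then show ?thesis using that by (simp add: minv_Ad[OF Q that(2)] transpose_Ad[OF Q] GLm_carrier)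
    qed
    have "normal_form m g ?Q p (\<lambda>e. - c e)"
      unfolding normal_form_def
    proof (intro conjI allI impI)
      fix i j x assume ij: "(i, j) \<in> ?O"
      then have ij': "i < m" "j < m" "i \<noteq> j" by (auto simp: offd_iff)
      have pij: "p i \<noteq> p j" using p ij' by (auto simp: bij_betw_def inj_on_def)
      show "- c (i, j) \<noteq> 0" using c[OF ij] by simp
      have "f (trv m i j x) \<approx> Ad Q (trv m (p j) (p i) (c (i, j) * x))" using T[OF ij, of x] A ij by auto
      from fg[OF trv_inverse(1) trv_inverse(1) this] have "g (trv m i j x) \<approx> Ad ?Q ((minv (trv m (p j) (p i) (c (i, j) * x)))\<^sup>T)"
        using ij' pij pij[symmetric] pm[OF ij'(1)] pm[OF ij'(2)] by simp
      also have "(minv (trv m (p j) (p i) (c (i, j) * x)))\<^sup>T = trv m (p i) (p j) (- c (i, j) * x)"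
        using trv_inverse(2)[OF pij[symmetric] pm[OF ij'(2)] pm[OF ij'(1)], of "c (i, j) * x"] by (simp add: transpose_trv)
      finally show "g (trv m i j x) \<approx> Ad ?Q (trv m (p i) (p j) (- c (i, j) * x))" .
    next
      fix s :: "nat \<Rightarrow> 'a" assume s: "\<forall>k<m. s k \<noteq> 0"
      then obtain y where y: "\<And>k. k < m \<Longrightarrow> y k \<noteq> 0" "f (mat_diag m s) \<approx> Ad Q (mat_diag m y)"
        and ys0: "\<And>i j. (i, j) \<in> ?O \<Longrightarrow> y (fst (sg (i, j))) * s j = s i * y (snd (sg (i, j)))" using D[of s] by blast
      have ys: "y (p j) * s j = s i * y (p i)" if "(i, j) \<in> ?O" for i j
        using ys0[OF that] bspec[OF A that] by simp
      show "\<exists>y. (\<forall>k<m. y k \<noteq> 0) \<and> g (mat_diag m s) \<approx> Ad ?Q (mat_diag m y) \<and> (\<forall>i j. (i, j) \<in> ?O \<longrightarrow> y (p i) * s j = s i * y (p j))"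
      proof (intro exI[of _ "\<lambda>i. inverse (y i)"] conjI allI impI)
        show "inverse (y k) \<noteq> 0" if "k < m" for k using y(1)[OF that] by simp
        have "g (mat_diag m s) \<approx> Ad ?Q ((minv (mat_diag m y))\<^sup>T)"
          by (rule fg[OF mat_diag_GLm(1) mat_diag_GLm(1) y(2)]) (use s y in auto)
        also have "(minv (mat_diag m y))\<^sup>T = mat_diag m (\<lambda>i. inverse (y i))"
          using mat_diag_GLm(2)[of m y] y(1) by (simp add: transpose_mat_diag)
        finally show "g (mat_diag m s) \<approx> Ad ?Q (mat_diag m (\<lambda>i. inverse (y i)))" .
        fix i j assume ij: "(i, j) \<in> ?O"
        then have "y (p i) \<noteq> 0" "y (p j) \<noteq> 0" using y(1) pm by (auto simp: offd_iff)
        then show "inverse (y (p i)) * s j = s i * inverse (y (p j))" using ys[OF ij] by (simp add: field_simps)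
      qed
    qed (use Q' p in auto)
    note nf = this
    have gG: "g B \<in> GLm m" if "B \<in> GLm m" for B using f_GLm[OF that] by (simp add: g_def GLm_minv GLm_transpose)
    have gm: "g (B * C) \<approx> g B * g C" if "B \<in> GLm m" "C \<in> GLm m" for B C
    proof -
      have FG: "f B \<in> GLm m" "f C \<in> GLm m" using f_GLm that by auto
      have "minv (f (B * C)) \<approx> minv (f B * f C)" by (rule peq_minv[OF GLm_mult[OF FG] f_mult[OF that]])
      then have "g (B * C) \<approx> (minv (f B * f C))\<^sup>T" unfolding g_def by (rule peq_transpose)
      also have "(minv (f B * f C))\<^sup>T = g B * g C" using FG
        by (simp add: minv_mult[of _ m] g_def transpose_mult[of _ m m _ m] GLm_carrier)
      finally show ?thesis .
    qed
    from normal_form_blocks[OF nf m2 gG gm] obtain P where P: "P \<in> GLm m"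
      "\<And>j x s y. 0 < j \<Longrightarrow> j < m \<Longrightarrow> \<forall>k<m. s k \<noteq> 0 \<Longrightarrow>
        g (trv m j 0 x * mat_diag m s * trv m 0 j y) \<approx> Ad P (trv m j 0 x * mat_diag m s * trv m 0 j y)" by blast
    have "g = (\<lambda>A. (minv (f A))\<^sup>T)" by (rule ext) (simp add: g_def)
    then show thesis by (intro that[OF _ P]) simp_all
  qed
qed

section \<open>Rationality over quadratic extensions\<close>

text \<open>A quadratic extension in coordinates, with a generator whose square lies in
  \<open>F\<close>. \<open>cj\<close> is constrained on \<open>K\<close> only, so elements must be
  known to lie in \<open>K\<close> before it can be computed with.\<close>

locale quad =
  fixes F K :: "'a::field_char_0 set" and dl :: 'a and cj :: "'a \<Rightarrow> 'a"
  assumes F01 [simp]: "0 \<in> F" "1 \<in> F"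
    and F_add [simp]: "x \<in> F \<Longrightarrow> y \<in> F \<Longrightarrow> x + y \<in> F"
    and F_mult [simp]: "x \<in> F \<Longrightarrow> y \<in> F \<Longrightarrow> x * y \<in> F"
    and F_uminus [simp]: "x \<in> F \<Longrightarrow> - x \<in> F"
    and F_inverse [simp]: "x \<in> F \<Longrightarrow> inverse x \<in> F"
    and dl: "dl \<notin> F" "dl * dl \<in> F"
    and K_eq: "K = {x + y * dl | x y. x \<in> F \<and> y \<in> F}"
    and cj_eq: "x \<in> F \<Longrightarrow> y \<in> F \<Longrightarrow> cj (x + y * dl) = x - y * dl"
begin

lemma F_minus [simp]: "x \<in> F \<Longrightarrow> y \<in> F \<Longrightarrow> x - y \<in> F"
  using F_add[of x "- y"] by simp

lemma F_divide [simp]: "x \<in> F \<Longrightarrow> y \<in> F \<Longrightarrow> x / y \<in> F"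
  by (simp add: divide_inverse)

lemma F_of_nat [simp]: "of_nat n \<in> F"
  by (induction n) auto

lemma F_numeral [simp]: "numeral n \<in> F"
  using F_of_nat[of "numeral n"] by simp

lemma F_sum: "(\<And>i. i \<in> A \<Longrightarrow> g i \<in> F) \<Longrightarrow> sum g A \<in> F"
  by (induction A rule: infinite_finite_induct) auto

lemma KE: assumes "x \<in> K" obtains a b where "a \<in> F" "b \<in> F" "x = a + b * dl"
  using assms by (auto simp: K_eq)

lemma KI: "a \<in> F \<Longrightarrow> b \<in> F \<Longrightarrow> a + b * dl \<in> K"
  by (auto simp: K_eq)

lemma F_K: "x \<in> F \<Longrightarrow> x \<in> K"
  using KI[of x 0] by simp

lemma dl_K: "dl \<in> K"
  using KI[of 0 1] by simp

lemma K_add [simp]: "x \<in> K \<Longrightarrow> y \<in> K \<Longrightarrow> x + y \<in> K"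
proof (elim KE)
  fix a b c d assume F: "a \<in> F" "b \<in> F" "c \<in> F" "d \<in> F" and e: "x = a + b * dl" "y = c + d * dl"
  have "x + y = (a + c) + (b + d) * dl" by (simp add: e algebra_simps)
  then show "x + y \<in> K" using KI F by simp
qed

lemma mult_form: "(a + b * dl) * (c + d * dl) = (a * c + b * d * (dl * dl)) + (a * d + b * c) * dl"
  by (simp add: algebra_simps)

lemma K_mult [simp]: "x \<in> K \<Longrightarrow> y \<in> K \<Longrightarrow> x * y \<in> K"
  by (elim KE) (simp only: mult_form, intro KI F_add F_mult dl(2))

lemma K_uminus [simp]: "x \<in> K \<Longrightarrow> - x \<in> K"
  using K_mult[of "- 1" x] F_K[of "- 1"] by simp

lemma K_minus [simp]: "x \<in> K \<Longrightarrow> y \<in> K \<Longrightarrow> x - y \<in> K"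
  using K_add[of x "- y"] by simp

lemma cj_F: "x \<in> F \<Longrightarrow> cj x = x"
  using cj_eq[of x 0] by simp

lemma cj_K [simp]: "x \<in> K \<Longrightarrow> cj x \<in> K"
  by (elim KE) (simp add: cj_eq, metis KI F_uminus minus_mult_left uminus_add_conv_diff add.commute)

lemma cj_dl: "cj dl = - dl"
  using cj_eq[of 0 1] by simp

lemma cj_cj: "x \<in> K \<Longrightarrow> cj (cj x) = x"
proof (elim KE)
  fix a b assume F: "a \<in> F" "b \<in> F" and e: "x = a + b * dl"
  have "cj x = a + (- b) * dl" using F by (simp add: e cj_eq)
  then show "cj (cj x) = x" using F cj_eq[of a "- b"] by (simp add: e)
qed

lemma cj_add: "x \<in> K \<Longrightarrow> y \<in> K \<Longrightarrow> cj (x + y) = cj x + cj y"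
proof (elim KE)
  fix a b c d assume F: "a \<in> F" "b \<in> F" "c \<in> F" "d \<in> F" and e: "x = a + b * dl" "y = c + d * dl"
  have "x + y = (a + c) + (b + d) * dl" by (simp add: e algebra_simps)
  then have "cj (x + y) = (a + c) - (b + d) * dl" using F by (simp only: cj_eq F_add)
  then show "cj (x + y) = cj x + cj y" using F by (simp add: e cj_eq algebra_simps)
qed

lemma cj_mult: "x \<in> K \<Longrightarrow> y \<in> K \<Longrightarrow> cj (x * y) = cj x * cj y"
proof (elim KE)
  fix a b c d assume F: "a \<in> F" "b \<in> F" "c \<in> F" "d \<in> F" and e: "x = a + b * dl" "y = c + d * dl"
  have "cj (x * y) = (a * c + b * d * (dl * dl)) - (a * d + b * c) * dl"
    unfolding e mult_form by (intro cj_eq F_add F_mult F dl(2))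
  then show "cj (x * y) = cj x * cj y" using F by (simp add: e cj_eq algebra_simps)
qed

lemma cj_uminus: "x \<in> K \<Longrightarrow> cj (- x) = - cj x"
  using cj_mult[of "- 1" x] F_K[of "- 1"] cj_F[of "- 1"] by simp

lemma cj_minus: "x \<in> K \<Longrightarrow> y \<in> K \<Longrightarrow> cj (x - y) = cj x - cj y"
  using cj_add[of x "- y"] by (simp add: cj_uminus)

lemma K_sum: "(\<And>i. i \<in> A \<Longrightarrow> g i \<in> K) \<Longrightarrow> sum g A \<in> K"
  by (induction A rule: infinite_finite_induct) (auto simp: F_K)

lemma cj_sum: "(\<And>i. i \<in> A \<Longrightarrow> g i \<in> K) \<Longrightarrow> cj (sum g A) = (\<Sum>i\<in>A. cj (g i))"
  by (induction A rule: infinite_finite_induct) (auto simp: cj_F cj_add K_sum)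

lemma cj_fixed: assumes "x \<in> K" "cj x = x" shows "x \<in> F"
proof -
  obtain a b where F: "a \<in> F" "b \<in> F" and e: "x = a + b * dl" using assms KE by metis
  have dl0: "dl \<noteq> 0" using dl by auto
  have "a - b * dl = a + b * dl" using assms(2) F by (simp add: e cj_eq)
  then have "2 * (b * dl) = 0" by (simp add: algebra_simps)
  then show ?thesis using dl0 F e by auto
qed

lemma norm_F: assumes "x \<in> K" shows "x * cj x \<in> F"
  by (rule cj_fixed) (use assms in \<open>simp_all add: cj_mult cj_cj mult.commute\<close>)

lemma K_inverse [simp]: assumes "x \<in> K" shows "inverse x \<in> K"
proof (cases "x = 0")
  case False
  have "cj x \<noteq> 0" using False cj_cj[OF assms] cj_F[of 0] by auto
  then have "inverse x = cj x * inverse (x * cj x)" using False by (simp add: field_simps)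
  then show ?thesis using assms norm_F[OF assms] by (metis K_mult F_K F_inverse cj_K)
qed (simp add: F_K)

lemma K_divide [simp]: "x \<in> K \<Longrightarrow> y \<in> K \<Longrightarrow> x / y \<in> K"
  by (simp add: divide_inverse)

lemma generated_by: assumes "z \<in> K" "z \<notin> F" "x \<in> K" shows "\<exists>a\<in>F. \<exists>b\<in>F. x = a + b * z"
proof -
  obtain a b where F: "a \<in> F" "b \<in> F" and e: "z = a + b * dl" using assms KE by metis
  obtain c d where F': "c \<in> F" "d \<in> F" and e': "x = c + d * dl" using assms KE by metis
  have b: "b \<noteq> 0" using assms(2) F e by auto
  have "x = (c - d / b * a) + (d / b) * z" using b by (simp add: e e' field_simps)
  then show ?thesis using F F' by (metis F_divide F_minus F_mult)
qed

text \<open>The quotient of 1 + dl by its conjugate: an element of norm 1 that generates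
  \<open>K\<close> over \<open>F\<close>. It serves as the parameter of the unitary
  quasi-reflections.\<close>

definition zz :: 'a where "zz = (1 + dl) / (1 - dl)"

lemma zz: "zz \<in> K" "cj zz * zz = 1" "zz \<notin> F"
proof -
  have "dl \<noteq> 1" "dl \<noteq> - 1" using dl(1) F01(2) F_uminus by metis+
  then have n: "1 - dl \<noteq> 0" "1 + dl \<noteq> 0" by (auto simp: add_eq_0_iff)
  have k: "1 + dl \<in> K" "1 - dl \<in> K" using dl_K F_K[of 1] by auto
  show "zz \<in> K" using k by (simp add: zz_def)
  have "zz * (1 - dl) = 1 + dl" using n by (simp add: zz_def)
  then have "cj (zz * (1 - dl)) = cj (1 + dl)" by simp
  then have "cj zz * (1 + dl) = 1 - dl"
    using k \<open>zz \<in> K\<close> dl_K F_K[of 1] by (simp add: cj_mult cj_add cj_minus cj_dl cj_F)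
  then have "cj zz = (1 - dl) / (1 + dl)" using n by (simp add: field_simps)
  then show "cj zz * zz = 1" using n by (simp add: zz_def)
  show "zz \<notin> F"
  proof
    assume z: "zz \<in> F"
    have "dl * (zz + 1) = zz - 1" using \<open>zz * (1 - dl) = 1 + dl\<close> by (simp add: algebra_simps)
    moreover have "zz + 1 \<noteq> 0"
    proof
      assume "zz + 1 = 0"
      then have "zz = - 1" by (simp add: add_eq_0_iff2)
      then show False using \<open>zz * (1 - dl) = 1 + dl\<close> by (simp add: algebra_simps)
    qed
    ultimately have "dl = (zz - 1) / (zz + 1)" by (simp add: field_simps)
    moreover have "(zz - 1) / (zz + 1) \<in> F" using z by (intro F_divide F_minus F_add F01)
    ultimately have "dl \<in> F" by simp
    then show False using dl by simp
  qed
qed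

end

section \<open>Unitary matrices, Hermitian projections and quasi-reflections\<close>

definition mat_over :: "'a set \<Rightarrow> nat \<Rightarrow> 'a mat set" where
  "mat_over K m = {A \<in> carrier_mat m m. \<forall>i<m. \<forall>j<m. A $$ (i, j) \<in> K}"

text \<open>For invertible \<open>Y\<close> and nonzero b_i, the unique B with
  \<open>Y\<^sup>T * mat_diag m b * B = mat_diag m b\<close>. Over Omega it takes the place of the
  conjugate of \<open>Y\<close>.\<close>

definition hthe :: "nat \<Rightarrow> (nat \<Rightarrow> 'a::field) \<Rightarrow> 'a mat \<Rightarrow> 'a mat" where
  "hthe m b Y = mat_diag m (\<lambda>i. inverse (b i)) * (minv Y)\<^sup>T * mat_diag m b"

text \<open>The l-th summand is Y_ll times the entry (k, j) of the inverse. The contraction recovers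
  from \<open>Ad Y\<close> the product of the trace and the inverse of \<open>Y\<close>, which does
  not change when \<open>Y\<close> is rescaled.\<close>

lemma Ad_matunit_contraction:
  assumes Y: "Y \<in> GLm m" and kj: "k < m" "j < m"
  shows "(\<Sum>l<m. Ad Y (matunit m l k) $$ (l, j)) = mtrace Y * minv Y $$ (k, j)"
proof -
  have [simp]: "Y \<in> carrier_mat m m" using Y GLm_carrier by auto
  have "Ad Y (matunit m l k) $$ (l, j) = Y $$ (l, l) * minv Y $$ (k, j)" if "l < m" for l
  proof -
    have "Ad Y (matunit m l k) = Y * (matunit m l k * minv Y)"
      by (simp add: Ad_def assoc_mult_mat[of _ m m _ m _ m])
    also have "\<dots> $$ (l, j) = (\<Sum>i<m. Y $$ (l, i) * (matunit m l k * minv Y) $$ (i, j))"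
      by (rule index_mult_mat'[of _ m m _ m]) (use that kj in auto)
    also have "\<dots> = (\<Sum>i<m. if i = l then Y $$ (l, l) * minv Y $$ (k, j) else 0)"
      by (rule sum.cong) (use that kj in \<open>auto simp: matunit_mult_left[of _ m m]\<close>)
    finally show ?thesis using that by simp
  qed
  then show ?thesis using carrier_matD[OF \<open>Y \<in> carrier_mat m m\<close>] by (simp add: mtrace_def sum_distrib_right)
qed

lemma hthe_GLm: assumes "Y \<in> GLm m" "\<And>k. k < m \<Longrightarrow> b k \<noteq> 0"
  shows "hthe m b Y \<in> GLm m" "minv (hthe m b Y) = mat_diag m (\<lambda>i. inverse (b i)) * Y\<^sup>T * mat_diag m b"
proof -
  have D: "mat_diag m b \<in> GLm m" "mat_diag m (\<lambda>i. inverse (b i)) \<in> GLm m"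
    using mat_diag_GLm(1)[of m b] mat_diag_GLm(1)[of m "\<lambda>i. inverse (b i)"] assms(2) by auto
  have mD: "minv (mat_diag m b) = mat_diag m (\<lambda>i. inverse (b i))" using mat_diag_GLm(2)[of m b] assms(2) by auto
  have mD': "minv (mat_diag m (\<lambda>i. inverse (b i))) = mat_diag m b"
    using minv_minv[OF D(1)] mD by simp
  have T: "(minv Y)\<^sup>T \<in> GLm m" using assms by (simp add: GLm_minv GLm_transpose)
  have mT: "minv ((minv Y)\<^sup>T) = Y\<^sup>T" by (simp add: minv_transpose[OF GLm_minv[OF assms(1)]] minv_minv[OF assms(1)])
  show "hthe m b Y \<in> GLm m" using D T by (simp add: hthe_def GLm_mult)
  show "minv (hthe m b Y) = mat_diag m (\<lambda>i. inverse (b i)) * Y\<^sup>T * mat_diag m b"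
    unfolding hthe_def minv_mult[OF GLm_mult[OF D(2) T] D(1)] minv_mult[OF D(2) T] mD mD' mT
    using assms(1) by (simp add: assoc_mult_mat[of _ m m _ m _ m] GLm_carrier)
qed

lemma index_diag_conj: assumes "A \<in> carrier_mat m m" "i < m" "j < m"
  shows "(mat_diag m (\<lambda>i. inverse (b i)) * A\<^sup>T * mat_diag m b) $$ (i, j) = inverse (b i) * A $$ (j, i) * (b j :: 'a::field)"
  using assms by (simp add: mat_diag_mult_left[of _ m m] mat_diag_mult_right[of _ m m])

lemma mtrace_hthe: assumes "Y \<in> GLm m" "\<And>k. k < m \<Longrightarrow> b k \<noteq> 0"
  shows "mtrace (hthe m b Y) = mtrace (minv Y)"
proof -
  have c: "minv Y \<in> carrier_mat m m" by (rule minv_carrier[OF GLm_carrier[OF assms(1)]])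
  have "hthe m b Y $$ (i, i) = minv Y $$ (i, i)" if "i < m" for i
    using assms(2)[OF that] that by (simp add: hthe_def index_diag_conj[OF c])
  moreover have "dim_row (hthe m b Y) = m" by (simp add: hthe_def mat_diag_def)
  ultimately show ?thesis using carrier_matD[OF c] by (simp add: mtrace_def)
qed

text \<open>The Hermitian projection onto the line spanned by \<open>v = u\<^sub>0 + c u\<^sub>j\<close>, for the form \<open>diag a\<close>.\<close>

definition proj :: "nat \<Rightarrow> (nat \<Rightarrow> 'a::field) \<Rightarrow> nat \<Rightarrow> 'a \<Rightarrow> 'a mat" where
  "proj m a j c = mat m m (\<lambda>(i, k). (if i = 0 then 1 else if i = j then c else 0) *
     (if k = 0 then 1 else if k = j then c else 0) * a k / (a 0 + c * c * a j))"

lemma proj_carrier [simp]: "proj m a j c \<in> carrier_mat m m"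
  by (simp add: proj_def)

lemma index_proj: "i < m \<Longrightarrow> k < m \<Longrightarrow> proj m a j c $$ (i, k) = (if i = 0 then 1 else if i = j then c else 0) *
     (if k = 0 then 1 else if k = j then c else 0) * a k / (a 0 + c * c * a j)"
  by (simp add: proj_def)

lemma sum_two: assumes "0 < j" "j < (m::nat)" "\<And>i. i < m \<Longrightarrow> i \<noteq> 0 \<Longrightarrow> i \<noteq> j \<Longrightarrow> g i = 0"
  shows "(\<Sum>i<m. g i) = g 0 + (g j :: 'a::comm_monoid_add)"
proof -
  have "(\<Sum>i<m. g i) = (\<Sum>i\<in>{0, j}. g i)" by (rule sum.mono_neutral_right) (use assms in auto)
  then show ?thesis using assms by simp
qed

lemma proj_idem: assumes "0 < j" "j < m" "a 0 + c * c * a j \<noteq> 0"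
  shows "proj m a j c * proj m a j c = proj m a j c" "mtrace (proj m a j c) = 1"
proof -
  let ?v = "\<lambda>i. if i = 0 then 1 else if i = j then c else 0" and ?h = "a 0 + c * c * a j"
  have s: "(\<Sum>l<m. ?v l * ?v l * a l / ?h) = 1"
    by (subst sum_two[OF assms(1,2)]) (use assms in \<open>auto simp: add_divide_distrib[symmetric]\<close>)
  show "proj m a j c * proj m a j c = proj m a j c"
  proof (rule eq_matI)
    fix i k assume "i < dim_row (proj m a j c)" "k < dim_col (proj m a j c)"
    then have ik: "i < m" "k < m" by (auto simp: proj_def)
    have "(proj m a j c * proj m a j c) $$ (i, k) = (\<Sum>l<m. (?v l * ?v l * a l / ?h) * (?v i * ?v k * a k / ?h))"
      unfolding index_mult_mat'[OF proj_carrier proj_carrier ik]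
      by (rule sum.cong) (use ik in \<open>simp_all add: index_proj\<close>)
    also have "\<dots> = ?v i * ?v k * a k / ?h" unfolding sum_distrib_right[symmetric] s by simp
    finally show "(proj m a j c * proj m a j c) $$ (i, k) = proj m a j c $$ (i, k)" using ik by (simp add: index_proj)
  qed (auto simp: proj_def)
  show "mtrace (proj m a j c) = 1"
    using s by (simp add: mtrace_def index_proj) (simp add: proj_def index_proj)
qed

lemma proj_selfadjoint: assumes "i < m" "k < m"
  shows "proj m a j c $$ (k, i) * a k = a i * proj m a j c $$ (i, k)"
  using assms by (simp add: index_proj)

text \<open>For an idempotent \<open>e\<close> this acts by \<open>z\<close> on the image of
  \<open>e\<close> and by 1 on its kernel; hence it is multiplicative in \<open>z\<close>.\<close>

definition qrefl :: "nat \<Rightarrow> 'a::field \<Rightarrow> 'a mat \<Rightarrow> 'a mat" where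
  "qrefl m z e = 1\<^sub>m m + (z - 1) \<cdot>\<^sub>m e"

lemma qrefl_carrier [simp]: "e \<in> carrier_mat m m \<Longrightarrow> qrefl m z e \<in> carrier_mat m m"
  by (simp add: qrefl_def)

lemma qrefl_mult: assumes e: "e \<in> carrier_mat m m" "e * e = e"
  shows "qrefl m z e * qrefl m w e = qrefl m (z * w) e"
proof -
  have "qrefl m z e * qrefl m w e = 1\<^sub>m m + ((z - 1) \<cdot>\<^sub>m e) + ((w - 1) \<cdot>\<^sub>m e + ((z - 1) * (w - 1)) \<cdot>\<^sub>m e)"
    using e by (simp add: qrefl_def mult_add_distrib_mat[of _ m m _ m] add_mult_distrib_mat[of _ m m _ _ m] mult_smult_distrib[of _ m m _ m]
        mult_smult_assoc_mat[of _ m m _ m] left_mult_one_mat[of _ m m] right_mult_one_mat[of _ m m] smult_smult_sq mult.commute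
        add_smult_distrib_left_mat[of _ m m])
  also have "\<dots> = qrefl m (z * w) e" using carrier_matD[OF e(1)] by (intro eq_matI) (auto simp: qrefl_def algebra_simps)
  finally show ?thesis .
qed

lemma qrefl_inverse: assumes e: "e \<in> carrier_mat m m" "e * e = e" and "z * w = 1"
  shows "qrefl m z e \<in> GLm m" "minv (qrefl m z e) = qrefl m w e"
proof -
  have "qrefl m z e * qrefl m w e = 1\<^sub>m m"
    using e(1) by (simp add: qrefl_mult[OF e] assms(3)) (auto intro!: eq_matI simp: qrefl_def)
  from GLmI(1)[OF _ _ this] minv_unique(1)[OF _ _ this] e
  show "qrefl m z e \<in> GLm m" "minv (qrefl m z e) = qrefl m w e" by auto
qed

lemma mtrace_qrefl: "e \<in> carrier_mat m m \<Longrightarrow> mtrace (qrefl m z e) = of_nat m + (z - 1) * mtrace e"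
  by (simp add: qrefl_def mtrace_add[of _ m] mtrace_smult[of _ m] mtrace_one)

lemma Ad_qrefl: assumes "P \<in> GLm m" "e \<in> carrier_mat m m" shows "Ad P (qrefl m z e) = qrefl m z (Ad P e)"
proof -
  have [simp]: "P \<in> carrier_mat m m" using assms GLm_carrier by auto
  have "Ad P (1\<^sub>m m) = 1\<^sub>m m" by (simp add: Ad_def right_mult_one_mat[of _ m m] minv_right[OF assms(1)])
  then show ?thesis using assms(2) by (simp add: qrefl_def Ad_add[of _ m] Ad_smult[of _ m])
qed

text \<open>Outside the coordinates 0 and j the quasi-reflection is the identity, so this is the
  factorization lower times diagonal times upper of a 2 x 2 matrix of determinant z. The hypothesis
  \<open>p\<close> says that its pivot is not 0.\<close>

lemma qrefl_proj_block:
  assumes j: "0 < j" "j < m" and h: "a 0 + c * c * a j \<noteq> 0" and z: "z \<noteq> 0"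
    and p: "1 + (z - 1) * (a 0 / (a 0 + c * c * a j)) \<noteq> (0::'a::field)"
  shows "\<exists>x s y. (\<forall>k<m. s k \<noteq> 0) \<and> qrefl m z (proj m a j c) = trv m j 0 x * mat_diag m s * trv m 0 j y"
proof -
  let ?h = "a 0 + c * c * a j"
  let ?p = "1 + (z - 1) * (a 0 / ?h)" and ?q = "(z - 1) * (c * a j / ?h)" and ?r = "(z - 1) * (c * a 0 / ?h)"
  let ?s = "\<lambda>k. if k = 0 then ?p else if k = j then z / ?p else 1"
  \<comment> \<open>The entry at (j, j): the contribution of the off-diagonal factors plus the
    second pivot, which is the determinant z divided by the first.\<close>
  have det: "?r / ?p * ?q + z / ?p = 1 + (z - 1) * (c * c * a j / ?h)"
  proof -
    have sum1: "a 0 / ?h + c * c * a j / ?h = 1" using h by (simp add: add_divide_distrib[symmetric])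
    define u where "u = a 0 / ?h"
    define w where "w = c * c * a j / ?h"
    have uw: "u = 1 - w" using sum1 by (simp add: u_def w_def eq_diff_eq)
    have rq: "?r * ?q = (z - 1) * (z - 1) * (u * w)" using h by (simp add: u_def w_def)
    have "?r * ?q + z = ?p * (1 + (z - 1) * w)" unfolding rq u_def[symmetric] uw by (simp add: algebra_simps)
    then have "(?r * ?q + z) / ?p = 1 + (z - 1) * w" by (simp only: nonzero_mult_div_cancel_left[OF p])
    then show ?thesis by (simp only: add_divide_distrib times_divide_eq_left w_def)
  qed
  have "qrefl m z (proj m a j c) = trv m j 0 (?r / ?p) * mat_diag m ?s * trv m 0 j (?q / ?p)"
  proof (rule eq_matI)
    fix i k assume "i < dim_row (trv m j 0 (?r / ?p) * mat_diag m ?s * trv m 0 j (?q / ?p))"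
      "k < dim_col (trv m j 0 (?r / ?p) * mat_diag m ?s * trv m 0 j (?q / ?p))"
    then have ik: "i < m" "k < m" by auto
    have m0: "0 < m" using j by simp
    have R: "(trv m j 0 (?r / ?p) * mat_diag m ?s * trv m 0 j (?q / ?p)) $$ (i, k) =
       trv m j 0 (?r / ?p) $$ (i, k) * ?s k + (if k = j then ?q / ?p * (trv m j 0 (?r / ?p) $$ (i, 0) * ?p) else 0)"
      using ik m0 by (simp add: trv_mult_right[of _ m] mat_diag_mult_right[of _ m m])
    have L: "qrefl m z (proj m a j c) $$ (i, k) = (if i = k then 1 else 0) + (z - 1) * proj m a j c $$ (i, k)"
      using ik carrier_matD[OF proj_carrier[of m a j c]] by (simp add: qrefl_def)
    define pp where "pp = ?p"
    define q where "q = ?q"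
    define r where "r = ?r"
    define s where "s = 1 + (z - 1) * (c * c * a j / ?h)"
    have pp: "pp \<noteq> 0" using p by (simp add: pp_def)
    have det': "r / pp * q + z / pp = s" using det by (simp only: pp_def q_def r_def s_def)
    have L': "(if i = k then 1 else 0) + (z - 1) * proj m a j c $$ (i, k) =
      (if i = 0 then if k = 0 then pp else if k = j then q else 0
       else if i = j then if k = 0 then r else if k = j then s else 0
       else if i = k then 1 else 0)"
      using j(1) by (simp add: index_proj[OF ik] pp_def q_def r_def s_def)
    have R': "trv m j 0 (r / pp) $$ (i, k) * (if k = 0 then pp else if k = j then z / pp else 1) +
      (if k = j then q / pp * (trv m j 0 (r / pp) $$ (i, 0) * pp) else 0) =
      (if i = 0 then if k = 0 then pp else if k = j then q else 0
       else if i = j then if k = 0 then r else if k = j then r / pp * q + z / pp else 0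
       else if i = k then 1 else 0)"
      using j pp ik m0 by (auto simp: index_trv)
    show "qrefl m z (proj m a j c) $$ (i, k) = (trv m j 0 (?r / ?p) * mat_diag m ?s * trv m 0 j (?q / ?p)) $$ (i, k)"
      using trans[OF L trans[OF L' trans[OF sym[OF R'[unfolded det']] sym[OF R[folded pp_def q_def r_def]]]]]
      by (simp only: pp_def q_def r_def)
  qed (auto simp: qrefl_def proj_def)
  moreover have "\<forall>k<m. ?s k \<noteq> 0" using p z by auto
  ultimately show ?thesis by (intro exI[of _ "?r / ?p"] exI[of _ ?s] exI[of _ "?q / ?p"] conjI)
qed

text \<open>The projection is self-adjoint for diag(a), so the adjoint of the quasi-reflection is
  the one with parameter cj z, and the two parameters multiply to 1.\<close>

lemma qrefl_proj_unitary:
  fixes cj :: "'a::field \<Rightarrow> 'a"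
  assumes j: "0 < j" "j < m" and h: "a 0 + c * c * a j \<noteq> 0"
    and z: "cj z * z = 1" and cjq: "map_mat cj (qrefl m z (proj m a j c)) = qrefl m (cj z) (proj m a j c)"
  shows "(qrefl m z (proj m a j c))\<^sup>T * mat_diag m a * map_mat cj (qrefl m z (proj m a j c)) = mat_diag m a"
proof -
  let ?e = "proj m a j c" and ?D = "mat_diag m a"
  have [simp]: "?e\<^sup>T \<in> carrier_mat m m" by simp
  have sa: "?e\<^sup>T * ?D = ?D * ?e"
    using carrier_matD[OF proj_carrier[of m a j c]] by (intro eq_matI) (auto simp: mat_diag_mult_left[of _ m m] mat_diag_mult_right[of _ m m] proj_selfadjoint)
  have "(qrefl m z ?e)\<^sup>T = qrefl m z (?e\<^sup>T)"
    using carrier_matD[OF proj_carrier[of m a j c]] by (intro eq_matI) (auto simp: qrefl_def)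
  moreover have "qrefl m z (?e\<^sup>T) * ?D = ?D * qrefl m z ?e"
    by (simp add: qrefl_def mult_add_distrib_mat[of _ m m _ m] add_mult_distrib_mat[of _ m m _ _ m] mult_smult_distrib[of _ m m _ m]
        mult_smult_assoc_mat[of _ m m _ m] left_mult_one_mat[of _ m m] right_mult_one_mat[of _ m m] sa)
  ultimately have "(qrefl m z ?e)\<^sup>T * ?D * map_mat cj (qrefl m z ?e) = ?D * (qrefl m z ?e * qrefl m (cj z) ?e)"
    by (simp add: cjq assoc_mult_mat[of _ m m _ m _ m])
  also have "\<dots> = ?D * qrefl m 1 ?e" using qrefl_mult[OF proj_carrier proj_idem(1)[OF j h], of z "cj z"] z by (simp add: mult.commute)
  also have "qrefl m 1 ?e = 1\<^sub>m m" using carrier_matD[OF proj_carrier[of m a j c]] by (intro eq_matI) (auto simp: qrefl_def)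
  finally show ?thesis by (simp add: right_mult_one_mat[of _ m m])
qed

text \<open>
  Over \<open>\<Omega>\<close>, an element of the unitary group of \<open>diag b\<close> is a pair \<open>(Y, hthe m b Y)\<close> and an
  endomorphism defined over \<open>F\<close> is a pair \<open>(E, map_mat cj E)\<close> with \<open>E\<close> over \<open>K\<close>. Conjugation by the
  former preserves the latter when \<open>Y\<close> represents an \<open>F\<close>-rational point of the adjoint group.
\<close>

definition rational_pair :: "nat \<Rightarrow> 'a set \<Rightarrow> ('a \<Rightarrow> 'a) \<Rightarrow> (nat \<Rightarrow> 'a) \<Rightarrow> 'a::field mat \<Rightarrow> bool" where
  "rational_pair m K cj b Y \<longleftrightarrow> (\<forall>E\<in>mat_over K m. Ad Y E \<in> mat_over K m \<and>
     Ad (hthe m b Y) (map_mat cj E) = map_mat cj (Ad Y E))"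

section \<open>What rationality says about a quasi-reflection\<close>

context quad
begin

text \<open>The contraction of \<open>Ad_matunit_contraction\<close> is applied to both components
  of the pair. Matrix units are fixed by \<open>cj\<close>, so the second contraction is the
  conjugate of the first.\<close>

lemma rational_pair_entry:
  assumes Y: "rational_pair m K cj b Y" "Y \<in> GLm m" and b: "\<And>k. k < m \<Longrightarrow> b k \<noteq> 0"
    and kj: "k < m" "j < m"
  shows "mtrace Y * minv Y $$ (k, j) \<in> K"
    "cj (mtrace Y * minv Y $$ (k, j)) = mtrace (minv Y) * (inverse (b k) * Y $$ (j, k) * b j)"
proof -
  have Yc: "Y \<in> carrier_mat m m" using Y GLm_carrier by blast
  have M: "matunit m l k \<in> mat_over K m" for l by (auto simp: mat_over_def F_K)
  have cM: "map_mat cj (matunit m l k) = matunit m l k" for l by (intro eq_matI) (auto simp: cj_F)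
  have A: "Ad Y (matunit m l k) $$ (l, j) \<in> K" if "l < m" for l
    using Y(1) M[of l] that kj unfolding rational_pair_def mat_over_def by blast
  show "mtrace Y * minv Y $$ (k, j) \<in> K"
    unfolding Ad_matunit_contraction[OF Y(2) kj, symmetric] by (rule K_sum) (use A in auto)
  have "cj (mtrace Y * minv Y $$ (k, j)) = (\<Sum>l<m. cj (Ad Y (matunit m l k) $$ (l, j)))"
    unfolding Ad_matunit_contraction[OF Y(2) kj, symmetric] by (rule cj_sum) (use A in auto)
  also have "\<dots> = (\<Sum>l<m. Ad (hthe m b Y) (matunit m l k) $$ (l, j))"
  proof (rule sum.cong)
    fix l assume "l \<in> {..<m}"
    then have l: "l < m" by simp
    have "Ad (hthe m b Y) (matunit m l k) = map_mat cj (Ad Y (matunit m l k))"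
      using Y(1) M[of l] cM[of l] unfolding rational_pair_def by metis
    moreover have "Ad Y (matunit m l k) \<in> carrier_mat m m" using Yc by simp
    ultimately show "cj (Ad Y (matunit m l k) $$ (l, j)) = Ad (hthe m b Y) (matunit m l k) $$ (l, j)"
      using l kj by auto
  qed simp
  also have "\<dots> = mtrace (hthe m b Y) * minv (hthe m b Y) $$ (k, j)"
    by (rule Ad_matunit_contraction[OF hthe_GLm(1)[OF Y(2) b] kj])
  also have "\<dots> = mtrace (minv Y) * (inverse (b k) * Y $$ (j, k) * b j)"
    by (simp add: mtrace_hthe[OF Y(2) b] hthe_GLm(2)[OF Y(2) b] index_diag_conj[OF Yc kj])
  finally show "cj (mtrace Y * minv Y $$ (k, j)) = mtrace (minv Y) * (inverse (b k) * Y $$ (j, k) * b j)" .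
qed

text \<open>\<open>Y\<close> is known only up to a scalar, which cancels in the trace times the
  inverse. Since \<open>qrefl m z G\<close> has trace m + z - 1 and inverse
  \<open>qrefl m w G\<close>, the previous lemma becomes a statement on the entries of
  \<open>G\<close>.\<close>

lemma rational_pair_qrefl:
  assumes Y: "rational_pair m K cj b Y" and b: "\<And>k. k < m \<Longrightarrow> b k \<noteq> 0"
    and P: "P \<in> GLm m" and e: "e \<in> carrier_mat m m" "e * e = e" "mtrace e = 1"
    and Yp: "Y \<approx> Ad P (qrefl m z e)" and zw: "z * w = 1" and kj: "k < m" "j < m"
  defines "G \<equiv> Ad P e"
  shows "(of_nat m + (z - 1)) * ((if k = j then 1 else 0) + (w - 1) * G $$ (k, j)) \<in> K"
    "cj ((of_nat m + (z - 1)) * ((if k = j then 1 else 0) + (w - 1) * G $$ (k, j))) =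
      (of_nat m + (w - 1)) * ((if k = j then 1 else 0) + (z - 1) * (inverse (b k) * G $$ (j, k) * b j))"
proof -
  have Gc [simp]: "G \<in> carrier_mat m m" using P e by (simp add: G_def GLm_carrier)
  have GG: "G * G = G" using Ad_mult[OF P e(1,1)] e(2) by (simp add: G_def)
  have trG: "mtrace G = 1" using mtrace_Ad[OF P e(1)] e(3) by (simp add: G_def)
  obtain c where c: "c \<noteq> 0" "Y = c \<cdot>\<^sub>m qrefl m z G"
    using Yp unfolding Ad_qrefl[OF P e(1)] G_def[symmetric] by (auto simp: peq_def)
  note inv = qrefl_inverse[OF Gc GG zw]
  have YG: "Y \<in> GLm m" using c inv(1) by (simp add: GLm_smult)
  have mY: "minv Y = inverse c \<cdot>\<^sub>m qrefl m w G" using minv_smult[OF c(1) inv(1)] inv(2) c(2) by simp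
  have dG: "dim_row G = m" "dim_col G = m" using carrier_matD[OF Gc] by auto
  have ent: "qrefl m x G $$ (i, l) = (if i = l then 1 else 0) + (x - 1) * G $$ (i, l)" if "i < m" "l < m" for x i l
    using that dG by (simp add: qrefl_def)
  have tr: "mtrace (qrefl m x G) = of_nat m + (x - 1)" for x by (simp add: mtrace_qrefl[OF Gc] trG)
  have dq: "dim_row (qrefl m x G) = m" "dim_col (qrefl m x G) = m" for x using dG by (simp_all add: qrefl_def)
  have t: "mtrace Y = c * (of_nat m + (z - 1))" "mtrace (minv Y) = inverse c * (of_nat m + (w - 1))"
    unfolding mY by (simp_all add: c(2) mtrace_smult[of _ m] tr)
  have 1: "mtrace Y * minv Y $$ (k, j) = (of_nat m + (z - 1)) * ((if k = j then 1 else 0) + (w - 1) * G $$ (k, j))"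
  proof -
    have "minv Y $$ (k, j) = inverse c * ((if k = j then 1 else 0) + (w - 1) * G $$ (k, j))"
      unfolding mY using kj dq by (simp add: ent)
    then show ?thesis using c(1) by (simp add: t)
  qed
  have 2: "mtrace (minv Y) * (inverse (b k) * Y $$ (j, k) * b j) =
      (of_nat m + (w - 1)) * ((if k = j then 1 else 0) + (z - 1) * (inverse (b k) * G $$ (j, k) * b j))"
  proof -
    have "Y $$ (j, k) = c * qrefl m z G $$ (j, k)" using c(2) kj dq by simp
    then have "mtrace (minv Y) * (inverse (b k) * Y $$ (j, k) * b j) =
      (of_nat m + (w - 1)) * (inverse (b k) * qrefl m z G $$ (j, k) * b j)"
      using c(1) by (simp add: t)
    also have "inverse (b k) * qrefl m z G $$ (j, k) * b j = (if k = j then 1 else 0) + (z - 1) * (inverse (b k) * G $$ (j, k) * b j)"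
      using b[OF kj(1)] kj by (auto simp: ent algebra_simps)
    finally show ?thesis .
  qed
  show "(of_nat m + (z - 1)) * ((if k = j then 1 else 0) + (w - 1) * G $$ (k, j)) \<in> K"
    "cj ((of_nat m + (z - 1)) * ((if k = j then 1 else 0) + (w - 1) * G $$ (k, j))) =
      (of_nat m + (w - 1)) * ((if k = j then 1 else 0) + (z - 1) * (inverse (b k) * G $$ (j, k) * b j))"
    using rational_pair_entry[OF Y YG b kj] unfolding 1 2 by auto
qed

end

text \<open>With \<open>c\<close> and all a_k in \<open>F\<close> the projection has entries in
  \<open>F\<close>, so conjugation affects the parameter only.\<close>

lemma (in quad) index_qrefl_F:
  assumes a: "\<And>k. k < m \<Longrightarrow> a k \<in> F" and j: "0 < j" "j < m" and c: "c \<in> F" and z: "z \<in> K"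
  shows "qrefl m z (proj m a j c) \<in> mat_over K m"
    "map_mat cj (qrefl m z (proj m a j c)) = qrefl m (cj z) (proj m a j c)"
proof -
  let ?e = "proj m a j c"
  have eF: "?e $$ (i, k) \<in> F" if "i < m" "k < m" for i k
  proof -
    have "a 0 \<in> F" "a j \<in> F" "a k \<in> F" using a j that by auto
    then have "a 0 + c * c * a j \<in> F" "(if i = 0 then 1 else if i = j then c else 0) * (if k = 0 then 1 else if k = j then c else 0) * a k \<in> F"
      using c by (simp_all split: if_split)
    then show ?thesis unfolding index_proj[OF that] by (rule F_divide[rotated])
  qed
  have ent: "qrefl m x ?e $$ (i, k) = (if i = k then 1 else 0) + (x - 1) * ?e $$ (i, k)" if "i < m" "k < m" for x i k
    using that carrier_matD[OF proj_carrier[of m a j c]] by (simp add: qrefl_def)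
  have K1: "1 \<in> K" "0 \<in> K" "1 - 1 \<in> F" using F_K by auto
  show "qrefl m z ?e \<in> mat_over K m"
    unfolding mat_over_def using ent eF z K1 F_K by auto
  show "map_mat cj (qrefl m z ?e) = qrefl m (cj z) ?e"
  proof (rule eq_matI)
    fix i k assume "i < dim_row (qrefl m (cj z) ?e)" "k < dim_col (qrefl m (cj z) ?e)"
    then have ik: "i < m" "k < m" by (auto simp: qrefl_def proj_def)
    have d: "(if i = k then 1 else 0 :: 'a) \<in> F" by simp
    have "cj (qrefl m z ?e $$ (i, k)) = qrefl m (cj z) ?e $$ (i, k)"
      unfolding ent[OF ik] using eF[OF ik] z d K1 F_K
      by (simp only: cj_add cj_mult cj_minus cj_F K_mult K_minus F_K F01)
    then show "map_mat cj (qrefl m z ?e) $$ (i, k) = qrefl m (cj z) ?e $$ (i, k)"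
      using ik by (simp add: qrefl_def proj_def)
  qed (auto simp: qrefl_def proj_def)
qed

section \<open>Equality of the fields, and a conformal matrix over the common field\<close>

context
  fixes F K\<^sub>1 K\<^sub>2 :: "'a::field_char_0 set" and d\<^sub>1 d\<^sub>2 cj\<^sub>1 cj\<^sub>2 m a b f P
  assumes q1: "quad F K\<^sub>1 d\<^sub>1 cj\<^sub>1" and q2: "quad F K\<^sub>2 d\<^sub>2 cj\<^sub>2" and m: "2 \<le> m"
    and a: "\<And>k. k < m \<Longrightarrow> a k \<in> F \<and> a k \<noteq> 0" and b: "\<And>k. k < m \<Longrightarrow> b k \<in> F \<and> b k \<noteq> 0"
    and rp: "\<And>A. A \<in> GLm m \<Longrightarrow> A \<in> mat_over K\<^sub>1 m \<Longrightarrow> A\<^sup>T * mat_diag m a * map_mat cj\<^sub>1 A = mat_diag m a \<Longrightarrow>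
      rational_pair m K\<^sub>2 cj\<^sub>2 b (f A)"
    and P: "P \<in> GLm m"
    and blk: "\<And>j x s y. 0 < j \<Longrightarrow> j < m \<Longrightarrow> \<forall>k<m. s k \<noteq> 0 \<Longrightarrow>
      f (trv m j 0 x * mat_diag m s * trv m 0 j y) \<approx> Ad P (trv m j 0 x * mat_diag m s * trv m 0 j y)"
begin

interpretation A: quad F K\<^sub>1 d\<^sub>1 cj\<^sub>1 by (rule q1)
interpretation B: quad F K\<^sub>2 d\<^sub>2 cj\<^sub>2 by (rule q2)

text \<open>The quasi-reflection is an F-point of the first unitary group, so \<open>rp\<close>
  applies to it; its factorization into a block lets \<open>blk\<close> identify its image up to a
  scalar.\<close>

lemma rational_projection:
  assumes j: "0 < j" "j < m" and c: "c \<in> F" and h: "a 0 + c * c * a j \<noteq> 0"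
    and z: "z \<in> K\<^sub>1" "cj\<^sub>1 z * z = 1" and p: "1 + (z - 1) * (a 0 / (a 0 + c * c * a j)) \<noteq> 0"
    and kl: "k < m" "l < m"
  defines "G \<equiv> Ad P (proj m a j c)"
  shows "(of_nat m + (z - 1)) * ((if k = l then 1 else 0) + (cj\<^sub>1 z - 1) * G $$ (k, l)) \<in> K\<^sub>2"
    "cj\<^sub>2 ((of_nat m + (z - 1)) * ((if k = l then 1 else 0) + (cj\<^sub>1 z - 1) * G $$ (k, l))) =
      (of_nat m + (cj\<^sub>1 z - 1)) * ((if k = l then 1 else 0) + (z - 1) * (inverse (b k) * G $$ (l, k) * b l))"
proof -
  let ?e = "proj m a j c"
  have z0: "z \<noteq> 0" using z by auto
  have zz: "z * cj\<^sub>1 z = 1" using z by (simp add: mult.commute)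
  have aF: "\<And>k. k < m \<Longrightarrow> a k \<in> F" using a by blast
  note Q = A.index_qrefl_F[OF aF j c z(1)]
  have "rational_pair m K\<^sub>2 cj\<^sub>2 b (f (qrefl m z ?e))"
    by (rule rp[OF qrefl_inverse(1)[OF proj_carrier proj_idem(1)[OF j h] zz] Q(1) qrefl_proj_unitary[OF j h z(2) Q(2)]])
  moreover have "f (qrefl m z ?e) \<approx> Ad P (qrefl m z ?e)"
    using qrefl_proj_block[OF j h z0 p] blk[OF j] by metis
  moreover have b0: "\<And>k. k < m \<Longrightarrow> b k \<noteq> 0" using b by blast
  ultimately show "(of_nat m + (z - 1)) * ((if k = l then 1 else 0) + (cj\<^sub>1 z - 1) * G $$ (k, l)) \<in> K\<^sub>2"
    "cj\<^sub>2 ((of_nat m + (z - 1)) * ((if k = l then 1 else 0) + (cj\<^sub>1 z - 1) * G $$ (k, l))) =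
      (of_nat m + (cj\<^sub>1 z - 1)) * ((if k = l then 1 else 0) + (z - 1) * (inverse (b k) * G $$ (l, k) * b l))"
    unfolding G_def
    using B.rational_pair_qrefl[OF _ _ P proj_carrier proj_idem[OF j h] _ zz kl, of b "f (qrefl m z ?e)"] by metis+
qed

text \<open>The pivot is affine in z with coefficients in \<open>F\<close> and nonzero slope, so a
  zero would put z into \<open>F\<close>.\<close>

lemma pivot_nonzero: assumes "z \<in> K\<^sub>1" "z \<notin> F" "u \<in> F" "u \<noteq> 0" shows "1 + (z - 1) * u \<noteq> 0"
proof
  assume "1 + (z - 1) * u = 0"
  then have "(z - 1) * u = - 1" by (simp add: add_eq_0_iff)
  then have "z = 1 - 1 / u" using assms(4) by (simp add: field_simps)
  then show False using assms by (metis A.F01(2) A.F_divide A.F_minus)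
qed

text \<open>The parameter -1 comes first: (m - 2) (1 - 2 G) has entries in the second field, hence
  so has G. For the parameter z of \<open>zz\<close>, the quasi-reflection with the conjugate
  parameter is the identity on the image of 1 - G; multiplying by 1 - G and taking the trace
  eliminates the conjugate and leaves (m + z - 1) (m - 1) in the second field. So z lies in both
  fields, and it generates each over \<open>F\<close>.\<close>

lemma same_field: assumes m3: "3 \<le> m" shows "K\<^sub>1 = K\<^sub>2"
proof -
  let ?G = "Ad P (proj m a 1 0)" and ?z = "A.zz"
  have j: "0 < (1::nat)" "1 < m" using m by auto
  have a0: "a 0 \<in> F" "a 0 \<noteq> 0" using a[of 0] m by auto
  have h: "a 0 + 0 * 0 * a 1 \<noteq> 0" using a0 by simp
  have Gc: "?G \<in> carrier_mat m m" using P by (simp add: GLm_carrier)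
  \<comment> \<open>This factor is the trace of the reflection with parameter -1; it would be 0 for
    m = 2.\<close>
  have m2: "(of_nat m + (- 1 - 1) :: 'a) \<noteq> 0"
  proof -
    have "of_nat m + (- 1 - 1) = (of_nat (m - 2) :: 'a)" using m by (simp add: of_nat_diff)
    moreover have "of_nat (m - 2) \<noteq> (0 :: 'a)" unfolding of_nat_eq_0_iff using m3 by simp
    ultimately show ?thesis by metis
  qed
  have GK: "?G $$ (k, l) \<in> K\<^sub>2" if kl: "k < m" "l < m" for k l
  proof -
    have m1: "- 1 \<in> K\<^sub>1" "cj\<^sub>1 (- 1) * - 1 = 1" using A.F_K[of "- 1"] A.cj_F[of "- 1"] by auto
    have p: "1 + (- 1 - 1) * (a 0 / (a 0 + 0 * 0 * a 1)) \<noteq> 0" using a0 by simp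
    let ?M = "(of_nat m + (- 1 - 1)) * ((if k = l then 1 else 0) + (cj\<^sub>1 (- 1) - 1) * ?G $$ (k, l))"
    have M: "?M \<in> K\<^sub>2" using rational_projection(1)[OF j A.F01(1) h m1 p kl] .
    have "cj\<^sub>1 (- 1) = - 1" using A.cj_F[of "- 1"] by simp
    then have "?G $$ (k, l) = ((if k = l then 1 else 0) - ?M / (of_nat m + (- 1 - 1))) / 2"
      (is "_ = ?R") using m2 by (simp add: field_simps)
    moreover have "?R \<in> K\<^sub>2"
      using M by (intro B.K_divide B.K_minus) (auto simp: B.F_K)
    ultimately show ?thesis by (rule ssubst)
  qed
  have p: "1 + (?z - 1) * (a 0 / (a 0 + 0 * 0 * a 1)) \<noteq> 0" using a0 by (intro pivot_nonzero A.zz) auto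
  let ?w = "cj\<^sub>1 ?z"
  let ?c = "of_nat m + (?z - 1)"
  have M: "?c * ((if k = l then 1 else 0) + (?w - 1) * ?G $$ (k, l)) \<in> K\<^sub>2" if "k < m" "l < m" for k l
    using rational_projection(1)[OF j A.F01(1) h A.zz(1,2) p that] .
  have GG: "?G * ?G = ?G" unfolding Ad_mult[OF P proj_carrier proj_carrier, symmetric] proj_idem(1)[OF j h] ..
  have trG: "mtrace ?G = 1" unfolding mtrace_Ad[OF P proj_carrier] by (rule proj_idem(2)[OF j h])
  have q: "qrefl m ?w ?G * (1\<^sub>m m - ?G) = 1\<^sub>m m - ?G"
  proof -
    have "1\<^sub>m m - ?G = qrefl m 0 ?G" using carrier_matD[OF Gc] by (intro eq_matI) (auto simp: qrefl_def)
    then show ?thesis using qrefl_mult[OF Gc GG, of ?w 0] by simp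
  qed
  have "mtrace (qrefl m ?w ?G * (1\<^sub>m m - ?G)) = (\<Sum>k<m. \<Sum>l<m. qrefl m ?w ?G $$ (k, l) * (1\<^sub>m m - ?G) $$ (l, k))"
    using Gc by (auto simp: mtrace_def qrefl_def index_mult_mat'[of _ m m _ m] simp del: index_mult_mat(1) intro!: sum.cong)
  then have "?c * mtrace (1\<^sub>m m - ?G) = (\<Sum>k<m. \<Sum>l<m. ?c * qrefl m ?w ?G $$ (k, l) * (1\<^sub>m m - ?G) $$ (l, k))"
    unfolding q by (simp add: sum_distrib_left mult.assoc)
  also have "\<dots> \<in> K\<^sub>2"
  proof (intro B.K_sum, rule B.K_mult)
    fix k l assume "k \<in> {..<m}" "l \<in> {..<m}"
    then have kl: "k < m" "l < m" by auto
    show "?c * qrefl m ?w ?G $$ (k, l) \<in> K\<^sub>2"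
      using M[OF kl] kl carrier_matD[OF Gc] by (simp add: qrefl_def)
    show "(1\<^sub>m m - ?G) $$ (l, k) \<in> K\<^sub>2"
      using GK[OF kl(2,1)] kl carrier_matD[OF Gc] by (auto simp: B.F_K)
  qed
  finally have "?c * (of_nat m - 1) \<in> K\<^sub>2" by (simp only: mtrace_minus[OF one_carrier_mat Gc] mtrace_one trG)
  moreover have n1: "(of_nat m - 1 :: 'a) \<noteq> 0" using m of_nat_eq_iff[of m 1, where 'a='a] by auto
  moreover have "?z = ?c * (of_nat m - 1) / (of_nat m - 1) - (of_nat m - 1)" using n1 by simp
  ultimately have z2: "?z \<in> K\<^sub>2" by (metis B.F01(2) B.F_K B.F_minus B.F_of_nat B.K_divide B.K_minus)
  show ?thesis
  proof
    show "K\<^sub>1 \<subseteq> K\<^sub>2"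
    proof
      fix x assume "x \<in> K\<^sub>1"
      then obtain u v where "u \<in> F" "v \<in> F" "x = u + v * ?z" using A.generated_by[OF A.zz(1,3)] by blast
      then show "x \<in> K\<^sub>2" using z2 by (simp add: B.F_K)
    qed
    show "K\<^sub>2 \<subseteq> K\<^sub>1"
    proof
      fix x assume "x \<in> K\<^sub>2"
      then obtain u v where "u \<in> F" "v \<in> F" "x = u + v * ?z" using B.generated_by[OF z2 A.zz(3)] by blast
      then show "x \<in> K\<^sub>1" using A.zz(1) by (simp add: A.F_K)
    qed
  qed
qed

text \<open>With a common field, m + z - 1 is a nonzero element of it, so each projection conjugated
  by \<open>P\<close> has entries in \<open>K\<close> and is self-adjoint for diag(b).
  \<open>T\<close> is the multiple of \<open>P\<close> defined over \<open>K\<close>. The form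
  \<open>H\<close> pulled back along \<open>T\<close> has the original projections self-adjoint, as
  diag(a) has, and these leave only multiples of diag(a).\<close>

lemma conformal_matrix:
  assumes K: "K\<^sub>1 = K\<^sub>2" and cj: "\<And>x. x \<in> K\<^sub>1 \<Longrightarrow> cj\<^sub>1 x = cj\<^sub>2 x"
  shows "\<exists>T\<in>GLm m. T \<in> mat_over K\<^sub>2 m \<and> (\<exists>l\<in>F. l \<noteq> 0 \<and> T\<^sup>T * mat_diag m b * map_mat cj\<^sub>2 T = l \<cdot>\<^sub>m mat_diag m a)"
proof -
  let ?z = "A.zz"
  let ?w = "cj\<^sub>1 ?z"
  have m0: "0 < m" using m by simp
  have a0: "a 0 \<in> F" "a 0 \<noteq> 0" using a[OF m0] by auto
  have Pc [simp]: "P \<in> carrier_mat m m" using P GLm_carrier by blast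
  have zK: "?z \<in> K\<^sub>2" "?w \<in> K\<^sub>2" "cj\<^sub>2 ?z = ?w" "cj\<^sub>2 ?w = ?z"
    using A.zz(1) K cj A.cj_cj[OF A.zz(1)] A.cj_K[OF A.zz(1)] by auto
  have z1: "?z \<noteq> 1" "?w \<noteq> 1" using A.zz by auto
  have cF: "of_nat m + (?z - 1) \<noteq> 0"
  proof
    assume "of_nat m + (?z - 1) = 0"
    then have "?z = 1 - of_nat m" by (simp add: algebra_simps eq_neg_iff_add_eq_0)
    then show False using A.zz(3) A.F_of_nat A.F01 A.F_minus by metis
  qed
  have cjc: "cj\<^sub>2 (of_nat m + (?z - 1)) = of_nat m + (?w - 1)"
    using zK by (simp add: B.cj_add B.cj_minus B.F_K B.cj_F)
  have cF': "of_nat m + (?w - 1) \<noteq> 0"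
  proof
    assume "of_nat m + (?w - 1) = 0"
    then have "cj\<^sub>2 (cj\<^sub>2 (of_nat m + (?z - 1))) = 0" by (simp add: cjc B.cj_F)
    moreover have "of_nat m + (?z - 1) \<in> K\<^sub>2" using zK by (simp add: B.F_K)
    ultimately show False using cF B.cj_cj by simp
  qed
  have proj: "Ad P (proj m a j c) $$ (k, l) \<in> K\<^sub>2 \<and>
      cj\<^sub>2 (Ad P (proj m a j c) $$ (k, l)) = inverse (b k) * Ad P (proj m a j c) $$ (l, k) * b l"
    if j: "0 < j" "j < m" and c: "c \<in> F" and h: "a 0 + c * c * a j \<noteq> 0" and kl: "k < m" "l < m" for j c k l
  proof -
    let ?G = "Ad P (proj m a j c)" and ?d = "if k = l then 1 else 0 :: 'a"
    have "a 0 / (a 0 + c * c * a j) \<in> F" using a[OF j(2)] a0 c by simp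
    then have p: "1 + (?z - 1) * (a 0 / (a 0 + c * c * a j)) \<noteq> 0" using a0 h by (intro pivot_nonzero A.zz) auto
    note R = rational_projection[OF j c h A.zz(1,2) p kl]
    have d: "?d \<in> F" by simp
    let ?M = "(of_nat m + (?z - 1)) * (?d + (?w - 1) * ?G $$ (k, l))"
    have Geq: "?G $$ (k, l) = (?M / (of_nat m + (?z - 1)) - ?d) / (?w - 1)" using cF z1 by simp
    have "(?M / (of_nat m + (?z - 1)) - ?d) / (?w - 1) \<in> K\<^sub>2"
      using R(1) zK d by (intro B.K_divide B.K_minus B.K_add) (auto simp: B.F_K)
    then have G: "?G $$ (k, l) \<in> K\<^sub>2" using Geq by simp
    have cK: "of_nat m + (?z - 1) \<in> K\<^sub>2" "?d \<in> K\<^sub>2" "?w - 1 \<in> K\<^sub>2" using zK d by (auto simp: B.F_K)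
    have "cj\<^sub>2 ?M = (of_nat m + (?w - 1)) * (?d + (?z - 1) * cj\<^sub>2 (?G $$ (k, l)))"
    proof -
      have "cj\<^sub>2 (?w - 1) = ?z - 1" using zK by (simp add: B.cj_minus B.F_K B.cj_F)
      then show ?thesis using cK G d by (simp only: B.cj_mult B.cj_add B.K_mult B.K_add cjc B.cj_F)
    qed
    then have "(?d + (?z - 1) * cj\<^sub>2 (?G $$ (k, l))) = ?d + (?z - 1) * (inverse (b k) * ?G $$ (l, k) * b l)"
      using R(2) cF' by (metis mult_left_cancel)
    then show ?thesis using G z1 by simp
  qed
  obtain l0 where l0: "l0 < m" "minv P $$ (0, l0) \<noteq> 0"
  proof (rule ccontr)
    assume "\<not> thesis"
    then have z: "minv P $$ (0, l) = 0" if "l < m" for l using that \<open>\<And>l0. l0 < m \<Longrightarrow> minv P $$ (0, l0) \<noteq> 0 \<Longrightarrow> thesis\<close> by blast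
    have "(minv P * P) $$ (0, 0) = (\<Sum>l<m. minv P $$ (0, l) * P $$ (l, 0))"
      by (rule index_mult_mat'[of _ m m _ m]) (use m0 in auto)
    also have "\<dots> = 0" using z by simp
    finally show False using m0 by (simp add: minv_left[OF P])
  qed
  \<comment> \<open>With this scalar, column 0 of \<open>T\<close> is column l0 of the conjugate of
    E_00 by \<open>P\<close>, whose entries lie in \<open>K\<close>.\<close>
  define mu where "mu = minv P $$ (0, l0)"
  define T where "T = mu \<cdot>\<^sub>m P"
  have T: "T \<in> GLm m" using P l0 by (simp add: T_def mu_def GLm_smult)
  have Tc [simp]: "T \<in> carrier_mat m m" by (simp add: T_def)
  have dT: "dim_row T = m" "dim_col T = m" using carrier_matD[OF Tc] by auto
  have AdT: "Ad T E = Ad P E" if "E \<in> carrier_mat m m" for E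
    using Ad_smult_left[OF _ P that] l0 by (simp add: T_def mu_def)
  have one: "0 < (1::nat)" "1 < m" using m by auto
  have h0: "a 0 + 0 * 0 * a 1 \<noteq> 0" using a0 by simp
  have p00: "proj m a 1 0 = matunit m 0 0" using a0 by (intro eq_matI) (auto simp: proj_def)
  have T0: "T $$ (k, 0) \<in> K\<^sub>2" if k: "k < m" for k
  proof -
    have "Ad P (matunit m 0 0) = P * (matunit m 0 0 * minv P)"
      by (simp add: Ad_def assoc_mult_mat[of _ m m _ m _ m])
    also have "\<dots> $$ (k, l0) = (\<Sum>i<m. P $$ (k, i) * (matunit m 0 0 * minv P) $$ (i, l0))"
      by (rule index_mult_mat'[of _ m m _ m]) (use k l0 in auto)
    also have "\<dots> = (\<Sum>i<m. if i = 0 then P $$ (k, 0) * mu else 0)"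
      by (rule sum.cong) (use k l0 m0 in \<open>auto simp: matunit_mult_left[of _ m m] mu_def\<close>)
    also have "\<dots> = T $$ (k, 0)" using m0 k carrier_matD[OF Pc] by (simp add: T_def mult.commute)
    finally show ?thesis using proj[OF one A.F01(1) h0 k l0(1)] unfolding p00 by simp
  qed
  \<comment> \<open>c = 1 works unless a_j = - a_0, and then c = 2 gives a_0 + 4 a_j = 3
    a_j.\<close>
  have "\<exists>c\<in>F. c \<noteq> 0 \<and> a 0 + c * c * a j \<noteq> 0" if j: "j < m" for j
  proof (cases "a 0 + a j = 0")
    case True
    then have "a 0 + 2 * 2 * a j = 3 * a j" by (simp add: add_eq_0_iff2)
    moreover have "3 * a j \<noteq> 0" using a[OF j] by simp
    ultimately have "a 0 + 2 * 2 * a j \<noteq> 0" by metis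
    then show ?thesis by (intro bexI[of _ 2]) auto
  next
    case False
    then show ?thesis by (intro bexI[of _ 1]) auto
  qed
  then obtain c where c: "j < m \<Longrightarrow> c j \<in> F \<and> c j \<noteq> 0 \<and> a 0 + c j * c j * a j \<noteq> 0" for j by metis
  have GT: "Ad P (proj m a j d) * T = T * proj m a j d" for j d
    using Ad_eq_iff[where E = "proj m a j d" and E' = "Ad P (proj m a j d)", OF T] AdT[OF proj_carrier] by simp
  \<comment> \<open>Column 0 of T e is a combination over \<open>F\<close> of the columns 0 and j of
    \<open>T\<close>, with nonzero coefficient at j. As it equals column 0 of G T, it has entries in
    \<open>K\<close>, and so does column j.\<close>
  have TK: "T $$ (k, j) \<in> K\<^sub>2" if k: "k < m" and j: "j < m" for k j
  proof (cases "j = 0")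
    case False
    then have j0: "0 < j" by simp
    let ?G = "Ad P (proj m a j (c j))" and ?h = "a 0 + c j * c j * a j"
    have cj': "c j \<in> F" "c j \<noteq> 0" "?h \<noteq> 0" using c[OF j] by auto
    have "(?G * T) $$ (k, 0) = (\<Sum>l<m. ?G $$ (k, l) * T $$ (l, 0))"
      by (rule index_mult_mat'[of _ m m _ m]) (use k m0 in auto)
    moreover have "(\<Sum>l<m. ?G $$ (k, l) * T $$ (l, 0)) \<in> K\<^sub>2"
      by (intro B.K_sum B.K_mult T0) (use proj[OF j0 j cj'(1,3) k] in auto)
    moreover have "(T * proj m a j (c j)) $$ (k, 0) = (\<Sum>l<m. T $$ (k, l) * proj m a j (c j) $$ (l, 0))"
      by (rule index_mult_mat'[of _ m m _ m]) (use k m0 in auto)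
    moreover have "(\<Sum>l<m. T $$ (k, l) * proj m a j (c j) $$ (l, 0)) = T $$ (k, 0) * (a 0 / ?h) + T $$ (k, j) * (c j * a 0 / ?h)"
      by (subst sum_two[OF j0 j]) (use m0 j j0 in \<open>auto simp: index_proj\<close>)
    ultimately have S: "T $$ (k, 0) * (a 0 / ?h) + T $$ (k, j) * (c j * a 0 / ?h) \<in> K\<^sub>2" (is "?S \<in> _")
      using GT[of j "c j"] by simp
    have fK: "a 0 / ?h \<in> K\<^sub>2" "c j * a 0 / ?h \<in> K\<^sub>2" using cj' a0 a[OF j] by (auto intro!: B.F_K)
    have nz: "c j * a 0 / ?h \<noteq> 0" using cj' a0 by simp
    have "T $$ (k, j) = (?S - T $$ (k, 0) * (a 0 / ?h)) / (c j * a 0 / ?h)"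
      by (simp only: add_diff_cancel_left' nonzero_mult_div_cancel_right[OF nz])
    moreover have "(?S - T $$ (k, 0) * (a 0 / ?h)) / (c j * a 0 / ?h) \<in> K\<^sub>2"
      by (intro B.K_divide B.K_minus B.K_mult S T0 k fK)
    ultimately show ?thesis by simp
  qed (use T0 k in simp)
  let ?D = "mat_diag m b" and ?Tc = "map_mat cj\<^sub>2 T"
  have Tcc [simp]: "?Tc \<in> carrier_mat m m" by simp
  define H where "H = T\<^sup>T * ?D * ?Tc"
  have H [simp]: "H \<in> carrier_mat m m" by (simp add: H_def)
  \<comment> \<open>\<open>G\<close> is self-adjoint for diag(b) and the projection has entries in
    \<open>F\<close>, so conjugating G T = T e does not change e.\<close>
  have He: "H * proj m a j d = (proj m a j d)\<^sup>T * H" if j: "0 < j" "j < m" and d: "d \<in> F" and h: "a 0 + d * d * a j \<noteq> 0" for j d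
  proof -
    let ?e = "proj m a j d" and ?G = "Ad P (proj m a j d)"
    have G [simp]: "?G \<in> carrier_mat m m" by simp
    have dG: "dim_row ?G = m" "dim_col ?G = m" using carrier_matD[OF G] by auto
    have [simp]: "?e\<^sup>T \<in> carrier_mat m m" "?G\<^sup>T \<in> carrier_mat m m" "map_mat cj\<^sub>2 ?G \<in> carrier_mat m m"
      using dG by auto
    have GD: "?D * map_mat cj\<^sub>2 ?G = ?G\<^sup>T * ?D"
    proof (rule eq_matI)
      fix k l assume "k < dim_row (?G\<^sup>T * ?D)" "l < dim_col (?G\<^sup>T * ?D)"
      then have kl: "k < m" "l < m" using dG by (auto simp: mat_diag_def)
      have "b k * cj\<^sub>2 (?G $$ (k, l)) = ?G $$ (l, k) * b l"
        using proj[OF j d h kl] b[OF kl(1)] by (simp add: field_simps)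
      then show "(?D * map_mat cj\<^sub>2 ?G) $$ (k, l) = (?G\<^sup>T * ?D) $$ (k, l)"
        using kl dG by (simp add: mat_diag_mult_left[of _ m m] mat_diag_mult_right[of _ m m])
    qed (auto simp: dG mat_diag_def)
    have eF: "?e $$ (k, l) \<in> F" if "k < m" "l < m" for k l
    proof -
      have "a 0 + d * d * a j \<in> F" "a l \<in> F" using a0 a that j d by simp_all
      then show ?thesis using d by (simp add: index_proj[OF that])
    qed
    have cT: "?Tc * ?e = map_mat cj\<^sub>2 ?G * ?Tc"
    proof (rule eq_matI)
      fix k l assume "k < dim_row (map_mat cj\<^sub>2 ?G * ?Tc)" "l < dim_col (map_mat cj\<^sub>2 ?G * ?Tc)"
      then have kl: "k < m" "l < m" using dG dT by auto
      have "(?Tc * ?e) $$ (k, l) = (\<Sum>i<m. cj\<^sub>2 (T $$ (k, i)) * ?e $$ (i, l))"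
        using kl dT by (subst index_mult_mat'[of _ m m _ m]) (auto intro!: sum.cong)
      also have "\<dots> = (\<Sum>i<m. cj\<^sub>2 (T $$ (k, i) * ?e $$ (i, l)))"
        by (rule sum.cong) (use TK kl eF in \<open>auto simp: B.cj_mult B.F_K B.cj_F\<close>)
      also have "\<dots> = cj\<^sub>2 ((T * ?e) $$ (k, l))"
        using kl TK eF by (subst B.cj_sum[symmetric]) (auto simp: B.F_K index_mult_mat'[of _ m m _ m] simp del: index_mult_mat(1))
      also have "(T * ?e) $$ (k, l) = (?G * T) $$ (k, l)" by (simp add: GT)
      also have "\<dots> = (\<Sum>i<m. ?G $$ (k, i) * T $$ (i, l))" by (rule index_mult_mat'[of _ m m _ m]) (use kl in auto)
      also have "cj\<^sub>2 \<dots> = (\<Sum>i<m. cj\<^sub>2 (?G $$ (k, i) * T $$ (i, l)))"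
        by (rule B.cj_sum) (use TK kl proj[OF j d h] in auto)
      also have "\<dots> = (\<Sum>i<m. cj\<^sub>2 (?G $$ (k, i)) * cj\<^sub>2 (T $$ (i, l)))"
        by (rule sum.cong) (use TK kl proj[OF j d h] in \<open>auto simp: B.cj_mult\<close>)
      also have "\<dots> = (map_mat cj\<^sub>2 ?G * ?Tc) $$ (k, l)"
        using kl dT dG by (subst index_mult_mat'[of _ m m _ m]) (auto intro!: sum.cong)
      finally show "(?Tc * ?e) $$ (k, l) = (map_mat cj\<^sub>2 ?G * ?Tc) $$ (k, l)" .
    qed (use dG dT carrier_matD[OF proj_carrier[of m a j d]] in auto)
    have "H * ?e = T\<^sup>T * (?D * map_mat cj\<^sub>2 ?G) * ?Tc"
      by (simp add: H_def assoc_mult_mat[of _ m m _ m _ m] cT)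
    also have "\<dots> = (T\<^sup>T * ?G\<^sup>T) * ?D * ?Tc" by (simp add: GD assoc_mult_mat[of _ m m _ m _ m])
    also have "T\<^sup>T * ?G\<^sup>T = ?e\<^sup>T * T\<^sup>T"
      using GT[of j d] by (simp add: transpose_mult[of _ m m _ m, symmetric])
    finally show ?thesis by (simp add: H_def assoc_mult_mat[of _ m m _ m _ m])
  qed
  have dH: "dim_row H = m" "dim_col H = m" using carrier_matD[OF H] by auto
  have He': "(\<Sum>i<m. H $$ (k, i) * proj m a j d $$ (i, l)) = (\<Sum>i<m. proj m a j d $$ (i, k) * H $$ (i, l))"
    if j: "0 < j" "j < m" and d: "d \<in> F" "a 0 + d * d * a j \<noteq> 0" and kl: "k < m" "l < m" for j d k l
  proof -
    have "(H * proj m a j d) $$ (k, l) = (\<Sum>i<m. H $$ (k, i) * proj m a j d $$ (i, l))"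
      by (rule index_mult_mat'[of _ m m _ m]) (use kl in auto)
    moreover have "((proj m a j d)\<^sup>T * H) $$ (k, l) = (\<Sum>i<m. (proj m a j d)\<^sup>T $$ (k, i) * H $$ (i, l))"
      by (rule index_mult_mat'[of _ m m _ m]) (use kl in auto)
    moreover have "(proj m a j d)\<^sup>T $$ (k, i) = proj m a j d $$ (i, k)" if "i < m" for i
      using that kl carrier_matD[OF proj_carrier[of m a j d]] by simp
    ultimately show ?thesis using He[OF j d] by simp
  qed
  \<comment> \<open>The projection E_00 separates index 0 from the others.\<close>
  have H0: "H $$ (0, j) = 0 \<and> H $$ (j, 0) = 0" if j: "0 < j" "j < m" for j
  proof -
    have e00: "proj m a 1 0 $$ (i, k) = (if i = 0 \<and> k = 0 then 1 else 0)" if "i < m" "k < m" for i k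
      unfolding p00 using that by simp
    have s1: "(\<Sum>i<m. H $$ (k, i) * proj m a 1 0 $$ (i, l)) = (if l = 0 then H $$ (k, 0) else 0)" if "l < m" for k l
    proof -
      have "(\<Sum>i<m. H $$ (k, i) * proj m a 1 0 $$ (i, l)) = (\<Sum>i<m. if i = 0 then (if l = 0 then H $$ (k, 0) else 0) else 0)"
        by (rule sum.cong) (use that e00 in auto)
      then show ?thesis using m0 by simp
    qed
    have s2: "(\<Sum>i<m. proj m a 1 0 $$ (i, k) * H $$ (i, l)) = (if k = 0 then H $$ (0, l) else 0)" if "k < m" for k l
    proof -
      have "(\<Sum>i<m. proj m a 1 0 $$ (i, k) * H $$ (i, l)) = (\<Sum>i<m. if i = 0 then (if k = 0 then H $$ (0, l) else 0) else 0)"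
        by (rule sum.cong) (use that e00 in auto)
      then show ?thesis using m0 by simp
    qed
    show ?thesis
      using He'[OF one A.F01(1) h0 m0 j(2)] He'[OF one A.F01(1) h0 j(2) m0] j
      unfolding s1[OF j(2)] s1[OF m0] s2[OF j(2)] s2[OF m0] by simp
  qed
  \<comment> \<open>This is the entry at (k, 0) of the self-adjointness for the projection along u_0
    + c u_j: orthogonality for k different from j, a comparison of the norms of u_0 and u_j for k =
    j.\<close>
  have Hkj: "H $$ (k, j) = (if k = j then H $$ (0, 0) / a 0 * a j else 0)" if j: "0 < j" "j < m" and k: "0 < k" "k < m" for k j
  proof -
    let ?h = "a 0 + c j * c j * a j"
    have cj': "c j \<in> F" "c j \<noteq> 0" "?h \<noteq> 0" using c[OF j(2)] by auto
    have e: "(\<Sum>i<m. H $$ (k, i) * proj m a j (c j) $$ (i, 0)) = H $$ (k, j) * (c j * a 0 / ?h)"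
      by (subst sum_two[OF j]) (use m0 j k H0[OF k] in \<open>auto simp: index_proj\<close>)
    have e': "(\<Sum>i<m. proj m a j (c j) $$ (i, k) * H $$ (i, 0)) = (if k = j then c j * a j / ?h * H $$ (0, 0) else 0)"
      by (subst sum_two[OF j]) (use m0 j k H0[OF j] in \<open>auto simp: index_proj\<close>)
    have "H $$ (k, j) * (c j * a 0 / ?h) = (if k = j then c j * a j / ?h * H $$ (0, 0) else 0)"
      using He'[OF j cj'(1,3) k(2) m0] unfolding e e' .
    then have eq: "c j / ?h * (H $$ (k, j) * a 0) = c j / ?h * (if k = j then a j * H $$ (0, 0) else 0)"
      by (auto simp: mult_ac)
    have nz: "c j / ?h \<noteq> 0" using cj' by simp
    have "H $$ (k, j) * a 0 = (if k = j then a j * H $$ (0, 0) else 0)"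
      by (rule iffD1[OF mult_left_cancel[OF nz] eq])
    then show ?thesis using a0 by (auto simp: nonzero_eq_divide_eq mult_ac)
  qed
  define lam where "lam = H $$ (0, 0) / a 0"
  have Hl: "H = lam \<cdot>\<^sub>m mat_diag m a"
  proof (rule eq_matI)
    fix k j assume "k < dim_row (lam \<cdot>\<^sub>m mat_diag m a)" "j < dim_col (lam \<cdot>\<^sub>m mat_diag m a)"
    then have kj: "k < m" "j < m" by (auto simp: mat_diag_def)
    show "H $$ (k, j) = (lam \<cdot>\<^sub>m mat_diag m a) $$ (k, j)"
      using kj a0 H0[of j] H0[of k] Hkj[of j k] by (cases "k = 0"; cases "j = 0") (auto simp: mat_diag_def lam_def)
  qed (auto simp: dH mat_diag_def)
  have "H $$ (0, 0) \<in> F"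
  proof -
    have "H $$ (0, 0) = (\<Sum>i<m. (T\<^sup>T * ?D) $$ (0, i) * ?Tc $$ (i, 0))"
      unfolding H_def by (rule index_mult_mat'[of _ m m _ m]) (use m0 in auto)
    also have "\<dots> = (\<Sum>i<m. b i * (T $$ (i, 0) * cj\<^sub>2 (T $$ (i, 0))))"
      by (rule sum.cong) (use m0 dT in \<open>auto simp: mat_diag_mult_right[of _ m m]\<close>)
    also have "\<dots> \<in> F" by (rule B.F_sum) (use b T0 B.norm_F in auto)
    finally show ?thesis .
  qed
  then have lF: "lam \<in> F" using a0 by (simp add: lam_def)
  have "lam \<noteq> 0"
  proof
    assume "lam = 0"
    then have Hz: "H = 0\<^sub>m m m" using Hl by (auto intro!: eq_matI simp: mat_diag_def)
    have D: "?D \<in> GLm m" using b by (intro mat_diag_GLm(1)) auto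
    have "minv (T\<^sup>T * ?D) * H = ?Tc"
    proof -
      have "T\<^sup>T * ?D \<in> GLm m" using T D by (simp add: GLm_mult GLm_transpose)
      then show ?thesis unfolding H_def
        by (simp add: assoc_mult_mat[of _ m m _ m ?Tc m, symmetric] minv_left left_mult_one_mat[of _ m m])
    qed
    then have Tz: "?Tc = 0\<^sub>m m m" by (simp add: Hz right_mult_zero_mat[of _ m m])
    have "T $$ (k, l) = 0" if "k < m" "l < m" for k l
    proof -
      have "cj\<^sub>2 (T $$ (k, l)) = 0" using arg_cong[OF Tz, of "\<lambda>A. A $$ (k, l)"] that dT by simp
      then show ?thesis using B.cj_cj[OF TK[OF that]] B.cj_F[of 0] by simp
    qed
    then have "T = 0\<^sub>m m m" using dT by (intro eq_matI) auto
    then have "T * minv T = 0\<^sub>m m m" by (simp add: left_mult_zero_mat[of _ m m] minv_carrier[OF Tc])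
    then have "1\<^sub>m m = (0\<^sub>m m m :: 'a mat)" by (simp add: minv_right[OF T])
    from arg_cong[OF this, of "\<lambda>A. A $$ (0, 0)"] show False using m0 by simp
  qed
  moreover have "T \<in> mat_over K\<^sub>2 m" using TK by (auto simp: mat_over_def)
  ultimately show ?thesis using T Hl lF unfolding H_def by blast
qed

end

section \<open>Passage to the dual form\<close>

lemma hthe_carrier: "Y \<in> carrier_mat m m \<Longrightarrow> hthe m b Y \<in> carrier_mat m m"
  by (simp add: hthe_def)

text \<open>The inverse transpose belongs to the dual space, on which the form is diag(1/b).
  Transposing every matrix in the condition for \<open>Y\<close> gives the condition for it.\<close>

lemma (in quad) rational_pair_dual:
  assumes Y: "Y \<in> GLm m" and b: "\<And>k. k < m \<Longrightarrow> b k \<noteq> 0" and rp: "rational_pair m K cj b Y"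
  shows "rational_pair m K cj (\<lambda>k. inverse (b k)) ((minv Y)\<^sup>T)"
  unfolding rational_pair_def
proof (intro ballI conjI)
  fix E assume E: "E \<in> mat_over K m"
  then have Ec [simp]: "E \<in> carrier_mat m m" by (simp add: mat_over_def)
  have Yc [simp]: "Y \<in> carrier_mat m m" using Y GLm_carrier by blast
  have overT: "B\<^sup>T \<in> mat_over K m" if "B \<in> mat_over K m" for B
    using that by (auto simp: mat_over_def)
  have ET: "E\<^sup>T \<in> mat_over K m" using overT[OF E] .
  let ?Z = "(minv Y)\<^sup>T"
  have Z: "?Z \<in> GLm m" using Y by (simp add: GLm_minv GLm_transpose)
  have adZ: "Ad ?Z E = (Ad Y (E\<^sup>T))\<^sup>T" by (simp add: transpose_Ad[OF Y])
  have R: "Ad Y (E\<^sup>T) \<in> mat_over K m" "Ad (hthe m b Y) (map_mat cj (E\<^sup>T)) = map_mat cj (Ad Y (E\<^sup>T))"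
    using rp ET by (auto simp: rational_pair_def)
  show "Ad ?Z E \<in> mat_over K m" unfolding adZ using overT[OF R(1)] .
  have tY: "hthe m b Y \<in> GLm m" using hthe_GLm(1)[OF Y b] .
  have h: "hthe m (\<lambda>k. inverse (b k)) ?Z = (minv (hthe m b Y))\<^sup>T"
  proof -
    have mZ: "minv ?Z = Y\<^sup>T" by (simp add: minv_transpose[OF GLm_minv[OF Y]] minv_minv[OF Y])
    have mh: "minv (hthe m b Y) = mat_diag m (\<lambda>i. inverse (b i)) * Y\<^sup>T * mat_diag m b"
      by (rule hthe_GLm(2)[OF Y b])
    show ?thesis unfolding mh unfolding hthe_def mZ
      by (simp add: transpose_mult[of _ m m _ m] transpose_mat_diag assoc_mult_mat[of _ m m _ m _ m])
  qed
  have cE: "map_mat cj (E\<^sup>T) = (map_mat cj E)\<^sup>T" by (intro eq_matI) auto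
  have "Ad (hthe m (\<lambda>k. inverse (b k)) ?Z) (map_mat cj E) = (Ad (hthe m b Y) (map_mat cj (E\<^sup>T)))\<^sup>T"
    unfolding h cE by (subst transpose_Ad[OF tY]) auto
  also have "\<dots> = (map_mat cj (Ad Y (E\<^sup>T)))\<^sup>T" by (simp only: R(2))
  also have "\<dots> = map_mat cj (Ad ?Z E)" unfolding adZ by (intro eq_matI) auto
  finally show "Ad (hthe m (\<lambda>k. inverse (b k)) ?Z) (map_mat cj E) = map_mat cj (Ad ?Z E)" .
qed

text \<open>\<open>blocks_up_to_duality\<close> may replace \<open>f\<close> by its inverse
  transpose. The results above then apply with 1/b in place of b, and the matrix that they give has
  to be carried back.\<close>

lemma pgl_hom_conformal:
  fixes F K\<^sub>1 K\<^sub>2 :: "'a::field_char_0 set"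
  assumes q1: "quad F K\<^sub>1 d\<^sub>1 cj\<^sub>1" and q2: "quad F K\<^sub>2 d\<^sub>2 cj\<^sub>2"
    and a: "\<And>k. k < m \<Longrightarrow> a k \<in> F \<and> a k \<noteq> 0" and b: "\<And>k. k < m \<Longrightarrow> b k \<in> F \<and> b k \<noteq> 0"
    and f: "pgl_hom m f"
    and rp: "\<And>A. A \<in> GLm m \<Longrightarrow> A \<in> mat_over K\<^sub>1 m \<Longrightarrow> A\<^sup>T * mat_diag m a * map_mat cj\<^sub>1 A = mat_diag m a \<Longrightarrow>
      rational_pair m K\<^sub>2 cj\<^sub>2 b (f A)"
  shows "3 \<le> m \<Longrightarrow> K\<^sub>1 = K\<^sub>2"
    and "K\<^sub>1 = K\<^sub>2 \<Longrightarrow> (\<And>x. x \<in> K\<^sub>1 \<Longrightarrow> cj\<^sub>1 x = cj\<^sub>2 x) \<Longrightarrow>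
      \<exists>T\<in>GLm m. T \<in> mat_over K\<^sub>2 m \<and> (\<exists>l\<in>F. l \<noteq> 0 \<and> T\<^sup>T * mat_diag m b * map_mat cj\<^sub>2 T = l \<cdot>\<^sub>m mat_diag m a)"
proof -
  interpret f: pgl_hom m f by (rule f)
  interpret B: quad F K\<^sub>2 d\<^sub>2 cj\<^sub>2 by (rule q2)
  let ?Concl = "\<lambda>b. (3 \<le> m \<longrightarrow> K\<^sub>1 = K\<^sub>2) \<and> (K\<^sub>1 = K\<^sub>2 \<longrightarrow> (\<forall>x\<in>K\<^sub>1. cj\<^sub>1 x = cj\<^sub>2 x) \<longrightarrow>
      (\<exists>T\<in>GLm m. T \<in> mat_over K\<^sub>2 m \<and> (\<exists>l\<in>F. l \<noteq> 0 \<and> T\<^sup>T * mat_diag m b * map_mat cj\<^sub>2 T = l \<cdot>\<^sub>m mat_diag m a)))"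
  obtain g P where g: "g = f \<or> g = (\<lambda>A. (minv (f A))\<^sup>T)" and P: "P \<in> GLm m" and
    blk: "\<And>j x s y. 0 < j \<Longrightarrow> j < m \<Longrightarrow> \<forall>k<m. s k \<noteq> 0 \<Longrightarrow>
      g (trv m j 0 x * mat_diag m s * trv m 0 j y) \<approx> Ad P (trv m j 0 x * mat_diag m s * trv m 0 j y)"
    by (rule f.blocks_up_to_duality, rule that)
  have bc: "?Concl c" if c: "\<And>k. k < m \<Longrightarrow> c k \<in> F \<and> c k \<noteq> 0"
    and rpg: "\<And>A. A \<in> GLm m \<Longrightarrow> A \<in> mat_over K\<^sub>1 m \<Longrightarrow> A\<^sup>T * mat_diag m a * map_mat cj\<^sub>1 A = mat_diag m a \<Longrightarrow>
      rational_pair m K\<^sub>2 cj\<^sub>2 c (g A)" for c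
  proof (intro conjI impI)
    assume "3 \<le> m"
    then show "K\<^sub>1 = K\<^sub>2"
      by (rule same_field[where b = c and f = g, OF q1 q2 f.m2 _ _ _ P, rotated 4]) (erule a | erule c | erule (2) rpg | erule (2) blk)+
  next
    assume "K\<^sub>1 = K\<^sub>2" "\<forall>x\<in>K\<^sub>1. cj\<^sub>1 x = cj\<^sub>2 x"
    then show "\<exists>T\<in>GLm m. T \<in> mat_over K\<^sub>2 m \<and> (\<exists>l\<in>F. l \<noteq> 0 \<and> T\<^sup>T * mat_diag m c * map_mat cj\<^sub>2 T = l \<cdot>\<^sub>m mat_diag m a)"
      by (intro conformal_matrix[where f = g, OF q1 q2 f.m2 _ _ _ P]) (erule a | erule c | erule (2) rpg | erule (2) blk | blast)+
  qed
  have "?Concl b"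
    using g
  proof
    assume "g = f"
    then show ?thesis using rp b by (intro bc) auto
  next
    assume gd: "g = (\<lambda>A. (minv (f A))\<^sup>T)"
    let ?b = "\<lambda>k. inverse (b k)"
    have C: "?Concl ?b"
    proof (rule bc)
      show "?b k \<in> F \<and> ?b k \<noteq> 0" if "k < m" for k using b[OF that] by simp
      fix A assume A: "A \<in> GLm m" "A \<in> mat_over K\<^sub>1 m" "A\<^sup>T * mat_diag m a * map_mat cj\<^sub>1 A = mat_diag m a"
      show "rational_pair m K\<^sub>2 cj\<^sub>2 ?b (g A)" unfolding gd
        by (rule B.rational_pair_dual[OF f.f_GLm[OF A(1)] _ rp[OF A]]) (use b in blast)
    qed
    have "\<exists>T\<in>GLm m. T \<in> mat_over K\<^sub>2 m \<and> (\<exists>l\<in>F. l \<noteq> 0 \<and> T\<^sup>T * mat_diag m b * map_mat cj\<^sub>2 T = l \<cdot>\<^sub>m mat_diag m a)"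
      if T: "T \<in> GLm m" "T \<in> mat_over K\<^sub>2 m" and l: "l \<in> F" "l \<noteq> 0" and
        e: "T\<^sup>T * mat_diag m ?b * map_mat cj\<^sub>2 T = l \<cdot>\<^sub>m mat_diag m a" for T l
    proof -
      \<comment> \<open>Since D diag(b) D = D, the matrix D T does for b what T does for
        1/b.\<close>
      let ?D = "mat_diag m ?b" and ?S = "mat_diag m ?b * T"
      have Tc [simp]: "T \<in> carrier_mat m m" using T GLm_carrier by blast
      have dT: "dim_row T = m" "dim_col T = m" using carrier_matD[OF Tc] by auto
      have D: "?D \<in> GLm m" using b by (intro mat_diag_GLm(1)) auto
      have entS: "?S $$ (i, j) = inverse (b i) * T $$ (i, j)" if "i < m" "j < m" for i j
        using that by (simp add: mat_diag_mult_left[of _ m m])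
      have TK: "T $$ (i, j) \<in> K\<^sub>2" if "i < m" "j < m" for i j using T(2) that by (auto simp: mat_over_def)
      have bK: "inverse (b i) \<in> F" if "i < m" for i using b[OF that] by simp
      have S: "?S \<in> mat_over K\<^sub>2 m"
        unfolding mat_over_def using entS TK bK B.F_K by auto
      have cS: "map_mat cj\<^sub>2 ?S = ?D * map_mat cj\<^sub>2 T"
      proof (rule eq_matI)
        fix i j assume "i < dim_row (?D * map_mat cj\<^sub>2 T)" "j < dim_col (?D * map_mat cj\<^sub>2 T)"
        then have ij: "i < m" "j < m" using dT by (auto simp: mat_diag_def)
        have "map_mat cj\<^sub>2 ?S $$ (i, j) = cj\<^sub>2 (?S $$ (i, j))" using ij dT by (simp add: mat_diag_def)
        also have "\<dots> = inverse (b i) * cj\<^sub>2 (T $$ (i, j))"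
          unfolding entS[OF ij] using TK[OF ij] bK[OF ij(1)] by (simp add: B.cj_mult B.F_K B.cj_F)
        also have "\<dots> = (?D * map_mat cj\<^sub>2 T) $$ (i, j)"
          using ij dT by (simp add: mat_diag_mult_left[of _ m m])
        finally show "map_mat cj\<^sub>2 ?S $$ (i, j) = (?D * map_mat cj\<^sub>2 T) $$ (i, j)" .
      qed (auto simp: dT mat_diag_def)
      have DD: "mat_diag m b * ?D = 1\<^sub>m m"
      proof (rule eq_matI)
        fix i j assume "i < dim_row (1\<^sub>m m :: 'a mat)" "j < dim_col (1\<^sub>m m :: 'a mat)"
        then have "i < m" "j < m" by simp_all
        moreover have "b i \<noteq> 0" using b \<open>i < m\<close> by blast
        ultimately show "(mat_diag m b * ?D) $$ (i, j) = 1\<^sub>m m $$ (i, j)"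
          unfolding mat_diag_diag by (cases "i = j") (simp_all add: mat_diag_def)
      qed (simp_all add: mat_diag_def)
      have "?S\<^sup>T * mat_diag m b * map_mat cj\<^sub>2 ?S = T\<^sup>T * ?D * (mat_diag m b * ?D) * map_mat cj\<^sub>2 T"
        unfolding cS by (simp add: transpose_mult[of _ m m _ m] transpose_mat_diag assoc_mult_mat[of _ m m _ m _ m] del: mat_diag_diag)
      also have "\<dots> = l \<cdot>\<^sub>m mat_diag m a" unfolding DD by (simp add: right_mult_one_mat[of _ m m] e)
      finally show ?thesis using S GLm_mult[OF D T(1)] l by blast
    qed
    then show ?thesis using C by blast
  qed
  then show "3 \<le> m \<Longrightarrow> K\<^sub>1 = K\<^sub>2"
    "K\<^sub>1 = K\<^sub>2 \<Longrightarrow> (\<And>x. x \<in> K\<^sub>1 \<Longrightarrow> cj\<^sub>1 x = cj\<^sub>2 x) \<Longrightarrow>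
      \<exists>T\<in>GLm m. T \<in> mat_over K\<^sub>2 m \<and> (\<exists>l\<in>F. l \<noteq> 0 \<and> T\<^sup>T * mat_diag m b * map_mat cj\<^sub>2 T = l \<cdot>\<^sub>m mat_diag m a)"
    by blast+
qed

section \<open>Quadratic extensions inside an algebraic closure\<close>

lemma ring_class_ring: "ring (class_ring :: 'a::field ring)"
  by (rule class_ring.ring_axioms)

lemma domain_class_ring: "domain (class_ring :: 'a::field ring)"
  by (rule field.axioms(1)[OF class_field])

text \<open>Coefficient lists start with the leading coefficient for \<open>ring.eval\<close> and
  with the constant one for \<open>Poly\<close>, hence the reversal.\<close>

lemma eval_class_ring: "ring.eval (class_ring :: 'a::field ring) (rev cs) x = poly (Poly cs) x"
proof (induction cs rule: rev_induct)
  case Nil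
  then show ?case by (simp add: ring.eval.simps[OF ring_class_ring])
next
  case (snoc c ds)
  have "ring.eval (class_ring :: 'a ring) (c # rev ds) x = c * x ^ length ds + ring.eval class_ring (rev ds) x"
    by (simp add: ring.eval.simps[OF ring_class_ring] class_ring_simps)
  then show ?case using snoc by (simp add: Poly_snoc poly_monom)
qed

text \<open>Transfers algebraic closedness to the form that \<open>pgl_hom\<close> assumes: a
  polynomial that splits has as many roots, with multiplicity, as its degree, hence at least
  one.\<close>

lemma algebraic_closure_root:
  fixes p :: "'a::field poly"
  assumes "algebraic_closure (class_ring :: 'a ring) F" and p: "0 < Polynomial.degree p"
  shows "\<exists>x. poly p x = 0"
proof -
  interpret C: algebraic_closure "class_ring :: 'a ring" F by fact
  let ?P = "rev (coeffs p)"
  have p0: "p \<noteq> 0" using p by auto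
  then have ne: "coeffs p \<noteq> []" by simp
  have hd: "hd ?P = Polynomial.lead_coeff p"
    using p0 by (simp add: hd_rev last_coeffs_eq_coeff_degree)
  have P: "?P \<in> carrier (poly_ring (class_ring :: 'a ring))"
    unfolding univ_poly_carrier[symmetric] polynomial_def using hd p0 by simp
  have "ring.splitted class_ring ?P" using C.roots_over_carrier P by simp
  then have "size (ring.roots class_ring ?P) = length ?P - 1" by (simp add: ring.splitted_def[OF ring_class_ring])
  also have "\<dots> > 0" using p by (simp add: length_coeffs_degree p0)
  finally obtain x where "x \<in># ring.roots class_ring ?P" by (metis less_numeral_extra(3) multiset_nonemptyE size_empty)
  then have "ring.is_root class_ring ?P x" using domain.roots_mem_iff_is_root[OF domain_class_ring P] by simp
  then have "ring.eval class_ring ?P x = 0" by (simp add: ring.is_root_def[OF ring_class_ring])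
  then show ?thesis using eval_class_ring[of "coeffs p" x] by (intro exI[of _ x]) simp
qed

lemma subfield_closed:
  assumes "subfield F (class_ring :: 'a::field ring)"
  shows "0 \<in> F" "1 \<in> F" "x \<in> F \<Longrightarrow> y \<in> F \<Longrightarrow> x + y \<in> F" "x \<in> F \<Longrightarrow> y \<in> F \<Longrightarrow> x * y \<in> F"
    "x \<in> F \<Longrightarrow> - x \<in> F" "x \<in> F \<Longrightarrow> inverse x \<in> F"
proof -
  note S = subringE[OF subfieldE(1)[OF assms]]
  show "0 \<in> F" "1 \<in> F" using S(2,3) by simp_all
  show "x \<in> F \<Longrightarrow> y \<in> F \<Longrightarrow> x + y \<in> F" "x \<in> F \<Longrightarrow> y \<in> F \<Longrightarrow> x * y \<in> F"
    using S(6,7) by simp_all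
  show "x \<in> F \<Longrightarrow> - x \<in> F" using S(5) by (simp add: class_ring_simps)
  show "inverse x \<in> F" if x: "x \<in> F"
  proof (cases "x = 0")
    case False
    then have "x \<in> Units (class_ring\<lparr>carrier := F\<rparr>)" using x subfield.subfield_Units[OF assms] by simp
    then obtain y where "y \<in> F" "x * y = 1" by (auto simp: Units_def)
    then show ?thesis using inverse_unique by metis
  qed (use x in simp)
qed

lemma line_extension_class_ring:
  "ring.line_extension (class_ring :: 'a::field ring) F v E = {a * v + e | a e. a \<in> F \<and> e \<in> E}"
  unfolding ring.line_extension_def[OF ring_class_ring]
  by (auto simp: set_add_def set_mult_def r_coset_def)

text \<open>If \<open>v\<close> and \<open>u\<close> span \<open>K\<close> over \<open>F\<close>,
  then t = v / u generates \<open>K\<close> and satisfies a quadratic equation; completing the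
  square gives a generator whose square lies in \<open>F\<close>.\<close>

lemma quadratic_generator:
  assumes F: "subfield F (class_ring :: 'a::field_char_0 ring)" and K: "subfield K (class_ring :: 'a ring)"
    and FK: "F \<subseteq> K" and dim: "ring.dimension class_ring 2 F K"
  obtains d where "d \<notin> F" "d * d \<in> F" "K = {x + y * d | x y. x \<in> F \<and> y \<in> F}"
proof -
  note f = subfield_closed[OF F] and k = subfield_closed[OF K]
  have fm: "x \<in> F \<Longrightarrow> y \<in> F \<Longrightarrow> x - y \<in> F" for x y using f(3)[of x "- y"] f(5) by simp
  obtain v E where v: "v \<notin> E" "ring.dimension class_ring 1 F E" "K = {a * v + e | a e. a \<in> F \<and> e \<in> E}"
    using dim by (cases rule: ring.dimension.cases[OF ring_class_ring, consumes 1]) (auto simp: line_extension_class_ring numeral_2_eq_2)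
  obtain u E' where u: "u \<notin> E'" "ring.dimension class_ring 0 F E'" "E = {a * u + e | a e. a \<in> F \<and> e \<in> E'}"
    using v(2) by (cases rule: ring.dimension.cases[OF ring_class_ring, consumes 1]) (auto simp: line_extension_class_ring)
  have "E' = {0}" using u(2) by (cases rule: ring.dimension.cases[OF ring_class_ring, consumes 1]) auto
  then have E: "E = {a * u | a. a \<in> F}" and u0: "u \<noteq> 0" using u by auto
  have Kuv: "K = {a * v + c * u | a c. a \<in> F \<and> c \<in> F}" unfolding v(3) E by auto
  define t where "t = v / u"
  have vt: "v = t * u" using u0 by (simp add: t_def)
  have tF: "t \<notin> F" using v(1) vt by (auto simp: E)
  have "u = 0 * v + 1 * u" "v = 1 * v + 0 * u" by simp_all
  then have uK: "u \<in> K" and vK: "v \<in> K" unfolding Kuv using f(1,2) by blast+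
  have tK: "t \<in> K" using k(4)[OF vK k(6)[OF uK]] by (simp add: t_def divide_inverse)
  have Kt: "\<exists>a\<in>F. \<exists>c\<in>F. x = a * t + c" if x: "x \<in> K" for x
  proof -
    have "x * u \<in> K" using k(4) x uK by blast
    then obtain a c where "a \<in> F" "c \<in> F" "x * u = a * v + c * u" by (auto simp: Kuv)
    then have "x * u = (a * t + c) * u" by (simp add: vt algebra_simps)
    then show ?thesis using u0 \<open>a \<in> F\<close> \<open>c \<in> F\<close> by auto
  qed
  obtain p q where pq: "p \<in> F" "q \<in> F" "t * t = p * t + q" using Kt[of "t * t"] tK k(4) by blast
  have two: "1 / 2 \<in> F" using f(6)[OF f(3)[OF f(2) f(2)]] by simp
  define d where "d = t - p * (1 / 2)"
  have pF: "p * (1 / 2) \<in> F" using f(4) pq two by blast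
  have dd: "d * d = q + (p * (1 / 2)) * (p * (1 / 2))" using pq(3) by (simp add: d_def algebra_simps)
  show thesis
  proof (rule that)
    show "d \<notin> F"
    proof
      assume "d \<in> F"
      then have "d + p * (1 / 2) \<in> F" using f(3) pF by blast
      then show False using tF by (simp add: d_def)
    qed
    show "d * d \<in> F" unfolding dd using f(3,4) pq(2) pF by blast
    show "K = {x + y * d | x y. x \<in> F \<and> y \<in> F}"
    proof
      show "K \<subseteq> {x + y * d | x y. x \<in> F \<and> y \<in> F}"
      proof
        fix x assume "x \<in> K"
        then obtain a c where ac: "a \<in> F" "c \<in> F" "x = a * t + c" using Kt by blast
        then have "x = (c + a * (p * (1 / 2))) + a * d" by (simp add: d_def algebra_simps)
        moreover have "c + a * (p * (1 / 2)) \<in> F" using f(3,4) ac pF by blast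
        ultimately show "x \<in> {x + y * d | x y. x \<in> F \<and> y \<in> F}" using ac by blast
      qed
      have dK: "d \<in> K" using k(3)[OF tK k(5)[of "p * (1 / 2)"]] pF FK by (auto simp: d_def)
      show "{x + y * d | x y. x \<in> F \<and> y \<in> F} \<subseteq> K" using k(3,4) dK FK by blast
    qed
  qed
qed

text \<open>An automorphism over \<open>F\<close> sends d to a square root of d^2, hence to d or -
  d, and is determined by this value. So the description in \<open>conj_over\<close> has exactly one
  solution.\<close>

lemma quad_conj_over:
  assumes F: "subfield F (class_ring :: 'a::field_char_0 ring)" and K: "subfield K (class_ring :: 'a ring)"
    and FK: "F \<subseteq> K" and dim: "ring.dimension class_ring 2 F K"
  shows "\<exists>d. quad F K d (conj_over F K)"
proof -
  note f = subfield_closed[OF F] and k = subfield_closed[OF K]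
  obtain d where d: "d \<notin> F" "d * d \<in> F" "K = {x + y * d | x y. x \<in> F \<and> y \<in> F}"
    by (rule quadratic_generator[OF F K FK dim])
  have d0: "d \<noteq> 0" using d f by auto
  have uniq: "x = x' \<and> y = y'" if "x \<in> F" "y \<in> F" "x' \<in> F" "y' \<in> F" "x + y * d = x' + y' * d" for x y x' y'
  proof -
    have e: "(y - y') * d = x' - x" using that(5) by (simp add: algebra_simps)
    have F': "x' - x \<in> F" "y - y' \<in> F" using f(3)[of x' "- x"] f(3)[of y "- y'"] f(5) that by auto
    have "y = y'"
    proof (rule ccontr)
      assume "y \<noteq> y'"
      then have "d = (x' - x) * inverse (y - y')" using e by (simp add: field_simps)
      then show False using d(1) f(4)[OF F'(1) f(6)[OF F'(2)]] by simp
    qed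
    then show ?thesis using e by simp
  qed
  have ex: "\<exists>c. \<forall>x y. x \<in> F \<longrightarrow> y \<in> F \<longrightarrow> c (x + y * d) = x - y * d"
  proof -
    define c where "c z = (THE w. \<exists>x y. x \<in> F \<and> y \<in> F \<and> z = x + y * d \<and> w = x - y * d)" for z
    have "c (x + y * d) = x - y * d" if "x \<in> F" "y \<in> F" for x y
      unfolding c_def by (rule the_equality) (use that uniq in blast)+
    then show ?thesis by blast
  qed
  then obtain c0 where c0: "\<And>x y. x \<in> F \<Longrightarrow> y \<in> F \<Longrightarrow> c0 (x + y * d) = x - y * d" by blast
  \<comment> \<open>Restricted because the members of \<open>galois_group\<close> are
    extensional.\<close>
  define c where "c = restrict c0 K"
  have q: "quad F K d c"
  proof
    show "c (x + y * d) = x - y * d" if "x \<in> F" "y \<in> F" for x y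
    proof -
      have "x + y * d \<in> K" using d(3) that by blast
      then show ?thesis using c0[OF that] by (simp add: c_def)
    qed
  qed (use f d in auto)
  interpret q: quad F K d c by (rule q)
  have gal: "c \<in> galois_group F K"
  proof -
    have "c \<in> Ring.ring_hom (fld K) (fld K)"
      by (rule ring_hom_memI) (auto simp: q.cj_mult q.cj_add q.cj_F)
    moreover have "bij_betw c K K"
      by (rule bij_betw_byWitness[where f' = c]) (auto simp: q.cj_cj)
    moreover have "c \<in> extensional K" by (simp add: c_def)
    ultimately show ?thesis using q.cj_F by (simp add: galois_group_def ring_iso_def)
  qed
  have "conj_over F K = c"
    unfolding conj_over_def
  proof (rule the_equality)
    show "c \<in> galois_group F K \<and> c \<noteq> (\<lambda>x\<in>K. x)"
    proof
      have "c d \<noteq> d" using q.cj_dl d0 by simp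
      then show "c \<noteq> (\<lambda>x\<in>K. x)" using q.dl_K by auto
    qed (rule gal)
    fix s assume s: "s \<in> galois_group F K \<and> s \<noteq> (\<lambda>x\<in>K. x)"
    then have hom: "s \<in> Ring.ring_hom (fld K) (fld K)" and ext: "s \<in> extensional K" and fixF: "\<And>x. x \<in> F \<Longrightarrow> s x = x"
      by (auto simp: galois_group_def ring_iso_def)
    have sm: "s (x * y) = s x * s y" "s (x + y) = s x + s y" if "x \<in> K" "y \<in> K" for x y
      using ring_hom_mult[OF hom] ring_hom_add[OF hom] that by auto
    have "s d * s d = d * d" using sm(1)[OF q.dl_K q.dl_K] fixF[OF d(2)] by simp
    then have "(s d - d) * (s d + d) = 0" by (simp add: algebra_simps)
    then have "s d = d \<or> s d = - d" by (auto simp: add_eq_0_iff2)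
    moreover have val: "s (x + y * d) = x + y * s d" if "x \<in> F" "y \<in> F" for x y
      using that sm fixF q.F_K q.dl_K by simp
    moreover have "s d \<noteq> d"
    proof
      assume "s d = d"
      then have "s x = x" if "x \<in> K" for x using val that by (auto elim!: q.KE)
      then have "s = (\<lambda>x\<in>K. x)" using ext by (auto simp: extensional_def)
      then show False using s by simp
    qed
    ultimately have "s d = - d" by blast
    then have "s x = c x" if "x \<in> K" for x
      using that by (elim q.KE) (simp add: val q.cj_eq)
    then show "s = c" using ext by (intro extensionalityI[of s K c]) (auto simp: c_def)
  qed
  then show ?thesis using q by blast
qed

lemma CM_field_over_quad:
  assumes "CM_field_over F (K :: 'a::field_char_0 set)"
  shows "\<exists>d. quad F K d (conj_over F K)"
  using assms quad_conj_over[of F K]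
  by (auto simp: CM_field_over_def totally_real_def totally_imaginary_def number_field_def)

section \<open>Restriction of scalars in matrix form\<close>

text \<open>
  For a quadratic extension \<open>K\<close> of \<open>F\<close> one has \<open>K \<otimes>\<^sub>F \<Omega> = \<Omega> \<times> \<Omega>\<close>. In a basis of \<open>K\<^sup>m\<close> over \<open>F\<close>,
  the endomorphisms of \<open>K\<^sup>m \<otimes>\<^sub>F \<Omega>\<close> over this ring are the matrices \<open>emb M N\<close>.
\<close>

locale restriction = quad F K dl cj
  for F K :: "'a::field_char_0 set" and dl :: 'a and cj :: "'a \<Rightarrow> 'a" +
  fixes m n :: nat and P Q :: "'a mat"
  assumes P: "P \<in> carrier_mat m n" and Q: "Q \<in> carrier_mat n m"
    and P_K: "i < m \<Longrightarrow> j < n \<Longrightarrow> P $$ (i, j) \<in> K" and Q_K: "i < n \<Longrightarrow> j < m \<Longrightarrow> Q $$ (i, j) \<in> K"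
    and PQ: "P * Q = 1\<^sub>m m" and PQ': "P * map_mat cj Q = 0\<^sub>m m m"
    and QP: "Q * P + map_mat cj Q * map_mat cj P = 1\<^sub>m n"
begin

text \<open>Omega^n is the sum of two copies of Omega^m, on which \<open>K\<close> acts through the
  inclusion and through \<open>cj\<close>. \<open>P\<close> and \<open>P'\<close> are the
  projections onto the two copies, \<open>Q\<close> and \<open>Q'\<close> the inclusions.\<close>

definition "P' = map_mat cj P"
definition "Q' = map_mat cj Q"

definition emb :: "'a mat \<Rightarrow> 'a mat \<Rightarrow> 'a mat" where
  "emb M N = Q * M * P + Q' * N * P'"

lemma dims [simp]: "P \<in> carrier_mat m n" "Q \<in> carrier_mat n m" "P' \<in> carrier_mat m n" "Q' \<in> carrier_mat n m"
  using P Q by (auto simp: P'_def Q'_def)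

lemma mult_dims [simp]:
  "A \<in> carrier_mat m n \<Longrightarrow> B \<in> carrier_mat n m \<Longrightarrow> A * B \<in> carrier_mat m m"
  "A \<in> carrier_mat n m \<Longrightarrow> B \<in> carrier_mat m n \<Longrightarrow> A * B \<in> carrier_mat n n"
  "A \<in> carrier_mat m m \<Longrightarrow> B \<in> carrier_mat m n \<Longrightarrow> A * B \<in> carrier_mat m n"
  "A \<in> carrier_mat n n \<Longrightarrow> B \<in> carrier_mat n m \<Longrightarrow> A * B \<in> carrier_mat n m"
  "A \<in> carrier_mat n m \<Longrightarrow> B \<in> carrier_mat m m \<Longrightarrow> A * B \<in> carrier_mat n m"
  "A \<in> carrier_mat m n \<Longrightarrow> B \<in> carrier_mat n n \<Longrightarrow> A * B \<in> carrier_mat m n"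
  by auto

lemma cj_mat_mult:
  assumes A: "A \<in> carrier_mat k l" and B: "B \<in> carrier_mat l r"
    and AK: "\<And>i j. i < k \<Longrightarrow> j < l \<Longrightarrow> A $$ (i, j) \<in> K" and BK: "\<And>i j. i < l \<Longrightarrow> j < r \<Longrightarrow> B $$ (i, j) \<in> K"
  shows "map_mat cj (A * B) = map_mat cj A * map_mat cj B"
proof (rule eq_matI)
  fix i j assume "i < dim_row (map_mat cj A * map_mat cj B)" "j < dim_col (map_mat cj A * map_mat cj B)"
  then have ij: "i < k" "j < r" using A B by auto
  have "map_mat cj (A * B) $$ (i, j) = cj (\<Sum>s<l. A $$ (i, s) * B $$ (s, j))"
    using A B ij by (simp add: index_mult_mat'[OF A B ij])
  also have "\<dots> = (\<Sum>s<l. cj (A $$ (i, s)) * cj (B $$ (s, j)))"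
    using AK BK ij by (subst cj_sum) (auto simp: cj_mult)
  also have "\<dots> = (map_mat cj A * map_mat cj B) $$ (i, j)"
    using A B ij by (subst index_mult_mat'[of _ k l _ r]) auto
  finally show "map_mat cj (A * B) $$ (i, j) = (map_mat cj A * map_mat cj B) $$ (i, j)" .
qed (use A B in auto)

lemma cj_mat_cj:
  assumes "A \<in> carrier_mat k l" "\<And>i j. i < k \<Longrightarrow> j < l \<Longrightarrow> A $$ (i, j) \<in> K"
  shows "map_mat cj (map_mat cj A) = A"
  using assms by (intro eq_matI) (auto simp: cj_cj)

lemma K_mat_mult:
  assumes "A \<in> carrier_mat k l" "B \<in> carrier_mat l r"
    "\<And>i j. i < k \<Longrightarrow> j < l \<Longrightarrow> A $$ (i, j) \<in> K" "\<And>i j. i < l \<Longrightarrow> j < r \<Longrightarrow> B $$ (i, j) \<in> K" "i < k" "j < r"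
  shows "(A * B) $$ (i, j) \<in> K"
  unfolding index_mult_mat'[OF assms(1,2,5,6)] using assms by (intro K_sum K_mult) auto

lemma P'Q': "P' * Q' = 1\<^sub>m m"
proof -
  have "P' * Q' = map_mat cj (P * Q)"
    unfolding P'_def Q'_def by (rule cj_mat_mult[symmetric, OF P Q]) (auto simp: P_K Q_K)
  also have "\<dots> = 1\<^sub>m m" unfolding PQ by (intro eq_matI) (auto simp: cj_F)
  finally show ?thesis .
qed

lemma P'Q: "P' * Q = 0\<^sub>m m m"
proof -
  have "P' * Q = P' * map_mat cj Q'" unfolding Q'_def by (subst cj_mat_cj[OF Q]) (auto simp: Q_K)
  also have "\<dots> = map_mat cj (P * Q')"
    unfolding P'_def by (rule cj_mat_mult[symmetric, of _ m n _ m]) (use carrier_matD[OF Q] in \<open>auto simp: P_K Q'_def Q_K\<close>)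
  also have "\<dots> = 0\<^sub>m m m" unfolding Q'_def PQ' by (intro eq_matI) (auto simp: cj_F)
  finally show ?thesis .
qed

lemma PQ'': "P * Q' = 0\<^sub>m m m"
  using PQ' by (simp add: Q'_def)

lemma asc:
  "A \<in> carrier_mat k1 k2 \<Longrightarrow> B \<in> carrier_mat k2 k3 \<Longrightarrow> C \<in> carrier_mat k3 k4 \<Longrightarrow> A * B * C = A * (B * (C::'a mat))"
  by (rule assoc_mult_mat)

lemmas assoc =
  asc[of _ m m _ m _ m] asc[of _ m m _ m _ n] asc[of _ m m _ n _ m] asc[of _ m m _ n _ n] asc[of _ m n
  _ m _ m] asc[of _ m n _ m _ n] asc[of _ m n _ n _ m] asc[of _ m n _ n _ n] asc[of _ n m _ m _ m]
  asc[of _ n m _ m _ n] asc[of _ n m _ n _ m] asc[of _ n m _ n _ n] asc[of _ n n _ m _ m] asc[of _ n n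
  _ m _ n] asc[of _ n n _ n _ m] asc[of _ n n _ n _ n]

lemma cancel:
  assumes "Z \<in> carrier_mat m k"
  shows "P * (Q * Z) = Z" "P * (Q' * Z) = 0\<^sub>m m k" "P' * (Q' * Z) = Z" "P' * (Q * Z) = 0\<^sub>m m k"
  using assms assoc_mult_mat[of P m n Q m Z k] assoc_mult_mat[of P m n Q' m Z k]
    assoc_mult_mat[of P' m n Q m Z k] assoc_mult_mat[of P' m n Q' m Z k]
  by (simp_all add: PQ PQ'' P'Q P'Q')

lemma emb_carrier [simp]: "M \<in> carrier_mat m m \<Longrightarrow> N \<in> carrier_mat m m \<Longrightarrow> emb M N \<in> carrier_mat n n"
  by (auto simp: emb_def)

lemma P_emb:
  assumes [simp]: "M \<in> carrier_mat m m" "N \<in> carrier_mat m m"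
  shows "P * emb M N = M * P" "P' * emb M N = N * P'"
  unfolding emb_def
  by (simp_all add: mult_add_distrib_mat[of _ m n _ n] assoc cancel[of _ n] left_add_zero_mat right_add_zero_mat[of _ m n])

lemma emb_mult:
  assumes [simp]: "M \<in> carrier_mat m m" "N \<in> carrier_mat m m" "M' \<in> carrier_mat m m" "N' \<in> carrier_mat m m"
  shows "emb M N * emb M' N' = emb (M * M') (N * N')"
proof -
  have "emb M N * emb M' N' = Q * (M * (P * emb M' N')) + Q' * (N * (P' * emb M' N'))"
    unfolding emb_def[of M N] by (simp add: add_mult_distrib_mat[of _ n n _ _ n] assoc)
  then show ?thesis unfolding P_emb[OF assms(3,4)] by (simp add: emb_def assoc)
qed

lemma P_emb_Q:
  assumes [simp]: "M \<in> carrier_mat m m" "N \<in> carrier_mat m m"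
  shows "P * emb M N * Q = M" and "P' * emb M N * Q' = N"
  by (simp_all add: P_emb[OF assms] assoc PQ P'Q' right_mult_one_mat[of _ m m])

lemma emb_inject:
  assumes "M \<in> carrier_mat m m" "N \<in> carrier_mat m m" "M' \<in> carrier_mat m m" "N' \<in> carrier_mat m m"
  shows "emb M N = emb M' N' \<longleftrightarrow> M = M' \<and> N = N'"
  using P_emb_Q[OF assms(1,2)] P_emb_Q[OF assms(3,4)] by metis

lemma emb_one [simp]: "emb (1\<^sub>m m) (1\<^sub>m m) = 1\<^sub>m n"
  using QP right_mult_one_mat[OF Q] right_mult_one_mat[OF dims(4)] by (simp add: emb_def P'_def Q'_def)

text \<open>Multiplication by \<open>dl\<close> has the eigenvalues dl and - dl on the two summands.
  They differ, so a matrix commuting with it has no off-diagonal blocks.\<close>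

lemma emb_commuting:
  assumes g: "g \<in> carrier_mat n n"
    and c: "g * emb (dl \<cdot>\<^sub>m 1\<^sub>m m) (- dl \<cdot>\<^sub>m 1\<^sub>m m) = emb (dl \<cdot>\<^sub>m 1\<^sub>m m) (- dl \<cdot>\<^sub>m 1\<^sub>m m) * g"
  shows "g = emb (P * g * Q) (P' * g * Q')"
proof -
  note [simp] = g
  let ?e = "emb (dl \<cdot>\<^sub>m 1\<^sub>m m) (- dl \<cdot>\<^sub>m 1\<^sub>m m)"
  have dl0: "dl \<noteq> 0" using dl by auto
  have Pe: "P * ?e = dl \<cdot>\<^sub>m P" "P' * ?e = - dl \<cdot>\<^sub>m P'"
    by (simp_all add: P_emb mult_smult_assoc_mat[of _ m m _ n] left_mult_one_mat[of _ m n])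
  have eQ: "?e * Q = dl \<cdot>\<^sub>m Q" "?e * Q' = - dl \<cdot>\<^sub>m Q'"
    unfolding emb_def
    by (simp_all add: add_mult_distrib_mat[of _ n n _ _ m] assoc PQ PQ'' P'Q P'Q' mult_smult_distrib[of _ n m _ m]
      mult_smult_assoc_mat[of _ m m _ m] right_mult_one_mat[of _ n m] right_mult_zero_mat[of _ n m] right_mult_zero_mat[of _ m m]
      right_add_zero_mat[of _ n m] left_add_zero_mat[of _ n m])
  have zero: "A = 0\<^sub>m m m" if A: "A \<in> carrier_mat m m" and e: "k \<cdot>\<^sub>m A = - k \<cdot>\<^sub>m A" and k: "k \<noteq> 0" for A and k :: 'a
  proof (rule eq_matI)
    fix i j assume ij: "i < dim_row (0\<^sub>m m m :: 'a mat)" "j < dim_col (0\<^sub>m m m :: 'a mat)"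
    have "(k \<cdot>\<^sub>m A) $$ (i, j) = (- k \<cdot>\<^sub>m A) $$ (i, j)" using e by simp
    then have "2 * (k * A $$ (i, j)) = 0" using A ij by simp
    then show "A $$ (i, j) = 0\<^sub>m m m $$ (i, j)" using k ij by simp
  qed (use A in auto)
  have "P * (g * ?e) * Q' = P * (?e * g) * Q'" by (simp only: c)
  then have "P * g * (?e * Q') = (P * ?e) * g * Q'" by (simp add: assoc)
  then have "- dl \<cdot>\<^sub>m (P * g * Q') = dl \<cdot>\<^sub>m (P * g * Q')"
    unfolding Pe eQ by (simp add: mult_smult_distrib[of _ m n _ m] mult_smult_assoc_mat[of _ m n _ n] mult_smult_assoc_mat[of _ m n _ m])
  then have z1: "P * g * Q' = 0\<^sub>m m m" by (intro zero[of _ dl]) (auto simp: dl0)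
  have "P' * (g * ?e) * Q = P' * (?e * g) * Q" by (simp only: c)
  then have "P' * g * (?e * Q) = (P' * ?e) * g * Q" by (simp add: assoc)
  then have "dl \<cdot>\<^sub>m (P' * g * Q) = - dl \<cdot>\<^sub>m (P' * g * Q)"
    unfolding Pe eQ by (simp add: mult_smult_distrib[of _ m n _ m] mult_smult_assoc_mat[of _ m n _ n] mult_smult_assoc_mat[of _ m n _ m])
  then have z2: "P' * g * Q = 0\<^sub>m m m" by (intro zero[of _ dl]) (auto simp: dl0)
  have "g = 1\<^sub>m n * g * 1\<^sub>m n" using left_mult_one_mat[OF g] right_mult_one_mat[OF g] by simp
  also have "\<dots> = (Q * P + Q' * P') * g * (Q * P + Q' * P')" by (simp add: QP P'_def Q'_def)
  also have "\<dots> = (Q * (P * g * Q) * P + Q * (P * g * Q') * P') + (Q' * (P' * g * Q) * P + Q' * (P' * g * Q') * P')"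
    by (simp add: mult_add_distrib_mat[of _ n n _ n] add_mult_distrib_mat[of _ n n _ _ n] assoc)
      (intro eq_matI, simp_all add: carrier_matD[OF dims(1)] carrier_matD[OF dims(2)] carrier_matD[OF dims(3)]
        carrier_matD[OF dims(4)] add_ac del: index_mult_mat(1))
  also have "\<dots> = emb (P * g * Q) (P' * g * Q')"
    unfolding z1 z2 emb_def
    by (simp add: right_mult_zero_mat[of _ n m] left_mult_zero_mat[of _ m n] right_add_zero_mat[of _ n n] left_add_zero_mat[of _ n n])
  finally show ?thesis .
qed

text \<open>The two summands of \<open>emb\<close> are conjugate to each other here, so each entry
  is a trace x + cj x.\<close>

lemma emb_F:
  assumes E: "E \<in> mat_over K m" shows "emb E (map_mat cj E) \<in> mat_over F n"
proof -
  have [simp]: "E \<in> carrier_mat m m" using E by (auto simp: mat_over_def)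
  have EK: "E $$ (i, j) \<in> K" if "i < m" "j < m" for i j using E that by (auto simp: mat_over_def)
  have QE: "(Q * E) $$ (i, j) \<in> K" if "i < n" "j < m" for i j
    by (rule K_mat_mult[of _ n m _ m]) (auto simp: that Q_K EK)
  have QEP: "(Q * E * P) $$ (i, j) \<in> K" if "i < n" "j < n" for i j
    by (rule K_mat_mult[of _ n m _ n]) (auto simp: that P_K QE simp del: index_mult_mat(1))
  have "Q' * map_mat cj E * P' = map_mat cj (Q * E * P)"
  proof -
    have "map_mat cj (Q * E * P) = map_mat cj (Q * E) * P'"
      unfolding P'_def by (rule cj_mat_mult[of _ n m _ n]) (auto simp: P_K QE simp del: index_mult_mat(1))
    moreover have "map_mat cj (Q * E) = Q' * map_mat cj E"
      unfolding Q'_def by (rule cj_mat_mult[of _ n m _ m]) (auto simp: Q_K EK)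
    ultimately show ?thesis by simp
  qed
  then have "emb E (map_mat cj E) = Q * E * P + map_mat cj (Q * E * P)" by (simp add: emb_def)
  moreover have "x + cj x \<in> F" if "x \<in> K" for x
    by (rule cj_fixed) (use that in \<open>simp_all add: cj_add cj_cj add.commute\<close>)
  ultimately show ?thesis using QEP carrier_matD[OF P] carrier_matD[OF Q] by (auto simp: mat_over_def simp del: index_mult_mat(1))
qed

text \<open>The blocks are recovered as P g Q and P' g Q', and conjugating the first gives the
  second when g has entries in \<open>F\<close>.\<close>

lemma emb_F_D:
  assumes M: "M \<in> carrier_mat m m" "N \<in> carrier_mat m m" and e: "emb M N \<in> mat_over F n"
  shows "M \<in> mat_over K m" "N = map_mat cj M"
proof -
  let ?g = "emb M N"
  have [simp]: "?g \<in> carrier_mat n n" using M by simp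
  have gF: "?g $$ (i, j) \<in> F" if "i < n" "j < n" for i j using e that by (auto simp: mat_over_def)
  have PgK: "(P * ?g) $$ (i, j) \<in> K" if "i < m" "j < n" for i j
    by (rule K_mat_mult[of _ m n _ n]) (auto simp: that P_K F_K[OF gF])
  have "(P * ?g * Q) $$ (i, j) \<in> K" if "i < m" "j < m" for i j
    by (rule K_mat_mult[of _ m n _ m]) (auto simp: that Q_K PgK simp del: index_mult_mat(1))
  then show "M \<in> mat_over K m" using P_emb_Q(1)[OF M] M by (auto simp: mat_over_def)
  have g': "map_mat cj ?g = ?g" by (rule eq_matI) (use gF carrier_matD[OF \<open>?g \<in> carrier_mat n n\<close>] in \<open>auto simp: cj_F\<close>)
  have "map_mat cj M = map_mat cj (P * ?g * Q)" using P_emb_Q(1)[OF M] by simp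
  also have "\<dots> = P' * ?g * Q'"
    by (subst cj_mat_mult[of _ m n _ m], (auto simp: Q_K PgK simp del: index_mult_mat(1))[4])
      (subst cj_mat_mult[of _ m n _ n], (auto simp: P_K F_K[OF gF])[4], simp only: g' P'_def Q'_def)
  also have "\<dots> = N" by (rule P_emb_Q(2)[OF M])
  finally show "N = map_mat cj M" ..
qed

end

section \<open>Adjoint groups\<close>

lemma (in group) normal_center: "center_of G \<lhd> G"
proof (rule normalI)
  show "subgroup (center_of G) G"
  proof
    show "center_of G \<subseteq> carrier G" by (auto simp: center_of_def)
    show "\<one> \<in> center_of G" by (simp add: center_of_def)
    fix y z assume z: "y \<in> center_of G" "z \<in> center_of G"
    then have c: "y \<in> carrier G" "z \<in> carrier G" by (auto simp: center_of_def)
    have "y \<otimes> z \<otimes> g = g \<otimes> (y \<otimes> z)" if g: "g \<in> carrier G" for g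
    proof -
      have yz: "y \<otimes> g = g \<otimes> y" "z \<otimes> g = g \<otimes> z" using z g unfolding center_of_def by blast+
      have "y \<otimes> z \<otimes> g = y \<otimes> (z \<otimes> g)" by (rule m_assoc[OF c g])
      also have "\<dots> = y \<otimes> g \<otimes> z" unfolding yz(2) by (rule m_assoc[OF c(1) g c(2), symmetric])
      also have "\<dots> = g \<otimes> (y \<otimes> z)" unfolding yz(1) by (rule m_assoc[OF g c])
      finally show ?thesis .
    qed
    then show "y \<otimes> z \<in> center_of G" using c by (simp add: center_of_def)
  next
    fix z assume z: "z \<in> center_of G"
    then have c: "z \<in> carrier G" by (auto simp: center_of_def)
    have "inv z \<otimes> g = g \<otimes> inv z" if g: "g \<in> carrier G" for g
    proof -
      have "z \<otimes> g = g \<otimes> z" using z g unfolding center_of_def by blast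
      then have "g = z \<otimes> g \<otimes> inv z" using c g by (metis inv_solve_right m_closed)
      also have "\<dots> = z \<otimes> (g \<otimes> inv z)" using c g by (simp add: m_assoc)
      finally show ?thesis using c g by (metis inv_closed inv_solve_left m_closed)
    qed
    then show "inv z \<in> center_of G" using c by (simp add: center_of_def)
  qed
  show "\<forall>y\<in>carrier G. center_of G #> y = y <# center_of G"
  proof
    fix y assume y: "y \<in> carrier G"
    have "z \<otimes> y = y \<otimes> z" if "z \<in> center_of G" for z using that y unfolding center_of_def by blast
    then show "center_of G #> y = y <# center_of G" unfolding r_coset_def l_coset_def by (intro SUP_cong refl) simp
  qed
qed

text \<open>\<open>s\<close> picks a representative of the image of each coset, so products are
  preserved modulo the center of \<open>H\<close>. A regular function on \<open>H\<close> that is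
  invariant under the center descends to the quotient, which is why it can be pulled back along
  \<open>s\<close>.\<close>

lemma adjoint_group_iso_lift:
  fixes G :: "('g, 'a) algebraic_group" and H :: "('h, 'a) algebraic_group"
  assumes G: "group G" and H: "group H"
    and phi: "\<phi> \<in> algebraic_group_iso (adjoint_group G) (adjoint_group H)"
  obtains s where "\<forall>g\<in>carrier G. s g \<in> carrier H"
    "\<forall>g\<in>carrier G. \<forall>h\<in>carrier G. \<exists>z\<in>center_of H. s (g \<otimes>\<^bsub>G\<^esub> h) = z \<otimes>\<^bsub>H\<^esub> (s g \<otimes>\<^bsub>H\<^esub> s h)"
    "\<forall>g\<in>carrier G. s g \<in> center_of H \<longrightarrow> g \<in> center_of G"
    "\<forall>p. restrict p (carrier H) \<in> regular H \<longrightarrow>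
      (\<forall>z\<in>center_of H. \<forall>g\<in>carrier H. p (z \<otimes>\<^bsub>H\<^esub> g) = p g) \<longrightarrow>
      (\<exists>q\<in>regular G. \<forall>g\<in>carrier G. q g = p (s g))"
proof -
  interpret G: group G by (rule G)
  interpret H: group H by (rule H)
  interpret ZG: normal "center_of G" G by (rule G.normal_center)
  interpret ZH: normal "center_of H" H by (rule H.normal_center)
  let ?ZG = "center_of G" and ?ZH = "center_of H"
  have cG: "carrier (adjoint_group G) = rcosets\<^bsub>G\<^esub> ?ZG" and cH: "carrier (adjoint_group H) = rcosets\<^bsub>H\<^esub> ?ZH"
    by (simp_all add: adjoint_group_def algebraic_quotient_def FactGroup_def)
  have mG: "(?ZG #>\<^bsub>G\<^esub> g) \<otimes>\<^bsub>adjoint_group G\<^esub> (?ZG #>\<^bsub>G\<^esub> h) = ?ZG #>\<^bsub>G\<^esub> (g \<otimes>\<^bsub>G\<^esub> h)"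
    if "g \<in> carrier G" "h \<in> carrier G" for g h
    using that by (simp add: adjoint_group_def algebraic_quotient_def FactGroup_def ZG.rcos_sum)
  have mH: "(?ZH #>\<^bsub>H\<^esub> g) \<otimes>\<^bsub>adjoint_group H\<^esub> (?ZH #>\<^bsub>H\<^esub> h) = ?ZH #>\<^bsub>H\<^esub> (g \<otimes>\<^bsub>H\<^esub> h)"
    if "g \<in> carrier H" "h \<in> carrier H" for g h
    using that by (simp add: adjoint_group_def algebraic_quotient_def FactGroup_def ZH.rcos_sum)
  have hom: "\<phi> \<in> hom (adjoint_group G) (adjoint_group H)" and inj: "inj_on \<phi> (rcosets\<^bsub>G\<^esub> ?ZG)"
    and reg: "\<And>f. f \<in> regular (adjoint_group H) \<Longrightarrow> compose (rcosets\<^bsub>G\<^esub> ?ZG) f \<phi> \<in> regular (adjoint_group G)"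
    using phi by (auto simp: algebraic_group_iso_def Group.iso_def bij_betw_def cG)
  have cos: "?ZG #>\<^bsub>G\<^esub> g \<in> rcosets\<^bsub>G\<^esub> ?ZG" if "g \<in> carrier G" for g
    using that by (rule G.rcosetsI[OF ZG.subset])
  have cosH: "?ZH #>\<^bsub>H\<^esub> g \<in> rcosets\<^bsub>H\<^esub> ?ZH" if "g \<in> carrier H" for g
    using that by (rule H.rcosetsI[OF ZH.subset])
  have "\<forall>g\<in>carrier G. \<exists>h\<in>carrier H. \<phi> (?ZG #>\<^bsub>G\<^esub> g) = ?ZH #>\<^bsub>H\<^esub> h"
  proof
    fix g assume g: "g \<in> carrier G"
    have "\<phi> (?ZG #>\<^bsub>G\<^esub> g) \<in> rcosets\<^bsub>H\<^esub> ?ZH" using hom_carrier[OF hom] cos[OF g] unfolding cG cH by blast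
    then show "\<exists>h\<in>carrier H. \<phi> (?ZG #>\<^bsub>G\<^esub> g) = ?ZH #>\<^bsub>H\<^esub> h" by (auto simp: RCOSETS_def)
  qed
  from bchoice[OF this[unfolded Bex_def]] obtain s
    where s0: "\<forall>g\<in>carrier G. s g \<in> carrier H \<and> \<phi> (?ZG #>\<^bsub>G\<^esub> g) = ?ZH #>\<^bsub>H\<^esub> s g" ..
  have s: "s g \<in> carrier H" if "g \<in> carrier G" for g using bspec[OF s0 that] ..
  have phis: "\<phi> (?ZG #>\<^bsub>G\<^esub> g) = ?ZH #>\<^bsub>H\<^esub> s g" if "g \<in> carrier G" for g using bspec[OF s0 that] ..
  have sub: "subgroup ?ZG G" "subgroup ?ZH H" by unfold_locales
  show thesis
  proof (rule that)
    show "\<forall>g\<in>carrier G. s g \<in> carrier H" using s by blast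
    have "\<exists>z\<in>center_of H. s (g \<otimes>\<^bsub>G\<^esub> h) = z \<otimes>\<^bsub>H\<^esub> (s g \<otimes>\<^bsub>H\<^esub> s h)" if gh: "g \<in> carrier G" "h \<in> carrier G" for g h
    proof -
      have "?ZH #>\<^bsub>H\<^esub> s (g \<otimes>\<^bsub>G\<^esub> h) = \<phi> ((?ZG #>\<^bsub>G\<^esub> g) \<otimes>\<^bsub>adjoint_group G\<^esub> (?ZG #>\<^bsub>G\<^esub> h))"
        unfolding mG[OF gh] using phis gh by simp
      also have "\<dots> = ?ZH #>\<^bsub>H\<^esub> (s g \<otimes>\<^bsub>H\<^esub> s h)"
        using hom_mult[OF hom] cos gh s by (simp add: cG phis mH)
      finally have "s (g \<otimes>\<^bsub>G\<^esub> h) \<in> ?ZH #>\<^bsub>H\<^esub> (s g \<otimes>\<^bsub>H\<^esub> s h)"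
        using H.rcos_self[OF s sub(2), of "g \<otimes>\<^bsub>G\<^esub> h"] gh by simp
      then show ?thesis by (auto simp: r_coset_def)
    qed
    then show "\<forall>g\<in>carrier G. \<forall>h\<in>carrier G. \<exists>z\<in>center_of H. s (g \<otimes>\<^bsub>G\<^esub> h) = z \<otimes>\<^bsub>H\<^esub> (s g \<otimes>\<^bsub>H\<^esub> s h)"
      by (intro ballI)
    have "g \<in> center_of G" if g: "g \<in> carrier G" "s g \<in> center_of H" for g
    proof -
      \<comment> \<open>The representative of the image of the identity can be any central element,
        so \<open>s\<close> of the identity is first shown to be central.\<close>
      have one: "\<one>\<^bsub>G\<^esub> \<in> carrier G" by simp
      have "?ZH #>\<^bsub>H\<^esub> (s \<one>\<^bsub>G\<^esub> \<otimes>\<^bsub>H\<^esub> s \<one>\<^bsub>G\<^esub>) = \<phi> ((?ZG #>\<^bsub>G\<^esub> \<one>\<^bsub>G\<^esub>) \<otimes>\<^bsub>adjoint_group G\<^esub> (?ZG #>\<^bsub>G\<^esub> \<one>\<^bsub>G\<^esub>))"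
        using hom_mult[OF hom] cos[OF one] s[OF one] by (simp add: cG phis mH)
      also have "\<dots> = ?ZH #>\<^bsub>H\<^esub> s \<one>\<^bsub>G\<^esub>" unfolding mG[OF one one] using phis[OF one] by simp
      finally have "s \<one>\<^bsub>G\<^esub> \<otimes>\<^bsub>H\<^esub> s \<one>\<^bsub>G\<^esub> \<in> ?ZH #>\<^bsub>H\<^esub> s \<one>\<^bsub>G\<^esub>"
        using H.rcos_self[OF _ sub(2), of "s \<one>\<^bsub>G\<^esub> \<otimes>\<^bsub>H\<^esub> s \<one>\<^bsub>G\<^esub>"] s[OF one] by simp
      then obtain z where z: "z \<in> ?ZH" "s \<one>\<^bsub>G\<^esub> \<otimes>\<^bsub>H\<^esub> s \<one>\<^bsub>G\<^esub> = z \<otimes>\<^bsub>H\<^esub> s \<one>\<^bsub>G\<^esub>" by (auto simp: r_coset_def)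
      have "z \<in> carrier H" using z(1) ZH.subset by blast
      then have "s \<one>\<^bsub>G\<^esub> \<in> ?ZH" using z s[OF one] by (metis H.r_cancel)
      then have "?ZH #>\<^bsub>H\<^esub> s \<one>\<^bsub>G\<^esub> = ?ZH #>\<^bsub>H\<^esub> s g"
        using H.coset_join2[OF s[OF one] sub(2)] H.coset_join2[OF s[OF g(1)] sub(2) g(2)] by simp
      then have "\<phi> (?ZG #>\<^bsub>G\<^esub> \<one>\<^bsub>G\<^esub>) = \<phi> (?ZG #>\<^bsub>G\<^esub> g)" using phis one g(1) by simp
      then have "?ZG #>\<^bsub>G\<^esub> \<one>\<^bsub>G\<^esub> = ?ZG #>\<^bsub>G\<^esub> g" using inj cos[OF one] cos[OF g(1)] by (auto dest: inj_onD)
      then have "g \<in> ?ZG #>\<^bsub>G\<^esub> \<one>\<^bsub>G\<^esub>" using G.rcos_self[OF g(1) sub(1)] by simp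
      then show ?thesis using ZG.subset by (auto simp: r_coset_def)
    qed
    then show "\<forall>g\<in>carrier G. s g \<in> center_of H \<longrightarrow> g \<in> center_of G" by (intro ballI impI)
    have "\<exists>q\<in>regular G. \<forall>g\<in>carrier G. q g = p (s g)"
      if p: "restrict p (carrier H) \<in> regular H" "\<forall>z\<in>center_of H. \<forall>g\<in>carrier H. p (z \<otimes>\<^bsub>H\<^esub> g) = p g" for p
    proof -
      \<comment> \<open>The value of \<open>p\<close> at some representative of the coset;
        invariance under the center makes the choice immaterial.\<close>
      define r where "r = (\<lambda>C\<in>rcosets\<^bsub>H\<^esub> ?ZH. p (SOME h. h \<in> C))"
      have r: "r (?ZH #>\<^bsub>H\<^esub> h) = p h" if h: "h \<in> carrier H" for h
      proof -
        have "(SOME y. y \<in> ?ZH #>\<^bsub>H\<^esub> h) \<in> ?ZH #>\<^bsub>H\<^esub> h" by (rule someI, rule H.rcos_self[OF h sub(2)])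
        then obtain z where z: "z \<in> ?ZH" "(SOME y. y \<in> ?ZH #>\<^bsub>H\<^esub> h) = z \<otimes>\<^bsub>H\<^esub> h" by (auto simp: r_coset_def)
        show ?thesis unfolding r_def using cosH[OF h] z p(2) h by simp
      qed
      have "(\<lambda>h\<in>carrier H. r (?ZH #>\<^bsub>H\<^esub> h)) = restrict p (carrier H)" by (rule restrict_ext) (rule r)
      then have "r \<in> regular (adjoint_group H)"
        using p(1) by (auto simp: adjoint_group_def algebraic_quotient_def FactGroup_def r_def)
      from reg[OF this]
      have "(\<lambda>g\<in>carrier G. compose (rcosets\<^bsub>G\<^esub> ?ZG) r \<phi> (?ZG #>\<^bsub>G\<^esub> g)) \<in> regular G"
        by (auto simp: adjoint_group_def algebraic_quotient_def)
      then show ?thesis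
        by (rule bexI[rotated]) (simp add: compose_eq cos phis r s)
    qed
    then show "\<forall>p. restrict p (carrier H) \<in> regular H \<longrightarrow>
      (\<forall>z\<in>center_of H. \<forall>g\<in>carrier H. p (z \<otimes>\<^bsub>H\<^esub> g) = p g) \<longrightarrow>
      (\<exists>q\<in>regular G. \<forall>g\<in>carrier G. q g = p (s g))"
      by (intro allI impI)
  qed
qed

section \<open>Unitary groups in matrix form\<close>

lemma dim_mat_diag [simp]: "dim_row (mat_diag m s) = m" "dim_col (mat_diag m s) = m"
  by (simp_all add: mat_diag_def)

text \<open>Inverse and transpose both reverse products, and the inner diagonal factors
  cancel.\<close>

lemma hthe_mult:
  assumes A: "A \<in> GLm m" and B: "B \<in> GLm m" and a: "\<And>k. k < m \<Longrightarrow> a k \<noteq> 0"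
  shows "hthe m a (A * B) = hthe m a A * hthe m a B"
proof -
  have [simp]: "A \<in> carrier_mat m m" "B \<in> carrier_mat m m" using A B GLm_carrier by auto
  have D: "mat_diag m a * (mat_diag m (\<lambda>i. inverse (a i)) * Z) = Z" if Z: "Z \<in> carrier_mat m m" for Z
  proof -
    have "mat_diag m a * mat_diag m (\<lambda>i. inverse (a i)) = 1\<^sub>m m"
      using minv_right[OF mat_diag_GLm(1)[of m a]] mat_diag_GLm(2)[of m a] a by simp
    then show ?thesis using Z by (simp add: assoc_mult_mat[of _ m m _ m _ m, symmetric] del: mat_diag_diag)
  qed
  show ?thesis
    by (simp add: hthe_def minv_mult[OF A B] transpose_mult[of _ m m _ m] assoc_mult_mat[of _ m m _ m _ m] D del: mat_diag_diag)
qed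

lemma hthe_scalar:
  assumes "k \<noteq> 0" "\<And>i. i < m \<Longrightarrow> a i \<noteq> 0"
  shows "hthe m a (k \<cdot>\<^sub>m 1\<^sub>m m) = inverse k \<cdot>\<^sub>m 1\<^sub>m m"
  using assms minv_smult[OF assms(1) GLm_one] by (auto intro!: eq_matI simp: hthe_def index_diag_conj simp del: index_mult_mat(1))

text \<open>The equation exhibits an inverse of the transpose of \<open>A\<close>, and this inverse
  determines \<open>B\<close>. Hence the unitary group over Omega is a copy of GL_m.\<close>

lemma isometry_iff_hthe:
  assumes a: "\<And>i. i < m \<Longrightarrow> a i \<noteq> 0" and A: "A \<in> carrier_mat m m" and B: "B \<in> carrier_mat m m"
  shows "A\<^sup>T * mat_diag m a * B = mat_diag m a \<longleftrightarrow> A \<in> GLm m \<and> B = hthe m a A"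
proof
  let ?H = "mat_diag m a" and ?H' = "mat_diag m (\<lambda>i. inverse (a i))"
  note [simp] = A B
  have H: "?H \<in> GLm m" "minv ?H = ?H'" using mat_diag_GLm[of m a] a by auto
  have H'H: "?H' * ?H = 1\<^sub>m m" and HH': "?H * ?H' = 1\<^sub>m m" using minv_left[OF H(1)] minv_right[OF H(1)] H(2) by simp_all
  {
    assume e: "A\<^sup>T * ?H * B = ?H"
    have "A\<^sup>T * (?H * B * ?H') = A\<^sup>T * ?H * B * ?H'" by (simp add: assoc_mult_mat[of _ m m _ m _ m] del: mat_diag_diag)
    also have "\<dots> = 1\<^sub>m m" unfolding e HH' ..
    finally have 1: "A\<^sup>T * (?H * B * ?H') = 1\<^sub>m m" .
    have AT: "A\<^sup>T \<in> GLm m" by (rule GLmI(1)[OF _ _ 1]) auto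
    from GLm_transpose[OF this] have AG: "A \<in> GLm m" by simp
    have mA: "minv (A\<^sup>T) = ?H * B * ?H'" by (rule minv_unique(1)[OF _ _ 1]) auto
    have "hthe m a A = ?H' * (?H * B * ?H') * ?H" unfolding hthe_def minv_transpose[OF AG, symmetric] mA ..
    also have "\<dots> = (?H' * ?H) * B * (?H' * ?H)" by (simp add: assoc_mult_mat[of _ m m _ m _ m] del: mat_diag_diag)
    also have "\<dots> = B" unfolding H'H using left_mult_one_mat[OF B] right_mult_one_mat[OF B] by simp
    finally show "A \<in> GLm m \<and> B = hthe m a A" using AG by simp
  }
  {
    assume "A \<in> GLm m \<and> B = hthe m a A"
    then have AG: "A \<in> GLm m" and Be: "B = hthe m a A" by auto
    have "A\<^sup>T * ?H * B = A\<^sup>T * (?H * ?H') * minv (A\<^sup>T) * ?H"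
      unfolding Be hthe_def minv_transpose[OF AG] by (simp add: assoc_mult_mat[of _ m m _ m _ m] del: mat_diag_diag)
    also have "\<dots> = ?H" unfolding HH' using minv_right[OF GLm_transpose[OF AG]]
      by (simp add: right_mult_one_mat[of _ m m] left_mult_one_mat[of _ m m])
    finally show "A\<^sup>T * ?H * B = ?H" .
  }
qed

locale unitary = restriction F K dl cj m n P Q
  for F K :: "'a::field_char_0 set" and dl :: 'a and cj :: "'a \<Rightarrow> 'a" and m n :: nat and P Q :: "'a mat" +
  fixes a :: "nat \<Rightarrow> 'a"
  assumes a_F: "k < m \<Longrightarrow> a k \<in> F" and a_0: "k < m \<Longrightarrow> a k \<noteq> 0" and m0: "0 < m"
begin

abbreviation "H \<equiv> mat_diag m a"

text \<open>The isomorphism from GL_m onto the Omega-points of the unitary group: \<open>A\<close>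
  acts on the first summand, and the form dictates the action on the second.\<close>

definition "iota A = emb A (hthe m a A)"

definition unitary_group :: "('a mat, 'a) algebraic_group" where
  "unitary_group = \<lparr>carrier = iota ` GLm m, monoid.mult = (*), one = 1\<^sub>m n,
     regular = (\<lambda>p. restrict p (iota ` GLm m)) ` GL_regular F n\<rparr>"

lemma hthe_GL [simp]: "A \<in> GLm m \<Longrightarrow> hthe m a A \<in> GLm m"
  using hthe_GLm(1) a_0 by blast

lemma GL_dims: "A \<in> GLm m \<Longrightarrow> A \<in> carrier_mat m m"
  by (rule GLm_carrier)

lemma iota_mult: "A \<in> GLm m \<Longrightarrow> B \<in> GLm m \<Longrightarrow> iota A * iota B = iota (A * B)"
  unfolding iota_def by (subst emb_mult) (simp_all add: GL_dims hthe_mult a_0)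

lemma iota_one [simp]: "iota (1\<^sub>m m) = 1\<^sub>m n"
  using hthe_scalar[of 1 m a] a_0 by (simp add: iota_def)

lemma iota_inject: "A \<in> GLm m \<Longrightarrow> B \<in> GLm m \<Longrightarrow> iota A = iota B \<longleftrightarrow> A = B"
  unfolding iota_def by (subst emb_inject) (auto simp: GL_dims)

lemma iota_carrier: "A \<in> GLm m \<Longrightarrow> iota A \<in> carrier_mat n n"
  by (simp add: iota_def GL_dims)

lemma iota_GLm: assumes "A \<in> GLm m" shows "iota A \<in> GLm n" "minv (iota A) = iota (minv A)"
proof -
  have e: "iota A * iota (minv A) = 1\<^sub>m n" using assms by (simp add: iota_mult GLm_minv minv_right)
  have c: "iota A \<in> carrier_mat n n" "iota (minv A) \<in> carrier_mat n n" using assms by (auto simp: iota_carrier GLm_minv)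
  show "iota A \<in> GLm n" by (rule GLmI(1)[OF c e])
  show "minv (iota A) = iota (minv A)" by (rule minv_unique(1)[OF c e])
qed

lemma one_unitary: "1\<^sub>m n \<in> iota ` GLm m"
  by (metis image_eqI iota_one GLm_one)

lemma group_unitary: "group unitary_group"
proof (rule groupI)
  show "\<exists>y\<in>carrier unitary_group. y \<otimes>\<^bsub>unitary_group\<^esub> g = \<one>\<^bsub>unitary_group\<^esub>" if g: "g \<in> carrier unitary_group" for g
  proof -
    obtain A where A: "A \<in> GLm m" "g = iota A" using g by (auto simp: unitary_group_def)
    have "iota (minv A) * g = 1\<^sub>m n" using A by (simp add: iota_mult GLm_minv minv_left)
    then show ?thesis using A GLm_minv by (auto simp: unitary_group_def)
  qed
qed (auto simp: unitary_group_def iota_mult GLm_mult iota_carrier assoc_mult_mat[of _ m m _ m _ m] GL_dims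
    one_unitary intro!: imageI left_mult_one_mat[of _ n n])

lemma center_unitary: "center_of unitary_group = iota ` {k \<cdot>\<^sub>m 1\<^sub>m m | k. k \<noteq> 0}"
proof
  show "iota ` {k \<cdot>\<^sub>m 1\<^sub>m m | k. k \<noteq> 0} \<subseteq> center_of unitary_group"
  proof
    fix z assume "z \<in> iota ` {k \<cdot>\<^sub>m 1\<^sub>m m | k. k \<noteq> 0}"
    then obtain k where k: "k \<noteq> 0" "z = iota (k \<cdot>\<^sub>m 1\<^sub>m m)" by auto
    have kG: "k \<cdot>\<^sub>m 1\<^sub>m m \<in> GLm m" using k by (simp add: GLm_smult)
    have "iota (k \<cdot>\<^sub>m 1\<^sub>m m) * iota A = iota A * iota (k \<cdot>\<^sub>m 1\<^sub>m m)" if A: "A \<in> GLm m" for A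
      using A kG by (simp add: iota_mult GL_dims mult_smult_assoc_mat[of _ m m _ m] mult_smult_distrib[of _ m m _ m]
        left_mult_one_mat[of _ m m] right_mult_one_mat[of _ m m])
    then show "z \<in> center_of unitary_group" using k kG by (auto simp: center_of_def unitary_group_def)
  qed
  show "center_of unitary_group \<subseteq> iota ` {k \<cdot>\<^sub>m 1\<^sub>m m | k. k \<noteq> 0}"
  proof
    fix z assume "z \<in> center_of unitary_group"
    then have z: "z \<in> iota ` GLm m" "\<And>g. g \<in> iota ` GLm m \<Longrightarrow> z * g = g * z"
      by (auto simp add: center_of_def unitary_group_def)
    from z(1) obtain A where A: "A \<in> GLm m" "z = iota A" by blast
    have comm: "A * B = B * A" if "B \<in> GLm m" for B
      using z(2)[of "iota B"] that A by (simp add: iota_mult iota_inject GLm_mult)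
    have [simp]: "A \<in> carrier_mat m m" using A GL_dims by blast
    have unit: "matunit m i j * A = A * matunit m i j" if ij: "i < m" "j < m" for i j
    proof -
      \<comment> \<open>Adding the identity makes the matrix unit invertible, with an entry 2 on the
        diagonal for i = j, and does not affect commutation with \<open>A\<close>.\<close>
      have G: "1\<^sub>m m + (matunit m i j :: 'a mat) \<in> GLm m"
      proof (cases "i = j")
        case True
        have "mat_diag m (\<lambda>k. if k = i then 2 else 1) = 1\<^sub>m m + (matunit m i j :: 'a mat)"
          using True ij by (auto intro!: eq_matI simp: mat_diag_def matunit_def)
        moreover have "mat_diag m (\<lambda>k. if k = i then 2 else (1 :: 'a)) \<in> GLm m"
          by (rule mat_diag_GLm(1)) simp
        ultimately show ?thesis by simp
      next
        case False
        then show ?thesis using trv_inverse(1)[OF False ij, of 1] by (simp add: trv_def)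
      qed
      have "A + A * matunit m i j = A + matunit m i j * A"
        using comm[OF G] by (simp add: mult_add_distrib_mat[of _ m m _ m] add_mult_distrib_mat[of _ m m _ _ m]
          left_mult_one_mat[of _ m m] right_mult_one_mat[of _ m m])
      then have e: "(A + A * matunit m i j) $$ (k, l) = (A + matunit m i j * A) $$ (k, l)" for k l by simp
      show ?thesis
      proof (rule eq_matI)
        fix k l assume "k < dim_row (A * matunit m i j)" "l < dim_col (A * matunit m i j)"
        then have "k < m" "l < m" using carrier_matD[OF \<open>A \<in> carrier_mat m m\<close>] by simp_all
        then show "(matunit m i j * A) $$ (k, l) = (A * matunit m i j) $$ (k, l)"
          using e[of k l] carrier_matD[OF \<open>A \<in> carrier_mat m m\<close>]
          by (simp add: index_add_mat(1)[of k "A * matunit m i j" l A] index_add_mat(1)[of k "matunit m i j * A" l A] del: index_mult_mat(1))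
      qed (simp_all add: carrier_matD[OF \<open>A \<in> carrier_mat m m\<close>])
    qed
    have e: "A = A $$ (0, 0) \<cdot>\<^sub>m 1\<^sub>m m" by (rule commute_matunits_scalar[OF _ m0 unit]) auto
    have "A $$ (0, 0) \<noteq> 0"
    proof
      assume "A $$ (0, 0) = 0"
      then have "A = 0 \<cdot>\<^sub>m 1\<^sub>m m" using e by simp
      then have "A * minv A = 0 \<cdot>\<^sub>m 1\<^sub>m m * minv A" by simp
      then have "(1\<^sub>m m :: 'a mat) $$ (0, 0) = (0 \<cdot>\<^sub>m 1\<^sub>m m * minv A) $$ (0, 0)" using minv_right[OF A(1)] by simp
      also have "\<dots> = 0" using m0 carrier_matD[OF GL_dims[OF GLm_minv[OF A(1)]]] by simp
      finally show False using m0 by simp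
    qed
    then show "z \<in> iota ` {k \<cdot>\<^sub>m 1\<^sub>m m | k. k \<noteq> 0}" using e A(2) by blast
  qed
qed

text \<open>The right-hand side is the carrier of \<open>U\<close> in coordinates: the matrices
  \<open>emb\<close> of scalars are multiplications by c, and the second family consists of the Gram
  matrices of the forms Tr (c h). Two instances already determine g: commuting with
  \<open>dl\<close> splits it into blocks A and B, and the form for c = 1, cut down by the transpose
  of Q and by Q', is the equation of \<open>isometry_iff_hthe\<close>.\<close>

lemma unitary_group_carrier:
  "iota ` GLm m = {g \<in> carrier_mat n n. det g \<noteq> 0 \<and>
     (\<forall>c\<in>K. g * emb (c \<cdot>\<^sub>m 1\<^sub>m m) (cj c \<cdot>\<^sub>m 1\<^sub>m m) = emb (c \<cdot>\<^sub>m 1\<^sub>m m) (cj c \<cdot>\<^sub>m 1\<^sub>m m) * g) \<and>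
     (\<forall>c\<in>K. g\<^sup>T * (c \<cdot>\<^sub>m (P\<^sup>T * H * P') + cj c \<cdot>\<^sub>m (P'\<^sup>T * H * P)) * g = c \<cdot>\<^sub>m (P\<^sup>T * H * P') + cj c \<cdot>\<^sub>m (P'\<^sup>T * H * P))}"
    (is "_ = ?R")
proof
  note T = transpose_mult[of _ n m _ m] transpose_mult[of _ m m _ n] transpose_mult[of _ m n _ n] transpose_mult[of _ m m _ m]
    transpose_mult[of _ m n _ m]
  have [simp]: "P\<^sup>T \<in> carrier_mat n m" "P'\<^sup>T \<in> carrier_mat n m" "Q\<^sup>T \<in> carrier_mat m n" "Q'\<^sup>T \<in> carrier_mat m n"
    using dims by (auto simp del: dims)
  have [simp]: "g\<^sup>T \<in> carrier_mat n n" if "g \<in> carrier_mat n n" for g :: "'a mat" using that by simp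
  have HT: "H\<^sup>T = H" by (rule transpose_mat_diag)
  show "iota ` GLm m \<subseteq> ?R"
  proof
    fix g assume "g \<in> iota ` GLm m"
    then obtain A where A: "A \<in> GLm m" and gA: "g = iota A" by auto
    let ?B = "hthe m a A"
    have [simp]: "A \<in> carrier_mat m m" "?B \<in> carrier_mat m m" using GL_dims[OF A] GL_dims[OF hthe_GL[OF A]] by auto
    have g: "g \<in> carrier_mat n n" "det g \<noteq> 0" using iota_GLm(1)[OF A] by (auto simp: gA GLm_def)
    note [simp] = g(1)
    have Pg: "P * g = A * P" "P' * g = ?B * P'" unfolding gA iota_def by (simp_all add: P_emb)
    have gP: "g\<^sup>T * P\<^sup>T = P\<^sup>T * A\<^sup>T" "g\<^sup>T * P'\<^sup>T = P'\<^sup>T * ?B\<^sup>T"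
      using arg_cong[OF Pg(1), of transpose_mat] arg_cong[OF Pg(2), of transpose_mat] by (simp_all add: T)
    have iso: "A\<^sup>T * H * ?B = H" using isometry_iff_hthe[of m a A ?B] a_0 A by simp
    have iso': "?B\<^sup>T * H * A = H" using arg_cong[OF iso, of transpose_mat] by (simp add: T HT assoc)
    have 1: "g\<^sup>T * (P\<^sup>T * H * P') * g = P\<^sup>T * H * P'"
    proof -
      have "g\<^sup>T * (P\<^sup>T * H * P') * g = (g\<^sup>T * P\<^sup>T) * H * (P' * g)" by (simp add: assoc)
      also have "\<dots> = P\<^sup>T * (A\<^sup>T * H * ?B) * P'" unfolding gP Pg by (simp add: assoc)
      finally show ?thesis unfolding iso .
    qed
    have 2: "g\<^sup>T * (P'\<^sup>T * H * P) * g = P'\<^sup>T * H * P"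
    proof -
      have "g\<^sup>T * (P'\<^sup>T * H * P) * g = (g\<^sup>T * P'\<^sup>T) * H * (P * g)" by (simp add: assoc)
      also have "\<dots> = P'\<^sup>T * (?B\<^sup>T * H * A) * P" unfolding gP Pg by (simp add: assoc)
      finally show ?thesis unfolding iso' .
    qed
    have iso_c: "g\<^sup>T * (c \<cdot>\<^sub>m (P\<^sup>T * H * P') + d \<cdot>\<^sub>m (P'\<^sup>T * H * P)) * g = c \<cdot>\<^sub>m (P\<^sup>T * H * P') + d \<cdot>\<^sub>m (P'\<^sup>T * H * P)" for c d
    proof -
      have "g\<^sup>T * (c \<cdot>\<^sub>m (P\<^sup>T * H * P') + d \<cdot>\<^sub>m (P'\<^sup>T * H * P)) * g
          = c \<cdot>\<^sub>m (g\<^sup>T * (P\<^sup>T * H * P') * g) + d \<cdot>\<^sub>m (g\<^sup>T * (P'\<^sup>T * H * P) * g)"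
        by (simp add: mult_add_distrib_mat[of _ n n _ n] add_mult_distrib_mat[of _ n n _ _ n]
          mult_smult_assoc_mat[of _ n n _ n] mult_smult_distrib[of _ n n _ n])
      then show ?thesis unfolding 1 2 .
    qed
    have "g * emb (c \<cdot>\<^sub>m 1\<^sub>m m) (d \<cdot>\<^sub>m 1\<^sub>m m) = emb (c \<cdot>\<^sub>m 1\<^sub>m m) (d \<cdot>\<^sub>m 1\<^sub>m m) * g" for c d
      unfolding gA iota_def by (simp add: emb_mult mult_smult_assoc_mat[of _ m m _ m] mult_smult_distrib[of _ m m _ m]
        left_mult_one_mat[of _ m m] right_mult_one_mat[of _ m m])
    then show "g \<in> ?R" using g iso_c by blast
  qed
  show "?R \<subseteq> iota ` GLm m"
  proof
    fix g assume gR: "g \<in> ?R"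
    then have g [simp]: "g \<in> carrier_mat n n" by simp
    have "g * emb (dl \<cdot>\<^sub>m 1\<^sub>m m) (- dl \<cdot>\<^sub>m 1\<^sub>m m) = emb (dl \<cdot>\<^sub>m 1\<^sub>m m) (- dl \<cdot>\<^sub>m 1\<^sub>m m) * g"
      using gR dl_K cj_dl by auto
    from emb_commuting[OF g this] obtain A B where AB [simp]: "A \<in> carrier_mat m m" "B \<in> carrier_mat m m" and e: "g = emb A B"
      by (metis g mult_dims(1,6) dims)
    have gQ: "g * Q = Q * A" "g * Q' = Q' * B"
      unfolding e emb_def
      by (simp_all add: add_mult_distrib_mat[of _ n n _ _ m] assoc PQ PQ'' P'Q P'Q' 
        right_mult_one_mat[of _ m m] right_mult_zero_mat[of _ n m] right_mult_zero_mat[of _ m m]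
        right_add_zero_mat[of _ n m] left_add_zero_mat[of _ n m])
    have Qg: "Q\<^sup>T * g\<^sup>T = A\<^sup>T * Q\<^sup>T" using arg_cong[OF gQ(1), of transpose_mat] by (simp add: transpose_mult[of _ n n _ m] T)
    let ?S = "P\<^sup>T * H * P' + P'\<^sup>T * H * P"
    have QP1: "Q\<^sup>T * P\<^sup>T = 1\<^sub>m m" "Q\<^sup>T * P'\<^sup>T = 0\<^sub>m m m"
      using arg_cong[OF PQ, of transpose_mat] arg_cong[OF P'Q, of transpose_mat] by (simp_all add: T)
    have "cj 1 = 1" by (simp add: cj_F)
    then have S: "g\<^sup>T * ?S * g = ?S" using gR F_K[OF F01(2)] by force
    have QS: "Q\<^sup>T * ?S * Q' = H"
    proof -
      have "Q\<^sup>T * ?S * Q' = (Q\<^sup>T * P\<^sup>T) * (H * (P' * Q')) + (Q\<^sup>T * P'\<^sup>T) * (H * (P * Q'))"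
        by (simp add: mult_add_distrib_mat[of _ m n _ n] add_mult_distrib_mat[of _ m n _ _ m] assoc)
      then show ?thesis unfolding QP1 P'Q' PQ''
        by (simp add: right_mult_one_mat[of _ m m] left_mult_one_mat[of _ m m] left_mult_zero_mat[of _ m m] right_mult_zero_mat[of _ m m]
          right_add_zero_mat[of _ m m])
    qed
    have "A\<^sup>T * H * B = A\<^sup>T * (Q\<^sup>T * ?S * Q') * B" by (simp only: QS)
    also have "\<dots> = (A\<^sup>T * Q\<^sup>T) * ?S * (Q' * B)" by (simp add: assoc)
    also have "\<dots> = Q\<^sup>T * (g\<^sup>T * ?S * g) * Q'" unfolding Qg[symmetric] gQ(2)[symmetric] by (simp add: assoc)
    also have "\<dots> = H" unfolding S QS ..
    finally have "A \<in> GLm m \<and> B = hthe m a A" using isometry_iff_hthe[of m a A B] a_0 by simp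
    then show "g \<in> iota ` GLm m" unfolding e iota_def by blast
  qed
qed

end

section \<open>Isomorphisms of projective unitary groups\<close>

lemma GL_regular_sum:
  assumes "0 \<in> F" "finite A" "\<And>x. x \<in> A \<Longrightarrow> p x \<in> GL_regular F n"
  shows "(\<lambda>g. \<Sum>x\<in>A. p x g) \<in> GL_regular F n"
  using assms(2,3) by (induction A rule: finite_induct) (auto intro: GL_regular.const assms(1) GL_regular.add)

lemma GL_regular_prod:
  assumes "1 \<in> F" "finite A" "\<And>x. x \<in> A \<Longrightarrow> p x \<in> GL_regular F n"
  shows "(\<lambda>g. \<Prod>x\<in>A. p x g) \<in> GL_regular F n"
  using assms(2,3) by (induction A rule: finite_induct) (auto intro: GL_regular.const assms(1) GL_regular.mult)

text \<open>Cramer's rule, with the cofactor expanded over permutations and indices that skip row j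
  and column i, so that only generators of the coordinate ring occur.\<close>

lemma (in quad) GL_regular_minv:
  assumes "i < n" "j < n"
  shows "\<exists>q\<in>GL_regular F n. \<forall>g\<in>carrier_mat n n. q g = minv g $$ (i, j)"
proof -
  let ?k = "n - 1" and ?ins = "\<lambda>i a. if a < i then a else Suc a"
  let ?q = "\<lambda>g. inverse (det g) * ((- 1) ^ (j + i) * (\<Sum>s | s permutes {0..<?k}. signof s *
    (\<Prod>a = 0..<?k. g $$ (?ins j a, ?ins i (s a)))))"
  have q_reg: "?q \<in> GL_regular F n"
  proof (intro GL_regular.mult GL_regular.inv_det GL_regular_sum GL_regular_prod F01)
    show "(\<lambda>g. (- 1) ^ (j + i)) \<in> GL_regular F n" by (rule GL_regular.const) (cases "even (j + i)"; simp)
    show "finite {s. s permutes {0..<?k}}" by (simp add: finite_permutations)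
    fix s assume "s \<in> {s. s permutes {0..<?k}}"
    then have s: "s a < ?k" if "a < ?k" for a using that permutes_in_image[of s "{0..<?k}" a] by simp
    show "(\<lambda>g. signof s) \<in> GL_regular F n" by (rule GL_regular.const) (simp add: sign_def)
    fix a assume "a \<in> {0..<?k}"
    then show "(\<lambda>g. g $$ (?ins j a, ?ins i (s a))) \<in> GL_regular F n"
      using s[of a] by (intro GL_regular.entry) auto
  qed simp
  have q_val: "?q g = minv g $$ (i, j)" if g: "g \<in> carrier_mat n n" for g
  proof -
    have "det (mat_delete g j i) = (\<Sum>s | s permutes {0..<?k}. signof s * (\<Prod>a = 0..<?k. mat_delete g j i $$ (a, s a)))"
      using g by (simp add: det_def mat_delete_def)
    also have "\<dots> = (\<Sum>s | s permutes {0..<?k}. signof s * (\<Prod>a = 0..<?k. g $$ (?ins j a, ?ins i (s a))))"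
    proof (intro sum.cong prod.cong refl arg_cong2[where f = "(*)"])
      fix s a assume s: "s \<in> {s. s permutes {0..<?k}}" and a: "a \<in> {0..<?k}"
      then have "s a < ?k" using permutes_in_image[of s "{0..<?k}" a] by simp
      then show "mat_delete g j i $$ (a, s a) = g $$ (?ins j a, ?ins i (s a))"
        using a g by (simp add: mat_delete_def)
    qed
    finally show ?thesis using g assms by (simp add: minv_def adj_mat_def cofactor_def)
  qed
  show ?thesis by (rule bexI[OF _ q_reg]) (intro ballI q_val)
qed

lemma (in quad) GL_regular_Ad:
  assumes E: "E \<in> mat_over F n" and ij: "i < n" "j < n"
  shows "\<exists>q\<in>GL_regular F n. \<forall>g\<in>carrier_mat n n. q g = Ad g E $$ (i, j)"
proof -
  have "\<forall>l\<in>{..<n}. \<exists>q. q \<in> GL_regular F n \<and> (\<forall>g\<in>carrier_mat n n. q g = minv g $$ (l, j))"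
    using GL_regular_minv[OF _ ij(2)] by auto
  from bchoice[OF this] obtain q where
    q: "\<forall>l\<in>{..<n}. q l \<in> GL_regular F n \<and> (\<forall>g\<in>carrier_mat n n. q l g = minv g $$ (l, j))" ..
  let ?q = "\<lambda>g. \<Sum>l<n. (\<Sum>k<n. g $$ (i, k) * E $$ (k, l)) * q l g"
  have q_reg: "?q \<in> GL_regular F n"
    using q E ij by (intro GL_regular.mult GL_regular_sum GL_regular.entry GL_regular.const F01) (auto simp: mat_over_def)
  have q_val: "?q g = Ad g E $$ (i, j)" if g [simp]: "g \<in> carrier_mat n n" for g
  proof -
    have [simp]: "E \<in> carrier_mat n n" using E by (simp add: mat_over_def)
    have "Ad g E $$ (i, j) = (\<Sum>l<n. (g * E) $$ (i, l) * minv g $$ (l, j))"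
      unfolding Ad_def by (rule index_mult_mat'[of _ n n _ n]) (use ij in auto)
    also have "\<dots> = ?q g"
    proof (rule sum.cong)
      fix l assume l: "l \<in> {..<n}"
      have "(g * E) $$ (i, l) = (\<Sum>k<n. g $$ (i, k) * E $$ (k, l))"
        by (rule index_mult_mat'[of _ n n _ n]) (use ij l in auto)
      then show "(g * E) $$ (i, l) * minv g $$ (l, j) = (\<Sum>k<n. g $$ (i, k) * E $$ (k, l)) * q l g"
        using q l by simp
    qed simp
    finally show ?thesis by simp
  qed
  show ?thesis by (rule bexI[OF _ q_reg]) (intro ballI q_val)
qed

lemma (in quad) GL_regular_F:
  assumes "p \<in> GL_regular F n" "g \<in> mat_over F n"
  shows "p g \<in> F"
  using assms(1)
proof (induction rule: GL_regular.induct)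
  case inv_det
  have g: "g \<in> carrier_mat n n" "\<And>i j. i < n \<Longrightarrow> j < n \<Longrightarrow> g $$ (i, j) \<in> F" using assms(2) by (auto simp: mat_over_def)
  have P: "(\<Prod>a\<in>A. x a) \<in> F" if "\<And>a. a \<in> A \<Longrightarrow> x a \<in> F" for A :: "nat set" and x
    using that by (induction A rule: infinite_finite_induct) auto
  have "signof s * (\<Prod>i = 0..<n. g $$ (i, s i)) \<in> F" if "s permutes {0..<n}" for s
    using that permutes_in_image[OF that] by (intro F_mult P g(2)) (auto simp: sign_def)
  then have "det g \<in> F" unfolding det_def'[OF g(1)] by (intro F_sum) simp
  then show ?case by simp
next
  case (entry i j)
  then show ?case using assms(2) by (auto simp: mat_over_def)
qed auto

section \<open>Regular functions along root subgroups\<close>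

definition polynomial_fun :: "('a::comm_ring_1 \<Rightarrow> 'a) \<Rightarrow> bool" where
  "polynomial_fun g \<longleftrightarrow> (\<exists>r. \<forall>t. g t = poly r t)"

lemma polynomial_fun_const: "polynomial_fun (\<lambda>t. c)"
  unfolding polynomial_fun_def by (intro exI[of _ "[:c:]"]) simp

lemma polynomial_fun_id: "polynomial_fun (\<lambda>t. t)"
  unfolding polynomial_fun_def by (intro exI[of _ "[:0, 1:]"]) simp

lemma polynomial_fun_add: "polynomial_fun g \<Longrightarrow> polynomial_fun h \<Longrightarrow> polynomial_fun (\<lambda>t. g t + h t)"
  unfolding polynomial_fun_def by (metis poly_add)

lemma polynomial_fun_mult: "polynomial_fun g \<Longrightarrow> polynomial_fun h \<Longrightarrow> polynomial_fun (\<lambda>t. g t * h t)"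
  unfolding polynomial_fun_def by (metis poly_mult)

lemma polynomial_fun_sum:
  "(\<And>x. x \<in> A \<Longrightarrow> polynomial_fun (g x)) \<Longrightarrow> polynomial_fun (\<lambda>t. \<Sum>x\<in>A. g x t)"
  by (induction A rule: infinite_finite_induct) (auto intro: polynomial_fun_const polynomial_fun_add)

lemma polynomial_fun_prod:
  "(\<And>x. x \<in> A \<Longrightarrow> polynomial_fun (g x)) \<Longrightarrow> polynomial_fun (\<lambda>t. \<Prod>x\<in>A. g x t)"
  by (induction A rule: infinite_finite_induct) (auto intro: polynomial_fun_const polynomial_fun_mult)

lemma polynomial_fun_index_mult:
  assumes "\<And>t. A t \<in> carrier_mat k l" "\<And>t. B t \<in> carrier_mat l r" "i < k" "j < r"
    "\<And>s. s < l \<Longrightarrow> polynomial_fun (\<lambda>t. A t $$ (i, s))" "\<And>s. s < l \<Longrightarrow> polynomial_fun (\<lambda>t. B t $$ (s, j))"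
  shows "polynomial_fun (\<lambda>t. (A t * B t) $$ (i, j))"
  unfolding index_mult_mat'[OF assms(1,2,3,4)] by (intro polynomial_fun_sum polynomial_fun_mult assms(5,6)) auto

text \<open>The second block involves the inverse transpose, and the inverse of a transvection is
  again affine in t.\<close>

lemma (in unitary) iota_trv_polynomial:
  assumes kl: "k < m" "l < m" "k \<noteq> l" and rs: "r < n" "s < n"
  shows "polynomial_fun (\<lambda>t. iota (trv m k l t) $$ (r, s))"
proof -
  have T: "polynomial_fun (\<lambda>t :: 'a. trv m k l t $$ (i, j))" if "i < m" "j < m" for i j
    using that by (cases "i = k \<and> j = l") (auto simp: index_trv intro!: polynomial_fun_const polynomial_fun_add polynomial_fun_id)
  have T': "polynomial_fun (\<lambda>t :: 'a. trv m k l (- t) $$ (i, j))" if ij: "i < m" "j < m" for i j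
  proof -
    have e: "trv m k l (- t) $$ (i, j) = (if i = j then 1 else 0) + (if i = k \<and> j = l then - 1 else 0) * t" for t :: 'a
      using ij by (simp add: index_trv)
    show ?thesis unfolding e by (intro polynomial_fun_const polynomial_fun_mult polynomial_fun_add polynomial_fun_id)
  qed
  have H: "polynomial_fun (\<lambda>t. hthe m a (trv m k l t) $$ (i, j))" if ij: "i < m" "j < m" for i j
    unfolding hthe_def trv_inverse(2)[OF kl(3,1,2)] index_diag_conj[OF trv_carrier ij]
    by (intro polynomial_fun_mult polynomial_fun_const T' ij)
  have Hc: "hthe m a (trv m k l t) \<in> carrier_mat m m" for t by (simp add: hthe_carrier)
  have "polynomial_fun (\<lambda>t. (Q * trv m k l t * P) $$ (r, s) + (Q' * hthe m a (trv m k l t) * P') $$ (r, s))"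
    by (intro polynomial_fun_add polynomial_fun_index_mult[of _ n m _ n] polynomial_fun_index_mult[of _ n m _ m])
      (auto simp: rs T H Hc polynomial_fun_const simp del: index_mult_mat(1))
  moreover have "iota (trv m k l t) $$ (r, s)
      = (Q * trv m k l t * P) $$ (r, s) + (Q' * hthe m a (trv m k l t) * P') $$ (r, s)" for t
    unfolding iota_def emb_def by (rule index_add_mat(1))
      (use rs carrier_matD[OF dims(3)] carrier_matD[OF dims(4)] in auto)
  ultimately show ?thesis by simp
qed

text \<open>The critical generator is the inverse determinant. The inverse of
  \<open>iota (trv m k l t)\<close> is its value at - t, so the inverse determinant is a determinant
  again.\<close>

lemma (in unitary) GL_regular_trv_polynomial:
  assumes kl: "k < m" "l < m" "k \<noteq> l" and p: "p \<in> GL_regular F n"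
  shows "polynomial_fun (\<lambda>t. p (iota (trv m k l t)))"
  using p
proof (induction rule: GL_regular.induct)
  case inv_det
  note T = trv_inverse[OF kl(3,1,2)]
  have c: "iota (trv m k l t) \<in> carrier_mat n n" for t by (rule iota_carrier[OF T(1)])
  have "inverse (det (iota (trv m k l t))) = det (iota (trv m k l (- t)))" for t
  proof -
    have "iota (trv m k l t) * iota (trv m k l (- t)) = 1\<^sub>m n"
      using minv_right[OF T(1)[of t]] T(2)[of t] iota_mult[OF T(1) T(1), of t "- t"] by simp
    then have "det (iota (trv m k l t)) * det (iota (trv m k l (- t))) = 1"
      using det_mult[OF c c] det_one by metis
    then show ?thesis by (rule inverse_unique)
  qed
  moreover have "polynomial_fun (\<lambda>t. det (iota (trv m k l (- t))))"
  proof -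
    have "polynomial_fun (\<lambda>t. det (iota (trv m k l t)))"
      unfolding det_def'[OF c]
      by (intro polynomial_fun_sum polynomial_fun_mult polynomial_fun_const polynomial_fun_prod iota_trv_polynomial[OF kl])
        (auto simp: permutes_in_image)
    then obtain r where r: "\<And>t. det (iota (trv m k l t)) = poly r t" unfolding polynomial_fun_def by blast
    show ?thesis unfolding polynomial_fun_def r by (intro exI[of _ "pcompose r [:0, - 1:]"]) (simp add: poly_pcompose)
  qed
  ultimately show ?case by simp
qed (auto intro: polynomial_fun_const polynomial_fun_add polynomial_fun_mult iota_trv_polynomial[OF kl])

lemma (in unitary) Ad_iota:
  assumes "A \<in> GLm m" "M \<in> carrier_mat m m" "N \<in> carrier_mat m m"
  shows "Ad (iota A) (emb M N) = emb (Ad A M) (Ad (hthe m a A) N)"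
proof -
  have c: "A \<in> carrier_mat m m" "hthe m a A \<in> carrier_mat m m"
    using GL_dims[OF assms(1)] GL_dims[OF hthe_GL[OF assms(1)]] by auto
  have h: "hthe m a (minv A) = minv (hthe m a A)"
  proof (rule minv_unique(1)[symmetric])
    have "hthe m a A * hthe m a (minv A) = hthe m a (1\<^sub>m m)"
      using assms(1) by (simp add: hthe_mult[symmetric] GLm_minv a_0 minv_right)
    also have "\<dots> = 1\<^sub>m m" using hthe_scalar[of 1 m a] a_0 by simp
    finally show "hthe m a A * hthe m a (minv A) = 1\<^sub>m m" .
  qed (auto simp: hthe_carrier c)
  show ?thesis
    unfolding Ad_def iota_GLm(2)[OF assms(1)] unfolding iota_def h
    using assms c by (simp add: emb_mult)
qed

text \<open>Matrix units are defined over every field, so this extends what is known for matrices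
  over \<open>K\<^sub>2\<close> to all matrices over Omega.\<close>

lemma Ad_matunit_expand:
  assumes Y: "Y \<in> carrier_mat m m" and E: "E \<in> carrier_mat m m" and ij: "i < m" "j < m"
  shows "Ad Y E $$ (i, j) = (\<Sum>k<m. \<Sum>l<m. E $$ (k, l) * Ad Y (matunit m k l) $$ (i, j))"
proof -
  have A: "Ad Y B $$ (i, j) = (\<Sum>l<m. \<Sum>k<m. Y $$ (i, k) * B $$ (k, l) * minv Y $$ (l, j))"
    if B: "B \<in> carrier_mat m m" for B
  proof -
    have "Ad Y B $$ (i, j) = (\<Sum>l<m. (Y * B) $$ (i, l) * minv Y $$ (l, j))"
      unfolding Ad_def by (rule index_mult_mat'[of _ m m _ m]) (use Y B ij in auto)
    then show ?thesis using index_mult_mat'[OF Y B ij(1)] by (simp add: sum_distrib_right)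
  qed
  have "Ad Y (matunit m k l) $$ (i, j) = Y $$ (i, k) * minv Y $$ (l, j)" if "k < m" "l < m" for k l
  proof -
    have inner: "(\<Sum>k'<m. Y $$ (i, k') * matunit m k l $$ (k', l') * minv Y $$ (l', j))
        = (if l' = l then Y $$ (i, k) * minv Y $$ (l, j) else 0)" if l': "l' < m" for l'
    proof -
      have "(\<Sum>k'<m. Y $$ (i, k') * matunit m k l $$ (k', l') * minv Y $$ (l', j))
          = (\<Sum>k'<m. if k' = k then (if l' = l then Y $$ (i, k) * minv Y $$ (l, j) else 0) else 0)"
        by (rule sum.cong) (use l' in auto)
      then show ?thesis using \<open>k < m\<close> by simp
    qed
    show ?thesis unfolding A[OF matunit_carrier] using that inner by simp
  qed
  then show ?thesis unfolding A[OF E] by (subst sum.swap) (simp add: mult_ac)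
qed

text \<open>The functions that are pulled back are the entries of the adjoint action on a matrix
  \<open>emb E (cj E)\<close>. It has entries in \<open>F\<close>, so they are regular over
  \<open>F\<close>, and central elements act trivially by conjugation. Their pull-backs are
  polynomial along root subgroups and have values in \<open>F\<close> at F-points; the first gives
  \<open>pgl_hom\<close>, the second the rational pairs.\<close>

proposition pgl_hom_of_iso:
  fixes F K\<^sub>1 K\<^sub>2 :: "'a::field_char_0 set"
  assumes split: "\<And>p::'a poly. 0 < degree p \<Longrightarrow> \<exists>x. poly p x = 0" and m: "2 \<le> m"
    and U1: "unitary F K\<^sub>1 d\<^sub>1 cj\<^sub>1 m n\<^sub>1 P\<^sub>1 Q\<^sub>1 a" and U2: "unitary F K\<^sub>2 d\<^sub>2 cj\<^sub>2 m n\<^sub>2 P\<^sub>2 Q\<^sub>2 b"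
    and iso: "\<phi> \<in> algebraic_group_iso (adjoint_group (unitary.unitary_group F cj\<^sub>1 m n\<^sub>1 P\<^sub>1 Q\<^sub>1 a))
      (adjoint_group (unitary.unitary_group F cj\<^sub>2 m n\<^sub>2 P\<^sub>2 Q\<^sub>2 b))"
  obtains f where "pgl_hom m f"
    "\<forall>A. A \<in> GLm m \<longrightarrow> A \<in> mat_over K\<^sub>1 m \<longrightarrow> A\<^sup>T * mat_diag m a * map_mat cj\<^sub>1 A = mat_diag m a \<longrightarrow>
      rational_pair m K\<^sub>2 cj\<^sub>2 b (f A)"
proof -
  interpret A: unitary F K\<^sub>1 d\<^sub>1 cj\<^sub>1 m n\<^sub>1 P\<^sub>1 Q\<^sub>1 a by (rule U1)
  interpret B: unitary F K\<^sub>2 d\<^sub>2 cj\<^sub>2 m n\<^sub>2 P\<^sub>2 Q\<^sub>2 b by (rule U2)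
  obtain s where s0: "\<forall>g\<in>carrier A.unitary_group. s g \<in> carrier B.unitary_group"
    "\<forall>g\<in>carrier A.unitary_group. \<forall>h\<in>carrier A.unitary_group.
      \<exists>z\<in>center_of B.unitary_group. s (g \<otimes>\<^bsub>A.unitary_group\<^esub> h) = z \<otimes>\<^bsub>B.unitary_group\<^esub> (s g \<otimes>\<^bsub>B.unitary_group\<^esub> s h)"
    "\<forall>g\<in>carrier A.unitary_group. s g \<in> center_of B.unitary_group \<longrightarrow> g \<in> center_of A.unitary_group"
    "\<forall>p. restrict p (carrier B.unitary_group) \<in> regular B.unitary_group \<longrightarrow>
      (\<forall>z\<in>center_of B.unitary_group. \<forall>g\<in>carrier B.unitary_group. p (z \<otimes>\<^bsub>B.unitary_group\<^esub> g) = p g) \<longrightarrow>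
      (\<exists>q\<in>regular A.unitary_group. \<forall>g\<in>carrier A.unitary_group. q g = p (s g))"
    by (rule adjoint_group_iso_lift[OF A.group_unitary B.group_unitary iso])
  note s1 = bspec[OF s0(1)] and s2 = bspec[OF bspec[OF s0(2)]] and s3 = bspec[OF s0(3), THEN mp] and s4 = s0(4)[THEN spec, THEN mp, THEN mp]
  have "\<forall>A\<in>GLm m. \<exists>Y. Y \<in> GLm m \<and> s (A.iota A) = B.iota Y"
  proof
    fix A :: "'a mat" assume "A \<in> GLm m"
    then have "s (A.iota A) \<in> B.iota ` GLm m" using s1[of "A.iota A"] by (simp add: A.unitary_group_def B.unitary_group_def)
    then show "\<exists>Y. Y \<in> GLm m \<and> s (A.iota A) = B.iota Y" by blast
  qed
  from bchoice[OF this] obtain f where "\<forall>A\<in>GLm m. f A \<in> GLm m \<and> s (A.iota A) = B.iota (f A)" ..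
  then have fG: "f A \<in> GLm m" and sf: "s (A.iota A) = B.iota (f A)" if "A \<in> GLm m" for A using that by auto
  have scal: "k \<cdot>\<^sub>m (1\<^sub>m m :: 'a mat) \<in> GLm m" if "k \<noteq> 0" for k using that by (simp add: GLm_smult)
  have key: "\<exists>q\<in>GL_regular F n\<^sub>1. \<forall>A\<in>GLm m.
      q (A.iota A) = B.emb (Ad (f A) E) (Ad (hthe m b (f A)) (map_mat cj\<^sub>2 E)) $$ (i, j)"
    if E: "E \<in> mat_over K\<^sub>2 m" and ij: "i < n\<^sub>2" "j < n\<^sub>2" for E i j
  proof -
    have Ec [simp]: "E \<in> carrier_mat m m" using E by (simp add: mat_over_def)
    let ?E = "B.emb E (map_mat cj\<^sub>2 E)"
    let ?p = "\<lambda>g. Ad g ?E $$ (i, j)"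
    have val: "?p (B.iota Y) = B.emb (Ad Y E) (Ad (hthe m b Y) (map_mat cj\<^sub>2 E)) $$ (i, j)" if "Y \<in> GLm m" for Y
      using B.Ad_iota[OF that] by simp
    obtain q where q: "q \<in> GL_regular F n\<^sub>2" "\<And>g. g \<in> carrier_mat n\<^sub>2 n\<^sub>2 \<Longrightarrow> q g = ?p g"
      using B.GL_regular_Ad[OF B.emb_F[OF E] ij] by blast
    have "restrict ?p (carrier B.unitary_group) = restrict q (carrier B.unitary_group)"
      by (rule restrict_ext) (auto simp: B.unitary_group_def q(2) B.iota_carrier)
    also have "\<dots> \<in> regular B.unitary_group" using q(1) by (auto simp: B.unitary_group_def)
    finally have 1: "restrict ?p (carrier B.unitary_group) \<in> regular B.unitary_group" .
    have 2: "\<forall>z\<in>center_of B.unitary_group. \<forall>g\<in>carrier B.unitary_group. ?p (z \<otimes>\<^bsub>B.unitary_group\<^esub> g) = ?p g"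
    proof (intro ballI)
      fix z g assume "z \<in> center_of B.unitary_group" "g \<in> carrier B.unitary_group"
      then obtain k Y where k: "k \<noteq> 0" "z = B.iota (k \<cdot>\<^sub>m 1\<^sub>m m)" and Y: "Y \<in> GLm m" "g = B.iota Y"
        unfolding B.center_unitary by (auto simp: B.unitary_group_def)
      have Yc: "Y \<in> carrier_mat m m" "hthe m b Y \<in> GLm m" using Y B.GL_dims by auto
      have kY: "k \<cdot>\<^sub>m 1\<^sub>m m * Y = k \<cdot>\<^sub>m Y"
        using Yc by (simp add: mult_smult_assoc_mat[of _ m m _ m] left_mult_one_mat[of _ m m])
      have "hthe m b (k \<cdot>\<^sub>m Y) = inverse k \<cdot>\<^sub>m hthe m b Y"
        using hthe_mult[OF scal[OF k(1)] Y(1), of b] hthe_scalar[of k m b] B.a_0 k(1) B.GL_dims[OF Yc(2)]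
        by (simp add: kY mult_smult_assoc_mat[of _ m m _ m] left_mult_one_mat[of _ m m])
      then have "Ad (hthe m b (k \<cdot>\<^sub>m Y)) (map_mat cj\<^sub>2 E) = Ad (hthe m b Y) (map_mat cj\<^sub>2 E)"
        using Ad_smult_left[of "inverse k", OF _ Yc(2)] k(1) by simp
      moreover have "Ad (k \<cdot>\<^sub>m Y) E = Ad Y E" using Ad_smult_left[OF k(1) Y(1)] by simp
      moreover have "z \<otimes>\<^bsub>B.unitary_group\<^esub> g = B.iota (k \<cdot>\<^sub>m Y)"
        using k Y scal by (simp add: B.unitary_group_def B.iota_mult kY)
      ultimately show "?p (z \<otimes>\<^bsub>B.unitary_group\<^esub> g) = ?p g"
        using val Y GLm_smult[OF k(1) Y(1)] by simp
    qed
    from s4[OF 1 2] obtain r where r: "r \<in> regular A.unitary_group" "\<forall>g\<in>carrier A.unitary_group. r g = ?p (s g)" by blast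
    from r(1) obtain q' where q': "q' \<in> GL_regular F n\<^sub>1" "r = restrict q' (A.iota ` GLm m)" by (auto simp: A.unitary_group_def)
    have "q' (A.iota A) = ?p (s (A.iota A))" if "A \<in> GLm m" for A
    proof -
      have "A.iota A \<in> carrier A.unitary_group" using that by (simp add: A.unitary_group_def)
      then show ?thesis using r(2) q'(2) that by auto
    qed
    then show ?thesis using q'(1) sf val fG by auto
  qed
  show thesis
  proof (rule that)
    show "pgl_hom m f"
    proof
      show "\<exists>x. poly p x = 0" if "0 < degree p" for p :: "'a poly" using split that .
      show "2 \<le> m" by (rule m)
      show "f A \<in> GLm m" if "A \<in> GLm m" for A using fG that .
      show "f (A * C) \<approx> f A * f C" if AC: "A \<in> GLm m" "C \<in> GLm m" for A C
      proof -
        have "A.iota A \<in> carrier A.unitary_group" "A.iota C \<in> carrier A.unitary_group"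
          using AC by (auto simp: A.unitary_group_def)
        from s2[OF this] obtain k where k: "k \<noteq> 0"
          "B.iota (f (A * C)) = B.iota (k \<cdot>\<^sub>m 1\<^sub>m m) * (B.iota (f A) * B.iota (f C))"
          unfolding B.center_unitary
          using AC by (auto simp: A.unitary_group_def B.unitary_group_def A.iota_mult sf GLm_mult)
        have c: "f A * f C \<in> carrier_mat m m" using B.GL_dims GLm_mult fG AC by blast
        have "B.iota (f (A * C)) = B.iota (k \<cdot>\<^sub>m 1\<^sub>m m * (f A * f C))"
          unfolding k(2) using fG AC scal[OF k(1)] by (simp add: B.iota_mult GLm_mult)
        then have "f (A * C) = k \<cdot>\<^sub>m 1\<^sub>m m * (f A * f C)"
          using fG AC scal[OF k(1)] by (subst (asm) B.iota_inject) (auto intro: GLm_mult)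
        also have "\<dots> = k \<cdot>\<^sub>m (f A * f C)"
          using c by (simp add: mult_smult_assoc_mat[of _ m m _ m] left_mult_one_mat[of _ m m])
        finally show ?thesis using peqI[OF k(1)] by simp
      qed
      show "A \<approx> 1\<^sub>m m" if A: "A \<in> GLm m" and e: "f A \<approx> 1\<^sub>m m" for A
      proof -
        obtain k where "k \<noteq> 0" "f A = k \<cdot>\<^sub>m 1\<^sub>m m" using e by (auto simp: peq_def)
        then have "s (A.iota A) \<in> center_of B.unitary_group" unfolding B.center_unitary sf[OF A] by auto
        then have "A.iota A \<in> center_of A.unitary_group" using s3 A by (simp add: A.unitary_group_def)
        then obtain l where l: "l \<noteq> 0" "A.iota A = A.iota (l \<cdot>\<^sub>m 1\<^sub>m m)" unfolding A.center_unitary by auto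
        then have "A = l \<cdot>\<^sub>m 1\<^sub>m m" using A scal by (simp add: A.iota_inject)
        then show ?thesis using peqI[OF l(1)] by simp
      qed
      show "\<exists>R\<in>carrier_mat m m. \<forall>t. Ad (f (trv m i j t)) E = evalm R t"
        if ij: "i < m" "j < m" "i \<noteq> j" and E: "E \<in> carrier_mat m m" for i j E
      proof -
        have T: "trv m i j t \<in> GLm m" for t :: 'a using trv_inverse(1)[OF ij(3,1,2)] .
        have fT: "f (trv m i j t) \<in> carrier_mat m m" for t using B.GL_dims[OF fG[OF T]] .
        have U: "polynomial_fun (\<lambda>t. Ad (f (trv m i j t)) E' $$ (r, c))"
          if E': "E' \<in> mat_over K\<^sub>2 m" and rc: "r < m" "c < m" for E' r c
        proof -
          let ?M = "\<lambda>t. Ad (f (trv m i j t)) E'" and ?N = "\<lambda>t. Ad (hthe m b (f (trv m i j t))) (map_mat cj\<^sub>2 E')"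
          have Ec [simp]: "E' \<in> carrier_mat m m" using E' by (simp add: mat_over_def)
          have c: "?M t \<in> carrier_mat m m" "?N t \<in> carrier_mat m m" for t using fT by (auto simp: hthe_carrier)
          have P: "polynomial_fun (\<lambda>t. B.emb (?M t) (?N t) $$ (u, v))" if uv: "u < n\<^sub>2" "v < n\<^sub>2" for u v
          proof -
            obtain q where q: "q \<in> GL_regular F n\<^sub>1" "\<forall>A\<in>GLm m.
              q (A.iota A) = B.emb (Ad (f A) E') (Ad (hthe m b (f A)) (map_mat cj\<^sub>2 E')) $$ (u, v)"
              using key[OF E' uv] by blast
            show ?thesis using A.GL_regular_trv_polynomial[OF ij q(1)] q(2) T by simp
          qed
          \<comment> \<open>Multiplication by the constant matrices P and Q of the second group
            extracts the first block.\<close>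
          have "polynomial_fun (\<lambda>t. (P\<^sub>2 * B.emb (?M t) (?N t) * Q\<^sub>2) $$ (r, c))"
            by (intro polynomial_fun_index_mult[of _ m n\<^sub>2 _ m] polynomial_fun_index_mult[of _ m n\<^sub>2 _ n\<^sub>2])
              (auto simp: rc P c polynomial_fun_const simp del: index_mult_mat(1))
          then show ?thesis unfolding B.P_emb_Q(1)[OF c] .
        qed
        have mu: "matunit m k l \<in> mat_over K\<^sub>2 m" if "k < m" "l < m" for k l
          using that by (auto simp: mat_over_def B.F_K)
        have "\<forall>rc\<in>{..<m} \<times> {..<m}. \<exists>r. \<forall>t. Ad (f (trv m i j t)) E $$ rc = poly r t"
        proof
          fix rc assume "rc \<in> {..<m} \<times> {..<m}"
          then obtain r c where rc: "rc = (r, c)" "r < m" "c < m" by auto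
          have "polynomial_fun (\<lambda>t. Ad (f (trv m i j t)) E $$ (r, c))"
            unfolding Ad_matunit_expand[OF fT E rc(2,3)]
            by (intro polynomial_fun_sum polynomial_fun_mult polynomial_fun_const U mu rc) auto
          then show "\<exists>r. \<forall>t. Ad (f (trv m i j t)) E $$ rc = poly r t" unfolding rc(1) polynomial_fun_def .
        qed
        from bchoice[OF this] obtain R where R: "\<forall>rc\<in>{..<m} \<times> {..<m}. \<forall>t. Ad (f (trv m i j t)) E $$ rc = poly (R rc) t" ..
        have "Ad (f (trv m i j t)) E = evalm (Matrix.mat m m R) t" for t
          using R carrier_matD[OF Ad_carrier[OF fT E]] by (intro eq_matI) (auto simp: evalm_def)
        then show ?thesis by (intro bexI[of _ "Matrix.mat m m R"]) auto
      qed
    qed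
    show "\<forall>A. A \<in> GLm m \<longrightarrow> A \<in> mat_over K\<^sub>1 m \<longrightarrow> A\<^sup>T * mat_diag m a * map_mat cj\<^sub>1 A = mat_diag m a \<longrightarrow>
      rational_pair m K\<^sub>2 cj\<^sub>2 b (f A)"
    proof (intro allI impI)
      fix A :: "'a mat" assume A: "A \<in> GLm m" "A \<in> mat_over K\<^sub>1 m" "A\<^sup>T * mat_diag m a * map_mat cj\<^sub>1 A = mat_diag m a"
      have Ac: "A \<in> carrier_mat m m" using A(2) by (simp add: mat_over_def)
      \<comment> \<open>For a unitary matrix over the first field the second block is the conjugate
        of the first, so \<open>iota\<close> of it has entries in \<open>F\<close>.\<close>
      have "map_mat cj\<^sub>1 A = hthe m a A" using isometry_iff_hthe[of m a A "map_mat cj\<^sub>1 A"] A(3) A.a_0 Ac by auto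
      then have iF: "A.iota A \<in> mat_over F n\<^sub>1" using A.emb_F[OF A(2)] by (simp add: A.iota_def)
      have fA: "f A \<in> carrier_mat m m" using B.GL_dims[OF fG[OF A(1)]] .
      show "rational_pair m K\<^sub>2 cj\<^sub>2 b (f A)"
        unfolding rational_pair_def
      proof (intro ballI)
        fix E assume E: "E \<in> mat_over K\<^sub>2 m"
        have Ec [simp]: "E \<in> carrier_mat m m" using E by (simp add: mat_over_def)
        let ?M = "Ad (f A) E" and ?N = "Ad (hthe m b (f A)) (map_mat cj\<^sub>2 E)"
        have c: "?M \<in> carrier_mat m m" "?N \<in> carrier_mat m m" using fA by (auto simp: hthe_carrier)
        have "B.emb ?M ?N $$ (i, j) \<in> F" if ij: "i < n\<^sub>2" "j < n\<^sub>2" for i j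
        proof -
          obtain q where q: "q \<in> GL_regular F n\<^sub>1" "\<forall>A\<in>GLm m.
            q (A.iota A) = B.emb (Ad (f A) E) (Ad (hthe m b (f A)) (map_mat cj\<^sub>2 E)) $$ (i, j)"
            using key[OF E ij] by blast
          show ?thesis using A.GL_regular_F[OF q(1) iF] q(2) A(1) by simp
        qed
        then have "B.emb ?M ?N \<in> mat_over F n\<^sub>2" using B.emb_carrier[OF c] by (auto simp: mat_over_def)
        from B.emb_F_D[OF c this]
        show "Ad (f A) E \<in> mat_over K\<^sub>2 m \<and> Ad (hthe m b (f A)) (map_mat cj\<^sub>2 E) = map_mat cj\<^sub>2 (Ad (f A) E)" by simp
      qed
    qed
  qed
qed

section \<open>Hermitian spaces in coordinates\<close>

text \<open>Indexed by positions, where \<open>lincomb\<close> is indexed by the vectors of a set,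
  so that coordinates are functions on numbers.\<close>

definition comb :: "('a, 'v) module \<Rightarrow> nat \<Rightarrow> (nat \<Rightarrow> 'v) \<Rightarrow> (nat \<Rightarrow> 'a) \<Rightarrow> 'v" where
  "comb V k v x = (\<Oplus>\<^bsub>V\<^esub>i\<in>{..<k}. x i \<odot>\<^bsub>V\<^esub> v i)"

text \<open>Instantiated twice for one record \<open>V\<close>: over \<open>K\<close>, and over the
  subfield \<open>F\<close> to which the basis \<open>b\<close> refers.\<close>

locale scalar_space = V: vectorspace "class_ring\<lparr>carrier := K\<rparr>" V
  for K :: "'a::field set" and V :: "('a, 'v) module"
begin

lemma smult_K [simp]: "x \<in> K \<Longrightarrow> v \<in> carrier V \<Longrightarrow> x \<odot>\<^bsub>V\<^esub> v \<in> carrier V"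
  using V.smult_closed by simp

lemma smult_add_left: "x \<in> K \<Longrightarrow> y \<in> K \<Longrightarrow> v \<in> carrier V \<Longrightarrow> (x + y) \<odot>\<^bsub>V\<^esub> v = x \<odot>\<^bsub>V\<^esub> v \<oplus>\<^bsub>V\<^esub> y \<odot>\<^bsub>V\<^esub> v"
  using V.smult_l_distr by simp

lemma smult_add_right: "x \<in> K \<Longrightarrow> u \<in> carrier V \<Longrightarrow> v \<in> carrier V \<Longrightarrow>
    x \<odot>\<^bsub>V\<^esub> (u \<oplus>\<^bsub>V\<^esub> v) = x \<odot>\<^bsub>V\<^esub> u \<oplus>\<^bsub>V\<^esub> x \<odot>\<^bsub>V\<^esub> v"
  using V.smult_r_distr by simp

lemma smult_mult: "x \<in> K \<Longrightarrow> y \<in> K \<Longrightarrow> v \<in> carrier V \<Longrightarrow> (x * y) \<odot>\<^bsub>V\<^esub> v = x \<odot>\<^bsub>V\<^esub> (y \<odot>\<^bsub>V\<^esub> v)"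
  using V.smult_assoc1 by simp

lemma comb_closed [simp]: "(\<And>i. i < k \<Longrightarrow> x i \<in> K) \<Longrightarrow> (\<And>i. i < k \<Longrightarrow> v i \<in> carrier V) \<Longrightarrow> comb V k v x \<in> carrier V"
  unfolding comb_def by (rule V.M.finsum_closed) auto

lemma comb_cong:
  assumes "\<And>i. i < k \<Longrightarrow> x i = y i" "\<And>i. i < k \<Longrightarrow> y i \<in> K" "\<And>i. i < k \<Longrightarrow> v i \<in> carrier V"
  shows "comb V k v x = comb V k v y"
  unfolding comb_def by (rule V.M.finsum_cong') (use assms in auto)

lemma comb_add:
  assumes "\<And>i. i < k \<Longrightarrow> x i \<in> K" "\<And>i. i < k \<Longrightarrow> y i \<in> K" "\<And>i. i < k \<Longrightarrow> v i \<in> carrier V"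
  shows "comb V k v x \<oplus>\<^bsub>V\<^esub> comb V k v y = comb V k v (\<lambda>i. x i + y i)"
proof -
  have "comb V k v (\<lambda>i. x i + y i) = (\<Oplus>\<^bsub>V\<^esub>i\<in>{..<k}. x i \<odot>\<^bsub>V\<^esub> v i \<oplus>\<^bsub>V\<^esub> y i \<odot>\<^bsub>V\<^esub> v i)"
    unfolding comb_def by (rule V.M.finsum_cong') (use assms smult_add_left in auto)
  also have "\<dots> = comb V k v x \<oplus>\<^bsub>V\<^esub> comb V k v y"
    unfolding comb_def by (rule V.M.finsum_addf) (use assms in auto)
  finally show ?thesis ..
qed

lemma comb_smult:
  assumes "c \<in> K" "\<And>i. i < k \<Longrightarrow> x i \<in> K" "\<And>i. i < k \<Longrightarrow> v i \<in> carrier V"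
  shows "c \<odot>\<^bsub>V\<^esub> comb V k v x = comb V k v (\<lambda>i. c * x i)"
proof -
  have "comb V k v (\<lambda>i. c * x i) = (\<Oplus>\<^bsub>V\<^esub>i\<in>{..<k}. c \<odot>\<^bsub>V\<^esub> (x i \<odot>\<^bsub>V\<^esub> v i))"
    unfolding comb_def by (rule V.M.finsum_cong') (use assms smult_mult in auto)
  also have "\<dots> = c \<odot>\<^bsub>V\<^esub> comb V k v x"
    unfolding comb_def by (rule V.finsum_smult[symmetric]) (use assms in auto)
  finally show ?thesis ..
qed

lemma additive_finsum:
  fixes t :: "'v \<Rightarrow> 'a"
  assumes t: "\<And>u w. u \<in> carrier V \<Longrightarrow> w \<in> carrier V \<Longrightarrow> t (u \<oplus>\<^bsub>V\<^esub> w) = t u + t w"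
    and "finite A" "\<And>i. i \<in> A \<Longrightarrow> g i \<in> carrier V"
  shows "t (finsum V g A) = (\<Sum>i\<in>A. t (g i))"
  using assms(2,3)
proof (induction A rule: finite_induct)
  case empty
  have "t \<zero>\<^bsub>V\<^esub> + t \<zero>\<^bsub>V\<^esub> = t \<zero>\<^bsub>V\<^esub> + 0" using t[of "\<zero>\<^bsub>V\<^esub>" "\<zero>\<^bsub>V\<^esub>"] by simp
  then have "t \<zero>\<^bsub>V\<^esub> = 0" by (rule add_left_imp_eq)
  then show ?case by simp
next
  case (insert i A)
  then have g: "g \<in> A \<rightarrow> carrier V" "g i \<in> carrier V" by auto
  then have "t (finsum V g (insert i A)) = t (g i) + t (finsum V g A)"
    using insert.hyps by (simp add: V.M.finsum_insert t)
  then show ?case using insert by simp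
qed

lemma additive_comb:
  fixes t :: "'v \<Rightarrow> 'a"
  assumes "\<And>u w. u \<in> carrier V \<Longrightarrow> w \<in> carrier V \<Longrightarrow> t (u \<oplus>\<^bsub>V\<^esub> w) = t u + t w"
    and "\<And>i. i < k \<Longrightarrow> x i \<in> K" "\<And>i. i < k \<Longrightarrow> v i \<in> carrier V"
  shows "t (comb V k v x) = (\<Sum>i<k. t (x i \<odot>\<^bsub>V\<^esub> v i))"
  unfolding comb_def by (rule additive_finsum) (use assms in auto)

lemma lin_indpt_comb:
  assumes inj: "inj_on v {..<k}" and v: "\<And>i. i < k \<Longrightarrow> v i \<in> carrier V" and indep: "V.lin_indpt (v ` {..<k})"
    and x: "\<And>i. i < k \<Longrightarrow> x i \<in> K" and z: "comb V k v x = \<zero>\<^bsub>V\<^esub>" and j: "j < k"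
  shows "x j = 0"
proof (rule ccontr)
  assume n: "x j \<noteq> 0"
  let ?y = "\<lambda>u. x (inv_into {..<k} v u)"
  have y: "?y (v i) = x i" if "i < k" for i using inj that by simp
  have "V.lincomb ?y (v ` {..<k}) = (\<Oplus>\<^bsub>V\<^esub>i\<in>{..<k}. ?y (v i) \<odot>\<^bsub>V\<^esub> v i)"
    unfolding V.lincomb_def by (rule V.M.finsum_reindex[OF _ inj]) (use x v y in auto)
  also have "\<dots> = comb V k v x" unfolding comb_def by (rule V.M.finsum_cong') (use x v y in auto)
  finally have l: "V.lincomb ?y (v ` {..<k}) = \<zero>\<^bsub>V\<^esub>" unfolding z .
  have "V.lin_dep (v ` {..<k})"
    by (rule V.lin_dep_crit[of "v ` {..<k}" _ ?y "v j"]) (use l n x y j in auto)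
  then show False using indep by simp
qed

lemma ordered_basis_coordinates:
  assumes ob: "ordered_basis K V b"
  obtains c where "\<forall>w\<in>carrier V. \<forall>i<length b. c i w \<in> K"
    "\<forall>w\<in>carrier V. comb V (length b) (nth b) (\<lambda>i. c i w) = w"
    "\<forall>x. (\<forall>i<length b. x i \<in> K) \<longrightarrow> (\<forall>i<length b. c i (comb V (length b) (nth b) x) = x i)"
proof -
  let ?n = "length b" and ?v = "nth b"
  have d: "distinct b" and li: "V.lin_indpt (set b)" and gen: "V.gen_set (set b)" and sub: "set b \<subseteq> carrier V"
    using ob unfolding ordered_basis_def V.basis_def by blast+
  have im: "?v ` {..<?n} = set b" by (auto simp: set_conv_nth)
  have inj: "inj_on ?v {..<?n}" using d by (auto simp: inj_on_def nth_eq_iff_index_eq)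
  have bc: "b ! i \<in> carrier V" if "i < ?n" for i using sub that by auto
  have "\<forall>w\<in>carrier V. \<exists>x. (\<forall>i<?n. x i \<in> K) \<and> comb V ?n ?v x = w"
  proof
    fix w assume "w \<in> carrier V"
    then have "w \<in> V.span (set b)" using gen by simp
    then obtain a where a: "a \<in> set b \<rightarrow> K" "V.lincomb a (set b) = w"
      using V.finite_in_span[OF finite_set sub] by auto
    have "comb V ?n ?v (\<lambda>i. a (b ! i)) = V.lincomb a (set b)"
      unfolding comb_def V.lincomb_def im[symmetric]
      by (rule V.M.finsum_reindex[OF _ inj, symmetric]) (use Pi_mem[OF a(1)] sub in \<open>auto simp: im intro!: smult_K\<close>)
    then show "\<exists>x. (\<forall>i<?n. x i \<in> K) \<and> comb V ?n ?v x = w" using a by (intro exI[of _ "\<lambda>i. a (b ! i)"]) auto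
  qed
  from bchoice[OF this] obtain c where c: "\<forall>w\<in>carrier V. (\<forall>i<?n. c w i \<in> K) \<and> comb V ?n ?v (c w) = w" ..
  have u: "c (comb V ?n ?v x) i = x i" if x: "\<forall>i<?n. x i \<in> K" and i: "i < ?n" for x i
  proof -
    let ?w = "comb V ?n ?v x"
    have w: "?w \<in> carrier V" using x bc by simp
    \<comment> \<open>\<open>K\<close> is known only as the carrier of a field inside
      \<open>class_ring\<close>, so its additive inverse of 1 has to be identified with that of the
      type.\<close>
    have m1: "- 1 \<in> K"
    proof -
      let ?j = "\<ominus>\<^bsub>class_ring\<lparr>carrier := K\<rparr>\<^esub> (1 :: 'a)"
      have "?j \<in> K" using V.R.a_inv_closed[OF V.R.one_closed] by simp
      moreover have "?j + 1 = 0" using V.R.l_neg[OF V.R.one_closed] by simp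
      ultimately show ?thesis by (metis eq_neg_iff_add_eq_0)
    qed
    have neg: "- y \<in> K" if "y \<in> K" for y using V.R.m_closed[of "- 1" y] m1 that by simp
    have dif: "y - z \<in> K" if "y \<in> K" "z \<in> K" for y z using V.R.a_closed[of y "- z"] neg that by simp
    have cw: "c ?w i \<in> K" if "i < ?n" for i using c w that by blast
    have cc: "comb V ?n ?v (c ?w) = ?w" using c w by blast
    have "comb V ?n ?v (\<lambda>i. c ?w i + - x i) = comb V ?n ?v (c ?w) \<oplus>\<^bsub>V\<^esub> comb V ?n ?v (\<lambda>i. - x i)"
      using comb_add[of ?n "c ?w" "\<lambda>i. - x i" ?v] cw x neg bc by simp
    also have "\<dots> = comb V ?n ?v x \<oplus>\<^bsub>V\<^esub> comb V ?n ?v (\<lambda>i. - x i)" unfolding cc ..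
    also have "\<dots> = comb V ?n ?v (\<lambda>i. x i + - x i)" using comb_add[of ?n x "\<lambda>i. - x i" ?v] x neg bc by simp
    also have "\<dots> = (\<Oplus>\<^bsub>V\<^esub>i\<in>{..<?n}. \<zero>\<^bsub>V\<^esub>)"
      unfolding comb_def by (rule V.M.finsum_cong') (use bc V.lmult_0 in auto)
    also have "\<dots> = \<zero>\<^bsub>V\<^esub>" by simp
    finally have "c ?w i + - x i = 0"
      by (intro lin_indpt_comb[OF inj bc _ _ _ i]) (use li im cw x dif in auto)
    then show ?thesis by simp
  qed
  show thesis
    by (rule that[of "\<lambda>i w. c w i"]) (use c u in auto)
qed

end

locale hermitian = quad F K dl cj + scalar_space K V
  for F K :: "'a::field_char_0 set" and dl :: 'a and cj :: "'a \<Rightarrow> 'a" and V :: "('a, 'v) module" +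
  fixes h :: "'v \<Rightarrow> 'v \<Rightarrow> 'a"
  assumes fin_dim: "V.fin_dim"
    and h_K [simp]: "u \<in> carrier V \<Longrightarrow> w \<in> carrier V \<Longrightarrow> h u w \<in> K"
    and h_add: "u \<in> carrier V \<Longrightarrow> v \<in> carrier V \<Longrightarrow> w \<in> carrier V \<Longrightarrow> h (u \<oplus>\<^bsub>V\<^esub> v) w = h u w + h v w"
    and h_smult: "c \<in> K \<Longrightarrow> v \<in> carrier V \<Longrightarrow> w \<in> carrier V \<Longrightarrow> h (c \<odot>\<^bsub>V\<^esub> v) w = c * h v w"
    and h_cj: "v \<in> carrier V \<Longrightarrow> w \<in> carrier V \<Longrightarrow> h w v = cj (h v w)"
    and h_nondeg: "v \<in> carrier V \<Longrightarrow> \<forall>w\<in>carrier V. h v w = 0 \<Longrightarrow> v = \<zero>\<^bsub>V\<^esub>"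
begin

lemma h_add_right: "u \<in> carrier V \<Longrightarrow> v \<in> carrier V \<Longrightarrow> w \<in> carrier V \<Longrightarrow> h w (u \<oplus>\<^bsub>V\<^esub> v) = h w u + h w v"
  by (subst (1 2 3) h_cj) (simp_all add: h_add cj_add)

lemma h_smult_right: "c \<in> K \<Longrightarrow> v \<in> carrier V \<Longrightarrow> w \<in> carrier V \<Longrightarrow> h w (c \<odot>\<^bsub>V\<^esub> v) = cj c * h w v"
  by (subst (1 2) h_cj) (simp_all add: h_smult cj_mult)

lemma h_comb:
  assumes "\<And>i. i < k \<Longrightarrow> x i \<in> K" "\<And>i. i < k \<Longrightarrow> v i \<in> carrier V" "w \<in> carrier V"
  shows "h (comb V k v x) w = (\<Sum>i<k. x i * h (v i) w)"
  using assms additive_comb[of "\<lambda>u. h u w" k x v] by (simp add: h_add h_smult)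

lemma h_comb_right:
  assumes "\<And>i. i < k \<Longrightarrow> x i \<in> K" "\<And>i. i < k \<Longrightarrow> v i \<in> carrier V" "w \<in> carrier V"
  shows "h w (comb V k v x) = (\<Sum>i<k. cj (x i) * h w (v i))"
  using assms additive_comb[of "\<lambda>u. h w u" k x v] by (simp add: h_add_right h_smult_right)

text \<open>The nonzero norms give linear independence and make the coefficients of
  \<open>orth_proj\<close> meaningful.\<close>

definition orthogonal_family :: "(nat \<Rightarrow> 'v) \<Rightarrow> nat \<Rightarrow> bool" where
  "orthogonal_family v k \<longleftrightarrow> (\<forall>i<k. v i \<in> carrier V \<and> h (v i) (v i) \<noteq> 0 \<and> (\<forall>j<k. i \<noteq> j \<longrightarrow> h (v i) (v j) = 0))"

definition orth_proj :: "(nat \<Rightarrow> 'v) \<Rightarrow> nat \<Rightarrow> 'v \<Rightarrow> 'v" where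
  "orth_proj v k w = comb V k v (\<lambda>i. h w (v i) / h (v i) (v i))"

lemma h_comb_orthogonal:
  assumes v: "orthogonal_family v k" and x: "\<And>i. i < k \<Longrightarrow> x i \<in> K" and j: "j < k"
  shows "h (comb V k v x) (v j) = x j * h (v j) (v j)"
proof -
  have "h (comb V k v x) (v j) = (\<Sum>i<k. x i * h (v i) (v j))"
    by (rule h_comb) (use v x j in \<open>auto simp: orthogonal_family_def\<close>)
  also have "\<dots> = (\<Sum>i<k. if i = j then x j * h (v j) (v j) else 0)"
    by (rule sum.cong) (use v j in \<open>auto simp: orthogonal_family_def\<close>)
  finally show ?thesis using j by simp
qed

lemma h_zero: "w \<in> carrier V \<Longrightarrow> h \<zero>\<^bsub>V\<^esub> w = 0"
  using h_add[of "\<zero>\<^bsub>V\<^esub>" "\<zero>\<^bsub>V\<^esub>" w] by simp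

text \<open>Pairing a linear relation with the j-th vector leaves its j-th coefficient times a
  nonzero norm, so the family is independent.\<close>

lemma orthogonal_family_le_dim:
  assumes v: "orthogonal_family v k"
  shows "k \<le> V.dim"
proof -
  have vc: "v i \<in> carrier V" if "i < k" for i using v that by (auto simp: orthogonal_family_def)
  have inj: "inj_on v {..<k}" using v by (auto simp: orthogonal_family_def inj_on_def) metis
  have "V.lin_indpt (v ` {..<k})"
  proof (rule V.finite_lin_indpt2)
    fix a assume a: "a \<in> v ` {..<k} \<rightarrow> carrier (class_ring\<lparr>carrier := K\<rparr>)" and z: "V.lincomb a (v ` {..<k}) = \<zero>\<^bsub>V\<^esub>"
    have aK: "a (v i) \<in> K" if "i < k" for i using Pi_mem[OF a, of "v i"] that by simp
    have "V.lincomb a (v ` {..<k}) = comb V k v (\<lambda>i. a (v i))"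
      unfolding V.lincomb_def comb_def by (rule V.M.finsum_reindex[OF _ inj]) (use aK vc in auto)
    then have z': "comb V k v (\<lambda>i. a (v i)) = \<zero>\<^bsub>V\<^esub>" using z by simp
    have "a (v j) * h (v j) (v j) = 0" if "j < k" for j
      using h_comb_orthogonal[OF v, of "\<lambda>i. a (v i)" j] aK that h_zero[OF vc[OF that]] by (simp only: z')
    then show "\<forall>u\<in>v ` {..<k}. a u = \<zero>\<^bsub>class_ring\<lparr>carrier := K\<rparr>\<^esub>"
      using v by (auto simp: orthogonal_family_def)
  qed (use vc in auto)
  then have "card (v ` {..<k}) \<le> V.dim" using vc by (intro V.li_le_dim(2)[OF fin_dim]) auto
  then show ?thesis using inj by (simp add: card_image)
qed

lemma norm_cj: "v \<in> carrier V \<Longrightarrow> h v v \<in> F"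
  using cj_fixed[of "h v v"] h_cj[of v v] by simp

text \<open>
  A nonzero vector \<open>u\<close> orthogonal to the family has a partner \<open>w\<close> orthogonal to the family with
  \<open>c = h u w \<noteq> 0\<close>; if \<open>u\<close> and \<open>w\<close> are isotropic, then \<open>u + c w\<close> has norm \<open>2 c cj(c)\<close>.
\<close>

lemma maximal_orthogonal_family_complete:
  assumes v: "orthogonal_family v k" and max: "\<not> (\<exists>v'. orthogonal_family v' (Suc k))" and w: "w \<in> carrier V"
  shows "orth_proj v k w = w"
proof -
  have vc: "v i \<in> carrier V" "h (v i) (v i) \<noteq> 0" if "i < k" for i using v that by (auto simp: orthogonal_family_def)
  have coK: "h w (v i) / h (v i) (v i) \<in> K" if "i < k" "w \<in> carrier V" for i w using vc that by simp
  have pc: "orth_proj v k w \<in> carrier V" if "w \<in> carrier V" for w unfolding orth_proj_def using vc coK that by simp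
  have m1: "- 1 \<in> K" by (simp add: F_K)
  define res where "res w = w \<oplus>\<^bsub>V\<^esub> (- 1) \<odot>\<^bsub>V\<^esub> orth_proj v k w" for w
  have rc: "res w \<in> carrier V" if "w \<in> carrier V" for w using that pc m1 by (simp add: res_def)
  have rv: "h (res w) (v j) = 0" if "w \<in> carrier V" "j < k" for w j
  proof -
    have "h (orth_proj v k w) (v j) = h w (v j)"
      unfolding orth_proj_def by (subst h_comb_orthogonal[OF v]) (use that vc coK in auto)
    then show ?thesis using that pc vc m1 by (simp add: res_def h_add h_smult)
  qed
  have vr: "h (v j) (res w) = 0" if "w \<in> carrier V" "j < k" for w j
    using h_cj[of "res w" "v j"] rv[OF that] rc that vc by (simp add: cj_F)
  have iso: "h z z = 0" if z: "z \<in> carrier V" "\<And>j. j < k \<Longrightarrow> h z (v j) = 0" for z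
  proof (rule ccontr)
    assume n: "h z z \<noteq> 0"
    have zv: "h (v j) z = 0" if "j < k" for j using h_cj[of z "v j"] z that vc by (simp add: cj_F)
    have "orthogonal_family (v(k := z)) (Suc k)"
      using v n z zv by (auto simp: orthogonal_family_def less_Suc_eq)
    then show False using max by blast
  qed
  have "res w = \<zero>\<^bsub>V\<^esub>"
  proof (rule h_nondeg[OF rc[OF w]], rule ballI, rule ccontr)
    fix w' assume w': "w' \<in> carrier V" and n: "h (res w) w' \<noteq> 0"
    let ?u = "res w" and ?w = "res w'"
    have u: "?u \<in> carrier V" and uw: "?w \<in> carrier V" using rc w w' by auto
    have "h ?u (orth_proj v k w') = (\<Sum>i<k. cj (h w' (v i) / h (v i) (v i)) * h ?u (v i))"
      unfolding orth_proj_def by (rule h_comb_right) (use vc coK w' u in auto)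
    also have "\<dots> = 0" using rv[OF w] by simp
    finally have "h ?u ?w = h ?u w'"
      using u w' pc m1 by (simp add: res_def[of w'] h_add_right h_smult_right)
    then have c: "h ?u ?w \<noteq> 0" using n by simp
    let ?c = "h ?u ?w"
    have cK: "?c \<in> K" using u uw by simp
    have i0: "h ?u ?u = 0" by (rule iso[OF u]) (rule rv[OF w])
    have i1: "h ?w ?w = 0" by (rule iso[OF uw]) (rule rv[OF w'])
    have z: "?u \<oplus>\<^bsub>V\<^esub> ?c \<odot>\<^bsub>V\<^esub> ?w \<in> carrier V" using u uw cK by simp
    have "h (?u \<oplus>\<^bsub>V\<^esub> ?c \<odot>\<^bsub>V\<^esub> ?w) (?u \<oplus>\<^bsub>V\<^esub> ?c \<odot>\<^bsub>V\<^esub> ?w)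
        = h ?u ?u + cj ?c * h ?u ?w + (?c * h ?w ?u + ?c * (cj ?c * h ?w ?w))"
      using u uw cK by (simp add: h_add h_add_right h_smult h_smult_right algebra_simps)
    also have "\<dots> = 2 * (?c * cj ?c)"
      unfolding i0 i1 using h_cj[OF u uw] by simp
    also have "\<dots> \<noteq> 0" using c cj_cj[OF cK] cj_F[OF F01(1)] by auto
    finally have "h (?u \<oplus>\<^bsub>V\<^esub> ?c \<odot>\<^bsub>V\<^esub> ?w) (?u \<oplus>\<^bsub>V\<^esub> ?c \<odot>\<^bsub>V\<^esub> ?w) \<noteq> 0" .
    moreover have "h (?u \<oplus>\<^bsub>V\<^esub> ?c \<odot>\<^bsub>V\<^esub> ?w) (?u \<oplus>\<^bsub>V\<^esub> ?c \<odot>\<^bsub>V\<^esub> ?w) = 0"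
      by (rule iso[OF z]) (use u uw cK rv w w' vc in \<open>simp add: h_add h_smult\<close>)
    ultimately show False by simp
  qed
  then have "w \<oplus>\<^bsub>V\<^esub> (- 1) \<odot>\<^bsub>V\<^esub> orth_proj v k w = \<zero>\<^bsub>V\<^esub>" by (simp add: res_def)
  then have "(w \<oplus>\<^bsub>V\<^esub> (- 1) \<odot>\<^bsub>V\<^esub> orth_proj v k w) \<oplus>\<^bsub>V\<^esub> orth_proj v k w = orth_proj v k w" using pc[OF w] by simp
  moreover have "(- 1) \<odot>\<^bsub>V\<^esub> orth_proj v k w \<oplus>\<^bsub>V\<^esub> orth_proj v k w = \<zero>\<^bsub>V\<^esub>"
    using smult_add_left[OF m1 F_K[OF F01(2)] pc[OF w]] V.smult_one[OF pc[OF w]] V.lmult_0[OF pc[OF w]] by simp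
  ultimately show ?thesis using w pc[OF w] m1 by (simp add: V.M.a_assoc)
qed

lemma orthogonal_family_complete:
  assumes "orthogonal_family v V.dim" "w \<in> carrier V"
  shows "orth_proj v V.dim w = w"
proof (rule maximal_orthogonal_family_complete[OF assms(1) _ assms(2)])
  show "\<not> (\<exists>v'. orthogonal_family v' (Suc V.dim))" using orthogonal_family_le_dim by fastforce
qed

text \<open>Lengths of orthogonal families are bounded by the dimension, so there is a longest one.
  It equals its own projections on all vectors by \<open>maximal_orthogonal_family_complete\<close>,
  hence spans and has full length.\<close>

lemma orthogonal_basis: obtains v where "orthogonal_family v V.dim"
proof -
  let ?P = "\<lambda>k. \<exists>v. orthogonal_family v k"
  have "?P 0" by (simp add: orthogonal_family_def)
  moreover have b: "\<And>k. ?P k \<Longrightarrow> k \<le> V.dim" using orthogonal_family_le_dim by blast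
  ultimately obtain k where k: "?P k" "\<And>l. ?P l \<Longrightarrow> l \<le> k"
    using GreatestI_nat[of ?P 0 V.dim] Greatest_le_nat[of ?P _ V.dim] by blast
  obtain v where v: "orthogonal_family v k" using k(1) by blast
  have vc: "v i \<in> carrier V" "h (v i) (v i) \<noteq> 0" if "i < k" for i using v that by (auto simp: orthogonal_family_def)
  have max: "\<not> (\<exists>v'. orthogonal_family v' (Suc k))" using k(2)[of "Suc k"] by auto
  have inj: "inj_on v {..<k}" using v by (auto simp: orthogonal_family_def inj_on_def) metis
  have "V.dim \<le> card (v ` {..<k})"
  proof (rule V.gen_ge_dim)
    show "V.gen_set (v ` {..<k})"
    proof
      show "V.span (v ` {..<k}) \<subseteq> carrier V" using V.span_is_subset2[of "v ` {..<k}"] vc by auto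
      show "carrier V \<subseteq> V.span (v ` {..<k})"
      proof
        fix w assume w: "w \<in> carrier V"
        let ?x = "\<lambda>i. h w (v i) / h (v i) (v i)" and ?y = "\<lambda>u. h w u / h u u"
        have "w = comb V k v ?x" using maximal_orthogonal_family_complete[OF v max w] by (simp add: orth_proj_def)
        also have "\<dots> = V.lincomb ?y (v ` {..<k})"
          unfolding comb_def V.lincomb_def by (rule V.M.finsum_reindex[OF _ inj, symmetric]) (use vc w in auto)
        finally show "w \<in> V.span (v ` {..<k})"
          unfolding V.span_def using vc w by (intro CollectI exI[of _ ?y] exI[of _ "v ` {..<k}"]) auto
      qed
    qed
  qed (use vc in auto)
  then have "k = V.dim" using inj b[OF k(1)] by (simp add: card_image)
  then show thesis using that v by simp
qed

end

text \<open>The trace form of \<open>K\<close> over \<open>F\<close> is nondegenerate. The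
  coordinates of q are solved from the values at 1 and dl: the trace of q is twice its first
  coordinate, the trace of q dl is 2 dl^2 times its second.\<close>

lemma (in quad) trace_form:
  assumes l: "l \<in> functionals F K"
  obtains q where "q \<in> K" "\<forall>x\<in>K. l x = q * x + cj (q * x)"
proof -
  have lF: "\<And>x. x \<in> K \<Longrightarrow> l x \<in> F" and ladd: "\<And>x y. x \<in> K \<Longrightarrow> y \<in> K \<Longrightarrow> l (x + y) = l x + l y"
    and lmult: "\<And>c x. c \<in> F \<Longrightarrow> x \<in> K \<Longrightarrow> l (c * x) = c * l x"
    using l by (auto simp: functionals_def)
  have dl0: "dl \<noteq> 0" using dl by auto
  have l1: "l 1 / 2 \<in> F" and ld: "l dl / (2 * (dl * dl)) \<in> F"
    using lF[of 1] lF[of dl] by (auto simp: F_K dl_K dl)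
  define q where "q = l 1 / 2 + l dl / (2 * (dl * dl)) * dl"
  have qK: "q \<in> K" unfolding q_def by (rule KI[OF l1 ld])
  have cq: "cj q = l 1 / 2 - l dl / (2 * (dl * dl)) * dl" unfolding q_def by (rule cj_eq[OF l1 ld])
  have "l x = q * x + cj (q * x)" if x: "x \<in> K" for x
  proof -
    obtain s t where st: "s \<in> F" "t \<in> F" "x = s + t * dl" using KE x by blast
    have lx: "l x = s * l 1 + t * l dl"
      using ladd[of s "t * dl"] lmult[of s 1] lmult[of t dl] st by (simp add: F_K dl_K)
    have cx: "cj x = s - t * dl" using st cj_eq by simp
    show ?thesis
      unfolding lx cj_mult[OF qK x] cx cq unfolding q_def unfolding st(3) using dl0 by (simp add: field_simps)
  qed
  then show thesis using that qK by blast
qed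

lemma (in quad) trace_form_functional: "q \<in> K \<Longrightarrow> (\<lambda>x. q * x + cj (q * x)) \<in> functionals F K"
proof -
  assume q: "q \<in> K"
  have "q * x + cj (q * x) \<in> F" if "x \<in> K" for x
    by (rule cj_fixed) (use q that in \<open>simp_all add: cj_add cj_cj add.commute\<close>)
  then show ?thesis
    using q by (auto simp: functionals_def cj_mult cj_add cj_F F_K algebra_simps)
qed

lemma (in restriction) index_emb_scalar:
  assumes "i < n" "j < n" "x \<in> K"
  shows "emb (x \<cdot>\<^sub>m 1\<^sub>m m) (cj x \<cdot>\<^sub>m 1\<^sub>m m) $$ (i, j)
    = (\<Sum>k<m. Q $$ (i, k) * (x * P $$ (k, j)) + cj (Q $$ (i, k) * (x * P $$ (k, j))))"
proof -
  have e: "(Q0 * (y \<cdot>\<^sub>m 1\<^sub>m m) * P0) $$ (i, j) = (\<Sum>k<m. Q0 $$ (i, k) * (y * P0 $$ (k, j)))"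
    if d: "Q0 \<in> carrier_mat n m" "P0 \<in> carrier_mat m n" for Q0 P0 :: "'a mat" and y
  proof -
    have "Q0 * (y \<cdot>\<^sub>m 1\<^sub>m m) * P0 = Q0 * (y \<cdot>\<^sub>m P0)"
      using d by (simp add: assoc_mult_mat[of _ n m _ m _ n] mult_smult_assoc_mat[of _ m m _ n])
    also have "\<dots> $$ (i, j) = (\<Sum>k<m. Q0 $$ (i, k) * (y \<cdot>\<^sub>m P0) $$ (k, j))"
      by (rule index_mult_mat'[of _ n m _ n]) (use d assms in auto)
    finally show ?thesis using d assms by simp
  qed
  have "emb (x \<cdot>\<^sub>m 1\<^sub>m m) (cj x \<cdot>\<^sub>m 1\<^sub>m m) $$ (i, j)
      = (Q * (x \<cdot>\<^sub>m 1\<^sub>m m) * P) $$ (i, j) + (Q' * (cj x \<cdot>\<^sub>m 1\<^sub>m m) * P') $$ (i, j)"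
    unfolding emb_def by (rule index_add_mat(1)) (use assms carrier_matD[OF dims(3)] carrier_matD[OF dims(4)] in auto)
  also have "\<dots> = (\<Sum>k<m. Q $$ (i, k) * (x * P $$ (k, j))) + (\<Sum>k<m. cj (Q $$ (i, k) * (x * P $$ (k, j))))"
    unfolding e[OF dims(2,1)] e[OF dims(4,3)]
    using assms carrier_matD[OF P] carrier_matD[OF Q]
    by (intro arg_cong2[where f = "(+)"] sum.cong refl) (auto simp: P'_def Q'_def cj_mult P_K Q_K)
  finally show ?thesis by (simp add: sum.distrib)
qed

lemma index_gram_diag:
  assumes "A \<in> carrier_mat m n" "B \<in> carrier_mat m r" "i < n" "j < r"
  shows "(A\<^sup>T * mat_diag m a * B) $$ (i, j) = (\<Sum>k<m. A $$ (k, i) * a k * (B $$ (k, j) :: 'a::field))"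
proof -
  have "A\<^sup>T * mat_diag m a * B = A\<^sup>T * (mat_diag m a * B)" using assms by (intro assoc_mult_mat[of _ n m _ m _ r]) auto
  also have "\<dots> $$ (i, j) = (\<Sum>k<m. A\<^sup>T $$ (i, k) * (mat_diag m a * B) $$ (k, j))"
    by (rule index_mult_mat'[of _ n m _ r]) (use assms in auto)
  also have "\<dots> = (\<Sum>k<m. A $$ (k, i) * a k * B $$ (k, j))"
    by (rule sum.cong) (use assms in \<open>auto simp: mat_diag_mult_left[of _ m r]\<close>)
  finally show ?thesis .
qed

text \<open>\<open>P\<close> holds the coordinates of the F-basis \<open>b\<close> in the orthogonal
  K-basis. For \<open>Q\<close>, each F-coordinate of x v_k is a linear functional of x in
  \<open>K\<close>, hence of the form Tr (q x) by \<open>trace_form\<close>; these q are its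
  entries.\<close>

lemma (in hermitian) U_eq_unitary_group:
  assumes VF: "vectorspace (fld F) V" and ob: "ordered_basis F V b"
    and v: "orthogonal_family v V.dim" and pos: "0 < V.dim"
  obtains P Q where "unitary F K dl cj V.dim (length b) P Q (\<lambda>k. h (v k) (v k))"
    "U F K V h b = unitary.unitary_group F cj V.dim (length b) P Q (\<lambda>k. h (v k) (v k))"
proof -
  interpret W: scalar_space F V by (rule scalar_space.intro[OF VF])
  let ?m = "V.dim" and ?n = "length b" and ?a = "\<lambda>k. h (v k) (v k)"
  have vc: "v k \<in> carrier V" and a0: "?a k \<noteq> 0" if "k < ?m" for k using v that by (auto simp: orthogonal_family_def)
  have aF: "?a k \<in> F" if "k < ?m" for k using norm_cj vc that by blast
  have orth: "h (v k) (v l) = 0" if "k < ?m" "l < ?m" "k \<noteq> l" for k l using v that by (auto simp: orthogonal_family_def)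
  have bc: "b ! i \<in> carrier V" if "i < ?n" for i
    using ob that unfolding ordered_basis_def W.V.basis_def by auto
  define c where "c w k = h w (v k) / ?a k" for w k
  have cK: "c w k \<in> K" if "w \<in> carrier V" "k < ?m" for w k using that vc by (simp add: c_def)
  have c_comb: "comb V ?m v (c w) = w" if "w \<in> carrier V" for w
    using orthogonal_family_complete[OF v that] by (simp add: orth_proj_def c_def[abs_def])
  have c_smult: "c (x \<odot>\<^bsub>V\<^esub> w) k = x * c w k" if "x \<in> K" "w \<in> carrier V" "k < ?m" for x w k
    using that vc by (simp add: c_def h_smult)
  have c_v: "c (v l) k = (if k = l then 1 else 0)" if "k < ?m" "l < ?m" for k l
    using that a0[OF that(1)] orth[of l k] by (auto simp: c_def)
  obtain be where beF: "\<forall>w\<in>carrier V. \<forall>i<?n. be i w \<in> F"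
    and be_comb: "\<forall>w\<in>carrier V. comb V ?n (nth b) (\<lambda>i. be i w) = w"
    and be_unique: "\<forall>x. (\<forall>i<?n. x i \<in> F) \<longrightarrow> (\<forall>i<?n. be i (comb V ?n (nth b) x) = x i)"
    by (rule W.ordered_basis_coordinates[OF ob])
  have be_add: "be i (u \<oplus>\<^bsub>V\<^esub> w) = be i u + be i w" if "u \<in> carrier V" "w \<in> carrier V" "i < ?n" for u w i
  proof -
    have "u \<oplus>\<^bsub>V\<^esub> w = comb V ?n (nth b) (\<lambda>i. be i u) \<oplus>\<^bsub>V\<^esub> comb V ?n (nth b) (\<lambda>i. be i w)"
      using be_comb that by simp
    also have "\<dots> = comb V ?n (nth b) (\<lambda>i. be i u + be i w)" by (rule W.comb_add) (use beF bc that in auto)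
    finally show ?thesis using be_unique[THEN spec, of "\<lambda>i. be i u + be i w"] beF that by auto
  qed
  have be_smult: "be i (x \<odot>\<^bsub>V\<^esub> w) = x * be i w" if "x \<in> F" "w \<in> carrier V" "i < ?n" for x w i
  proof -
    have "x \<odot>\<^bsub>V\<^esub> w = x \<odot>\<^bsub>V\<^esub> comb V ?n (nth b) (\<lambda>i. be i w)" using be_comb that by simp
    also have "\<dots> = comb V ?n (nth b) (\<lambda>i. x * be i w)" by (rule W.comb_smult) (use beF bc that in auto)
    finally show ?thesis using be_unique[THEN spec, of "\<lambda>i. x * be i w"] beF that by auto
  qed
  have "\<forall>ik\<in>{..<?n} \<times> {..<?m}. \<exists>q. q \<in> K \<and> (\<forall>x\<in>K. be (fst ik) (x \<odot>\<^bsub>V\<^esub> v (snd ik)) = q * x + cj (q * x))"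
  proof
    fix ik assume "ik \<in> {..<?n} \<times> {..<?m}"
    then have ik: "fst ik < ?n" "snd ik < ?m" by auto
    have "(\<lambda>x. be (fst ik) (x \<odot>\<^bsub>V\<^esub> v (snd ik))) \<in> functionals F K"
      using ik vc beF smult_add_left be_add smult_mult be_smult F_K by (auto simp: functionals_def)
    from trace_form[OF this]
    show "\<exists>q. q \<in> K \<and> (\<forall>x\<in>K. be (fst ik) (x \<odot>\<^bsub>V\<^esub> v (snd ik)) = q * x + cj (q * x))" by metis
  qed
  from bchoice[OF this] obtain q where q0: "\<forall>ik\<in>{..<?n} \<times> {..<?m}. q ik \<in> K \<and>
      (\<forall>x\<in>K. be (fst ik) (x \<odot>\<^bsub>V\<^esub> v (snd ik)) = q ik * x + cj (q ik * x))" ..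
  have qK: "q (i, k) \<in> K" and be_v: "\<And>x. x \<in> K \<Longrightarrow> be i (x \<odot>\<^bsub>V\<^esub> v k) = q (i, k) * x + cj (q (i, k) * x)"
    if "i < ?n" "k < ?m" for i k using bspec[OF q0, of "(i, k)"] that by auto
  have be_eq: "be i w = (\<Sum>k<?m. q (i, k) * c w k + cj (q (i, k) * c w k))" if w: "w \<in> carrier V" and i: "i < ?n" for i w
  proof -
    have "be i w = be i (comb V ?m v (c w))" by (simp only: c_comb[OF w])
    also have "\<dots> = (\<Sum>k<?m. be i (c w k \<odot>\<^bsub>V\<^esub> v k))"
      by (rule additive_comb) (use be_add i cK[OF w] vc in auto)
    also have "\<dots> = (\<Sum>k<?m. q (i, k) * c w k + cj (q (i, k) * c w k))"
      by (rule sum.cong) (use be_v i cK[OF w] in auto)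
    finally show ?thesis .
  qed
  define P where "P = Matrix.mat ?m ?n (\<lambda>(k, j). c (b ! j) k)"
  define Q where "Q = Matrix.mat ?n ?m q"
  have P_dim: "P \<in> carrier_mat ?m ?n" and Q_dim: "Q \<in> carrier_mat ?n ?m" by (auto simp: P_def Q_def)
  have Pi: "P $$ (k, j) = c (b ! j) k" if "k < ?m" "j < ?n" for k j using that by (simp add: P_def)
  have Qi: "Q $$ (i, k) = q (i, k)" if "k < ?m" "i < ?n" for k i using that by (simp add: Q_def)
  \<comment> \<open>The k-th K-coordinate of x v_l, computed through the F-basis. As x varies, the
    coefficients of x and of cj x can be separated; \<open>solve\<close> does so with x = 1 and x =
    dl.\<close>
  have key: "(\<Sum>i<?n. c (b ! i) k * q (i, l)) * x + (\<Sum>i<?n. c (b ! i) k * cj (q (i, l))) * cj x = (if k = l then x else 0)"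
    if kl: "k < ?m" "l < ?m" and x: "x \<in> K" for k l x
  proof -
    let ?w = "x \<odot>\<^bsub>V\<^esub> v l"
    have w: "?w \<in> carrier V" using x kl vc by simp
    have "h ?w (v k) = h (comb V ?n (nth b) (\<lambda>i. be i ?w)) (v k)" using be_comb w by simp
    also have "\<dots> = (\<Sum>i<?n. be i ?w * h (b ! i) (v k))" by (rule h_comb) (use beF w F_K bc vc kl in auto)
    finally have "c ?w k = (\<Sum>i<?n. be i ?w * c (b ! i) k)" by (simp add: c_def sum_divide_distrib)
    also have "\<dots> = (\<Sum>i<?n. (q (i, l) * x + cj (q (i, l)) * cj x) * c (b ! i) k)"
      by (rule sum.cong) (use be_v kl x cj_mult qK in auto)
    also have "\<dots> = (\<Sum>i<?n. c (b ! i) k * q (i, l)) * x + (\<Sum>i<?n. c (b ! i) k * cj (q (i, l))) * cj x"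
      unfolding sum_distrib_right sum.distrib[symmetric] by (rule sum.cong) (simp_all add: algebra_simps)
    finally have "(\<Sum>i<?n. c (b ! i) k * q (i, l)) * x + (\<Sum>i<?n. c (b ! i) k * cj (q (i, l))) * cj x = c ?w k" ..
    also have "\<dots> = x * (if k = l then 1 else 0)" by (simp only: c_smult[OF x vc[OF kl(2)] kl(1)] c_v[OF kl])
    finally show ?thesis by simp
  qed
  have solve: "(\<Sum>i<?n. c (b ! i) k * q (i, l)) = (if k = l then 1 else 0) \<and> (\<Sum>i<?n. c (b ! i) k * cj (q (i, l))) = 0"
    if kl: "k < ?m" "l < ?m" for k l
  proof -
    let ?s = "\<Sum>i<?n. c (b ! i) k * q (i, l)" and ?t = "\<Sum>i<?n. c (b ! i) k * cj (q (i, l))" and ?d = "if k = l then 1 else (0 :: 'a)"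
    have 1: "?s + ?t = ?d" using key[OF kl, of 1] by (simp add: F_K cj_F)
    have "(?s - ?t) * dl = ?d * dl" using key[OF kl dl_K] by (simp add: cj_dl algebra_simps)
    moreover have "dl \<noteq> 0" using dl by auto
    ultimately have 2: "?s - ?t = ?d" by simp
    have "2 * ?t = (?s + ?t) - (?s - ?t)" by (simp add: algebra_simps)
    also have "\<dots> = 0" unfolding 1 2 by simp
    finally have "?t = 0" by simp
    then show ?thesis using 1 by simp
  qed
  have PQ: "P * Q = 1\<^sub>m ?m"
  proof (rule eq_matI)
    fix k l assume "k < dim_row (1\<^sub>m ?m :: 'a mat)" "l < dim_col (1\<^sub>m ?m :: 'a mat)"
    then have kl: "k < ?m" "l < ?m" by auto
    have "(P * Q) $$ (k, l) = (\<Sum>i<?n. c (b ! i) k * q (i, l))"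
      unfolding index_mult_mat'[OF P_dim Q_dim kl] by (rule sum.cong) (use kl Pi Qi in auto)
    then show "(P * Q) $$ (k, l) = 1\<^sub>m ?m $$ (k, l)" using solve[OF kl] kl by simp
  qed (use P_dim Q_dim in auto)
  have PQ': "P * map_mat cj Q = 0\<^sub>m ?m ?m"
  proof (rule eq_matI)
    fix k l assume "k < dim_row (0\<^sub>m ?m ?m :: 'a mat)" "l < dim_col (0\<^sub>m ?m ?m :: 'a mat)"
    then have kl: "k < ?m" "l < ?m" by auto
    have "(P * map_mat cj Q) $$ (k, l) = (\<Sum>i<?n. P $$ (k, i) * map_mat cj Q $$ (i, l))"
      by (rule index_mult_mat'[OF P_dim _ kl]) (use Q_dim in auto)
    also have "\<dots> = (\<Sum>i<?n. c (b ! i) k * cj (q (i, l)))"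
      by (rule sum.cong) (use kl Pi Qi carrier_matD[OF Q_dim] in auto)
    finally show "(P * map_mat cj Q) $$ (k, l) = 0\<^sub>m ?m ?m $$ (k, l)" using solve[OF kl] kl by simp
  qed (use P_dim Q_dim in auto)
  have be_basis: "be i (b ! j) = (if i = j then 1 else 0)" if ij: "i < ?n" "j < ?n" for i j
  proof -
    have "comb V ?n (nth b) (\<lambda>i. if i = j then 1 else 0) = (\<Oplus>\<^bsub>V\<^esub>i\<in>{..<?n}. if j = i then b ! i else \<zero>\<^bsub>V\<^esub>)"
      unfolding comb_def by (rule V.M.finsum_cong') (use bc W.V.smult_one W.V.lmult_0 in auto)
    also have "\<dots> = b ! j" by (rule V.M.finsum_singleton) (use bc ij in auto)
    finally show ?thesis using be_unique[THEN spec, of "\<lambda>i. if i = j then 1 else 0"] ij by auto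
  qed
  have QP: "Q * P + map_mat cj Q * map_mat cj P = 1\<^sub>m ?n"
  proof (rule eq_matI)
    fix i j assume "i < dim_row (1\<^sub>m ?n :: 'a mat)" "j < dim_col (1\<^sub>m ?n :: 'a mat)"
    then have ij: "i < ?n" "j < ?n" by auto
    have "(Q * P + map_mat cj Q * map_mat cj P) $$ (i, j) = (Q * P) $$ (i, j) + (map_mat cj Q * map_mat cj P) $$ (i, j)"
      by (rule index_add_mat(1)) (use ij carrier_matD[OF P_dim] carrier_matD[OF Q_dim] in auto)
    also have "(Q * P) $$ (i, j) = (\<Sum>k<?m. Q $$ (i, k) * P $$ (k, j))" by (rule index_mult_mat'[OF Q_dim P_dim ij])
    also have "(map_mat cj Q * map_mat cj P) $$ (i, j) = (\<Sum>k<?m. map_mat cj Q $$ (i, k) * map_mat cj P $$ (k, j))"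
      by (rule index_mult_mat'[OF _ _ ij]) (use P_dim Q_dim in auto)
    also have "(\<Sum>k<?m. Q $$ (i, k) * P $$ (k, j)) + (\<Sum>k<?m. map_mat cj Q $$ (i, k) * map_mat cj P $$ (k, j))
        = (\<Sum>k<?m. q (i, k) * c (b ! j) k + cj (q (i, k) * c (b ! j) k))"
      unfolding sum.distrib[symmetric]
      by (rule sum.cong) (use ij Pi Qi cK bc qK cj_mult carrier_matD[OF P_dim] carrier_matD[OF Q_dim] in auto)
    also have "\<dots> = be i (b ! j)" by (rule be_eq[symmetric]) (use bc ij in auto)
    finally show "(Q * P + map_mat cj Q * map_mat cj P) $$ (i, j) = 1\<^sub>m ?n $$ (i, j)" using be_basis[OF ij] ij by simp
  qed (use P_dim Q_dim in auto)
  interpret R: restriction F K dl cj ?m ?n P Q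
    by unfold_locales (use P_dim Q_dim PQ PQ' QP Pi Qi cK bc qK in auto)
  interpret N: unitary F K dl cj ?m ?n P Q ?a
    by unfold_locales (use aF a0 pos in auto)
  have endo: "endo_mat F V b (\<lambda>w. x \<odot>\<^bsub>V\<^esub> w) = R.emb (x \<cdot>\<^sub>m 1\<^sub>m ?m) (cj x \<cdot>\<^sub>m 1\<^sub>m ?m)" if x: "x \<in> K" for x
  proof -
    let ?M = "R.emb (x \<cdot>\<^sub>m 1\<^sub>m ?m) (cj x \<cdot>\<^sub>m 1\<^sub>m ?m)"
    have Mc: "?M \<in> carrier_mat ?n ?n" by (rule R.emb_carrier) auto
    have xb: "x \<odot>\<^bsub>V\<^esub> b ! j \<in> carrier V" if "j < ?n" for j using x bc that by simp
    have M: "?M $$ (i, j) = be i (x \<odot>\<^bsub>V\<^esub> b ! j)" if ij: "i < ?n" "j < ?n" for i j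
      unfolding R.index_emb_scalar[OF ij x] be_eq[OF xb[OF ij(2)] ij(1)]
      by (rule sum.cong) (use ij Pi Qi c_smult[OF x bc] in auto)
    show ?thesis unfolding endo_mat_def
    proof (rule the_equality)
      have "elements_mat ?M \<subseteq> F" using M beF xb carrier_matD[OF Mc] by (auto simp: elements_mat_def)
      moreover have "x \<odot>\<^bsub>V\<^esub> b ! j = (\<Oplus>\<^bsub>V\<^esub>i\<in>{..<?n}. ?M $$ (i, j) \<odot>\<^bsub>V\<^esub> b ! i)" if j: "j < ?n" for j
      proof -
        have "x \<odot>\<^bsub>V\<^esub> b ! j = comb V ?n (nth b) (\<lambda>i. be i (x \<odot>\<^bsub>V\<^esub> b ! j))" using be_comb xb[OF j] by simp
        also have "\<dots> = comb V ?n (nth b) (\<lambda>i. ?M $$ (i, j))"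
          by (rule W.comb_cong) (use M j beF xb bc in auto)
        finally show ?thesis unfolding comb_def .
      qed
      ultimately show "?M \<in> carrier_mat ?n ?n \<and> elements_mat ?M \<subseteq> F \<and>
        (\<forall>j<?n. x \<odot>\<^bsub>V\<^esub> b ! j = (\<Oplus>\<^bsub>V\<^esub>i\<in>{..<?n}. ?M $$ (i, j) \<odot>\<^bsub>V\<^esub> b ! i))" using Mc by blast
      fix N assume N: "N \<in> carrier_mat ?n ?n \<and> elements_mat N \<subseteq> F \<and>
        (\<forall>j<?n. x \<odot>\<^bsub>V\<^esub> b ! j = (\<Oplus>\<^bsub>V\<^esub>i\<in>{..<?n}. N $$ (i, j) \<odot>\<^bsub>V\<^esub> b ! i))"
      have NF: "N $$ (i, j) \<in> F" if "i < ?n" "j < ?n" for i j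
        using elements_matI[of N ?n ?n i j] N that by blast
      have NM: "N $$ (i, j) = ?M $$ (i, j)" if ij: "i < ?n" "j < ?n" for i j
      proof -
        have "x \<odot>\<^bsub>V\<^esub> b ! j = comb V ?n (nth b) (\<lambda>i. N $$ (i, j))" unfolding comb_def using N ij by blast
        then show ?thesis using M[OF ij] be_unique[THEN spec, of "\<lambda>i. N $$ (i, j)"] NF ij by simp
      qed
      have "N \<in> carrier_mat ?n ?n" using N by blast
      note d = carrier_matD[OF this] carrier_matD[OF Mc]
      show "N = ?M" by (rule eq_matI) (simp_all only: d NM)
    qed
  qed
  \<comment> \<open>The first matrix product is the Gram matrix of h itself, the second its
    conjugate, so together they give the form Tr (q h).\<close>
  have gram: "gram_mat b (\<lambda>u w. l (h u w)) = q \<cdot>\<^sub>m (P\<^sup>T * N.H * R.P') + cj q \<cdot>\<^sub>m (R.P'\<^sup>T * N.H * P)"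
    if q: "q \<in> K" and l: "\<forall>x\<in>K. l x = q * x + cj (q * x)" for l q
  proof (rule eq_matI)
    let ?S = "P\<^sup>T * N.H * R.P'" and ?S' = "R.P'\<^sup>T * N.H * P"
    have Sd: "?S \<in> carrier_mat ?n ?n" "?S' \<in> carrier_mat ?n ?n" using P_dim by (auto simp: R.P'_def)
    {
      fix i j assume "i < dim_row (q \<cdot>\<^sub>m ?S + cj q \<cdot>\<^sub>m ?S')" "j < dim_col (q \<cdot>\<^sub>m ?S + cj q \<cdot>\<^sub>m ?S')"
      then have ij: "i < ?n" "j < ?n" using Sd by auto
      have S: "?S $$ (i, j) = (\<Sum>k<?m. c (b ! i) k * ?a k * cj (c (b ! j) k))"
        "?S' $$ (i, j) = (\<Sum>k<?m. cj (c (b ! i) k) * ?a k * c (b ! j) k)"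
        by (subst index_gram_diag[of _ ?m ?n _ ?n]; use P_dim ij in \<open>auto simp: R.P'_def Pi intro!: sum.cong\<close>)+
      have "h (b ! i) (b ! j) = h (comb V ?m v (c (b ! i))) (b ! j)" using c_comb bc ij by simp
      also have "\<dots> = (\<Sum>k<?m. c (b ! i) k * h (v k) (b ! j))" by (rule h_comb) (use cK bc vc ij in auto)
      also have "\<dots> = ?S $$ (i, j)"
        unfolding S(1)
      proof (rule sum.cong)
        fix k assume "k \<in> {..<?m}"
        then have k: "k < ?m" by simp
        have "h (b ! j) (v k) = c (b ! j) k * ?a k" using a0[OF k] by (simp add: c_def)
        then have "h (v k) (b ! j) = cj (c (b ! j) k * ?a k)" using h_cj[OF bc[OF ij(2)] vc[OF k]] by simp
        also have "\<dots> = ?a k * cj (c (b ! j) k)" using cK bc ij k aF by (simp add: cj_mult F_K cj_F)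
        finally show "c (b ! i) k * h (v k) (b ! j) = c (b ! i) k * ?a k * cj (c (b ! j) k)" by simp
      qed simp
      finally have hS: "h (b ! i) (b ! j) = ?S $$ (i, j)" .
      have cS: "cj (?S $$ (i, j)) = ?S' $$ (i, j)"
        unfolding S using cK bc ij aF by (subst cj_sum) (auto simp: cj_mult F_K cj_F cj_cj)
      have lq: "l (h (b ! i) (b ! j)) = q * h (b ! i) (b ! j) + cj q * cj (h (b ! i) (b ! j))"
        using l[rule_format, of "h (b ! i) (b ! j)"] bc ij q by (simp add: cj_mult)
      have "l (h (b ! i) (b ! j)) = q * ?S $$ (i, j) + cj q * ?S' $$ (i, j)"
        unfolding lq unfolding hS cS ..
      then show "gram_mat b (\<lambda>u w. l (h u w)) $$ (i, j) = (q \<cdot>\<^sub>m ?S + cj q \<cdot>\<^sub>m ?S') $$ (i, j)"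
      proof -
        have "(q \<cdot>\<^sub>m ?S + cj q \<cdot>\<^sub>m ?S') $$ (i, j) = (q \<cdot>\<^sub>m ?S) $$ (i, j) + (cj q \<cdot>\<^sub>m ?S') $$ (i, j)"
          by (rule index_add_mat(1)) (simp_all only: index_smult_mat carrier_matD[OF Sd(2)] ij)
        also have "\<dots> = q * ?S $$ (i, j) + cj q * ?S' $$ (i, j)"
          by (subst (1 2) index_smult_mat(1)) (simp_all only: carrier_matD[OF Sd(1)] carrier_matD[OF Sd(2)] ij)
        finally show "l (h (b ! i) (b ! j)) = q * ?S $$ (i, j) + cj q * ?S' $$ (i, j) \<Longrightarrow>
            gram_mat b (\<lambda>u w. l (h u w)) $$ (i, j) = (q \<cdot>\<^sub>m ?S + cj q \<cdot>\<^sub>m ?S') $$ (i, j)"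
          using ij by (simp only: gram_mat_def index_mat(1) prod.case)
      qed
    }
    show "dim_row (gram_mat b (\<lambda>u w. l (h u w))) = dim_row (q \<cdot>\<^sub>m ?S + cj q \<cdot>\<^sub>m ?S')"
      "dim_col (gram_mat b (\<lambda>u w. l (h u w))) = dim_col (q \<cdot>\<^sub>m ?S + cj q \<cdot>\<^sub>m ?S')"
      using Sd by (auto simp: gram_mat_def)
  qed
  have isom: "(\<forall>l\<in>functionals F K. g\<^sup>T * gram_mat b (\<lambda>u w. l (h u w)) * g = gram_mat b (\<lambda>u w. l (h u w))) \<longleftrightarrow>
    (\<forall>q\<in>K. g\<^sup>T * (q \<cdot>\<^sub>m (P\<^sup>T * N.H * R.P') + cj q \<cdot>\<^sub>m (R.P'\<^sup>T * N.H * P)) * g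
      = q \<cdot>\<^sub>m (P\<^sup>T * N.H * R.P') + cj q \<cdot>\<^sub>m (R.P'\<^sup>T * N.H * P))" (is "?A \<longleftrightarrow> ?B") for g
  proof
    assume A: ?A
    show ?B
    proof
      fix q assume q: "q \<in> K"
      have g: "gram_mat b (\<lambda>u w. q * h u w + cj (q * h u w)) = q \<cdot>\<^sub>m (P\<^sup>T * N.H * R.P') + cj q \<cdot>\<^sub>m (R.P'\<^sup>T * N.H * P)"
        by (rule gram[OF q]) simp
      show "g\<^sup>T * (q \<cdot>\<^sub>m (P\<^sup>T * N.H * R.P') + cj q \<cdot>\<^sub>m (R.P'\<^sup>T * N.H * P)) * g
        = q \<cdot>\<^sub>m (P\<^sup>T * N.H * R.P') + cj q \<cdot>\<^sub>m (R.P'\<^sup>T * N.H * P)"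
        using bspec[OF A trace_form_functional[OF q]] unfolding g .
    qed
  next
    assume B: ?B
    show ?A
    proof
      fix l assume "l \<in> functionals F K"
      then obtain q where q: "q \<in> K" "\<forall>x\<in>K. l x = q * x + cj (q * x)" by (rule trace_form)
      show "g\<^sup>T * gram_mat b (\<lambda>u w. l (h u w)) * g = gram_mat b (\<lambda>u w. l (h u w))"
        unfolding gram[OF q] using bspec[OF B q(1)] .
    qed
  qed
  have comm: "(\<forall>x\<in>K. g * endo_mat F V b (\<lambda>w. x \<odot>\<^bsub>V\<^esub> w) = endo_mat F V b (\<lambda>w. x \<odot>\<^bsub>V\<^esub> w) * g) \<longleftrightarrow>
    (\<forall>x\<in>K. g * R.emb (x \<cdot>\<^sub>m 1\<^sub>m ?m) (cj x \<cdot>\<^sub>m 1\<^sub>m ?m) = R.emb (x \<cdot>\<^sub>m 1\<^sub>m ?m) (cj x \<cdot>\<^sub>m 1\<^sub>m ?m) * g)" for g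
    by (rule ball_cong) (simp_all only: endo)
  have "U F K V h b = N.unitary_group"
    unfolding U_def Let_def N.unitary_group_def N.unitary_group_carrier isom comm ..
  moreover have "unitary F K dl cj ?m ?n P Q ?a" by unfold_locales
  ultimately show thesis using that by blast
qed

text \<open>The columns of \<open>T\<close> are coordinates of vectors u'_j whose Gram matrix is l
  times that of the v_j. The map with v_j -> u'_j is conformal, with factor 1/l because
  \<open>conformal\<close> puts the factor on the side of h_2.\<close>

lemma conformal_of_matrix:
  assumes A: "hermitian F K dl cj V\<^sub>1 h\<^sub>1" and B: "hermitian F K dl cj V\<^sub>2 h\<^sub>2"
    and v: "hermitian.orthogonal_family V\<^sub>1 h\<^sub>1 v m" and u: "hermitian.orthogonal_family V\<^sub>2 h\<^sub>2 u m"
    and m: "m = vectorspace.dim (fld K) V\<^sub>1" "m = vectorspace.dim (fld K) V\<^sub>2"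
    and T: "T \<in> mat_over K m" and l: "l \<in> F" "l \<noteq> 0"
    and e: "T\<^sup>T * mat_diag m (\<lambda>k. h\<^sub>2 (u k) (u k)) * map_mat cj T = l \<cdot>\<^sub>m mat_diag m (\<lambda>k. h\<^sub>1 (v k) (v k))"
  shows "conformal F K V\<^sub>1 h\<^sub>1 V\<^sub>2 h\<^sub>2"
proof -
  interpret A: hermitian F K dl cj V\<^sub>1 h\<^sub>1 by (rule A)
  interpret B: hermitian F K dl cj V\<^sub>2 h\<^sub>2 by (rule B)
  let ?a = "\<lambda>k. h\<^sub>1 (v k) (v k)" and ?b = "\<lambda>k. h\<^sub>2 (u k) (u k)"
  have Tc: "T \<in> carrier_mat m m" and TK: "T $$ (i, j) \<in> K" if "i < m" "j < m" for i j
    using T that by (auto simp: mat_over_def)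
  have Tcm: "T \<in> carrier_mat m m" using T by (simp add: mat_over_def)
  have vc: "v k \<in> carrier V\<^sub>1" and a0: "?a k \<noteq> 0" if "k < m" for k using v that by (auto simp: A.orthogonal_family_def)
  have uc: "u k \<in> carrier V\<^sub>2" and b0: "?b k \<noteq> 0" if "k < m" for k using u that by (auto simp: B.orthogonal_family_def)
  define c where "c w k = h\<^sub>1 w (v k) / ?a k" for w k
  define u' where "u' j = comb V\<^sub>2 m u (\<lambda>k. T $$ (k, j))" for j
  define f where "f w = comb V\<^sub>2 m u' (c w)" for w
  \<comment> \<open>The inverse of \<open>f\<close>, obtained by orthogonal expansion in the vectors
    u'_j.\<close>
  define g where "g w = comb V\<^sub>1 m v (\<lambda>i. h\<^sub>2 w (u' i) / h\<^sub>2 (u' i) (u' i))" for w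
  have cK: "c w k \<in> K" if "w \<in> carrier V\<^sub>1" "k < m" for w k using that vc by (simp add: c_def)
  have c_comb: "comb V\<^sub>1 m v (c w) = w" if "w \<in> carrier V\<^sub>1" for w
    using A.orthogonal_family_complete[of v w] v that unfolding m(1) by (simp add: A.orth_proj_def c_def[abs_def])
  have u'c: "u' j \<in> carrier V\<^sub>2" if "j < m" for j unfolding u'_def using TK uc that by simp
  have uu: "h\<^sub>2 (u' i) (u' j) = (if i = j then l * ?a i else 0)" if ij: "i < m" "j < m" for i j
  proof -
    have "h\<^sub>2 (u' i) (u' j) = (\<Sum>k<m. T $$ (k, i) * h\<^sub>2 (u k) (u' j))"
      unfolding u'_def[of i] by (rule B.h_comb) (use TK uc u'c ij in auto)
    also have "\<dots> = (\<Sum>k<m. T $$ (k, i) * ?b k * cj (T $$ (k, j)))"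
    proof (rule sum.cong)
      fix k assume "k \<in> {..<m}"
      then have k: "k < m" by simp
      have bF: "?b k \<in> F" using B.norm_cj uc[OF k] by blast
      have "h\<^sub>2 (u k) (u' j) = cj (T $$ (k, j) * ?b k)"
        using B.h_cj[OF u'c[OF ij(2)] uc[OF k]] B.h_comb_orthogonal[OF u, of "\<lambda>k. T $$ (k, j)" k] TK ij k
        by (simp add: u'_def)
      also have "\<dots> = ?b k * cj (T $$ (k, j))" using TK[OF k ij(2)] bF by (simp add: A.cj_mult A.F_K A.cj_F)
      finally show "T $$ (k, i) * h\<^sub>2 (u k) (u' j) = T $$ (k, i) * ?b k * cj (T $$ (k, j))" by simp
    qed simp
    also have "\<dots> = (T\<^sup>T * mat_diag m ?b * map_mat cj T) $$ (i, j)"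
      by (subst index_gram_diag[of _ m m _ m]) (use Tcm ij in auto)
    also have "\<dots> = (if i = j then l * ?a i else 0)" unfolding e using ij by (simp add: mat_diag_def)
    finally show ?thesis .
  qed
  have u': "B.orthogonal_family u' m" unfolding B.orthogonal_family_def using u'c uu l(2) a0 by auto
  have u'0: "h\<^sub>2 (u' i) (u' i) \<noteq> 0" if "i < m" for i using uu that l(2) a0 by simp
  have fc: "f w \<in> carrier V\<^sub>2" if "w \<in> carrier V\<^sub>1" for w unfolding f_def using cK u'c that by simp
  have xK: "h\<^sub>2 w (u' i) / h\<^sub>2 (u' i) (u' i) \<in> K" if "w \<in> carrier V\<^sub>2" "i < m" for w i using u'c that by simp
  have gc: "g w \<in> carrier V\<^sub>1" if "w \<in> carrier V\<^sub>2" for w unfolding g_def using xK vc that by simp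
  have hf: "h\<^sub>2 (f w) (u' i) = c w i * (l * ?a i)" if "w \<in> carrier V\<^sub>1" "i < m" for w i
    unfolding f_def using B.h_comb_orthogonal[OF u', of "c w" i] cK that uu by simp
  have gf: "g (f w) = w" if w: "w \<in> carrier V\<^sub>1" for w
  proof -
    have "g (f w) = comb V\<^sub>1 m v (c w)"
      unfolding g_def by (rule A.comb_cong) (use hf uu w l(2) a0 cK vc in auto)
    then show ?thesis using c_comb[OF w] by simp
  qed
  have fg: "f (g w) = w" if w: "w \<in> carrier V\<^sub>2" for w
  proof -
    have "f (g w) = comb V\<^sub>2 m u' (\<lambda>i. h\<^sub>2 w (u' i) / h\<^sub>2 (u' i) (u' i))"
      unfolding f_def
    proof (rule B.comb_cong)
      show "c (g w) i = h\<^sub>2 w (u' i) / h\<^sub>2 (u' i) (u' i)" if i: "i < m" for i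
        unfolding c_def g_def using A.h_comb_orthogonal[OF v, of "\<lambda>i. h\<^sub>2 w (u' i) / h\<^sub>2 (u' i) (u' i)" i] xK w i a0 by simp
    qed (use xK w u'c in auto)
    also have "\<dots> = w" using B.orthogonal_family_complete[of u' w] u' w unfolding m(2) by (simp add: B.orth_proj_def)
    finally show ?thesis .
  qed
  have bij: "bij_betw f (carrier V\<^sub>1) (carrier V\<^sub>2)"
    by (rule bij_betw_byWitness[where f' = g]) (use gf fg fc gc in auto)
  have f_add: "f (w \<oplus>\<^bsub>V\<^sub>1\<^esub> w') = f w \<oplus>\<^bsub>V\<^sub>2\<^esub> f w'" if w: "w \<in> carrier V\<^sub>1" "w' \<in> carrier V\<^sub>1" for w w'
  proof -
    have "f w \<oplus>\<^bsub>V\<^sub>2\<^esub> f w' = comb V\<^sub>2 m u' (\<lambda>i. c w i + c w' i)"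
      unfolding f_def by (rule B.comb_add) (use cK w u'c in auto)
    also have "\<dots> = f (w \<oplus>\<^bsub>V\<^sub>1\<^esub> w')"
      unfolding f_def by (rule B.comb_cong) (use cK w u'c vc A.h_add in \<open>auto simp: c_def add_divide_distrib\<close>)
    finally show ?thesis ..
  qed
  have f_smult: "f (x \<odot>\<^bsub>V\<^sub>1\<^esub> w) = x \<odot>\<^bsub>V\<^sub>2\<^esub> f w" if x: "x \<in> K" and w: "w \<in> carrier V\<^sub>1" for x w
  proof -
    have "x \<odot>\<^bsub>V\<^sub>2\<^esub> f w = comb V\<^sub>2 m u' (\<lambda>i. x * c w i)"
      unfolding f_def by (rule B.comb_smult) (use x cK w u'c in auto)
    also have "\<dots> = f (x \<odot>\<^bsub>V\<^sub>1\<^esub> w)"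
      unfolding f_def by (rule B.comb_cong) (use x cK w u'c vc A.h_smult in \<open>auto simp: c_def\<close>)
    finally show ?thesis ..
  qed
  have lin: "linear_map (fld K) V\<^sub>1 V\<^sub>2 f"
    unfolding linear_map_def mod_hom_def mod_hom_axioms_def module_hom_def
    using A.V.vectorspace_axioms B.V.vectorspace_axioms A.V.module_axioms B.V.module_axioms fc f_add f_smult
    by auto
  have h: "h\<^sub>1 w w' = inverse l * h\<^sub>2 (f w) (f w')" if w: "w \<in> carrier V\<^sub>1" "w' \<in> carrier V\<^sub>1" for w w'
  proof -
    have "h\<^sub>2 (f w) (f w') = (\<Sum>i<m. c w i * h\<^sub>2 (u' i) (f w'))"
      unfolding f_def[of w] by (rule B.h_comb) (use cK w u'c fc in auto)
    also have "\<dots> = (\<Sum>i<m. l * (c w i * h\<^sub>1 (v i) w'))"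
    proof (rule sum.cong)
      fix i assume "i \<in> {..<m}"
      then have i: "i < m" by simp
      have aF: "?a i \<in> F" using A.norm_cj vc[OF i] by blast
      have "h\<^sub>2 (u' i) (f w') = cj (c w' i * (l * ?a i))"
        using B.h_cj[OF fc[OF w(2)] u'c[OF i]] hf[OF w(2) i] by simp
      also have "\<dots> = l * cj (c w' i * ?a i)"
        using cK[OF w(2) i] aF l(1) by (simp add: A.cj_mult A.F_K A.cj_F)
      also have "c w' i * ?a i = h\<^sub>1 w' (v i)" using a0[OF i] by (simp add: c_def)
      also have "cj (h\<^sub>1 w' (v i)) = h\<^sub>1 (v i) w'" using A.h_cj[OF w(2) vc[OF i]] by simp
      finally show "c w i * h\<^sub>2 (u' i) (f w') = l * (c w i * h\<^sub>1 (v i) w')" by simp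
    qed simp
    also have "\<dots> = l * h\<^sub>1 (comb V\<^sub>1 m v (c w)) w'"
      by (subst A.h_comb) (use cK w vc in \<open>auto simp: sum_distrib_left\<close>)
    also have "\<dots> = l * h\<^sub>1 w w'" by (simp only: c_comb[OF w(1)])
    finally show ?thesis using l(2) by simp
  qed
  show ?thesis
    unfolding conformal_def using lin bij h l A.F_inverse[OF l(1)] by (intro exI[of _ f] exI[of _ "inverse l"]) auto
qed

lemma vectorspace_subfield:
  fixes V :: "('a::field, 'v) module"
  assumes F: "subfield F (class_ring :: 'a ring)" and FK: "F \<subseteq> K" and V: "vectorspace (fld K) V"
  shows "vectorspace (fld F) V"
proof -
  interpret V: scalar_space K V by (rule scalar_space.intro[OF V])
  have f: "field (fld F)" by (rule ring.subfield_iff(2)[OF ring_class_ring F])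
  have "module (fld F) V"
    by (rule moduleI)
      (use FK V.smult_add_left V.smult_add_right V.smult_mult V.V.M.abelian_group_axioms V.V.smult_one f in
        \<open>auto simp: field_def domain_def subset_iff\<close>)
  then show ?thesis using f by (simp add: vectorspace_def)
qed

lemma hermitian_of_space:
  assumes "quad F K d (conj_over F K)" and h: "hermitian_space F K V h"
  shows "hermitian F K d (conj_over F K) V h"
proof -
  note h' = h[unfolded hermitian_space_def hermitian_form_def nondegenerate_form_def]
  have s: "scalar_space K V" by (rule scalar_space.intro[OF conjunct1[OF h']])
  have fin: "vectorspace.fin_dim (fld K) V" by (rule conjunct1[OF conjunct2[OF h']])
  note f = conjunct2[OF conjunct2[OF h']]
  note hK = conjunct1[OF conjunct1[OF f]] and add = conjunct1[OF conjunct2[OF conjunct1[OF f]]]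
    and smult = conjunct1[OF conjunct2[OF conjunct2[OF conjunct1[OF f]]]]
    and cj = conjunct2[OF conjunct2[OF conjunct2[OF conjunct1[OF f]]]] and nd = conjunct2[OF f]
  show ?thesis
    by (intro hermitian.intro hermitian_axioms.intro assms(1) s fin)
      (rule hK[rule_format] add[rule_format] smult[rule_format] cj[rule_format] nd[THEN bspec, THEN mp]; assumption)+
qed

theorem proposition6p4:
  fixes F K\<^sub>1 K\<^sub>2 :: "'a::field_char_0 set"
    and V\<^sub>1 :: "('a, 'v) module" and V\<^sub>2 :: "('a, 'w) module"
    and h\<^sub>1 :: "'v \<Rightarrow> 'v \<Rightarrow> 'a" and h\<^sub>2 :: "'w \<Rightarrow> 'w \<Rightarrow> 'a"
    and b\<^sub>1 :: "'v list" and b\<^sub>2 :: "'w list"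
  assumes "algebraic_closure (class_ring :: 'a ring) F"
    and "CM_field_over F K\<^sub>1" and "CM_field_over F K\<^sub>2"
    and "hermitian_space F K\<^sub>1 V\<^sub>1 h\<^sub>1" and "hermitian_space F K\<^sub>2 V\<^sub>2 h\<^sub>2"
    and "ordered_basis F V\<^sub>1 b\<^sub>1" and "ordered_basis F V\<^sub>2 b\<^sub>2"
    and "isomorphic_algebraic_groups (PU F K\<^sub>1 V\<^sub>1 h\<^sub>1 b\<^sub>1) (PU F K\<^sub>2 V\<^sub>2 h\<^sub>2 b\<^sub>2)"
  shows "(\<forall>m. m = vectorspace.dim (fld K\<^sub>1) V\<^sub>1 \<and> m = vectorspace.dim (fld K\<^sub>2) V\<^sub>2 \<and> m \<ge> 3
            \<longrightarrow> K\<^sub>1 = K\<^sub>2 \<and> conformal F K\<^sub>1 V\<^sub>1 h\<^sub>1 V\<^sub>2 h\<^sub>2) \<and>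
         (\<forall>m. m = vectorspace.dim (fld K\<^sub>1) V\<^sub>1 \<and> m = vectorspace.dim (fld K\<^sub>2) V\<^sub>2 \<and> m = 2 \<and> K\<^sub>1 = K\<^sub>2
            \<longrightarrow> conformal F K\<^sub>1 V\<^sub>1 h\<^sub>1 V\<^sub>2 h\<^sub>2)"
proof -
  have F: "subfield F (class_ring :: 'a ring)" and FK: "F \<subseteq> K\<^sub>1" "F \<subseteq> K\<^sub>2"
    using assms(2,3) by (auto simp: CM_field_over_def totally_real_def number_field_def)
  obtain d\<^sub>1 where q1: "quad F K\<^sub>1 d\<^sub>1 (conj_over F K\<^sub>1)" using CM_field_over_quad[OF assms(2)] by blast
  obtain d\<^sub>2 where q2: "quad F K\<^sub>2 d\<^sub>2 (conj_over F K\<^sub>2)" using CM_field_over_quad[OF assms(3)] by blast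
  interpret A: hermitian F K\<^sub>1 d\<^sub>1 "conj_over F K\<^sub>1" V\<^sub>1 h\<^sub>1 by (rule hermitian_of_space[OF q1 assms(4)])
  interpret B: hermitian F K\<^sub>2 d\<^sub>2 "conj_over F K\<^sub>2" V\<^sub>2 h\<^sub>2 by (rule hermitian_of_space[OF q2 assms(5)])
  \<comment> \<open>Both claims follow from this one: for m >= 3 the equality of the fields is
    proved first, for m = 2 it is given.\<close>
  have main: "(3 \<le> m \<longrightarrow> K\<^sub>1 = K\<^sub>2) \<and> (K\<^sub>1 = K\<^sub>2 \<longrightarrow> conformal F K\<^sub>1 V\<^sub>1 h\<^sub>1 V\<^sub>2 h\<^sub>2)"
    if m: "m = A.V.dim" "m = B.V.dim" and m2: "2 \<le> m" for m
  proof -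
    obtain v where v: "A.orthogonal_family v A.V.dim" by (rule A.orthogonal_basis)
    obtain u where u: "B.orthogonal_family u B.V.dim" by (rule B.orthogonal_basis)
    have pos: "0 < A.V.dim" "0 < B.V.dim" using m m2 by auto
    let ?a = "\<lambda>k. h\<^sub>1 (v k) (v k)" and ?b = "\<lambda>k. h\<^sub>2 (u k) (u k)"
    obtain P\<^sub>1 Q\<^sub>1 where U1: "unitary F K\<^sub>1 d\<^sub>1 (conj_over F K\<^sub>1) A.V.dim (length b\<^sub>1) P\<^sub>1 Q\<^sub>1 ?a"
      "U F K\<^sub>1 V\<^sub>1 h\<^sub>1 b\<^sub>1 = unitary.unitary_group F (conj_over F K\<^sub>1) A.V.dim (length b\<^sub>1) P\<^sub>1 Q\<^sub>1 ?a"
      by (rule A.U_eq_unitary_group[OF vectorspace_subfield[OF F FK(1) A.V.vectorspace_axioms] assms(6) v pos(1)])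
    obtain P\<^sub>2 Q\<^sub>2 where U2: "unitary F K\<^sub>2 d\<^sub>2 (conj_over F K\<^sub>2) B.V.dim (length b\<^sub>2) P\<^sub>2 Q\<^sub>2 ?b"
      "U F K\<^sub>2 V\<^sub>2 h\<^sub>2 b\<^sub>2 = unitary.unitary_group F (conj_over F K\<^sub>2) B.V.dim (length b\<^sub>2) P\<^sub>2 Q\<^sub>2 ?b"
      by (rule B.U_eq_unitary_group[OF vectorspace_subfield[OF F FK(2) B.V.vectorspace_axioms] assms(7) u pos(2)])
    note U = U1[folded m(1)] U2[folded m(2)] and vu = v[folded m(1)] u[folded m(2)]
    obtain \<phi> where phi: "\<phi> \<in> algebraic_group_iso (PU F K\<^sub>1 V\<^sub>1 h\<^sub>1 b\<^sub>1) (PU F K\<^sub>2 V\<^sub>2 h\<^sub>2 b\<^sub>2)"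
      using assms(8) by (auto simp: isomorphic_algebraic_groups_def)
    obtain f where f: "pgl_hom m f" and rp: "\<forall>A. A \<in> GLm m \<longrightarrow> A \<in> mat_over K\<^sub>1 m \<longrightarrow>
        A\<^sup>T * mat_diag m ?a * map_mat (conj_over F K\<^sub>1) A = mat_diag m ?a \<longrightarrow> rational_pair m K\<^sub>2 (conj_over F K\<^sub>2) ?b (f A)"
      by (rule pgl_hom_of_iso[OF algebraic_closure_root[OF assms(1)] m2 U(1,3) phi[unfolded PU_def U(2,4)]])
    have a: "?a k \<in> F \<and> ?a k \<noteq> 0" if "k < m" for k
      using vu(1) that A.norm_cj by (auto simp: A.orthogonal_family_def)
    have b: "?b k \<in> F \<and> ?b k \<noteq> 0" if "k < m" for k
      using vu(2) that B.norm_cj by (auto simp: B.orthogonal_family_def)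
    show ?thesis
    proof (intro conjI impI)
      assume "3 \<le> m"
      then show "K\<^sub>1 = K\<^sub>2"
        by (rule pgl_hom_conformal(1)[where a = ?a and b = ?b, OF q1 q2 _ _ f, rotated 3])
          (erule a | erule b | (rule rp[rule_format], assumption+))+
    next
      assume K: "K\<^sub>1 = K\<^sub>2"
      have "\<exists>T\<in>GLm m. T \<in> mat_over K\<^sub>2 m \<and> (\<exists>l\<in>F. l \<noteq> 0 \<and>
          T\<^sup>T * mat_diag m ?b * map_mat (conj_over F K\<^sub>2) T = l \<cdot>\<^sub>m mat_diag m ?a)"
        by (rule pgl_hom_conformal(2)[where a = ?a and b = ?b, OF q1 q2 _ _ f])
          (erule a | erule b | (rule rp[rule_format], assumption+) | rule K | simp only: K)+
      then obtain T l where T: "T \<in> mat_over K\<^sub>2 m" "l \<in> F" "l \<noteq> 0"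
        "T\<^sup>T * mat_diag m ?b * map_mat (conj_over F K\<^sub>2) T = l \<cdot>\<^sub>m mat_diag m ?a" by blast
      show "conformal F K\<^sub>1 V\<^sub>1 h\<^sub>1 V\<^sub>2 h\<^sub>2"
        unfolding K
        by (rule conformal_of_matrix[OF hermitian_of_space[OF q2 assms(4)[unfolded K]] B.hermitian_axioms vu
              m(1)[unfolded K] m(2) T])
    qed
  qed
  then show ?thesis by auto
qed

end
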